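(* Let $\alpha\in\mathbb{C}$, let $\mathfrak{g}=\mathfrak{gl}(3)$ be the Lie algebra of complex $3\times 3$ matrices, and let $S^\alpha(V)$, $J^\alpha$, $\mathfrak{A}^\alpha=U(\mathfrak{g})/J^\alpha$, $L^{k\theta}$ and $\langle\cdot,\cdot\rangle_\alpha$ be as defined in the context. Then: (i) $S^\alpha(V)$ is an irreducible $\mathfrak{g}$-module for every $\alpha\in\mathbb{C}$. (ii) The kernel $J^\alpha$ of the representation $U(\mathfrak{g})\to \operatorname{End}(S^\alpha(V))$ is a maximal (two-sided) ideal of $U(\mathfrak{g})$ if $\alpha\notin\mathbb{Z}_{<0}$. (iii) If $\alpha\notin\mathbb{Z}_{\ge 0}$, then, as a $\mathfrak{g}$-module with respect to the adjoint representation, $\mathfrak{A}^\alpha\cong\bigoplus_{k=0}^{\infty}L^{k\theta}$. (iv) If $\alpha\in\mathbb{Z}_{\ge 0}$, then, as a $\mathfrak{g}$-module with respect to the adjoint representation, $\mathfrak{A}^\alpha\cong\bigoplus_{k=0}^{\alpha}L^{k\theta}$. (v) If $\alpha\notin\mathbb{Z}_{\ge 0}$, then the algebra $\mathfrak{A}^\alpha$ is isomorphic to the twisted generalized Weyl algebra associated with the graph $\Gamma$ with two vertices $1,2$ joined by an edge, the commutative algebra $R=\mathbb{C}[E_{11},E_{22},E_{33}]/(E_{11}+E_{22}+E_{33}-\alpha)$, the automorphisms $$\sigma_1(E_{11})=E_{11}-1,\quad \sigma_1(E_{22})=E_{22}+1,\quad \sigma_1(E_{33})=E_{33},$$ $$\sigma_2(E_{11})=E_{11},\quad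 \sigma_2(E_{22})=E_{22}-1,\quad \sigma_2(E_{33})=E_{33}+1,$$ and the elements $t_1=E_{22}(E_{11}+1)$, $t_2=E_{33}(E_{22}+1)$ of $R$. (vi) The form $\langle u,v\rangle_\alpha=\varphi\big((u\,\omega(v))^\sharp\big)(\alpha,0,0)$ is nondegenerate on $\mathfrak{A}^\alpha$ for $\alpha\notin\mathbb{Z}_{<0}$.
   Context: $E_{ij}$ are the matrix units of $\mathfrak{g}=\mathfrak{gl}(3)$, $\mathfrak{h}=\operatorname{Span}(E_{11},E_{22},E_{33})$ is the Cartan subalgebra, and a weight is written $(\lambda_1,\lambda_2,\lambda_3)$ with $\lambda_i$ its value on $E_{ii}$. Highest weights are taken with respect to the upper triangular Borel subalgebra. Modules $S^\alpha(V)$. If $\alpha\in\mathbb{Z}_{\ge0}$, $S^\alpha(V)=\operatorname{Span}(x_1^{k_1}x_2^{k_2}x_3^{k_3}: k_1+k_2+k_3=\alpha,\ k_1,k_2,k_3\in\mathbb{Z}_{\ge0})$. If $\alpha\notin\mathbb{Z}_{\ge0}$, $S^\alpha(V)=\operatorname{Span}(x_1^{k_1}x_2^{k_2}x_3^{k_3}: k_1+k_2+k_3=\alpha,\ k_2,k_3\in\mathbb{Z}_{\ge0})$, where $x_1^{k}$ for $k\in\mathbb{C}$ is a formal expression satisfying $\partial x_1^k/\partial x_1=kx_1^{k-1}$ and $x_1\cdot x_1^k=x_1^{k+1}$. The $\mathfrak{g}$-action is $E_{ij}\mapsto x_i\,\partial/\partial x_j$. The highest weight is $(\alpha,0,0)$.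 $J^\alpha$ is the kernel of the induced homomorphism $U(\mathfrak{g})\to\operatorname{End}(S^\alpha(V))$, and $\mathfrak{A}^\alpha=U(\mathfrak{g})/J^\alpha$ is a $\mathfrak{g}$-module via the adjoint action. $\theta$ is the highest weight $(1,0,-1)$ of the adjoint representation, and $L^{k\theta}$ is the irreducible finite-dimensional $\mathfrak{g}$-module of highest weight $k\theta$. The form. $Z(\mathfrak{g})$ is the center of $U(\mathfrak{g})$. One has $U(\mathfrak{g})=Z(\mathfrak{g})\oplus[U(\mathfrak{g}),U(\mathfrak{g})]$, and $u\mapsto u^\sharp$ is the projection onto $Z(\mathfrak{g})$ along $[U(\mathfrak{g}),U(\mathfrak{g})]$. $\omega$ is the involutive antiautomorphism of $U(\mathfrak{g})$ with $\omega(E_{ij})=E_{ji}$. $\varphi$ is the Harish-Chandra homomorphism, normalized so that for $z\in Z(\mathfrak{g})$ and $\lambda\in\mathfrak{h}^*$, $\varphi(z)(\lambda)$ is the scalar by which $z$ acts on a highest weight module of highest weight $\lambda$. The form $\varphi((u\omega(v))^\sharp)(\alpha,0,0)$ on $U(\mathfrak{g})$ descends to $\mathfrak{A}^\alpha$. Twisted generalized Weyl algebras. Let $R$ be a commutative $\mathbb{C}$-algebra, $\Gamma$ a finite nonoriented tree with vertex set $\Gamma_0$ and edge set $\Gamma_1$, $\{\sigma_i\}_{i\in\Gamma_0}$ pairwise commuting automorphisms of $R$, and $\{t_i\}_{i\in\Gamma_0}$ nonzero elements of $R$ such that $t_it_j=\sigma_i^{-1}(t_j)\sigma_j^{-1}(t_i)$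 if $(i,j)\in\Gamma_1$ and $\sigma_i(t_j)=t_j$ if $i\neq j$ and $(i,j)\notin\Gamma_1$. Let $\mathfrak{A}'$ be the algebra generated by $R$ and elements $X_i,Y_i$ ($i\in\Gamma_0$) subject to the relations (for all $r\in R$): $X_ir=\sigma_i(r)X_i$; $Y_ir=\sigma_i^{-1}(r)Y_i$; $X_iY_j=Y_jX_i$ if $i\ne j$; $Y_iX_i=t_i$; $X_iY_i=\sigma_i(t_i)$. It is graded by $\mathbb{Z}^{\Gamma_0}$ with $\deg R=0$, $\deg X_i=e_i$, $\deg Y_i=-e_i$. Among the homogeneous two-sided ideals of $\mathfrak{A}'$ intersecting $R$ trivially there is a largest one, $I$. The twisted generalized Weyl algebra is $\mathfrak{A}'/I$. *)

theory Defs
  imports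
    "HOL-Analysis.Analysis"
    "HOL-Library.Poly_Mapping"
    "HOL-Algebra.Algebra"
    "HOL-Algebra.Algebraic_Closure_Type"
begin

section \<open>Complex algebras\<close>

text \<open>
  Complex vector spaces and complex associative algebras are records of type
  \<open>(complex, 'a) module\<close>; for a vector space the fields \<open>mult\<close> and \<open>one\<close> are ignored.
\<close>

abbreviation \<CC> :: "complex ring" where
  "\<CC> \<equiv> ring_of_type_algebra"

definition alg_iso ::
  "(complex, 'a, 'e) module_scheme \<Rightarrow> (complex, 'b, 'f) module_scheme \<Rightarrow> ('a \<Rightarrow> 'b) set" where
  "alg_iso A B = {f \<in> ring_iso A B. \<forall>c. \<forall>x\<in>carrier A. f (c \<odot>\<^bsub>A\<^esub> x) = c \<odot>\<^bsub>B\<^esub> f x}"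

definition lin_span :: "(complex, 'a, 'e) module_scheme \<Rightarrow> 'a set \<Rightarrow> 'a set" where
  "lin_span M B = {\<Oplus>\<^bsub>M\<^esub>b\<in>F. c b \<odot>\<^bsub>M\<^esub> b | F c. finite F \<and> F \<subseteq> B}"

definition opp_alg :: "(complex, 'a) module \<Rightarrow> (complex, 'a) module" where
  "opp_alg A = A\<lparr>monoid.mult := (\<lambda>x y. y \<otimes>\<^bsub>A\<^esub> x)\<rparr>"

definition quot_alg :: "(complex, 'a) module \<Rightarrow> 'a set \<Rightarrow> (complex, 'a set) module" where
  "quot_alg A I =
     \<lparr>carrier = carrier (A Quot I), monoid.mult = monoid.mult (A Quot I),
      monoid.one = monoid.one (A Quot I),
      ring.zero = ring.zero (A Quot I), ring.add = ring.add (A Quot I),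
      smult = (\<lambda>c C. \<Union>x\<in>C. I +>\<^bsub>A\<^esub> (c \<odot>\<^bsub>A\<^esub> x))\<rparr>"

text \<open>The product is convolution, i.e. this is a subalgebra of the monoid algebra of \<open>'k\<close>.\<close>

definition monoid_alg :: "('k::monoid_add \<Rightarrow>\<^sub>0 complex) set \<Rightarrow> (complex, 'k \<Rightarrow>\<^sub>0 complex) module" where
  "monoid_alg C = \<lparr>carrier = C, monoid.mult = (*), monoid.one = 1, ring.zero = 0, ring.add = (+),
     smult = (\<lambda>c p. Poly_Mapping.single 0 c * p)\<rparr>"


section \<open>Presentations by generators and relations\<close>

instantiation list :: (type) monoid_add
begin
definition zero_list :: "'a list" where "zero_list = []"
definition plus_list :: "'a list \<Rightarrow> 'a list \<Rightarrow> 'a list" where "plus_list = (@)"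
instance by standard (simp_all add: zero_list_def plus_list_def)
end

text \<open>Elements of the free algebra are finitely supported functions on words.\<close>

type_synonym 'x free = "'x list \<Rightarrow>\<^sub>0 complex"

definition free_alg :: "'x set \<Rightarrow> (complex, 'x free) module" where
  "free_alg G = monoid_alg {p. \<forall>w\<in>Poly_Mapping.keys p. set w \<subseteq> G}"

definition gen :: "'x \<Rightarrow> 'x free" where
  "gen x = Poly_Mapping.single [x] 1"

definition const :: "complex \<Rightarrow> 'x free" where
  "const c = Poly_Mapping.single [] c"

text \<open>A pair \<open>(l, r)\<close> in \<open>Rel\<close> stands for the relation \<open>l = r\<close>.\<close>

definition rel_ideal :: "'x set \<Rightarrow> ('x free \<times> 'x free) set \<Rightarrow> 'x free set" where
  "rel_ideal G Rel = Idl\<^bsub>free_alg G\<^esub> {l - r | l r. (l, r) \<in> Rel}"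

definition presented_alg ::
  "'x set \<Rightarrow> ('x free \<times> 'x free) set \<Rightarrow> (complex, 'x free set) module" where
  "presented_alg G Rel = quot_alg (free_alg G) (rel_ideal G Rel)"

definition presented_class ::
  "'x set \<Rightarrow> ('x free \<times> 'x free) set \<Rightarrow> 'x free \<Rightarrow> 'x free set" where
  "presented_class G Rel p = rel_ideal G Rel +>\<^bsub>free_alg G\<^esub> p"

definition free_eval :: "(complex, 'b) module \<Rightarrow> ('x \<Rightarrow> 'b) \<Rightarrow> 'x free \<Rightarrow> 'b" where
  "free_eval B f p =
     (\<Oplus>\<^bsub>B\<^esub>w\<in>Poly_Mapping.keys p.
        Poly_Mapping.lookup p w \<odot>\<^bsub>B\<^esub> foldr (\<lambda>x y. f x \<otimes>\<^bsub>B\<^esub> y) w \<one>\<^bsub>B\<^esub>)"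

text \<open>
  The homomorphism from a presented algebra to \<open>B\<close> that extends \<open>f\<close>. The choice of the
  representative is immaterial whenever \<open>f\<close> respects the relations.
\<close>

definition induced_hom :: "(complex, 'b) module \<Rightarrow> ('x \<Rightarrow> 'b) \<Rightarrow> 'x free set \<Rightarrow> 'b" where
  "induced_hom B f u = free_eval B f (SOME p. p \<in> u)"


section \<open>The Lie algebra gl(3) and its enveloping algebra\<close>

text \<open>
  Rows and columns are indexed by the numeral type \<open>3\<close>, with elements \<open>1\<close>, \<open>2\<close>, \<open>3\<close>.
  In its library order \<open>3 = 0\<close> is the least element, so that order is never used here.
\<close>

type_synonym gl3 = "complex ^ 3 ^ 3"

definition matrix_unit :: "3 \<Rightarrow> 3 \<Rightarrow> gl3" where
  "matrix_unit i j = (\<chi> a b. if a = i \<and> b = j then 1 else 0)"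

definition gl3_scale :: "complex \<Rightarrow> gl3 \<Rightarrow> gl3" where
  "gl3_scale c x = (\<chi> a b. c * x $ a $ b)"

definition gl3_bracket :: "gl3 \<Rightarrow> gl3 \<Rightarrow> gl3" where
  "gl3_bracket x y = x ** y - y ** x"

text \<open>
  The first two relations make the free algebra on the underlying set of gl(3) into the
  tensor algebra of the vector space gl(3).
\<close>

inductive_set U_rel :: "(gl3 free \<times> gl3 free) set" where
  "(gen (x + y), gen x + gen y) \<in> U_rel"
| "(gen (gl3_scale c x), const c * gen x) \<in> U_rel"
| "(gen (gl3_bracket x y), gen x * gen y - gen y * gen x) \<in> U_rel"

type_synonym Uelt = "gl3 free set"

definition U :: "(complex, Uelt) module" where
  "U = presented_alg UNIV U_rel"

definition \<iota> :: "gl3 \<Rightarrow> Uelt" where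
  "\<iota> x = presented_class UNIV U_rel (gen x)"


section \<open>Modules over gl(3)\<close>

record 'm gmod = "(complex, 'm) module" +
  act :: "gl3 \<Rightarrow> 'm \<Rightarrow> 'm"

definition with_act :: "(complex, 'm) module \<Rightarrow> (gl3 \<Rightarrow> 'm \<Rightarrow> 'm) \<Rightarrow> 'm gmod" where
  "with_act M f = module.extend M (gmod.fields f)"

definition gmodule :: "'m gmod \<Rightarrow> bool" where
  "gmodule M \<longleftrightarrow> module \<CC> M \<and>
     (\<forall>x. \<forall>m\<in>carrier M. act M x m \<in> carrier M) \<and>
     (\<forall>x. \<forall>m\<in>carrier M. \<forall>n\<in>carrier M. act M x (m \<oplus>\<^bsub>M\<^esub> n) = act M x m \<oplus>\<^bsub>M\<^esub> act M x n) \<and>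
     (\<forall>x c. \<forall>m\<in>carrier M. act M x (c \<odot>\<^bsub>M\<^esub> m) = c \<odot>\<^bsub>M\<^esub> act M x m) \<and>
     (\<forall>x y. \<forall>m\<in>carrier M. act M (x + y) m = act M x m \<oplus>\<^bsub>M\<^esub> act M y m) \<and>
     (\<forall>c x. \<forall>m\<in>carrier M. act M (gl3_scale c x) m = c \<odot>\<^bsub>M\<^esub> act M x m) \<and>
     (\<forall>x y. \<forall>m\<in>carrier M.
        act M (gl3_bracket x y) m = act M x (act M y m) \<ominus>\<^bsub>M\<^esub> act M y (act M x m))"

definition gsubmodule :: "'m set \<Rightarrow> 'm gmod \<Rightarrow> bool" where
  "gsubmodule N M \<longleftrightarrow> submodule N \<CC> M \<and> (\<forall>x. \<forall>m\<in>N. act M x m \<in> N)"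

definition irreducible_gmod :: "'m gmod \<Rightarrow> bool" where
  "irreducible_gmod M \<longleftrightarrow> gmodule M \<and> carrier M \<noteq> {\<zero>\<^bsub>M\<^esub>} \<and>
     (\<forall>N. gsubmodule N M \<longrightarrow> N = {\<zero>\<^bsub>M\<^esub>} \<or> N = carrier M)"

definition gmod_iso :: "'m gmod \<Rightarrow> 'n gmod \<Rightarrow> ('m \<Rightarrow> 'n) set" where
  "gmod_iso M N = {f. bij_betw f (carrier M) (carrier N) \<and>
     (\<forall>m\<in>carrier M. \<forall>n\<in>carrier M. f (m \<oplus>\<^bsub>M\<^esub> n) = f m \<oplus>\<^bsub>N\<^esub> f n) \<and>
     (\<forall>c. \<forall>m\<in>carrier M. f (c \<odot>\<^bsub>M\<^esub> m) = c \<odot>\<^bsub>N\<^esub> f m) \<and>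
     (\<forall>x. \<forall>m\<in>carrier M. f (act M x m) = act N x (f m))}"

definition gmod_sum :: "'i set \<Rightarrow> ('i \<Rightarrow> 'm gmod) \<Rightarrow> ('i \<Rightarrow> 'm) gmod" where
  "gmod_sum K L =
     \<lparr>carrier = {f \<in> (\<Pi>\<^sub>E k\<in>K. carrier (L k)). finite {k \<in> K. f k \<noteq> \<zero>\<^bsub>L k\<^esub>}},
      monoid.mult = undefined, monoid.one = undefined,
      ring.zero = (\<lambda>k\<in>K. \<zero>\<^bsub>L k\<^esub>),
      ring.add = (\<lambda>f g. \<lambda>k\<in>K. f k \<oplus>\<^bsub>L k\<^esub> g k),
      smult = (\<lambda>c f. \<lambda>k\<in>K. c \<odot>\<^bsub>L k\<^esub> f k),
      act = (\<lambda>x f. \<lambda>k\<in>K. act (L k) x (f k))\<rparr>"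

definition End_alg :: "'m gmod \<Rightarrow> (complex, 'm \<Rightarrow> 'm) module" where
  "End_alg M =
     \<lparr>carrier = {f \<in> carrier M \<rightarrow>\<^sub>E carrier M.
        (\<forall>m\<in>carrier M. \<forall>n\<in>carrier M. f (m \<oplus>\<^bsub>M\<^esub> n) = f m \<oplus>\<^bsub>M\<^esub> f n) \<and>
        (\<forall>c. \<forall>m\<in>carrier M. f (c \<odot>\<^bsub>M\<^esub> m) = c \<odot>\<^bsub>M\<^esub> f m)},
      monoid.mult = compose (carrier M),
      monoid.one = (\<lambda>m\<in>carrier M. m),
      ring.zero = (\<lambda>m\<in>carrier M. \<zero>\<^bsub>M\<^esub>),
      ring.add = (\<lambda>f g. \<lambda>m\<in>carrier M. f m \<oplus>\<^bsub>M\<^esub> g m),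
      smult = (\<lambda>c f. \<lambda>m\<in>carrier M. c \<odot>\<^bsub>M\<^esub> f m)\<rparr>"

definition U_rep :: "'m gmod \<Rightarrow> Uelt \<Rightarrow> ('m \<Rightarrow> 'm)" where
  "U_rep M = induced_hom (End_alg M) (\<lambda>x. \<lambda>m\<in>carrier M. act M x m)"

text \<open>A weight is written as the vector of its values on the diagonal matrix units.\<close>

definition highest_weight_vector :: "'m gmod \<Rightarrow> complex ^ 3 \<Rightarrow> 'm \<Rightarrow> bool" where
  "highest_weight_vector M lam v \<longleftrightarrow> v \<in> carrier M \<and> v \<noteq> \<zero>\<^bsub>M\<^esub> \<and>
     (\<forall>(i, j)\<in>{(1, 2), (1, 3), (2, 3)}. act M (matrix_unit i j) v = \<zero>\<^bsub>M\<^esub>) \<and>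
     (\<forall>i. act M (matrix_unit i i) v = (lam $ i) \<odot>\<^bsub>M\<^esub> v)"

definition highest_weight_module :: "complex ^ 3 \<Rightarrow> 'm gmod \<Rightarrow> bool" where
  "highest_weight_module lam M \<longleftrightarrow> gmodule M \<and>
     (\<exists>v. highest_weight_vector M lam v \<and> (\<forall>N. gsubmodule N M \<and> v \<in> N \<longrightarrow> N = carrier M))"

definition finite_dim :: "'m gmod \<Rightarrow> bool" where
  "finite_dim M \<longleftrightarrow> (\<exists>B. finite B \<and> B \<subseteq> carrier M \<and> carrier M = lin_span M B)"

definition \<theta> :: "complex ^ 3" where
  "\<theta> = vector [1, 0, -1]"

text \<open>This determines \<open>M\<close> up to isomorphism.\<close>

definition is_L_theta :: "nat \<Rightarrow> 'm gmod \<Rightarrow> bool" where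
  "is_L_theta k M \<longleftrightarrow>
     irreducible_gmod M \<and> finite_dim M \<and> highest_weight_module (of_nat k *s \<theta>) M"


section \<open>The modules \<open>S\<^sup>\<alpha>(V)\<close> and the algebras \<open>\<AA>\<^sup>\<alpha>\<close>\<close>

text \<open>
  The formal monomial with exponent vector \<open>k\<close> is the basis element \<open>single k 1\<close> of the group
  algebra of \<open>complex ^ 3\<close>, so that multiplying monomials adds exponents.
\<close>

type_synonym fexpr = "(complex ^ 3) \<Rightarrow>\<^sub>0 complex"

definition x_var :: "3 \<Rightarrow> fexpr" where
  "x_var i = Poly_Mapping.single (axis i 1) 1"

definition x_diff :: "3 \<Rightarrow> fexpr \<Rightarrow> fexpr" where
  "x_diff j p = (\<Sum>k\<in>Poly_Mapping.keys p.
     Poly_Mapping.single (k - axis j 1) (k $ j * Poly_Mapping.lookup p k))"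

definition S_exponents :: "complex \<Rightarrow> (complex ^ 3) set" where
  "S_exponents \<alpha> =
     (if \<alpha> \<in> \<nat> then {k. k $ 1 + k $ 2 + k $ 3 = \<alpha> \<and> k $ 1 \<in> \<nat> \<and> k $ 2 \<in> \<nat> \<and> k $ 3 \<in> \<nat>}
      else {k. k $ 1 + k $ 2 + k $ 3 = \<alpha> \<and> k $ 2 \<in> \<nat> \<and> k $ 3 \<in> \<nat>})"

definition S_mod :: "complex \<Rightarrow> fexpr gmod" where
  "S_mod \<alpha> = with_act (monoid_alg {p. Poly_Mapping.keys p \<subseteq> S_exponents \<alpha>})
     (\<lambda>x p. \<Sum>i\<in>UNIV. \<Sum>j\<in>UNIV. Poly_Mapping.single 0 (x $ i $ j) * (x_var i * x_diff j p))"

definition J :: "complex \<Rightarrow> Uelt set" where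
  "J \<alpha> = a_kernel U (End_alg (S_mod \<alpha>)) (U_rep (S_mod \<alpha>))"

definition \<AA> :: "complex \<Rightarrow> (complex, Uelt set) module" where
  "\<AA> \<alpha> = quot_alg U (J \<alpha>)"

definition \<AA>_class :: "complex \<Rightarrow> Uelt \<Rightarrow> Uelt set" where
  "\<AA>_class \<alpha> u = J \<alpha> +>\<^bsub>U\<^esub> u"

definition \<AA>_adjoint :: "complex \<Rightarrow> Uelt set gmod" where
  "\<AA>_adjoint \<alpha> = with_act (\<AA> \<alpha>)
     (\<lambda>x a. \<AA>_class \<alpha> (\<iota> x) \<otimes>\<^bsub>\<AA> \<alpha>\<^esub> a \<ominus>\<^bsub>\<AA> \<alpha>\<^esub> a \<otimes>\<^bsub>\<AA> \<alpha>\<^esub> \<AA>_class \<alpha> (\<iota> x))"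


section \<open>The form\<close>

definition U_center :: "Uelt set" where
  "U_center = {z \<in> carrier U. \<forall>u\<in>carrier U. z \<otimes>\<^bsub>U\<^esub> u = u \<otimes>\<^bsub>U\<^esub> z}"

definition U_commutators :: "Uelt set" where
  "U_commutators =
     lin_span U {u \<otimes>\<^bsub>U\<^esub> v \<ominus>\<^bsub>U\<^esub> v \<otimes>\<^bsub>U\<^esub> u | u v. u \<in> carrier U \<and> v \<in> carrier U}"

definition U_sharp :: "Uelt \<Rightarrow> Uelt" where
  "U_sharp u = (THE z. z \<in> U_center \<and> u \<ominus>\<^bsub>U\<^esub> z \<in> U_commutators)"

definition \<omega> :: "Uelt \<Rightarrow> Uelt" where
  "\<omega> = induced_hom (opp_alg U) (\<lambda>x. \<iota> (transpose x))"

text \<open>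
  The value at \<open>lam\<close> of the Harish-Chandra image of \<open>z\<close>. Every highest weight module is
  a quotient of \<open>U\<close> by a left ideal and so has a copy whose elements are sets of elements of \<open>U\<close>.
\<close>

definition harish_chandra :: "Uelt \<Rightarrow> complex ^ 3 \<Rightarrow> complex" where
  "harish_chandra z lam = (THE c. \<forall>M :: Uelt set gmod. highest_weight_module lam M \<longrightarrow>
     (\<forall>m\<in>carrier M. U_rep M z m = c \<odot>\<^bsub>M\<^esub> m))"

definition U_form :: "complex \<Rightarrow> Uelt \<Rightarrow> Uelt \<Rightarrow> complex" where
  "U_form \<alpha> u v = harish_chandra (U_sharp (u \<otimes>\<^bsub>U\<^esub> \<omega> v)) (vector [\<alpha>, 0, 0])"


section \<open>Twisted generalized Weyl algebras\<close>

text \<open>A nonoriented graph is given by its vertex set and a symmetric edge relation.\<close>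

definition finite_tree :: "'v set \<Rightarrow> ('v \<times> 'v) set \<Rightarrow> bool" where
  "finite_tree V E \<longleftrightarrow> finite V \<and> V \<noteq> {} \<and> E \<subseteq> V \<times> V \<and> sym E \<and> irrefl E \<and>
     (\<forall>u\<in>V. \<forall>v\<in>V. \<exists>!p. p \<noteq> [] \<and> hd p = u \<and> last p = v \<and> distinct p \<and> set p \<subseteq> V \<and>
        successively (\<lambda>a b. (a, b) \<in> E) p)"

definition tgwa_datum ::
  "'v set \<Rightarrow> ('v \<times> 'v) set \<Rightarrow> (complex, 'r) module \<Rightarrow> ('v \<Rightarrow> 'r \<Rightarrow> 'r) \<Rightarrow> ('v \<Rightarrow> 'r) \<Rightarrow> bool" where
  "tgwa_datum V E R \<sigma> t \<longleftrightarrow>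
     finite_tree V E \<and> algebra \<CC> R \<and>
     (\<forall>i\<in>V. \<sigma> i \<in> alg_iso R R) \<and>
     (\<forall>i\<in>V. \<forall>j\<in>V. \<forall>r\<in>carrier R. \<sigma> i (\<sigma> j r) = \<sigma> j (\<sigma> i r)) \<and>
     (\<forall>i\<in>V. t i \<in> carrier R \<and> t i \<noteq> \<zero>\<^bsub>R\<^esub>) \<and>
     (\<forall>(i, j)\<in>E. t i \<otimes>\<^bsub>R\<^esub> t j =
        inv_into (carrier R) (\<sigma> i) (t j) \<otimes>\<^bsub>R\<^esub> inv_into (carrier R) (\<sigma> j) (t i)) \<and>
     (\<forall>i\<in>V. \<forall>j\<in>V. i \<noteq> j \<and> (i, j) \<notin> E \<longrightarrow> \<sigma> i (t j) = t j)"

datatype ('r, 'v) tgwa_gen = R_gen 'r | X_gen 'v | Y_gen 'v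

definition tgwa_gens :: "'v set \<Rightarrow> (complex, 'r) module \<Rightarrow> ('r, 'v) tgwa_gen set" where
  "tgwa_gens V R = R_gen ` carrier R \<union> X_gen ` V \<union> Y_gen ` V"

text \<open>The first four relations make \<open>R_gen\<close> a homomorphism of algebras.\<close>

inductive_set tgwa_rel ::
  "'v set \<Rightarrow> (complex, 'r) module \<Rightarrow> ('v \<Rightarrow> 'r \<Rightarrow> 'r) \<Rightarrow> ('v \<Rightarrow> 'r) \<Rightarrow>
     (('r, 'v) tgwa_gen free \<times> ('r, 'v) tgwa_gen free) set"
  for V :: "'v set" and R :: "(complex, 'r) module" and \<sigma> :: "'v \<Rightarrow> 'r \<Rightarrow> 'r" and t :: "'v \<Rightarrow> 'r"
where
  "r \<in> carrier R \<Longrightarrow> s \<in> carrier R \<Longrightarrow>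
     (gen (R_gen (r \<oplus>\<^bsub>R\<^esub> s)), gen (R_gen r) + gen (R_gen s)) \<in> tgwa_rel V R \<sigma> t"
| "r \<in> carrier R \<Longrightarrow> (gen (R_gen (c \<odot>\<^bsub>R\<^esub> r)), const c * gen (R_gen r)) \<in> tgwa_rel V R \<sigma> t"
| "r \<in> carrier R \<Longrightarrow> s \<in> carrier R \<Longrightarrow>
     (gen (R_gen (r \<otimes>\<^bsub>R\<^esub> s)), gen (R_gen r) * gen (R_gen s)) \<in> tgwa_rel V R \<sigma> t"
| "(gen (R_gen \<one>\<^bsub>R\<^esub>), 1) \<in> tgwa_rel V R \<sigma> t"
| "i \<in> V \<Longrightarrow> r \<in> carrier R \<Longrightarrow>
     (gen (X_gen i) * gen (R_gen r), gen (R_gen (\<sigma> i r)) * gen (X_gen i)) \<in> tgwa_rel V R \<sigma> t"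
| "i \<in> V \<Longrightarrow> r \<in> carrier R \<Longrightarrow>
     (gen (Y_gen i) * gen (R_gen r), gen (R_gen (inv_into (carrier R) (\<sigma> i) r)) * gen (Y_gen i))
       \<in> tgwa_rel V R \<sigma> t"
| "i \<in> V \<Longrightarrow> j \<in> V \<Longrightarrow> i \<noteq> j \<Longrightarrow>
     (gen (X_gen i) * gen (Y_gen j), gen (Y_gen j) * gen (X_gen i)) \<in> tgwa_rel V R \<sigma> t"
| "i \<in> V \<Longrightarrow> (gen (Y_gen i) * gen (X_gen i), gen (R_gen (t i))) \<in> tgwa_rel V R \<sigma> t"
| "i \<in> V \<Longrightarrow> (gen (X_gen i) * gen (Y_gen i), gen (R_gen (\<sigma> i (t i)))) \<in> tgwa_rel V R \<sigma> t"

definition tgwa_pre where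
  "tgwa_pre V R \<sigma> t = presented_alg (tgwa_gens V R) (tgwa_rel V R \<sigma> t)"

definition tgwa_class where
  "tgwa_class V R \<sigma> t = presented_class (tgwa_gens V R) (tgwa_rel V R \<sigma> t)"

fun gen_degree :: "('r, 'v) tgwa_gen \<Rightarrow> 'v \<Rightarrow> int" where
  "gen_degree (R_gen r) v = 0"
| "gen_degree (X_gen i) v = (if v = i then 1 else 0)"
| "gen_degree (Y_gen i) v = (if v = i then -1 else 0)"

definition word_degree :: "('r, 'v) tgwa_gen list \<Rightarrow> 'v \<Rightarrow> int" where
  "word_degree w v = (\<Sum>g\<leftarrow>w. gen_degree g v)"

definition tgwa_component where
  "tgwa_component V R \<sigma> t d =
     {tgwa_class V R \<sigma> t p | p. p \<in> carrier (free_alg (tgwa_gens V R)) \<and>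
        (\<forall>w\<in>Poly_Mapping.keys p. word_degree w = d)}"

definition tgwa_homogeneous_ideal where
  "tgwa_homogeneous_ideal V R \<sigma> t K \<longleftrightarrow> ideal K (tgwa_pre V R \<sigma> t) \<and>
     (\<forall>a\<in>K. \<exists>D h. finite D \<and> (\<forall>d\<in>D. h d \<in> K \<inter> tgwa_component V R \<sigma> t d) \<and>
        a = (\<Oplus>\<^bsub>tgwa_pre V R \<sigma> t\<^esub>d\<in>D. h d))"

definition tgwa_ideal where
  "tgwa_ideal V R \<sigma> t = (GREATEST K. tgwa_homogeneous_ideal V R \<sigma> t K \<and>
     K \<inter> (\<lambda>r. tgwa_class V R \<sigma> t (gen (R_gen r))) ` carrier R = {\<zero>\<^bsub>tgwa_pre V R \<sigma> t\<^esub>})"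

definition tgwa where
  "tgwa V R \<sigma> t = quot_alg (tgwa_pre V R \<sigma> t) (tgwa_ideal V R \<sigma> t)"


section \<open>The base ring \<open>\<complex>[E\<^sub>1\<^sub>1, E\<^sub>2\<^sub>2, E\<^sub>3\<^sub>3] / (E\<^sub>1\<^sub>1 + E\<^sub>2\<^sub>2 + E\<^sub>3\<^sub>3 - \<alpha>)\<close>\<close>

type_synonym poly3 = "(3 \<Rightarrow>\<^sub>0 nat) \<Rightarrow>\<^sub>0 complex"

definition poly3_alg :: "(complex, poly3) module" where
  "poly3_alg = monoid_alg UNIV"

definition poly3_var :: "3 \<Rightarrow> poly3" where
  "poly3_var i = Poly_Mapping.single (Poly_Mapping.single i 1) 1"

definition R_ideal :: "complex \<Rightarrow> poly3 set" where
  "R_ideal \<alpha> = Idl\<^bsub>poly3_alg\<^esub>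
     {poly3_var 1 + poly3_var 2 + poly3_var 3 - Poly_Mapping.single 0 \<alpha>}"

definition R_alg :: "complex \<Rightarrow> (complex, poly3 set) module" where
  "R_alg \<alpha> = quot_alg poly3_alg (R_ideal \<alpha>)"

definition R_E :: "complex \<Rightarrow> 3 \<Rightarrow> poly3 set" where
  "R_E \<alpha> i = R_ideal \<alpha> +>\<^bsub>poly3_alg\<^esub> poly3_var i"

end

theory Submission
  imports Defs
begin

text \<open>Throughout, \<open>al\<close> is the parameter of \<open>S\<^sup>\<alpha>(V)\<close>. All algebras are handled through polynomial or word
  representatives: a \<open>cover\<close> is a surjection from a set of finitely supported functions onto an
  algebra. The enveloping algebra is covered by words in the nine matrix units, and \<open>Jp al\<close> is the set
  of combinations of words that act as zero on \<open>S\<^sup>\<alpha>(V)\<close>, the preimage of the annihilator.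

  Irreducibility: raising operators applied to the top monomial of a nonzero vector lead to the
  highest weight vector, and lowering operators lead from there to every monomial, as the coefficients
  that occur do not vanish (\<open>lower_to_top\<close>, \<open>raise_mon\<close>).

  Adjoint structure: on words of bounded length the adjoint action of \<open>E\<^sub>i\<^sub>j\<close> is the adjoint of that of
  \<open>E\<^sub>j\<^sub>i\<close> for the Hermitian form in which words are orthonormal. So invariant subspaces have
  invariant complements, and every proper inclusion of them shows a new highest weight vector
  (\<open>highest_weight_between\<close>). An operator on \<open>S\<^sup>\<alpha>(V)\<close> commuting with the raising operators is
  determined by its weight and its value on one monomial, which leaves only the powers of \<open>E\<^sub>1\<^sub>3\<close> (\<open>hwv_unique\<close>), and
  \<open>E\<^sub>1\<^sub>3\<^sup>k\<close> acts as zero exactly if \<open>\<alpha>\<close> is a natural number below \<open>k\<close> (\<open>e13_in_Jp\<close>). Thus the quotient is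
  the sum of the submodules generated by the surviving powers, and the sum is direct since the Casimir
  operator separates them.

  Maximality: a larger ideal contains a power of \<open>E\<^sub>1\<^sub>3\<close> outside the annihilator, and contracting
  \<open>E\<^sub>1\<^sub>3\<^sup>n\<^sup>+\<^sup>1\<close> with the adjoint representation gives \<open>E\<^sub>1\<^sub>3\<^sup>n\<close> with a factor that is nonzero unless \<open>\<alpha>\<close> is
  \<open>n\<close> or \<open>- n - 3\<close> (\<open>descent\<close>). So the ideal contains 1.

  The form: the projection onto the centre is the projection onto adjoint invariants, so the form is
  the trace form \<open>tr (p q\<^sup>*)\<close> with \<open>q\<^sup>*\<close> the adjoint operator for the contravariant form. Its radical is a
  proper ideal containing the annihilator, hence equal to it by maximality (\<open>tr_radical\<close>).

  Twisted generalized Weyl algebra: for \<open>\<alpha> \<notin> \<nat>\<close> the base ring is the ring of functions on the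
  weights of \<open>S\<^sup>\<alpha>(V)\<close>, and \<open>X\<^sub>1, X\<^sub>2, Y\<^sub>1, Y\<^sub>2\<close> act as \<open>E\<^sub>1\<^sub>2, E\<^sub>2\<^sub>3, E\<^sub>2\<^sub>1, E\<^sub>3\<^sub>2\<close>. Every homogeneous element of degree zero
  lies in the base ring (\<open>degree_zero\<close>), and any two monomials are connected by operators of the
  algebra, so a homogeneous element acting nontrivially can be multiplied into a nonzero element of the
  base ring. Therefore the kernel of the action is the largest graded ideal meeting the base ring
  trivially (\<open>tgwa_cover\<close>, \<open>N_nondegenerate\<close>).\<close>


text \<open>Short names for the constants of finitely supported functions.\<close>

abbreviation lookup where "lookup \<equiv> Poly_Mapping.lookup"
abbreviation single where "single \<equiv> Poly_Mapping.single"
abbreviation keys where "keys \<equiv> Poly_Mapping.keys"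

section \<open>Complex algebras covered by monoid algebras\<close>

abbreviation sc :: "complex => ('k::monoid_add \<Rightarrow>\<^sub>0 complex) => ('k \<Rightarrow>\<^sub>0 complex)" where
  "sc c p \<equiv> single 0 c * p"

lemma lookup_sc [simp]: "lookup (sc c p) k = c * lookup p k"
  by (simp flip: mult_map_scale_conv_mult add: Poly_Mapping.map.rep_eq when_def)

lemma keys_sc: "keys (sc c p) \<subseteq> keys p"
  by (auto simp: in_keys_iff)

lemma sc_mult_right: "p * sc c q = sc c (p * (q :: 'k::monoid_add \<Rightarrow>\<^sub>0 complex))"
proof -
  have comm: "p * single 0 c = sc c p" for p :: "'k \<Rightarrow>\<^sub>0 complex"
  proof (induction p rule: Poly_Mapping.update_induct)
    case const then show ?case by simp
  next
    case (update f a b)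
    have "Poly_Mapping.update a b f = f + single a b"
      using update(1) by (intro poly_mapping_eqI)
        (auto simp: lookup_update lookup_add lookup_single in_keys_iff when_def)
    then show ?case using update(3) by (simp add: algebra_simps mult_single)
  qed
  show ?thesis by (metis comm mult.assoc)
qed

lemma sc_sc [simp]: "sc c (sc d p) = sc (c * d) (p :: 'k::monoid_add \<Rightarrow>\<^sub>0 complex)"
  by (simp add: mult_single flip: mult.assoc)

lemma sc_add_left: "sc (c + d) p = sc c p + sc d (p :: 'k::monoid_add \<Rightarrow>\<^sub>0 complex)"
  by (simp add: single_add algebra_simps)

lemma sc_one [simp]: "sc 1 p = (p :: 'k::monoid_add \<Rightarrow>\<^sub>0 complex)"
  by simp

lemma sc_minus_one: "sc (-1) p = - (p :: 'k::monoid_add \<Rightarrow>\<^sub>0 complex)"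
  by (simp add: single_uminus)

lemma sc_zero [simp]: "sc 0 p = (0 :: 'k::monoid_add \<Rightarrow>\<^sub>0 complex)"
  by simp

lemma sc_single [simp]: "sc c (single k d) = single (k::'k::monoid_add) (c * d)"
  by (simp add: mult_single)

lemma poly_mapping_expand:
  "p = (\<Sum>k\<in>keys p. single k (lookup p k))"
  by (intro poly_mapping_eqI)
     (auto simp: lookup_sum lookup_single when_def in_keys_iff)

lemma poly_mapping_induct [case_names zero single add]:
  fixes p :: "'k \<Rightarrow>\<^sub>0 complex"
  assumes "P 0"
    and "\<And>k c. k \<in> keys p ==> P (single k c)"
    and "\<And>p q. P p ==> P q ==> P (p + q)"
  shows "P p"
proof -
  have "P (\<Sum>k\<in>F. single k (lookup p k))"
    if "finite F" "F \<subseteq> keys p" for F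
    using that by (induction F rule: finite_induct) (auto intro: assms)
  from this[OF finite_keys order_refl] show ?thesis
    by (simp only: poly_mapping_expand[symmetric])
qed

lemma carrier_\<CC> [simp]: "carrier \<CC> = UNIV" "\<zero>\<^bsub>\<CC>\<^esub> = 0" "\<one>\<^bsub>\<CC>\<^esub> = 1"
  "x \<oplus>\<^bsub>\<CC>\<^esub> y = x + y" "x \<otimes>\<^bsub>\<CC>\<^esub> y = x * y"
  by (simp_all add: ring_of_type_algebra_def)

lemma cring_\<CC>: "cring \<CC>" by (rule cring_from_type_algebra)

lemma a_inv_\<CC> [simp]: "\<ominus>\<^bsub>\<CC>\<^esub> x = - x"
proof -
  interpret cring \<CC> by (rule cring_\<CC>)
  have "x \<oplus>\<^bsub>\<CC>\<^esub> (- x) = \<zero>\<^bsub>\<CC>\<^esub>" by simp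
  then show ?thesis by (metis UNIV_I add.inv_equality add.m_comm carrier_\<CC>(1))
qed

text \<open>Unlike the library's notion of an algebra this one is not commutative.\<close>

locale cx_alg = module "\<CC> :: complex ring" A + ring A for A :: "(complex, 'a, 'e) module_scheme" (structure) +
  assumes smult_mult_l: "x \<in> carrier A ==> y \<in> carrier A ==> (c \<odot> x) \<otimes> y = c \<odot> (x \<otimes> y)"
    and smult_mult_r: "x \<in> carrier A ==> y \<in> carrier A ==> x \<otimes> (c \<odot> y) = c \<odot> (x \<otimes> y)"

lemma (in cx_alg) smult_facts [simp]:
  "x \<in> carrier A ==> 0 \<odot> x = \<zero>" "x \<in> carrier A ==> 1 \<odot> x = x"
  "x \<in> carrier A ==> c \<odot> x \<in> carrier A" "c \<odot> \<zero> = \<zero>"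
  using smult_l_null smult_one smult_closed smult_r_null by auto

lemma (in cx_alg) smult_rules:
  assumes "x \<in> carrier A"
  shows "y \<in> carrier A ==> c \<odot> (x \<oplus> y) = c \<odot> x \<oplus> c \<odot> y"
    "(c + d) \<odot> x = c \<odot> x \<oplus> d \<odot> x" "(c * d) \<odot> x = c \<odot> (d \<odot> x)" "(- c) \<odot> x = \<ominus> (c \<odot> x)"
  using assms smult_r_distr[of c x y] smult_l_distr[of c d x] smult_assoc1[of c d x] smult_l_minus[of c x]
  by auto

lemma cx_algI:
  fixes A :: "(complex, 'a, 'e) module_scheme" (structure)
  assumes "module \<CC> A" "ring A"
   "\<And>x y c. x \<in> carrier A ==> y \<in> carrier A ==> (c \<odot> x) \<otimes> y = c \<odot> (x \<otimes> y)"
   "\<And>x y c. x \<in> carrier A ==> y \<in> carrier A ==> x \<otimes> (c \<odot> y) = c \<odot> (x \<otimes> y)"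
  shows "cx_alg A"
  using assms by (intro cx_alg.intro cx_alg_axioms.intro) auto

definition subalg :: "('k::monoid_add \<Rightarrow>\<^sub>0 complex) set => bool" where
  "subalg C \<longleftrightarrow> 0 \<in> C \<and> 1 \<in> C \<and> (\<forall>p\<in>C. \<forall>q\<in>C. p + q \<in> C \<and> p * q \<in> C) \<and> (\<forall>c. \<forall>p\<in>C. sc c p \<in> C)"

lemma subalg_UNIV [simp]: "subalg UNIV" by (simp add: subalg_def)

locale alg_map = cx_alg A for A :: "(complex, 'a, 'e) module_scheme" (structure) +
  fixes C :: "('k::monoid_add \<Rightarrow>\<^sub>0 complex) set" and \<pi> :: "('k \<Rightarrow>\<^sub>0 complex) => 'a"
  assumes subalg: "subalg C"
    and map_closed [simp]: "p \<in> C ==> \<pi> p \<in> carrier A"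
    and map_add: "p \<in> C ==> q \<in> C ==> \<pi> (p + q) = \<pi> p \<oplus> \<pi> q"
    and map_mult: "p \<in> C ==> q \<in> C ==> \<pi> (p * q) = \<pi> p \<otimes> \<pi> q"
    and map_one: "\<pi> 1 = \<one>"
    and map_sc: "p \<in> C ==> \<pi> (sc c p) = c \<odot> \<pi> p"
begin

lemma C_zero [simp]: "0 \<in> C" and C_one [simp]: "1 \<in> C"
  and C_add [simp]: "p \<in> C ==> q \<in> C ==> p + q \<in> C"
  and C_mult [simp]: "p \<in> C ==> q \<in> C ==> p * q \<in> C"
  and C_sc [simp]: "p \<in> C ==> sc c p \<in> C"
  using subalg by (auto simp: subalg_def)

lemma C_uminus [simp]: "p \<in> C ==> - p \<in> C"
  using C_sc[of p "-1"] by (simp add: sc_minus_one)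

lemma C_diff [simp]: "p \<in> C ==> q \<in> C ==> p - q \<in> C"
  using C_add[of p "- q"] by simp

lemma C_sum [simp]: "(\<And>i. i \<in> F ==> h i \<in> C) ==> sum h F \<in> C"
  by (induction F rule: infinite_finite_induct) auto

lemma map_zero [simp]: "\<pi> 0 = \<zero>"
  using map_sc[of 0 0] map_closed[of 0] by (simp del: map_closed)

lemma map_uminus: "p \<in> C ==> \<pi> (- p) = \<ominus> \<pi> p"
  using map_sc[of p "-1"] by (simp add: sc_minus_one smult_rules)

lemma map_diff: "p \<in> C ==> q \<in> C ==> \<pi> (p - q) = \<pi> p \<ominus> \<pi> q"
  using map_add[of p "- q"] by (simp add: map_uminus minus_eq)

lemma map_sum: "(\<And>i. i \<in> F ==> h i \<in> C) ==> \<pi> (sum h F) = (\<Oplus>i\<in>F. \<pi> (h i))"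
proof (induction F rule: infinite_finite_induct)
  case (insert x F)
  then show ?case by (simp add: map_add Pi_def)
qed auto

end

text \<open>Identities in a covered algebra are proved for representatives, where the automation for the
  commutative additive group of finitely supported functions applies.\<close>

locale cover = alg_map +
  assumes surj: "carrier A = \<pi> ` C"

lemma coverI:
  fixes A :: "(complex, 'a, 'e) module_scheme" (structure)
  assumes C: "subalg C" and carr: "carrier A = \<pi> ` C" and zero: "\<pi> 0 = \<zero>" and one: "\<pi> 1 = \<one>"
    and add: "\<And>p q. p \<in> C ==> q \<in> C ==> \<pi> (p + q) = \<pi> p \<oplus> \<pi> q"
    and mult: "\<And>p q. p \<in> C ==> q \<in> C ==> \<pi> (p * q) = \<pi> p \<otimes> \<pi> q"
    and smult: "\<And>p c. p \<in> C ==> \<pi> (sc c p) = c \<odot> \<pi> p"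
  shows "cover A C \<pi>"
proof -
  have C_add: "p \<in> C ==> q \<in> C ==> p + q \<in> C"
    and C_mult: "p \<in> C ==> q \<in> C ==> p * q \<in> C" and C_sc: "p \<in> C ==> sc c p \<in> C"
    and C01: "0 \<in> C" "1 \<in> C" for p q c
    using C by (auto simp: subalg_def)
  note ops = add[symmetric] mult[symmetric] smult[symmetric] zero[symmetric] one[symmetric]
  have neg: "\<exists>y\<in>carrier A. y \<oplus> x = \<zero>" if x: "x \<in> carrier A" for x
  proof -
    obtain p where p: "p \<in> C" "x = \<pi> p" using x carr by auto
    have "sc (-1) p \<in> C" using p C_sc by blast
    moreover have "\<pi> (sc (-1) p) \<oplus> x = \<zero>"
      using p calculation by (simp only: ops) (simp add: sc_minus_one)
    ultimately show ?thesis using carr by auto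
  qed
  have ab: "abelian_group A"
  proof (rule abelian_groupI)
    show "\<And>x. x \<in> carrier A ==> \<exists>y\<in>carrier A. y \<oplus> x = \<zero>" by (rule neg)
  qed (unfold carr, auto simp: ops C_add C01 algebra_simps)
  have ring: "ring A"
    by (rule ringI[OF ab])
       (unfold carr, auto intro!: monoidI simp: carr ops C_add C_mult C01 algebra_simps)
  have mod: "module \<CC> A"
    by (rule moduleI[OF cring_\<CC> ab])
       (auto simp: carr ops C_add C_sc C01 algebra_simps sc_add_left)
  have alg: "cx_alg A"
    by (rule cx_algI[OF mod ring])
       (auto simp: carr ops C_mult C_sc sc_mult_right algebra_simps)
  show ?thesis
    using alg by (intro cover.intro alg_map.intro alg_map_axioms.intro cover_axioms.intro)
      (auto simp: carr C add mult smult one)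
qed

lemma cover_monoid_alg: "subalg C ==> cover (monoid_alg C) C (\<lambda>p. p)"
  by (rule coverI) (auto simp: monoid_alg_def)

lemma (in alg_map) kernel_ideal: "ideal {p \<in> C. \<pi> p = \<zero>} (monoid_alg C)"
proof -
  note cov = cover_monoid_alg[OF subalg]
  note al = cover.axioms(1)[OF cov]
  have R: "ring (monoid_alg C)"
    using alg_map.axioms(1)[OF al] cx_alg.axioms(2) by blast
  have G: "group (add_monoid (monoid_alg C))"
    using R ring.is_abelian_group abelian_group.a_group by blast
  have inv: "\<ominus>\<^bsub>monoid_alg C\<^esub> p = - p" if "p \<in> C" for p
    using alg_map.map_uminus[OF al that] by simp
  have carr: "carrier (monoid_alg C) = C" "x \<oplus>\<^bsub>monoid_alg C\<^esub> y = x + y"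
    "x \<otimes>\<^bsub>monoid_alg C\<^esub> y = x * y" for x y
    by (simp_all add: monoid_alg_def)
  show ?thesis
  proof (rule idealI[OF R])
    show "subgroup {p \<in> C. \<pi> p = \<zero>} (add_monoid (monoid_alg C))"
    proof (rule group.subgroupI[OF G])
      show "{p \<in> C. \<pi> p = \<zero>} \<noteq> {}" using map_zero C_zero by blast
      fix a assume "a \<in> {p \<in> C. \<pi> p = \<zero>}"
      then have "\<ominus>\<^bsub>monoid_alg C\<^esub> a \<in> {p \<in> C. \<pi> p = \<zero>}" by (simp add: inv map_uminus)
      then show "inv\<^bsub>add_monoid (monoid_alg C)\<^esub> a \<in> {p \<in> C. \<pi> p = \<zero>}" by (simp only: a_inv_def)
    qed (auto simp: carr map_add)
  qed (auto simp: carr map_mult)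
qed

lemma cover_quot:
  fixes A :: "(complex, 'a) module"
  assumes "cover A C \<pi>" and I: "ideal I A"
  shows "cover (quot_alg A I) C (\<lambda>p. I +>\<^bsub>A\<^esub> \<pi> p)"
    and "p \<in> C ==> q \<in> C ==> I +>\<^bsub>A\<^esub> \<pi> p = I +>\<^bsub>A\<^esub> \<pi> q \<longleftrightarrow> \<pi> (p - q) \<in> I"
    and "p \<in> C ==> I +>\<^bsub>A\<^esub> \<pi> p = \<zero>\<^bsub>quot_alg A I\<^esub> \<longleftrightarrow> \<pi> p \<in> I"
proof -
  interpret cover A C \<pi> by fact
  interpret I: ideal I A by fact
  have eq: "I +>\<^bsub>A\<^esub> \<pi> p = I +>\<^bsub>A\<^esub> \<pi> q \<longleftrightarrow> \<pi> (p - q) \<in> I" if "p \<in> C" "q \<in> C" for p q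
    using quotient_eq_iff_same_a_r_cos[OF I, of "\<pi> p" "\<pi> q"] that by (simp add: map_diff)
  have zero: "\<zero>\<^bsub>quot_alg A I\<^esub> = I +>\<^bsub>A\<^esub> \<pi> 0"
    by (simp add: quot_alg_def FactRing_def a_coset_add_zero I.a_subset)
  have sm: "c \<odot>\<^bsub>quot_alg A I\<^esub> (I +>\<^bsub>A\<^esub> \<pi> p) = I +>\<^bsub>A\<^esub> \<pi> (sc c p)" if p: "p \<in> C" for c p
  proof -
    have *: "I +>\<^bsub>A\<^esub> (c \<odot>\<^bsub>A\<^esub> x) = I +>\<^bsub>A\<^esub> \<pi> (sc c p)" if x: "x \<in> I +>\<^bsub>A\<^esub> \<pi> p" for x
    proof -
      have "x \<in> carrier A" using x a_r_coset_subset_G[OF I.a_subset, of "\<pi> p"] p by auto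
      then obtain q where q: "q \<in> C" "x = \<pi> q" using surj by auto
      have "\<pi> (q - p) \<in> I"
        using eq[of q p] a_repr_independence[of x I "\<pi> p"] x p q I.additive_subgroup_axioms
          additive_subgroup.a_subgroup by (metis map_closed)
      then have "c \<odot>\<^bsub>A\<^esub> \<pi> (q - p) \<in> I"
        using I.I_l_closed[of "\<pi> (q - p)" "c \<odot>\<^bsub>A\<^esub> \<one>\<^bsub>A\<^esub>"] p q by (simp add: smult_mult_l)
      then have "\<pi> (sc c q - sc c p) \<in> I"
        using map_sc[of "q - p" c] p q by (simp add: algebra_simps)
      then show ?thesis using eq[of "sc c q" "sc c p"] p q by (simp add: map_sc)
    qed
    have "\<pi> p \<in> I +>\<^bsub>A\<^esub> \<pi> p" using p by (simp add: I.a_rcos_self)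
    then show ?thesis using * by (auto simp: quot_alg_def)
  qed
  have hom: "(+>\<^bsub>A\<^esub>) I \<in> ring_hom A (A Quot I)" by (rule I.rcos_ring_hom)
  show "cover (quot_alg A I) C (\<lambda>p. I +>\<^bsub>A\<^esub> \<pi> p)"
  proof (rule coverI[OF subalg])
    show "carrier (quot_alg A I) = (\<lambda>p. I +>\<^bsub>A\<^esub> \<pi> p) ` C"
      using surj by (auto simp: quot_alg_def FactRing_def A_RCOSETS_def')
  qed (use hom zero sm in \<open>auto simp: quot_alg_def map_add map_mult map_one ring_hom_def map_sc\<close>)
  show "p \<in> C ==> q \<in> C ==> I +>\<^bsub>A\<^esub> \<pi> p = I +>\<^bsub>A\<^esub> \<pi> q \<longleftrightarrow> \<pi> (p - q) \<in> I"
    by (rule eq)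
  show "p \<in> C ==> I +>\<^bsub>A\<^esub> \<pi> p = \<zero>\<^bsub>quot_alg A I\<^esub> \<longleftrightarrow> \<pi> p \<in> I"
    using eq[of p 0] zero by simp
qed

section \<open>Evaluation of the free algebra\<close>

definition words :: "'x set => 'x free set" where
  "words G = {p. \<forall>w\<in>keys p. set w \<subseteq> G}"

lemma free_alg_words: "free_alg G = monoid_alg (words G)"
  by (simp add: free_alg_def words_def)

lemma words_UNIV [simp]: "words UNIV = UNIV" by (simp add: words_def)

lemma subalg_words: "subalg (words G)"
proof -
  have "p * q \<in> words G" if "p \<in> words G" "q \<in> words G" for p q
  proof -
    have "set w \<subseteq> G" if w: "w \<in> keys (p * q)" for w
    proof -
      from w keys_mult[of p q] obtain a b where "w = a + b" "a \<in> keys p" "b \<in> keys q"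
        by blast
      then show ?thesis using \<open>p \<in> words G\<close> \<open>q \<in> words G\<close> by (auto simp: words_def plus_list_def)
    qed
    then show ?thesis by (simp add: words_def)
  qed
  moreover have "p + q \<in> words G" if "p \<in> words G" "q \<in> words G" for p q
    using that Poly_Mapping.keys_add[of p q] by (fastforce simp: words_def)
  moreover have "sc c p \<in> words G" if "p \<in> words G" for p c
    using that by (auto simp: words_def in_keys_iff)
  moreover have "0 \<in> words G" "1 \<in> words G" by (simp_all add: words_def zero_list_def)
  ultimately show ?thesis unfolding subalg_def by blast
qed

lemma words_induct [consumes 1, case_names zero single add]:
  assumes "p \<in> words G" and "P 0"
    and "\<And>w c. set w \<subseteq> G ==> P (single w c)"
    and "\<And>p q. p \<in> words G ==> q \<in> words G ==> P p ==> P q ==> P (p + q)"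
  shows "P p"
proof -
  have *: "\<And>w. w \<in> keys p ==> set w \<subseteq> G" using assms(1) by (simp add: words_def)
  have "P p \<and> p \<in> words G"
  proof (induction p rule: poly_mapping_induct)
    case zero then show ?case using assms(2) by (simp add: words_def)
  next
    case (single k c)
    then show ?case using assms(3)[of k c] *[of k] by (simp add: words_def)
  next
    case (add p q)
    then show ?case using assms(4)[of p q] subalg_words[of G] by (simp add: subalg_def)
  qed
  then show ?thesis by blast
qed

lemma gen_in_words [simp]: "x \<in> G ==> gen x \<in> words G"
  by (simp add: words_def gen_def)

lemma (in cx_alg) free_eval_alg_map:
  assumes f: "\<And>x. x \<in> G ==> f x \<in> carrier A"
  shows "alg_map A (words G) (\<lambda>p. \<Oplus>w\<in>keys p.
    lookup p w \<odot> foldr (\<lambda>x y. f x \<otimes> y) w \<one>)"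
proof -
  define W where "W w = foldr (\<lambda>x y. f x \<otimes> y) w \<one>" for w
  define e where "e p = (\<Oplus>w\<in>keys p. lookup p w \<odot> W w)" for p
  have W [simp]: "set w \<subseteq> G ==> W w \<in> carrier A" for w
    unfolding W_def by (induction w) (auto simp: f)
  have W_app: "set v \<subseteq> G ==> set w \<subseteq> G ==> W (v @ w) = W v \<otimes> W w" for v w
    using W by (induction v) (auto simp: W_def f m_assoc)
  have e_super: "e p = (\<Oplus>w\<in>F. lookup p w \<odot> W w)"
    if "finite F" "keys p \<subseteq> F" "\<And>w. w \<in> F ==> set w \<subseteq> G" for p F
    unfolding e_def using that
    by (intro add.finprod_mono_neutral_cong_left[unfolded finsum_def[symmetric]]) (auto simp: in_keys_iff)
  have wk: "w \<in> keys p ==> p \<in> words G ==> set w \<subseteq> G" for w p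
    by (auto simp: words_def)
  have e_closed: "e p \<in> carrier A" if "p \<in> words G" for p
    unfolding e_def using that by (intro finsum_closed) (auto simp: wk)
  have e_add: "e (p + q) = e p \<oplus> e q" if p: "p \<in> words G" and q: "q \<in> words G" for p q
  proof -
    let ?F = "keys p \<union> keys q"
    have "e (p + q) = (\<Oplus>w\<in>?F. lookup (p + q) w \<odot> W w)"
      using Poly_Mapping.keys_add[of p q] p q by (intro e_super) (auto dest: wk)
    also have "\<dots> = (\<Oplus>w\<in>?F. lookup p w \<odot> W w \<oplus> lookup q w \<odot> W w)"
      using p q by (intro finsum_cong') (auto simp: lookup_add smult_rules dest!: wk)
    also have "\<dots> = (\<Oplus>w\<in>?F. lookup p w \<odot> W w) \<oplus> (\<Oplus>w\<in>?F. lookup q w \<odot> W w)"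
      using p q by (intro finsum_addf) (auto dest!: wk)
    also have "(\<Oplus>w\<in>?F. lookup p w \<odot> W w) = e p"
      using p q by (intro e_super[symmetric]) (auto dest: wk)
    also have "(\<Oplus>w\<in>?F. lookup q w \<odot> W w) = e q"
      using p q by (intro e_super[symmetric]) (auto dest: wk)
    finally show ?thesis .
  qed
  have e_single: "e (single w c) = c \<odot> W w" if "set w \<subseteq> G" for w c
    using that by (cases "c = 0") (auto simp: e_def)
  have e_sc: "e (sc c p) = c \<odot> e p" if p: "p \<in> words G" for c p
  proof -
    have "e (sc c p) = (\<Oplus>w\<in>keys p. lookup (sc c p) w \<odot> W w)"
      using p keys_sc[of c p] by (intro e_super) (auto dest: wk)
    also have "\<dots> = (\<Oplus>w\<in>keys p. c \<odot> (lookup p w \<odot> W w))"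
      using p by (intro finsum_cong') (auto simp: smult_rules dest!: wk)
    also have "\<dots> = c \<odot> e p"
      unfolding e_def using p by (intro finsum_smult_ldistr[symmetric]) (auto dest!: wk)
    finally show ?thesis .
  qed
  have e_zero: "e 0 = \<zero>" by (simp add: e_def)
  note cl = subalg_words[of G, unfolded subalg_def]
  have e_mult1: "e (single v c * q) = e (single v c) \<otimes> e q"
    if v: "set v \<subseteq> G" and q: "q \<in> words G" for v c q
    using q
  proof (induction q rule: words_induct)
    case zero then show ?case using v by (simp add: e_zero e_single)
  next
    case (single w d)
    then show ?case using v
      by (simp add: mult_single plus_list_def e_single W_app smult_mult_l smult_mult_r mult.commute[of c] flip: smult_rules(3))
  next
    case (add p q)
    moreover have "single v c \<in> words G" using v by (auto simp: words_def split: if_splits)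
    ultimately show ?case using cl by (simp add: distrib_left e_add e_closed r_distr)
  qed
  have e_mult: "e (p * q) = e p \<otimes> e q" if p: "p \<in> words G" and q: "q \<in> words G" for p q
    using p
  proof (induction p rule: words_induct)
    case zero then show ?case using q by (simp add: e_zero e_closed)
  next
    case (single w d) then show ?case using q e_mult1 by simp
  next
    case (add p p') then show ?case using q cl by (simp add: distrib_right e_add e_closed l_distr)
  qed
  have "e 1 = \<one>" using e_single[of "[]" 1] by (simp add: W_def zero_list_def flip: single_one)
  then show ?thesis
    unfolding W_def[symmetric] e_def[symmetric]
    by unfold_locales (auto simp: subalg_words e_closed e_add e_mult e_sc)
qed

lemma free_eval_hom:
  fixes A :: "(complex, 'a) module"
  assumes "cx_alg A" and f: "\<And>x. x \<in> G ==> f x \<in> carrier A"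
  shows "alg_map A (words G) (free_eval A f)"
proof -
  interpret cx_alg A by fact
  have "free_eval A f = (\<lambda>p. \<Oplus>\<^bsub>A\<^esub>w\<in>keys p.
    lookup p w \<odot>\<^bsub>A\<^esub> foldr (\<lambda>x y. f x \<otimes>\<^bsub>A\<^esub> y) w \<one>\<^bsub>A\<^esub>)"
    by (simp add: free_eval_def fun_eq_iff)
  then show ?thesis using free_eval_alg_map[of G f] f by simp
qed

lemma free_eval_gen:
  fixes A :: "(complex, 'a) module"
  assumes "cx_alg A" and f: "f x \<in> carrier A"
  shows "free_eval A f (gen x) = f x"
proof -
  interpret cx_alg A by fact
  show ?thesis using f by (simp add: free_eval_def gen_def)
qed

lemma single_Cons: "single (x # w) c = gen x * single w (c :: complex)"
  by (simp add: gen_def mult_single plus_list_def)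

lemma single_Nil: "single [] c = sc c (1 :: 'x free)"
  by (simp add: zero_list_def)

text \<open>Induction over the free algebra along its ring structure.\<close>

lemma free_induct [consumes 1, case_names one gen sc add]:
  assumes "p \<in> words G" and one: "P 1"
    and gen: "\<And>x q. x \<in> G ==> q \<in> words G ==> P q ==> P (gen x * q)"
    and sc: "\<And>c q. q \<in> words G ==> P q ==> P (sc c q)"
    and add: "\<And>p q. p \<in> words G ==> q \<in> words G ==> P p ==> P q ==> P (p + q)"
  shows "P p"
  using assms(1)
proof (induction p rule: words_induct)
  note cl = subalg_words[of G, unfolded subalg_def]
  case zero then show ?case using sc[of 1 0] one cl by simp
next
  note cl = subalg_words[of G, unfolded subalg_def]
  case (single w c)
  then show ?case
  proof (induction w)
    case Nil then show ?case using sc[of 1 c] one cl by (simp only: single_Nil)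
  next
    case (Cons x w)
    then show ?case using gen[of x "single w c"]
      by (simp add: single_Cons words_def)
  qed
next
  case (add p q) then show ?case using assms(5) by blast
qed

lemma alg_map_eqI:
  assumes "alg_map A (words G) \<phi>" "alg_map A (words G) \<psi>"
    and "\<And>x. x \<in> G ==> \<phi> (gen x) = \<psi> (gen x)" and "p \<in> words G"
  shows "\<phi> p = \<psi> p"
proof -
  interpret P: alg_map A "words G" \<phi> by fact
  interpret Q: alg_map A "words G" \<psi> by fact
  show ?thesis using assms(4)
  proof (induction p rule: free_induct)
    case one then show ?case by (simp only: P.map_one Q.map_one)
  next
    case (gen x q)
    then show ?case using assms(3)[of x] by (simp add: P.map_mult Q.map_mult)
  next
    case (sc c q) then show ?case by (simp only: P.map_sc Q.map_sc)
  next
    case (add p q) then show ?case by (simp only: P.map_add Q.map_add)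
  qed
qed

section \<open>Presented algebras\<close>

lemma rel_ideal_ideal:
  assumes rel: "Rel \<subseteq> words G \<times> words G"
  shows "ideal (rel_ideal G Rel) (monoid_alg (words G))"
    "{l - r | l r. (l, r) \<in> Rel} \<subseteq> words G"
proof -
  note cov = cover_monoid_alg[OF subalg_words[of G]]
  note al = cover.axioms(1)[OF cov]
  have R: "ring (monoid_alg (words G))"
    using alg_map.axioms(1)[OF al] cx_alg.axioms(2) by blast
  show *: "{l - r | l r. (l, r) \<in> Rel} \<subseteq> words G"
    using rel alg_map.C_diff[OF al] by blast
  show "ideal (rel_ideal G Rel) (monoid_alg (words G))"
    unfolding rel_ideal_def free_alg_words
    by (rule ring.genideal_ideal[OF R]) (use * in \<open>simp add: monoid_alg_def\<close>)
qed

lemma presented_cover: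
  assumes rel: "Rel \<subseteq> words G \<times> words G"
  shows "cover (presented_alg G Rel) (words G) (presented_class G Rel)"
    and "p \<in> words G ==> q \<in> words G ==>
      presented_class G Rel p = presented_class G Rel q \<longleftrightarrow> p - q \<in> rel_ideal G Rel"
    and "(l, r) \<in> Rel ==> presented_class G Rel l = presented_class G Rel r"
    and "p \<in> presented_class G Rel p'  ==> p' \<in> words G ==> 
       p \<in> words G \<and> presented_class G Rel p = presented_class G Rel p'"
    and "p \<in> words G ==> p \<in> presented_class G Rel p"
proof -
  note cov = cover_monoid_alg[OF subalg_words[of G]]
  note al = cover.axioms(1)[OF cov]
  have R: "ring (monoid_alg (words G))"
    using alg_map.axioms(1)[OF al] cx_alg.axioms(2) by blast
  note I = rel_ideal_ideal(1)[OF rel]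
  have eq: "presented_class G Rel = (\<lambda>p. rel_ideal G Rel +>\<^bsub>monoid_alg (words G)\<^esub> p)"
    by (simp add: fun_eq_iff presented_class_def free_alg_words)
  show "cover (presented_alg G Rel) (words G) (presented_class G Rel)"
    unfolding presented_alg_def eq free_alg_words by (rule cover_quot(1)[OF cov I])
  show 2: "p \<in> words G ==> q \<in> words G ==>
      presented_class G Rel p = presented_class G Rel q \<longleftrightarrow> p - q \<in> rel_ideal G Rel" for p q
    unfolding eq by (rule cover_quot(2)[OF cov I])
  show "(l, r) \<in> Rel ==> presented_class G Rel l = presented_class G Rel r"
  proof (subst 2)
    assume "(l, r) \<in> Rel"
    then show "l - r \<in> rel_ideal G Rel"
      unfolding rel_ideal_def free_alg_words
      using ring.genideal_self[OF R, of "{l - r | l r. (l, r) \<in> Rel}"] rel_ideal_ideal(2)[OF rel]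
      by (auto simp: monoid_alg_def)
  qed (use rel in auto)
  have self: "p \<in> presented_class G Rel p" if "p \<in> words G" for p
    unfolding eq using that abelian_subgroup.a_rcos_self[OF ideal.axioms(1)[OF I, THEN abelian_subgroupI3, OF ring.is_abelian_group[OF R]]]
    by (simp add: monoid_alg_def)
  show "p \<in> words G ==> p \<in> presented_class G Rel p" by (rule self)
  assume p: "p \<in> presented_class G Rel p'" and p': "p' \<in> words G"
  have "rel_ideal G Rel \<subseteq> words G" using ideal.Icarr[OF I] by (auto simp: monoid_alg_def)
  then obtain d where "d \<in> rel_ideal G Rel" "p = d + p'"
    using p unfolding eq by (auto simp: a_r_coset_def r_coset_def monoid_alg_def)
  moreover have "p \<in> words G"
    using calculation \<open>rel_ideal G Rel \<subseteq> words G\<close> p' subalg_words[of G] by (auto simp: subalg_def)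
  ultimately show "p \<in> words G \<and> presented_class G Rel p = presented_class G Rel p'"
    using 2[of p p'] p' by simp
qed

text \<open>The choice of a representative inside \<open>induced_hom\<close> is harmless, since evaluation kills the ideal of
  relations.\<close>

lemma induced_hom_class:
  fixes B :: "(complex, 'b) module"
  assumes rel: "Rel \<subseteq> words G \<times> words G"
    and B: "cx_alg B" and f: "\<And>x. x \<in> G ==> f x \<in> carrier B"
    and resp: "\<And>l r. (l, r) \<in> Rel ==> free_eval B f l = free_eval B f r"
    and p: "p \<in> words G"
  shows "induced_hom B f (presented_class G Rel p) = free_eval B f p"
proof -
  interpret E: alg_map B "words G" "free_eval B f" by (rule free_eval_hom[OF B f])
  have ker: "free_eval B f q = \<zero>\<^bsub>B\<^esub>" if "q \<in> rel_ideal G Rel" for q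
  proof -
    have "ideal {p \<in> words G. free_eval B f p = \<zero>\<^bsub>B\<^esub>} (monoid_alg (words G))" by (rule E.kernel_ideal)
    moreover have "{l - r | l r. (l, r) \<in> Rel} \<subseteq> {p \<in> words G. free_eval B f p = \<zero>\<^bsub>B\<^esub>}"
      using rel resp subalg_words[of G] by (fastforce simp: E.map_diff E.r_neg E.minus_eq)
    moreover have "ring (monoid_alg (words G))"
      using cover_monoid_alg[OF subalg_words[of G]] cover.axioms(1) alg_map.axioms(1) cx_alg.axioms(2) by blast
    ultimately have "rel_ideal G Rel \<subseteq> {p \<in> words G. free_eval B f p = \<zero>\<^bsub>B\<^esub>}"
      unfolding rel_ideal_def free_alg_words by (intro ring.genideal_minimal)
    then show ?thesis using that by blast
  qed
  define q where "q = (SOME q. q \<in> presented_class G Rel p)"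
  have "q \<in> presented_class G Rel p"
    unfolding q_def using presented_cover(5)[OF rel p] by (rule someI)
  then have q: "q \<in> words G" and "presented_class G Rel q = presented_class G Rel p"
    using presented_cover(4)[OF rel _ p] by auto
  then have "q - p \<in> rel_ideal G Rel" using presented_cover(2)[OF rel _ p] by blast
  then have "free_eval B f (q - p) = \<zero>\<^bsub>B\<^esub>" by (rule ker)
  then have "free_eval B f q = free_eval B f p" using q p by (simp add: E.map_diff)
  then show ?thesis by (simp add: induced_hom_def q_def)
qed

section \<open>The enveloping algebra as a quotient of words in matrix units\<close>

definition lie_map :: "(complex, 'b) module => (gl3 => 'b) => bool" where
  "lie_map B f \<longleftrightarrow> cx_alg B \<and> (\<forall>x. f x \<in> carrier B) \<and>
     (\<forall>x y. f (x + y) = f x \<oplus>\<^bsub>B\<^esub> f y) \<and> (\<forall>c x. f (gl3_scale c x) = c \<odot>\<^bsub>B\<^esub> f x) \<and>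
     (\<forall>x y. f (gl3_bracket x y) = f x \<otimes>\<^bsub>B\<^esub> f y \<ominus>\<^bsub>B\<^esub> f y \<otimes>\<^bsub>B\<^esub> f x)"

abbreviation U_class :: "gl3 free => Uelt" where
  "U_class \<equiv> presented_class UNIV U_rel"

lemma U_class_cover: "cover U UNIV U_class"
  using presented_cover(1)[of U_rel UNIV] by (simp add: U_def)

interpretation U: cover U UNIV U_class by (rule U_class_cover)

lemma U_class_rel: "(l, r) \<in> U_rel ==> U_class l = U_class r"
  using presented_cover(3)[of U_rel UNIV l r] by simp

lemma const_eq: "const c = sc c 1"
  by (simp add: const_def zero_list_def)

lemma iota_lie_map: "lie_map U \<iota>"
proof -
  have "\<iota> (x + y) = \<iota> x \<oplus>\<^bsub>U\<^esub> \<iota> y" for x y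
    using U_class_rel[OF U_rel.intros(1)[of x y]] by (simp add: \<iota>_def U.map_add)
  moreover have "\<iota> (gl3_scale c x) = c \<odot>\<^bsub>U\<^esub> \<iota> x" for c x
    using U_class_rel[OF U_rel.intros(2)[of c x]] U.map_sc[of "gen x" c] by (simp add: \<iota>_def const_eq)
  moreover have "\<iota> (gl3_bracket x y) = \<iota> x \<otimes>\<^bsub>U\<^esub> \<iota> y \<ominus>\<^bsub>U\<^esub> \<iota> y \<otimes>\<^bsub>U\<^esub> \<iota> x" for x y
    using U_class_rel[OF U_rel.intros(3)[of x y]] by (simp add: \<iota>_def U.map_diff U.map_mult)
  moreover have "cx_alg U" by (rule U.cx_alg_axioms)
  ultimately show ?thesis by (simp add: lie_map_def \<iota>_def)
qed

text \<open>The relations of the enveloping algebra say exactly that the generators form a representation of the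
  Lie algebra, so every such representation extends.\<close>

lemma lie_map_respects:
  assumes f: "lie_map B f" and "(l, r) \<in> U_rel"
  shows "free_eval B f l = free_eval B f r"
proof -
  have B: "cx_alg B" and fB: "\<And>x. f x \<in> carrier B" using f by (auto simp: lie_map_def)
  interpret E: alg_map B UNIV "free_eval B f" using free_eval_hom[of B UNIV f, OF B] fB by simp
  have g: "free_eval B f (gen x) = f x" for x by (rule free_eval_gen[of B f x, OF B fB])
  show ?thesis
    using assms(2)
  proof cases
    case (2 c x)
    have "free_eval B f (const c * gen x) = c \<odot>\<^bsub>B\<^esub> f x"
      using E.map_sc[of "gen x" c] by (simp add: const_eq g)
    then show ?thesis using f by (simp add: 2 g lie_map_def)
  qed (use f in \<open>auto simp: g E.map_add E.map_diff E.map_mult lie_map_def\<close>)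
qed

lemma induced_hom_U:
  assumes f: "lie_map B f"
  shows "induced_hom B f (U_class p) = free_eval B f p"
  using f by (intro induced_hom_class) (auto simp: lie_map_def lie_map_respects[OF f])

lemma gl3_expand: "x = (\<Sum>i\<in>UNIV. \<Sum>j\<in>UNIV. gl3_scale (x $ i $ j) (matrix_unit i j))"
proof (simp only: vec_eq_iff, intro allI)
  fix a b :: 3
  have "(\<Sum>i\<in>UNIV. \<Sum>j\<in>UNIV. gl3_scale (x $ i $ j) (matrix_unit i j)) $ a $ b
    = (\<Sum>i\<in>UNIV. \<Sum>j\<in>UNIV. if i = a \<and> j = b then x $ i $ j else 0)"
    unfolding sum_component by (intro sum.cong) (auto simp: gl3_scale_def matrix_unit_def)
  also have "\<dots> = (\<Sum>i\<in>UNIV. \<Sum>j\<in>UNIV. if i = a then (if j = b then x $ i $ j else 0) else 0)"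
    by (intro sum.cong) auto
  also have "\<dots> = (\<Sum>i\<in>UNIV. if i = a then x $ i $ b else 0)"
    by (intro sum.cong) auto
  also have "\<dots> = x $ a $ b" by simp
  finally show "x $ a $ b = (\<Sum>i\<in>UNIV. \<Sum>j\<in>UNIV. gl3_scale (x $ i $ j) (matrix_unit i j)) $ a $ b" by simp
qed

lemma gl3_induct [case_names unit scale add]:
  assumes "\<And>i j. P (matrix_unit i j)" and sc: "\<And>c x. P x ==> P (gl3_scale c x)"
    and add: "\<And>x y. P x ==> P y ==> P (x + y)"
  shows "P x"
proof -
  have z: "P 0" using sc[of "matrix_unit 1 1" 0] assms(1)[of 1 1]
    by (simp add: gl3_scale_def zero_vec_def)
  have *: "P (\<Sum>i\<in>F. h i)" if "finite F" "\<And>i. P (h i)" for F :: "3 set" and h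
    using that(1) by (induction F) (auto simp: z that(2) add)
  show ?thesis by (subst gl3_expand) (intro * sc assms(1), auto)
qed

lemma bracket_units:
  "gl3_bracket (matrix_unit i j) (matrix_unit k l) =
     (if j = k then matrix_unit i l else 0) - (if l = i then matrix_unit k j else 0)"
proof -
  have "matrix_unit i j ** matrix_unit k l = (if j = k then matrix_unit i l else 0)" for i j k l
  proof (simp only: vec_eq_iff, intro allI)
    fix a b
    have "(matrix_unit i j ** matrix_unit k l) $ a $ b
      = (\<Sum>m\<in>UNIV. if m = j then (if a = i \<and> j = k \<and> b = l then 1 else 0) else 0)"
      unfolding matrix_matrix_mult_def matrix_unit_def vec_lambda_beta by (intro sum.cong) auto
    then show "(matrix_unit i j ** matrix_unit k l) $ a $ b = (if j = k then matrix_unit i l else 0) $ a $ b"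
      by (simp add: matrix_unit_def)
  qed
  then show ?thesis by (auto simp: gl3_bracket_def)
qed

type_synonym T = "(3 \<times> 3) free"

definition unit_fun :: "(gl3 => 'b) => 3 \<times> 3 => 'b" where
  "unit_fun f = (\<lambda>(i, j). f (matrix_unit i j))"

text \<open>Matrix units suffice as generators. Words in them have a basis, finite in each length, that the
  orthogonality arguments below need; words in arbitrary matrices have not.\<close>

definition \<pi> :: "T => Uelt" where
  "\<pi> = free_eval U (unit_fun \<iota>)"

lemma lie_map_eval:
  assumes "lie_map B f"
  shows "alg_map B UNIV (free_eval B (unit_fun f))"
    and "free_eval B (unit_fun f) (gen (i, j)) = f (matrix_unit i j)"
proof -
  have B: "cx_alg B" and fB: "\<And>x. f x \<in> carrier B" using assms by (auto simp: lie_map_def)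
  show "alg_map B UNIV (free_eval B (unit_fun f))"
    using free_eval_hom[of B UNIV "unit_fun f", OF B] fB by (auto simp: unit_fun_def)
  show "free_eval B (unit_fun f) (gen (i, j)) = f (matrix_unit i j)"
    using fB by (subst free_eval_gen[OF B]) (auto simp: unit_fun_def)
qed

lemma \<pi>_gen: "\<pi> (gen (i, j)) = \<iota> (matrix_unit i j)"
  unfolding \<pi>_def by (rule lie_map_eval(2)[OF iota_lie_map])

lemma \<pi>_cover: "cover U UNIV \<pi>"
proof -
  interpret P: alg_map U UNIV \<pi> unfolding \<pi>_def by (rule lie_map_eval(1)[OF iota_lie_map])
  have i: "\<iota> x \<in> range \<pi>" for x
  proof (induction x rule: gl3_induct)
    case (unit i j) show ?case by (metis \<pi>_gen rangeI)
  next
    case (scale c x)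
    then obtain p where "\<iota> x = \<pi> p" by auto
    then show ?case using iota_lie_map P.map_sc[of p c] by (auto simp: lie_map_def intro!: range_eqI)
  next
    case (add x y)
    then obtain p q where "\<iota> x = \<pi> p" "\<iota> y = \<pi> q" by auto
    then show ?case using iota_lie_map P.map_add[of p q] by (auto simp: lie_map_def intro!: range_eqI)
  qed
  have "U_class p \<in> range \<pi>" for p
  proof -
    have "p \<in> words UNIV" by simp
    then show ?thesis
    proof (induction p rule: free_induct)
      case one show ?case using P.map_one U.map_one by (metis rangeI)
    next
      case (gen x q)
      obtain a b where "\<iota> x = \<pi> a" "U_class q = \<pi> b" using i[of x] gen(3) by auto
      then have "U_class (Defs.gen x * q) = \<pi> (a * b)" by (simp add: U.map_mult P.map_mult flip: \<iota>_def)
      then show ?case by simp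
    next
      case (sc c q)
      then obtain b where "U_class q = \<pi> b" by auto
      then show ?case using P.map_sc[of b c] U.map_sc[of q c] by (auto intro!: range_eqI)
    next
      case (add p q)
      then obtain a b where "U_class p = \<pi> a" "U_class q = \<pi> b" by auto
      then show ?case using P.map_add[of a b] U.map_add[of p q] by (auto intro!: range_eqI)
    qed
  qed
  then have "carrier U \<subseteq> range \<pi>" unfolding U.surj by blast
  moreover have "range \<pi> \<subseteq> carrier U" using P.map_closed by (intro image_subsetI) simp
  ultimately have "carrier U = range \<pi>" by (rule equalityI)
  then show ?thesis using P.alg_map_axioms by (intro cover.intro cover_axioms.intro) auto
qed

interpretation P: cover U UNIV \<pi> by (rule \<pi>_cover)

lemma induced_hom_\<pi>:
  assumes f: "lie_map B f"
  shows "induced_hom B f (\<pi> p) = free_eval B (unit_fun f) p"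
proof -
  have B: "cx_alg B" and fB: "\<And>x. f x \<in> carrier B" using f by (auto simp: lie_map_def)
  interpret E: alg_map B UNIV "free_eval B f" using free_eval_hom[of B UNIV f, OF B] fB by simp
  interpret F: alg_map B UNIV "free_eval B (unit_fun f)" by (rule lie_map_eval(1)[OF f])
  have lift: "\<exists>q. \<pi> p = U_class q" for p using U.surj P.map_closed[of p] by auto
  have h: "alg_map B UNIV (\<lambda>p. induced_hom B f (\<pi> p))"
  proof
    fix p q :: T
    obtain a b where ab: "\<pi> p = U_class a" "\<pi> q = U_class b" using lift by blast
    show "induced_hom B f (\<pi> p) \<in> carrier B" by (simp add: ab induced_hom_U[OF f])
    show "induced_hom B f (\<pi> (p + q)) = induced_hom B f (\<pi> p) \<oplus>\<^bsub>B\<^esub> induced_hom B f (\<pi> q)"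
      using induced_hom_U[OF f, of "a + b"] by (simp add: P.map_add U.map_add E.map_add ab induced_hom_U[OF f])
    show "induced_hom B f (\<pi> (p * q)) = induced_hom B f (\<pi> p) \<otimes>\<^bsub>B\<^esub> induced_hom B f (\<pi> q)"
      using induced_hom_U[OF f, of "a * b"] by (simp add: P.map_mult U.map_mult E.map_mult ab induced_hom_U[OF f])
    show "induced_hom B f (\<pi> (sc c p)) = c \<odot>\<^bsub>B\<^esub> induced_hom B f (\<pi> p)" for c
      using induced_hom_U[OF f, of "sc c a"] by (simp add: P.map_sc U.map_sc E.map_sc ab induced_hom_U[OF f])
    show "induced_hom B f (\<pi> 1) = \<one>\<^bsub>B\<^esub>"
      using induced_hom_U[OF f, of 1] by (simp add: P.map_one U.map_one E.map_one)
  qed simp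
  have g: "induced_hom B f (\<pi> (gen (i, j))) = f (matrix_unit i j)" for i j
    using induced_hom_U[OF f, of "gen (matrix_unit i j)"] free_eval_gen[of B f, OF B fB]
    by (simp add: \<pi>_gen \<iota>_def)
  show ?thesis
    by (rule alg_map_eqI[where G = UNIV and A = B])
       (use h F.alg_map_axioms in \<open>auto simp: g lie_map_eval(2)[OF f]\<close>)
qed

lemma \<pi>_comm:
  "\<pi> (gen (i, j) * gen (k, l) - gen (k, l) * gen (i, j)) =
   \<pi> ((if j = k then gen (i, l) else 0) - (if l = i then gen (k, j) else 0))"
proof -
  have cl: "\<iota> x \<in> carrier U" and add: "\<iota> (x + y) = \<iota> x \<oplus>\<^bsub>U\<^esub> \<iota> y"
    and sc: "\<iota> (gl3_scale c x) = c \<odot>\<^bsub>U\<^esub> \<iota> x" for x y c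
    using iota_lie_map by (auto simp: lie_map_def)
  have "gl3_scale 0 0 = 0" by (simp add: gl3_scale_def zero_vec_def)
  then have z: "\<iota> 0 = \<zero>\<^bsub>U\<^esub>" using sc[of 0 0] U.smult_facts(1)[OF cl[of 0]] by metis
  have d: "\<iota> (x - y) = \<iota> x \<ominus>\<^bsub>U\<^esub> \<iota> y" for x y
    using add[of "x - y" y] cl by (simp add: U.minus_eq U.a_assoc U.r_neg)
  have "\<pi> (gen (i, j) * gen (k, l) - gen (k, l) * gen (i, j)) = \<iota> (gl3_bracket (matrix_unit i j) (matrix_unit k l))"
    using iota_lie_map by (simp add: P.map_diff P.map_mult \<pi>_gen lie_map_def)
  also have "\<dots> = \<pi> ((if j = k then gen (i, l) else 0) - (if l = i then gen (k, j) else 0))"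
    unfolding bracket_units d P.map_diff[OF UNIV_I UNIV_I]
    by (intro arg_cong2[where f = "\<lambda>x y. x \<ominus>\<^bsub>U\<^esub> y"]) (auto simp: \<pi>_gen z)
  finally show ?thesis .
qed

section \<open>Representations\<close>

lemma End_alg_cx_alg:
  assumes "module \<CC> M"
  shows "cx_alg (End_alg M)"
proof -
  interpret M: module \<CC> M by fact
  have cr: "carrier (End_alg M) = {f \<in> carrier M \<rightarrow>\<^sub>E carrier M.
        (\<forall>m\<in>carrier M. \<forall>n\<in>carrier M. f (m \<oplus>\<^bsub>M\<^esub> n) = f m \<oplus>\<^bsub>M\<^esub> f n) \<and>
        (\<forall>c. \<forall>m\<in>carrier M. f (c \<odot>\<^bsub>M\<^esub> m) = c \<odot>\<^bsub>M\<^esub> f m)}"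
    by (simp add: End_alg_def)
  have memI: "f \<in> carrier (End_alg M)"
    if "\<And>m. m \<in> carrier M ==> f m \<in> carrier M" "\<And>m. m \<notin> carrier M ==> f m = undefined"
      "\<And>m n. m \<in> carrier M ==> n \<in> carrier M ==> f (m \<oplus>\<^bsub>M\<^esub> n) = f m \<oplus>\<^bsub>M\<^esub> f n"
      "\<And>c m. m \<in> carrier M ==> f (c \<odot>\<^bsub>M\<^esub> m) = c \<odot>\<^bsub>M\<^esub> f m" for f
    using that unfolding cr by (auto simp: PiE_def extensional_def)
  have memD: "m \<in> carrier M ==> f m \<in> carrier M" "m \<notin> carrier M ==> f m = undefined"
      "m \<in> carrier M ==> n \<in> carrier M ==> f (m \<oplus>\<^bsub>M\<^esub> n) = f m \<oplus>\<^bsub>M\<^esub> f n"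
      "m \<in> carrier M ==> f (c \<odot>\<^bsub>M\<^esub> m) = c \<odot>\<^bsub>M\<^esub> f m"
    if "f \<in> carrier (End_alg M)" for f m n c
    using that unfolding cr by (auto simp: PiE_def extensional_def)
  have eqI: "f = g" if "f \<in> carrier (End_alg M)" "g \<in> carrier (End_alg M)"
      "\<And>m. m \<in> carrier M ==> f m = g m" for f g
  proof
    fix m show "f m = g m" using that memD(2)[OF that(1)] memD(2)[OF that(2)]
      by (cases "m \<in> carrier M") auto
  qed
  have op: "(f \<oplus>\<^bsub>End_alg M\<^esub> g) m = (if m \<in> carrier M then f m \<oplus>\<^bsub>M\<^esub> g m else undefined)"
    "(f \<otimes>\<^bsub>End_alg M\<^esub> g) m = (if m \<in> carrier M then f (g m) else undefined)"
    "(c \<odot>\<^bsub>End_alg M\<^esub> f) m = (if m \<in> carrier M then c \<odot>\<^bsub>M\<^esub> f m else undefined)"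
    "\<zero>\<^bsub>End_alg M\<^esub> m = (if m \<in> carrier M then \<zero>\<^bsub>M\<^esub> else undefined)"
    "\<one>\<^bsub>End_alg M\<^esub> m = (if m \<in> carrier M then m else undefined)" for f g m c
    by (simp_all add: End_alg_def compose_def)
  have sm: "c \<odot>\<^bsub>M\<^esub> m \<in> carrier M"
    "n \<in> carrier M ==> c \<odot>\<^bsub>M\<^esub> (m \<oplus>\<^bsub>M\<^esub> n) = c \<odot>\<^bsub>M\<^esub> m \<oplus>\<^bsub>M\<^esub> c \<odot>\<^bsub>M\<^esub> n"
    "(c + d) \<odot>\<^bsub>M\<^esub> m = c \<odot>\<^bsub>M\<^esub> m \<oplus>\<^bsub>M\<^esub> d \<odot>\<^bsub>M\<^esub> m"
    "c \<odot>\<^bsub>M\<^esub> (d \<odot>\<^bsub>M\<^esub> m) = (c * d) \<odot>\<^bsub>M\<^esub> m" "1 \<odot>\<^bsub>M\<^esub> m = m" "c \<odot>\<^bsub>M\<^esub> \<zero>\<^bsub>M\<^esub> = \<zero>\<^bsub>M\<^esub>"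
    "(-1) \<odot>\<^bsub>M\<^esub> m = \<ominus>\<^bsub>M\<^esub> m"
    if "m \<in> carrier M" for c d m n
    using that M.smult_closed[of c m] M.smult_r_distr[of c m n] M.smult_l_distr[of c d m]
      M.smult_assoc1[of c d m] M.smult_one[of m] M.smult_r_null[of c] M.smult_l_minus[of 1 m] by auto
  have zero_cl: "\<zero>\<^bsub>End_alg M\<^esub> \<in> carrier (End_alg M)" and one_cl: "\<one>\<^bsub>End_alg M\<^esub> \<in> carrier (End_alg M)"
    by (rule memI; simp add: op sm)+
  have add_cl: "f \<oplus>\<^bsub>End_alg M\<^esub> g \<in> carrier (End_alg M)" and mult_cl: "f \<otimes>\<^bsub>End_alg M\<^esub> g \<in> carrier (End_alg M)"
    if "f \<in> carrier (End_alg M)" "g \<in> carrier (End_alg M)" for f g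
    by (rule memI; simp add: op memD[OF that(1)] memD[OF that(2)] sm M.a_ac)+
  have sm_cl: "c \<odot>\<^bsub>End_alg M\<^esub> f \<in> carrier (End_alg M)" if f: "f \<in> carrier (End_alg M)" for c f
    by (rule memI; simp add: op memD[OF f] sm mult.commute)
  note cl = zero_cl one_cl add_cl mult_cl sm_cl
  note D = memD(1,3,4)
  have ab: "abelian_group (End_alg M)"
  proof (rule abelian_groupI)
    show "\<exists>g\<in>carrier (End_alg M). g \<oplus>\<^bsub>End_alg M\<^esub> f = \<zero>\<^bsub>End_alg M\<^esub>" if f: "f \<in> carrier (End_alg M)" for f
    proof (rule bexI)
      show "((-1) \<odot>\<^bsub>End_alg M\<^esub> f) \<oplus>\<^bsub>End_alg M\<^esub> f = \<zero>\<^bsub>End_alg M\<^esub>"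
        by (rule eqI) (simp_all add: cl f op sm D[OF f] M.l_neg)
    qed (simp add: cl f)
    show "f \<oplus>\<^bsub>End_alg M\<^esub> g \<oplus>\<^bsub>End_alg M\<^esub> h = f \<oplus>\<^bsub>End_alg M\<^esub> (g \<oplus>\<^bsub>End_alg M\<^esub> h)"
      if "f \<in> carrier (End_alg M)" "g \<in> carrier (End_alg M)" "h \<in> carrier (End_alg M)" for f g h
      by (rule eqI) (simp_all add: that cl op D[OF that(1)] D[OF that(2)] D[OF that(3)] M.a_assoc)
    show "f \<oplus>\<^bsub>End_alg M\<^esub> g = g \<oplus>\<^bsub>End_alg M\<^esub> f"
      if "f \<in> carrier (End_alg M)" "g \<in> carrier (End_alg M)" for f g
      by (rule eqI) (simp_all add: that cl op D[OF that(1)] D[OF that(2)] M.a_comm)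
    show "\<zero>\<^bsub>End_alg M\<^esub> \<oplus>\<^bsub>End_alg M\<^esub> f = f" if "f \<in> carrier (End_alg M)" for f
      by (rule eqI) (simp_all add: that cl op D[OF that(1)])
  qed (simp_all add: cl)
  have mon: "monoid (End_alg M)"
  proof (rule monoidI)
    show "f \<otimes>\<^bsub>End_alg M\<^esub> g \<otimes>\<^bsub>End_alg M\<^esub> h = f \<otimes>\<^bsub>End_alg M\<^esub> (g \<otimes>\<^bsub>End_alg M\<^esub> h)"
      if "f \<in> carrier (End_alg M)" "g \<in> carrier (End_alg M)" "h \<in> carrier (End_alg M)" for f g h
      by (rule eqI) (simp_all add: that cl op D[OF that(1)] D[OF that(2)] D[OF that(3)])
    show "\<one>\<^bsub>End_alg M\<^esub> \<otimes>\<^bsub>End_alg M\<^esub> f = f" "f \<otimes>\<^bsub>End_alg M\<^esub> \<one>\<^bsub>End_alg M\<^esub> = f" if "f \<in> carrier (End_alg M)" for f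
      by (rule eqI; simp add: that cl op D[OF that(1)])+
  qed (simp_all add: cl)
  have ring: "ring (End_alg M)"
  proof (rule ringI[OF ab mon])
    fix f g h assume "f \<in> carrier (End_alg M)" "g \<in> carrier (End_alg M)" "h \<in> carrier (End_alg M)"
    note that = this
    show "(f \<oplus>\<^bsub>End_alg M\<^esub> g) \<otimes>\<^bsub>End_alg M\<^esub> h = f \<otimes>\<^bsub>End_alg M\<^esub> h \<oplus>\<^bsub>End_alg M\<^esub> g \<otimes>\<^bsub>End_alg M\<^esub> h"
      "h \<otimes>\<^bsub>End_alg M\<^esub> (f \<oplus>\<^bsub>End_alg M\<^esub> g) = h \<otimes>\<^bsub>End_alg M\<^esub> f \<oplus>\<^bsub>End_alg M\<^esub> h \<otimes>\<^bsub>End_alg M\<^esub> g"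
      by (rule eqI; simp add: that cl op D[OF that(1)] D[OF that(2)] D[OF that(3)])+
  qed
  have mod: "module \<CC> (End_alg M)"
  proof (rule moduleI[OF cring_\<CC> ab])
    fix c d :: complex and f g assume "f \<in> carrier (End_alg M)"
    note that = this
    show "c \<odot>\<^bsub>End_alg M\<^esub> f \<in> carrier (End_alg M)" by (rule cl(5)[OF that])
    show "(c \<oplus>\<^bsub>\<CC>\<^esub> d) \<odot>\<^bsub>End_alg M\<^esub> f = c \<odot>\<^bsub>End_alg M\<^esub> f \<oplus>\<^bsub>End_alg M\<^esub> d \<odot>\<^bsub>End_alg M\<^esub> f"
      "(c \<otimes>\<^bsub>\<CC>\<^esub> d) \<odot>\<^bsub>End_alg M\<^esub> f = c \<odot>\<^bsub>End_alg M\<^esub> (d \<odot>\<^bsub>End_alg M\<^esub> f)"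
      "\<one>\<^bsub>\<CC>\<^esub> \<odot>\<^bsub>End_alg M\<^esub> f = f"
      by (rule eqI; simp add: that cl op sm D[OF that(1)])+
    assume g: "g \<in> carrier (End_alg M)"
    show "c \<odot>\<^bsub>End_alg M\<^esub> (f \<oplus>\<^bsub>End_alg M\<^esub> g) = c \<odot>\<^bsub>End_alg M\<^esub> f \<oplus>\<^bsub>End_alg M\<^esub> c \<odot>\<^bsub>End_alg M\<^esub> g"
      by (rule eqI; simp add: that g cl op sm D[OF that(1)] D[OF g])
  qed
  show ?thesis
  proof (rule cx_algI[OF mod ring])
    fix f g c assume that: "f \<in> carrier (End_alg M)" "g \<in> carrier (End_alg M)"
    show "(c \<odot>\<^bsub>End_alg M\<^esub> f) \<otimes>\<^bsub>End_alg M\<^esub> g = c \<odot>\<^bsub>End_alg M\<^esub> (f \<otimes>\<^bsub>End_alg M\<^esub> g)"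
      "f \<otimes>\<^bsub>End_alg M\<^esub> (c \<odot>\<^bsub>End_alg M\<^esub> g) = c \<odot>\<^bsub>End_alg M\<^esub> (f \<otimes>\<^bsub>End_alg M\<^esub> g)"
      by (rule eqI; simp add: that cl op sm D[OF that(1)] D[OF that(2)])+
  qed
qed

lemma gmodule_lie_map:
  assumes "gmodule M"
  shows "lie_map (End_alg M) (\<lambda>x. \<lambda>m\<in>carrier M. act M x m)"
proof -
  have M: "module \<CC> M" using assms by (simp add: gmodule_def)
  interpret M: module \<CC> M by (rule M)
  interpret E: cx_alg "End_alg M" by (rule End_alg_cx_alg[OF M])
  let ?f = "\<lambda>x. \<lambda>m\<in>carrier M. act M x m"
  have cl: "?f x \<in> carrier (End_alg M)" for x
    using assms M.smult_closed by (auto simp: End_alg_def gmodule_def)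
  have sm: "c \<odot>\<^bsub>M\<^esub> m \<in> carrier M" if "m \<in> carrier M" for c m using that M.smult_closed by simp
  have minus: "(f \<ominus>\<^bsub>End_alg M\<^esub> g) = (\<lambda>m\<in>carrier M. f m \<ominus>\<^bsub>M\<^esub> g m)"
    if f: "f \<in> carrier (End_alg M)" and g: "g \<in> carrier (End_alg M)" for f g
  proof -
    have "(-1) \<odot>\<^bsub>M\<^esub> g m = \<ominus>\<^bsub>M\<^esub> g m" if "m \<in> carrier M" for m
      using g that M.smult_l_minus[of 1 "g m"] M.smult_one[of "g m"] by (auto simp: End_alg_def)
    moreover have "f \<ominus>\<^bsub>End_alg M\<^esub> g = f \<oplus>\<^bsub>End_alg M\<^esub> ((-1) \<odot>\<^bsub>End_alg M\<^esub> g)"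
      using g by (simp add: E.minus_eq E.smult_rules)
    ultimately show ?thesis by (simp add: M.minus_eq) (auto simp: End_alg_def fun_eq_iff)
  qed
  have br: "?f (gl3_bracket x y) = ?f x \<otimes>\<^bsub>End_alg M\<^esub> ?f y \<ominus>\<^bsub>End_alg M\<^esub> ?f y \<otimes>\<^bsub>End_alg M\<^esub> ?f x" for x y
    by (subst minus[OF E.m_closed[OF cl cl] E.m_closed[OF cl cl]])
       (use assms in \<open>auto simp: gmodule_def End_alg_def compose_def fun_eq_iff\<close>)
  have "?f (x + y) = ?f x \<oplus>\<^bsub>End_alg M\<^esub> ?f y" "?f (gl3_scale c x) = c \<odot>\<^bsub>End_alg M\<^esub> ?f x" for x y c
    using assms by (auto simp: gmodule_def End_alg_def fun_eq_iff)
  then show ?thesis unfolding lie_map_def using cl br E.cx_alg_axioms by blast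
qed

definition rep :: "'m gmod => T => 'm => 'm" where
  "rep M p = U_rep M (\<pi> p)"

lemma rep_alg_map: "gmodule M ==> alg_map (End_alg M) UNIV (rep M)"
  using lie_map_eval(1)[OF gmodule_lie_map[of M]] induced_hom_\<pi>[OF gmodule_lie_map[of M]]
  by (simp add: rep_def[abs_def] U_rep_def)

lemma rep_facts:
  assumes M: "gmodule M" and m: "m \<in> carrier M"
  shows "rep M p m \<in> carrier M"
    and "rep M (gen (i, j)) m = act M (matrix_unit i j) m"
    and "rep M (p + q) m = rep M p m \<oplus>\<^bsub>M\<^esub> rep M q m"
    and "rep M (p * q) m = rep M p (rep M q m)"
    and "rep M 1 m = m" and "rep M 0 m = \<zero>\<^bsub>M\<^esub>"
    and "rep M (sc c p) m = c \<odot>\<^bsub>M\<^esub> rep M p m"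
    and "n \<in> carrier M ==> rep M p (m \<oplus>\<^bsub>M\<^esub> n) = rep M p m \<oplus>\<^bsub>M\<^esub> rep M p n"
    and "rep M p (c \<odot>\<^bsub>M\<^esub> m) = c \<odot>\<^bsub>M\<^esub> rep M p m"
    and "rep M p \<zero>\<^bsub>M\<^esub> = \<zero>\<^bsub>M\<^esub>"
proof -
  interpret M: module \<CC> M using M by (simp add: gmodule_def)
  interpret E: alg_map "End_alg M" UNIV "rep M" by (rule rep_alg_map[OF M])
  have cl: "rep M p \<in> carrier (End_alg M)" for p by simp
  show "rep M p m \<in> carrier M" using cl[of p] m by (auto simp: End_alg_def simp del: E.map_closed)
  show "rep M (gen (i, j)) m = act M (matrix_unit i j) m"
    using m by (simp add: rep_def U_rep_def induced_hom_\<pi>[OF gmodule_lie_map[OF M]] lie_map_eval(2)[OF gmodule_lie_map[OF M]])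
  show "rep M (p + q) m = rep M p m \<oplus>\<^bsub>M\<^esub> rep M q m"
    "rep M (p * q) m = rep M p (rep M q m)" "rep M 1 m = m" "rep M 0 m = \<zero>\<^bsub>M\<^esub>"
    using m by (simp_all only: E.map_add[OF UNIV_I UNIV_I] E.map_mult[OF UNIV_I UNIV_I] E.map_one E.map_zero)
      (simp_all add: End_alg_def compose_def)
  show "rep M (sc c p) m = c \<odot>\<^bsub>M\<^esub> rep M p m"
    unfolding E.map_sc[OF UNIV_I] using m by (simp add: End_alg_def)
  show "n \<in> carrier M ==> rep M p (m \<oplus>\<^bsub>M\<^esub> n) = rep M p m \<oplus>\<^bsub>M\<^esub> rep M p n"
    "rep M p (c \<odot>\<^bsub>M\<^esub> m) = c \<odot>\<^bsub>M\<^esub> rep M p m"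
    using cl[of p] m by (auto simp: End_alg_def simp del: E.map_closed)
  have r: "rep M p (0 \<odot>\<^bsub>M\<^esub> m) = 0 \<odot>\<^bsub>M\<^esub> rep M p m" "rep M p m \<in> carrier M" if "m \<in> carrier M" for m
    using cl[of p] that by (auto simp: End_alg_def simp del: E.map_closed)
  show "rep M p \<zero>\<^bsub>M\<^esub> = \<zero>\<^bsub>M\<^esub>"
    using r[OF M.zero_closed] M.smult_l_null[of "\<zero>\<^bsub>M\<^esub>"] M.smult_l_null[of "rep M p \<zero>\<^bsub>M\<^esub>"] by auto
qed

section \<open>The antiautomorphism\<close>

lemma opp_alg_cx_alg:
  assumes "cx_alg A" shows "cx_alg (opp_alg A)"
proof -
  interpret cx_alg A by fact
  have ab: "abelian_group (opp_alg A)"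
  proof (rule abelian_groupI)
    show "\<exists>y\<in>carrier (opp_alg A). y \<oplus>\<^bsub>opp_alg A\<^esub> x = \<zero>\<^bsub>opp_alg A\<^esub>" if "x \<in> carrier (opp_alg A)" for x
      using that l_neg[of x] by (intro bexI[of _ "\<ominus>\<^bsub>A\<^esub> x"]) (auto simp: opp_alg_def)
  qed (auto simp: opp_alg_def a_ac)
  have ring: "ring (opp_alg A)"
    by (rule ringI[OF ab]) (auto intro!: monoidI simp: opp_alg_def m_assoc l_distr r_distr)
  have mod: "module \<CC> (opp_alg A)"
    by (rule moduleI[OF cring_\<CC> ab]) (auto simp: opp_alg_def smult_rules)
  show ?thesis
    by (rule cx_algI[OF mod ring]) (auto simp: opp_alg_def smult_mult_l smult_mult_r)
qed

lemma omega_lie_map: "lie_map (opp_alg U) (\<lambda>x. \<iota> (transpose x))"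
proof -
  have t: "transpose (x + y) = transpose x + transpose y" "transpose (gl3_scale c x) = gl3_scale c (transpose x)"
    for x y c by (simp_all add: transpose_def gl3_scale_def vec_eq_iff)
  have "transpose (x - y) = transpose x - transpose y" for x y :: gl3
    by (simp add: transpose_def vec_eq_iff)
  then have b: "transpose (gl3_bracket x y) = gl3_bracket (transpose y) (transpose x)" for x y
    by (simp add: gl3_bracket_def matrix_transpose_mul)
  interpret O: cx_alg "opp_alg U" by (rule opp_alg_cx_alg[OF U.cx_alg_axioms])
  have "x \<ominus>\<^bsub>opp_alg U\<^esub> y = x \<ominus>\<^bsub>U\<^esub> y" if "y \<in> carrier U" for x y
    using that O.smult_rules(4)[of y 1] U.smult_rules(4)[of y 1] O.smult_facts(2)[of y]
    by (simp add: O.minus_eq U.minus_eq) (simp add: opp_alg_def)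
  then show ?thesis
    using iota_lie_map O.cx_alg_axioms U.m_closed by (auto simp: lie_map_def t b) (auto simp: opp_alg_def)
qed

interpretation W: alg_map "opp_alg U" UNIV "\<lambda>p. \<omega> (\<pi> p)"
  using lie_map_eval(1)[OF omega_lie_map] induced_hom_\<pi>[OF omega_lie_map] by (simp add: \<omega>_def)

lemma omega_facts:
  "\<omega> (\<pi> p) \<in> carrier U" "\<omega> (\<pi> (p + q)) = \<omega> (\<pi> p) \<oplus>\<^bsub>U\<^esub> \<omega> (\<pi> q)"
  "\<omega> (\<pi> (p * q)) = \<omega> (\<pi> q) \<otimes>\<^bsub>U\<^esub> \<omega> (\<pi> p)"
  "\<omega> (\<pi> (sc c p)) = c \<odot>\<^bsub>U\<^esub> \<omega> (\<pi> p)" "\<omega> (\<pi> 1) = \<one>\<^bsub>U\<^esub>"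
  "\<omega> (\<pi> (gen (i, j))) = \<pi> (gen (j, i))"
proof -
  have [simp]: "carrier (opp_alg U) = carrier U" by (simp add: opp_alg_def)
  have "transpose (matrix_unit i j) = matrix_unit j i" for i j
    by (auto simp: transpose_def matrix_unit_def vec_eq_iff)
  then show "\<omega> (\<pi> (gen (i, j))) = \<pi> (gen (j, i))"
    unfolding \<omega>_def induced_hom_\<pi>[OF omega_lie_map] lie_map_eval(2)[OF omega_lie_map] by (simp add: \<pi>_gen)
  show "\<omega> (\<pi> p) \<in> carrier U" using W.map_closed[of p] by simp
  show "\<omega> (\<pi> (p + q)) = \<omega> (\<pi> p) \<oplus>\<^bsub>U\<^esub> \<omega> (\<pi> q)" using W.map_add[of p q] by (simp add: opp_alg_def)
  show "\<omega> (\<pi> (p * q)) = \<omega> (\<pi> q) \<otimes>\<^bsub>U\<^esub> \<omega> (\<pi> p)" using W.map_mult[of p q] by (simp add: opp_alg_def)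
  show "\<omega> (\<pi> (sc c p)) = c \<odot>\<^bsub>U\<^esub> \<omega> (\<pi> p)" using W.map_sc[of p c] by (simp add: opp_alg_def)
  show "\<omega> (\<pi> 1) = \<one>\<^bsub>U\<^esub>" using W.map_one by (simp add: opp_alg_def)
qed

declare single_of_nat [simp del] single_numeral [simp del] single_of_int [simp del]

unbundle no fps_syntax

section \<open>The modules of homogeneous expressions\<close>

lemma x_diff_superset:
  assumes "finite F" "keys p \<subseteq> F"
  shows "x_diff j p = (\<Sum>k\<in>F. single (k - axis j 1) (k $ j * lookup p k))"
  unfolding x_diff_def using assms
  by (intro sum.mono_neutral_left) (auto simp: in_keys_iff)

lemma x_diff_add: "x_diff j (p + q) = x_diff j p + x_diff j q"
proof -
  let ?F = "keys p \<union> keys q"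
  have "keys (p + q) \<subseteq> ?F" by (rule Poly_Mapping.keys_add)
  then show ?thesis
    by (simp add: x_diff_superset[of ?F] lookup_add algebra_simps single_add sum.distrib)
qed

lemma x_diff_sc: "x_diff j (sc c p) = sc c (x_diff j p)"
  using keys_sc[of c p] by (simp add: x_diff_superset[of "keys p"] sum_distrib_left mult_single)
    (simp add: mult.left_commute)

lemma x_diff_single: "x_diff j (single k c) = single (k - axis j 1) (k $ j * c)"
  by (simp add: x_diff_superset[of "{k}"])

definition euler :: "3 => 3 => fexpr => fexpr" where
  "euler i j p = x_var i * x_diff j p"

lemma euler_add: "euler i j (p + q) = euler i j p + euler i j q"
  by (simp add: euler_def x_diff_add algebra_simps)

lemma euler_sc: "euler i j (sc c p) = sc c (euler i j p)"
  by (simp add: euler_def x_diff_sc sc_mult_right)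

lemma euler_zero [simp]: "euler i j 0 = 0"
  using euler_sc[of i j 0 0] by simp

lemma euler_sum: "euler i j (sum h F) = (\<Sum>x\<in>F. euler i j (h x))"
  by (induction F rule: infinite_finite_induct) (auto simp: euler_add)

lemma euler_uminus: "euler i j (- p) = - euler i j p"
  using euler_sc[of i j "-1" p] by (simp add: sc_minus_one)

lemma euler_single: "euler i j (single k c) =
    single (k + axis i 1 - axis j 1) (k $ j * c)"
  by (simp add: euler_def x_diff_single x_var_def mult_single algebra_simps)

lemma euler_comm:
  "euler i j (euler k l p) - euler k l (euler i j p) =
     (if j = k then euler i l p else 0) - (if l = i then euler k j p else 0)"
proof (induction p rule: poly_mapping_induct)
  case (single m c)
  have ax: "axis i 1 $ j = (if i = j then 1 else 0 :: complex)" for i j :: 3 by (simp add: axis_def)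
  have e: "m + axis k 1 - axis l 1 + axis i 1 - axis j 1 = m + axis i 1 - axis j 1 + axis k 1 - axis l 1"
    "m + axis k 1 - axis l 1 + axis i 1 - axis k 1 = m + axis i 1 - axis l 1"
    "m + axis k 1 - axis l 1 + axis l 1 - axis j 1 = m + axis k 1 - axis j 1"
    by (simp_all add: algebra_simps)
  show ?case
    by (simp add: euler_single e single_diff[symmetric] ax, cases "j = k"; cases "l = i"; cases "l = j")
       (auto simp: algebra_simps single_diff[symmetric] single_add[symmetric] single_uminus)
next
  case (add p q)
  have "euler i j (euler k l (p + q)) - euler k l (euler i j (p + q)) =
    (euler i j (euler k l p) - euler k l (euler i j p)) + (euler i j (euler k l q) - euler k l (euler i j q))"
    by (simp add: euler_add)
  also have "\<dots> = ((if j = k then euler i l p else 0) - (if l = i then euler k j p else 0)) +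
    ((if j = k then euler i l q else 0) - (if l = i then euler k j q else 0))" by (simp only: add)
  finally show ?case by (simp add: euler_add)
qed simp

lemma S_mod_simps:
  "carrier (S_mod al) = {p. keys p \<subseteq> S_exponents al}"
  "p \<oplus>\<^bsub>S_mod al\<^esub> q = p + q" "c \<odot>\<^bsub>S_mod al\<^esub> p = sc c p" "\<zero>\<^bsub>S_mod al\<^esub> = 0"
  "act (S_mod al) x p = (\<Sum>i\<in>UNIV. \<Sum>j\<in>UNIV. sc (x $ i $ j) (euler i j p))"
  by (simp_all add: S_mod_def with_act_def monoid_alg_def module.extend_def gmod.fields_def euler_def)

lemma act_unit: "act (S_mod al) (matrix_unit i j) p = euler i j p"
proof -
  have "(\<Sum>l\<in>UNIV. sc (if k = i \<and> l = j then 1 else 0) (euler k l p)) = (if k = i then euler k j p else 0)" for k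
  proof -
    have "(\<Sum>l\<in>UNIV. sc (if k = i \<and> l = j then 1 else 0) (euler k l p))
      = (\<Sum>l\<in>UNIV. if l = j then (if k = i then euler k j p else 0) else 0)"
      by (intro sum.cong) auto
    then show ?thesis by simp
  qed
  then show ?thesis unfolding S_mod_simps matrix_unit_def vec_lambda_beta by simp
qed

text \<open>Exponents are recorded by those of the last two variables, which are natural numbers for every
  \<open>al\<close>.\<close>

definition ex :: "complex => nat => nat => complex ^ 3" where
  "ex al a b = vector [al - of_nat a - of_nat b, of_nat a, of_nat b]"

lemma ex_nth [simp]: "ex al a b $ 1 = al - of_nat a - of_nat b" "ex al a b $ 2 = of_nat a" "ex al a b $ 3 = of_nat b"
  by (simp_all add: ex_def)

lemma ex_inj: "ex al a b = ex al a' b' \<longleftrightarrow> a = a' \<and> b = b'"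
  by (metis ex_nth(2,3) of_nat_eq_iff)

text \<open>For a natural number \<open>al\<close> the exponent of the first variable must not become negative.\<close>

definition idx :: "complex => (nat \<times> nat) set" where
  "idx al = {(a, b). \<forall>n. al = of_nat n --> a + b \<le> n}"

lemma vec3_eqI: "x $ 1 = y $ 1 ==> x $ 2 = y $ 2 ==> x $ 3 = y $ 3 ==> x = (y :: 'a ^ 3)"
  by (simp add: vec_eq_iff forall_3)

lemma S_exponents_eq: "S_exponents al = (\<lambda>(a, b). ex al a b) ` idx al"
proof (intro equalityI subsetI)
  fix k assume k: "k \<in> S_exponents al"
  then obtain a b where ab: "k $ 2 = of_nat a" "k $ 3 = of_nat b"
    by (auto simp: S_exponents_def Nats_def split: if_splits)
  have s: "k $ 1 + k $ 2 + k $ 3 = al" using k by (auto simp: S_exponents_def split: if_splits)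
  have "k = ex al a b" using ab s by (intro vec3_eqI) (auto simp: algebra_simps)
  moreover have "(a, b) \<in> idx al"
  proof -
    have "a + b \<le> n" if "al = of_nat n" for n
    proof -
      have "k $ 1 \<in> \<nat>" using k that by (auto simp: S_exponents_def)
      then obtain c where "k $ 1 = of_nat c" by (auto simp: Nats_def)
      then have "of_nat (c + a + b) = (of_nat n :: complex)" using s ab that by simp
      then show ?thesis by (simp only: of_nat_eq_iff)
    qed
    then show ?thesis by (auto simp: idx_def)
  qed
  ultimately show "k \<in> (\<lambda>(a, b). ex al a b) ` idx al" by (auto intro!: image_eqI[of _ _ "(a, b)"])
next
  fix k assume "k \<in> (\<lambda>(a, b). ex al a b) ` idx al"
  then obtain a b where ab: "k = ex al a b" "(a, b) \<in> idx al" by auto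
  have "al - of_nat a - of_nat b \<in> \<nat>" if "al \<in> \<nat>"
  proof -
    have "\<exists>n. al = of_nat n" using \<open>al \<in> \<nat>\<close> unfolding Nats_def by blast
    then obtain n where n: "al = of_nat n" by blast
    then have "al - of_nat a - of_nat b = of_nat (n - (a + b))" using ab by (simp add: idx_def of_nat_diff)
    then show ?thesis by simp
  qed
  then show "k \<in> S_exponents al" using ab by (simp add: S_exponents_def)
qed

lemma Nats_pred: "x \<in> \<nat> ==> x \<noteq> 0 ==> x - 1 \<in> (\<nat> :: complex set)"
proof (elim Nats_cases)
  fix n assume "x \<noteq> 0" and n: "x = of_nat n"
  then obtain m where "n = Suc m" by (cases n) auto
  then have "x - 1 = of_nat m" using n by simp
  then show ?thesis by simp
qed

lemma S_exponents_step:
  fixes k :: "complex ^ 3"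
  assumes "k \<in> S_exponents al" "k $ j \<noteq> 0"
  shows "k + axis i 1 - axis j 1 \<in> S_exponents al"
  using exhaust_3[of i] exhaust_3[of j] assms
  by (elim disjE) (auto simp: S_exponents_def axis_def Nats_pred algebra_simps split: if_splits)

lemma euler_closed:
  assumes "keys p \<subseteq> S_exponents al"
  shows "keys (euler i j p) \<subseteq> S_exponents al"
proof -
  have "keys p \<subseteq> S_exponents al --> keys (euler i j p) \<subseteq> S_exponents al"
  proof -
    have "keys (euler i j (\<Sum>k\<in>keys p. single k (lookup p k)))
       \<subseteq> (\<Union>k\<in>keys p. keys (euler i j (single k (lookup p k))))"
      unfolding euler_sum by (rule Poly_Mapping.keys_sum)
    then show ?thesis using S_exponents_step[of _ al j i]
      unfolding poly_mapping_expand[of p, symmetric] euler_single by (fastforce split: if_splits)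
  qed
  then show ?thesis using assms by blast
qed

lemma subalg_like_S:
  "keys p \<subseteq> S ==> keys q \<subseteq> S ==> keys (p + q) \<subseteq> S"
  "keys p \<subseteq> S ==> keys (sc c p) \<subseteq> S"
  using Poly_Mapping.keys_add[of p q] keys_sc[of c p] by auto

lemma S_mod_module: "module \<CC> (S_mod al)"
proof (rule moduleI[OF cring_\<CC>])
  show "abelian_group (S_mod al)"
  proof (rule abelian_groupI)
    show "\<exists>y\<in>carrier (S_mod al). y \<oplus>\<^bsub>S_mod al\<^esub> x = \<zero>\<^bsub>S_mod al\<^esub>" if "x \<in> carrier (S_mod al)" for x
      using that by (intro bexI[of _ "- x"]) (auto simp: S_mod_simps)
  qed (auto simp: S_mod_simps subalg_like_S(1)[THEN subsetD] algebra_simps)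
qed (auto simp: S_mod_simps subalg_like_S(2)[THEN subsetD] sc_add_left distrib_left simp flip: mult.assoc intro: subalg_like_S(2)[THEN subsetD] simp: mult_single)

lemma S_mod_minus: "q \<in> carrier (S_mod al) ==> p \<ominus>\<^bsub>S_mod al\<^esub> q = p - q"
proof -
  assume q: "q \<in> carrier (S_mod al)"
  interpret M: module \<CC> "S_mod al" by (rule S_mod_module)
  have "\<ominus>\<^bsub>S_mod al\<^esub> q = - q"
    using M.smult_l_minus[of 1 q] M.smult_one[of q] q by (simp add: S_mod_simps(3) sc_minus_one)
  then show ?thesis by (simp add: a_minus_def S_mod_simps)
qed

lemma act_S_linear:
  "act (S_mod al) (x + y) p = act (S_mod al) x p + act (S_mod al) y p"
  "act (S_mod al) (gl3_scale c x) p = sc c (act (S_mod al) x p)"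
  "act (S_mod al) x (p + q) = act (S_mod al) x p + act (S_mod al) x q"
  "act (S_mod al) x (sc c p) = sc c (act (S_mod al) x p)"
proof -
  show "act (S_mod al) (x + y) p = act (S_mod al) x p + act (S_mod al) y p"
    by (simp only: S_mod_simps vector_add_component sc_add_left sum.distrib)
  show "act (S_mod al) (gl3_scale c x) p = sc c (act (S_mod al) x p)"
    by (simp only: S_mod_simps gl3_scale_def vec_lambda_beta sum_distrib_left sc_sc)
  show "act (S_mod al) x (p + q) = act (S_mod al) x p + act (S_mod al) x q"
    by (simp only: S_mod_simps euler_add distrib_left sum.distrib)
  show "act (S_mod al) x (sc c p) = sc c (act (S_mod al) x p)"
    by (simp only: S_mod_simps euler_sc sum_distrib_left sc_sc mult.commute[of _ c])
qed

lemma act_S_zero: "act (S_mod al) 0 p = 0"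
  by (simp add: S_mod_simps)

lemma act_S_diff: "act (S_mod al) (x - y) p = act (S_mod al) x p - act (S_mod al) y p"
  using act_S_linear(1)[of al "x - y" y p] by simp

lemma gl3_bracket_linear:
  "gl3_bracket (x + x') y = gl3_bracket x y + gl3_bracket x' y"
  "gl3_bracket y (x + x') = gl3_bracket y x + gl3_bracket y x'"
  "gl3_bracket (gl3_scale c x) y = gl3_scale c (gl3_bracket x y)"
  "gl3_bracket y (gl3_scale c x) = gl3_scale c (gl3_bracket y x)"
  by (simp_all add: gl3_bracket_def vec_eq_iff gl3_scale_def matrix_matrix_mult_def sum.distrib
      sum_distrib_left algebra_simps)

lemma act_S_bracket:
  "act (S_mod al) (gl3_bracket x y) p = act (S_mod al) x (act (S_mod al) y p) - act (S_mod al) y (act (S_mod al) x p)"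
proof (induction x rule: gl3_induct)
  case (unit i j)
  show ?case
  proof (induction y rule: gl3_induct)
    case (unit k l)
    show ?case by (auto simp: bracket_units act_S_diff act_S_zero act_unit euler_comm)
  next
    case (scale c y) then show ?case
      by (simp only: gl3_bracket_linear act_S_linear right_diff_distrib)
  next
    case (add y y') then show ?case by (simp add: gl3_bracket_linear act_S_linear)
  qed
next
  case (scale c x) then show ?case
    by (simp only: gl3_bracket_linear act_S_linear right_diff_distrib)
next
  case (add x x') then show ?case by (simp add: gl3_bracket_linear act_S_linear)
qed

lemma act_S_closed:
  "p \<in> carrier (S_mod al) ==> act (S_mod al) x p \<in> carrier (S_mod al)"
proof -
  have *: "keys (sum h F) \<subseteq> S" if "\<And>i. keys (h i) \<subseteq> S" for h :: "3 => fexpr" and F S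
    using Poly_Mapping.keys_sum[of h F] that by blast
  show "p \<in> carrier (S_mod al) ==> act (S_mod al) x p \<in> carrier (S_mod al)"
    unfolding S_mod_simps mem_Collect_eq by (intro * subalg_like_S(2) euler_closed) auto
qed

lemma S_mod_gmodule: "gmodule (S_mod al)"
  unfolding gmodule_def
  using S_mod_module[of al] act_S_closed act_S_linear act_S_bracket
  by (simp add: S_mod_minus) (simp add: S_mod_simps(2,3))

section \<open>Monomials\<close>

definition mon :: "complex => nat => nat => fexpr" where
  "mon al a b = single (ex al a b) 1"

definition act1 :: "complex => T => fexpr => fexpr" where
  "act1 al = rep (S_mod al)"

abbreviation S :: "complex => fexpr set" where
  "S al \<equiv> carrier (S_mod al)"

lemma act1_closed [simp]: "f \<in> S al ==> act1 al p f \<in> S al"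
  using rep_facts(1)[OF S_mod_gmodule] by (simp add: act1_def)

lemma act1_simps:
  assumes "f \<in> S al"
  shows "act1 al (gen (i, j)) f = euler i j f"
    "act1 al (p + q) f = act1 al p f + act1 al q f"
    "act1 al 1 f = f" "act1 al 0 f = 0" "act1 al (p * q) f = act1 al p (act1 al q f)"
    "act1 al (- p) f = - act1 al p f" "act1 al (p - q) f = act1 al p f - act1 al q f"
    "g \<in> S al ==> act1 al p (f + g) = act1 al p f + act1 al p g"
proof -
  note F = rep_facts[OF S_mod_gmodule assms, folded act1_def, unfolded S_mod_simps(2-4)]
  show "act1 al (gen (i, j)) f = euler i j f" using F(2) by (simp add: act_unit)
  show *: "act1 al (p + q) f = act1 al p f + act1 al q f" for p q using F(3) .
  show "act1 al 1 f = f" "act1 al 0 f = 0" "act1 al (p * q) f = act1 al p (act1 al q f)" using F(4-6) by auto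
  show "g \<in> S al ==> act1 al p (f + g) = act1 al p f + act1 al p g" by (rule F(8))
  show m: "act1 al (- p) f = - act1 al p f" for p using F(7)[of "-1" p] by (simp only: sc_minus_one)
  show "act1 al (p - q) f = act1 al p f - act1 al q f" using *[of p "- q"] by (simp add: m)
qed

lemmas act1_ring = act1_simps(2-8)

lemma act1_sc:
  assumes "f \<in> S al"
  shows "act1 al (sc c p) f = sc c (act1 al p f)" "act1 al p (sc c f) = sc c (act1 al p f)"
  using rep_facts(7,9)[OF S_mod_gmodule assms, folded act1_def, unfolded S_mod_simps(2-4)] by auto

lemma act1_zero [simp]: "act1 al p 0 = 0"
  using rep_facts(10)[of "S_mod al" 0 p] S_mod_gmodule[of al] unfolding act1_def S_mod_simps(4) S_mod_simps(1)
  by simp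

lemma mon_in_S [simp]: "(a, b) \<in> idx al ==> mon al a b \<in> S al"
  by (auto simp: mon_def S_mod_simps S_exponents_eq intro!: image_eqI[of _ _ "(a, b)"])

lemma S_zero [simp]: "0 \<in> S al" by (simp add: S_mod_simps)
lemma S_add [simp]: "p \<in> S al ==> q \<in> S al ==> p + q \<in> S al"
  unfolding S_mod_simps mem_Collect_eq by (rule subalg_like_S)
lemma S_sc [simp]: "p \<in> S al ==> sc c p \<in> S al"
  unfolding S_mod_simps mem_Collect_eq by (rule subalg_like_S)
lemma S_sum [simp]: "(\<And>i. i \<in> F ==> h i \<in> S al) ==> sum h F \<in> S al"
  by (induction F rule: infinite_finite_induct) auto

lemma S_keys:
  assumes "f \<in> S al" "k \<in> keys f"
  shows "\<exists>a b. k = ex al a b \<and> (a, b) \<in> idx al"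
proof -
  have "keys f \<subseteq> (\<lambda>(a, b). ex al a b) ` idx al"
    using assms(1) by (simp only: S_mod_simps mem_Collect_eq S_exponents_eq)
  then have "k \<in> (\<lambda>(a, b). ex al a b) ` idx al" using assms(2) by (rule subsetD)
  then obtain x where "x \<in> idx al" "k = (case x of (a, b) => ex al a b)" by (rule imageE)
  then show ?thesis by (cases x) auto
qed

lemma S_induct [consumes 1, case_names zero monomial add]:
  assumes "f \<in> S al" "P 0" "\<And>a b c. (a, b) \<in> idx al ==> P (sc c (mon al a b))"
    "\<And>f g. f \<in> S al ==> g \<in> S al ==> P f ==> P g ==> P (f + g)"
  shows "P f"
proof -
  note * = S_keys[OF assms(1)]
  have "P f \<and> f \<in> S al"
  proof (induction f rule: poly_mapping_induct)
    case (single k c)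
    then obtain a b where ab: "k = ex al a b" "(a, b) \<in> idx al" using * by blast
    then have "single k c = sc c (mon al a b)" by (simp add: mon_def)
    then show ?case using assms(3)[OF ab(2), of c] S_sc[OF mon_in_S[OF ab(2)], of c] by metis
  next
    case zero show ?case using assms(2) by simp
  next
    case (add p q) then show ?case using assms(4)[of p q] S_add by blast
  qed
  then show ?thesis ..
qed

text \<open>Monomials span, so this reduces every identity of operators to the nine formulas of \<open>mon_step\<close>.\<close>

lemma act1_eqI:
  assumes "\<And>a b. (a, b) \<in> idx al ==> act1 al p (mon al a b) = act1 al q (mon al a b)" "f \<in> S al"
  shows "act1 al p f = act1 al q f"
  using assms(2)
  by (induction f rule: S_induct) (auto simp: assms(1) act1_simps(8) act1_sc)

lemma mon_step:
  assumes "(a, b) \<in> idx al"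
  shows "act1 al (gen (1, 1)) (mon al a b) = sc (al - of_nat a - of_nat b) (mon al a b)"
    "act1 al (gen (2, 2)) (mon al a b) = sc (of_nat a) (mon al a b)"
    "act1 al (gen (3, 3)) (mon al a b) = sc (of_nat b) (mon al a b)"
    "act1 al (gen (1, 2)) (mon al a b) = sc (of_nat a) (mon al (a - 1) b)"
    "act1 al (gen (1, 3)) (mon al a b) = sc (of_nat b) (mon al a (b - 1))"
    "act1 al (gen (2, 3)) (mon al a b) = sc (of_nat b) (mon al (a + 1) (b - 1))"
    "act1 al (gen (3, 2)) (mon al a b) = sc (of_nat a) (mon al (a - 1) (b + 1))"
    "act1 al (gen (2, 1)) (mon al a b) = sc (al - of_nat a - of_nat b) (mon al (a + 1) b)"
    "act1 al (gen (3, 1)) (mon al a b) = sc (al - of_nat a - of_nat b) (mon al a (b + 1))"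
proof -
  have e: "act1 al (gen (i, j)) (mon al a b) = single (ex al a b + axis i 1 - axis j 1) (ex al a b $ j)" for i j
    unfolding act1_simps(1)[OF mon_in_S[OF assms]] by (simp add: mon_def euler_single)
  have s: "single k c = sc c (mon al a' b')" if "c = 0 \<or> k = ex al a' b'" for k c a' b'
    using that by (auto simp: mon_def)
  have n: "(1::3) \<noteq> 2" "(1::3) \<noteq> 3" "(2::3) \<noteq> 3" by simp_all
  show "act1 al (gen (1, 1)) (mon al a b) = sc (al - of_nat a - of_nat b) (mon al a b)"
    "act1 al (gen (2, 2)) (mon al a b) = sc (of_nat a) (mon al a b)"
    "act1 al (gen (3, 3)) (mon al a b) = sc (of_nat b) (mon al a b)"
    "act1 al (gen (1, 2)) (mon al a b) = sc (of_nat a) (mon al (a - 1) b)"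
    "act1 al (gen (1, 3)) (mon al a b) = sc (of_nat b) (mon al a (b - 1))"
    "act1 al (gen (2, 3)) (mon al a b) = sc (of_nat b) (mon al (a + 1) (b - 1))"
    "act1 al (gen (3, 2)) (mon al a b) = sc (of_nat a) (mon al (a - 1) (b + 1))"
    "act1 al (gen (2, 1)) (mon al a b) = sc (al - of_nat a - of_nat b) (mon al (a + 1) b)"
    "act1 al (gen (3, 1)) (mon al a b) = sc (al - of_nat a - of_nat b) (mon al a (b + 1))"
    unfolding e
    subgoal by (subst ex_nth, rule s) simp
    subgoal by (subst ex_nth, rule s) simp
    subgoal by (subst ex_nth, rule s) simp
    subgoal by (subst ex_nth, rule s) (cases a; auto intro!: vec3_eqI simp: axis_def n)
    subgoal by (subst ex_nth, rule s) (cases b; auto intro!: vec3_eqI simp: axis_def n)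
    subgoal by (subst ex_nth, rule s) (cases b; auto intro!: vec3_eqI simp: axis_def n)
    subgoal by (subst ex_nth, rule s) (cases a; auto intro!: vec3_eqI simp: axis_def n)
    subgoal by (subst ex_nth, rule s) (auto intro!: vec3_eqI simp: axis_def n)
    subgoal by (subst ex_nth, rule s) (auto intro!: vec3_eqI simp: axis_def n)
    done
qed

lemma idx_down: "(a, b) \<in> idx al ==> a' + b' \<le> a + b ==> (a', b') \<in> idx al"
  by (fastforce simp: idx_def)

lemma idx_up: "(a, b) \<in> idx al ==> al - of_nat a - of_nat b = 0 \<or> (a + 1, b) \<in> idx al \<and> (a, b + 1) \<in> idx al"
proof -
  assume ab: "(a, b) \<in> idx al"
  have "Suc (a + b) \<le> n" if "al = of_nat n" "al - of_nat a - of_nat b \<noteq> 0" for n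
  proof -
    have "a + b \<le> n" using ab that by (auto simp: idx_def)
    moreover have "a + b \<noteq> n" using that by auto
    ultimately show ?thesis by simp
  qed
  then show ?thesis by (auto simp: idx_def)
qed

lemma idx_nonzero: "(a, b) \<in> idx al ==> k < a + b ==> al - of_nat k \<noteq> 0"
  by (auto simp: idx_def)

lemma idx_00 [simp]: "(0, 0) \<in> idx al" by (simp add: idx_def)

lemma mon_nonzero: "sc c (mon al a b) = 0 \<longleftrightarrow> c = 0"
  unfolding mon_def sc_single mult_1_right by (metis lookup_single_eq lookup_zero single_zero)

lemma lookup_mon: "lookup (mon al a b) (ex al a' b') = (if a = a' \<and> b = b' then 1 else 0)"
  by (auto simp: mon_def lookup_single when_def ex_inj)

text \<open>The coefficients on the way from the highest weight vector to a monomial are factors \<open>al - m\<close> with \<open>m\<close>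
  below the total degree in the last two variables; none of them vanishes on a monomial of the module.\<close>

lemma raise_mon:
  assumes "(a, b) \<in> idx al"
  shows "\<exists>c. c \<noteq> 0 \<and> act1 al (gen (2, 1) ^ a * gen (3, 1) ^ b) (mon al 0 0) = sc c (mon al a b)"
proof -
  have 1: "\<exists>c. c \<noteq> 0 \<and> act1 al (gen (3, 1) ^ b') (mon al 0 0) = sc c (mon al 0 b')" if "b' \<le> b" for b'
    using that
  proof (induction b')
    case 0 then show ?case by (intro exI[of _ 1]) (simp add: act1_ring)
  next
    case (Suc d)
    then obtain c where c: "c \<noteq> 0" "act1 al (gen (3, 1) ^ d) (mon al 0 0) = sc c (mon al 0 d)" by auto
    have d: "(0, d) \<in> idx al" using assms Suc by (auto intro: idx_down)
    have "al - of_nat d \<noteq> 0" using assms Suc by (intro idx_nonzero) auto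
    then show ?case using c d
      by (intro exI[of _ "c * (al - of_nat d)"]) (simp add: act1_ring act1_sc mon_step)
  qed
  have "\<exists>c. c \<noteq> 0 \<and> act1 al (gen (2, 1) ^ a' * gen (3, 1) ^ b) (mon al 0 0) = sc c (mon al a' b)" if "a' \<le> a" for a'
    using that
  proof (induction a')
    case 0 then show ?case using 1[of b] by simp
  next
    case (Suc d)
    then obtain c where c: "c \<noteq> 0" "act1 al (gen (2, 1) ^ d * gen (3, 1) ^ b) (mon al 0 0) = sc c (mon al d b)" by auto
    have d: "(d, b) \<in> idx al" using assms Suc by (auto intro: idx_down)
    have "al - of_nat (d + b) \<noteq> 0" using assms Suc by (intro idx_nonzero) auto
    then have "al - of_nat d - of_nat b \<noteq> 0" by (simp add: algebra_simps)
    then show ?case using c d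
      by (intro exI[of _ "c * (al - of_nat d - of_nat b)"]) (simp add: act1_ring act1_sc mon_step mult.assoc)
  qed
  then show ?thesis by blast
qed

text \<open>The falling factorial \<open>a (a - 1) \<dots> (a - k + 1)\<close>, the coefficient produced by differentiating \<open>k\<close>
  times.\<close>

definition ffact :: "nat => nat => complex" where
  "ffact a k = (\<Prod>i<k. of_nat a - of_nat i)"

lemma ffact_zero: "a < k ==> ffact a k = 0"
  by (auto simp: ffact_def)

lemma ffact_nonzero: "k \<le> a ==> ffact a k \<noteq> 0"
  by (auto simp: ffact_def)

lemma E13_power:
  assumes "(a, b) \<in> idx al"
  shows "act1 al (gen (1, 3) ^ k) (mon al a b) = sc (ffact b k) (mon al a (b - k))"
proof (induction k)
  case 0 then show ?case using assms by (simp add: act1_ring ffact_def)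
next
  case (Suc k)
  have "(a, b - k) \<in> idx al" using assms by (rule idx_down) simp
  moreover have "act1 al (gen (1, 3) ^ Suc k) (mon al a b) = act1 al (gen (1, 3)) (act1 al (gen (1, 3) ^ k) (mon al a b))"
    using assms by (simp add: act1_ring)
  moreover have "ffact b k * of_nat (b - k) = ffact b (Suc k)"
    by (cases "k \<le> b") (auto simp: ffact_def of_nat_diff ffact_zero[unfolded ffact_def])
  ultimately show ?case using Suc by (simp add: act1_sc mon_step)
qed

lemma E12_power:
  assumes "(a, b) \<in> idx al"
  shows "act1 al (gen (1, 2) ^ k) (mon al a b) = sc (ffact a k) (mon al (a - k) b)"
proof (induction k)
  case 0 then show ?case using assms by (simp add: act1_ring ffact_def)
next
  case (Suc k)
  have "(a - k, b) \<in> idx al" using assms by (rule idx_down) simp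
  moreover have "act1 al (gen (1, 2) ^ Suc k) (mon al a b) = act1 al (gen (1, 2)) (act1 al (gen (1, 2) ^ k) (mon al a b))"
    using assms by (simp add: act1_ring)
  moreover have "ffact a k * of_nat (a - k) = ffact a (Suc k)"
    by (cases "k \<le> a") (auto simp: ffact_def of_nat_diff ffact_zero[unfolded ffact_def])
  ultimately show ?case using Suc by (simp add: act1_sc mon_step)
qed

lemma S_expand:
  assumes "f \<in> S al"
  obtains F c where "finite F" "F \<subseteq> idx al" "f = (\<Sum>(a, b)\<in>F. sc (c (a, b)) (mon al a b))" 
    "\<forall>x\<in>F. c x \<noteq> 0" "F = {} \<longleftrightarrow> f = 0"
proof
  let ?g = "\<lambda>(a, b). ex al a b"
  let ?F = "{x \<in> idx al. ?g x \<in> keys f}"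
  have inj: "inj_on ?g ?F" by (auto simp: inj_on_def ex_inj)
  have im: "?g ` ?F = keys f"
  proof (intro equalityI subsetI)
    fix k assume k: "k \<in> keys f"
    then obtain a b where "k = ex al a b" "(a, b) \<in> idx al" using S_keys[OF assms] by blast
    then show "k \<in> ?g ` ?F" using k by (intro image_eqI[of _ _ "(a, b)"]) auto
  qed auto
  show "finite ?F" by (rule finite_imageD[OF _ inj]) (simp only: im finite_keys)
  show "?F \<subseteq> idx al" by auto
  have "f = (\<Sum>k\<in>?g ` ?F. single k (lookup f k))"
    unfolding im by (rule poly_mapping_expand)
  also have "\<dots> = (\<Sum>x\<in>?F. single (?g x) (lookup f (?g x)))"
    by (rule sum.reindex[OF inj, unfolded o_def])
  also have "\<dots> = (\<Sum>(a, b)\<in>?F. sc (lookup f (?g (a, b))) (mon al a b))"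
    by (intro sum.cong) (auto simp: mon_def)
  finally show "f = (\<Sum>(a, b)\<in>?F. sc (lookup f (?g (a, b))) (mon al a b))" .
  show "\<forall>x\<in>?F. lookup f (?g x) \<noteq> 0" by (auto simp: in_keys_iff)
  have "?g ` ?F = {} \<longleftrightarrow> f = 0" unfolding im by (rule keys_eq_empty)
  then show "?F = {} \<longleftrightarrow> f = 0" by (simp only: image_is_empty)
qed

lemma act1_sum: "(\<And>i. i \<in> F ==> h i \<in> S al) ==> act1 al p (sum h F) = (\<Sum>i\<in>F. act1 al p (h i))"
  by (induction F rule: infinite_finite_induct) (auto simp: act1_simps(8))

text \<open>Differentiate by the exponents of a monomial of largest degree in the last two variables: every other
  monomial that occurs has a smaller exponent in one of them and is killed.\<close>

lemma lower_to_top: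
  assumes "f \<in> S al" "f \<noteq> 0"
  shows "\<exists>p c. c \<noteq> 0 \<and> act1 al p f = sc c (mon al 0 0)"
proof -
  obtain F c where F: "finite F" "F \<subseteq> idx al" "f = (\<Sum>(a, b)\<in>F. sc (c (a, b)) (mon al a b))"
    "\<forall>x\<in>F. c x \<noteq> 0" "F = {} \<longleftrightarrow> f = 0"
    by (rule S_expand[OF assms(1)])
  have "F \<noteq> {}" using F assms by simp
  let ?h = "\<lambda>(a, b). a + b :: nat"
  have "Max (?h ` F) \<in> ?h ` F" using \<open>F \<noteq> {}\<close> F(1) by (intro Max_in) auto
  then obtain x where "x \<in> F" "Max (?h ` F) = ?h x" by (rule imageE) blast
  moreover obtain a b where "x = (a, b)" by fastforce
  ultimately have ab: "(a, b) \<in> F" and "Max (?h ` F) = a + b" by auto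
  then have mx: "a' + b' \<le> a + b" if "(a', b') \<in> F" for a' b'
    using Max_ge[OF finite_imageI[OF F(1)] imageI[OF that], of ?h] by simp
  let ?p = "gen (1, 2) ^ a * gen (1, 3) ^ b :: T"
  have "act1 al ?p (sc (c (a', b')) (mon al a' b')) = (if (a', b') = (a, b) then sc (c (a, b) * ffact a a * ffact b b) (mon al 0 0) else 0)"
    if "(a', b') \<in> F" for a' b'
  proof -
    have i: "(a', b') \<in> idx al" "(a', b' - b) \<in> idx al" using that F idx_down[of a' b' al a' "b' - b"] by auto
    have "act1 al ?p (sc (c (a', b')) (mon al a' b')) = sc (c (a', b') * (ffact b' b * ffact a' a)) (mon al (a' - a) (b' - b))"
      using i by (simp add: act1_ring act1_sc E13_power E12_power)
    moreover have "ffact b' b * ffact a' a = 0" if "(a', b') \<noteq> (a, b)"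
    proof -
      have "a' < a \<or> b' < b" using mx[OF \<open>(a', b') \<in> F\<close>] that by auto
      then show ?thesis using ffact_zero by auto
    qed
    ultimately show ?thesis by (auto simp: algebra_simps)
  qed
  then have "act1 al ?p f = (\<Sum>x\<in>F. if x = (a, b) then sc (c (a, b) * ffact a a * ffact b b) (mon al 0 0) else 0)"
    unfolding F(3) using F(2) by (subst act1_sum) (auto intro!: sum.cong)
  also have "\<dots> = sc (c (a, b) * ffact a a * ffact b b) (mon al 0 0)" using ab F(1) by simp
  finally show ?thesis using F(4) ab ffact_nonzero by (intro exI[of _ ?p] exI[of _ "c (a, b) * ffact a a * ffact b b"]) auto
qed

text \<open>Go down to the highest weight vector and from there, term by term, to the target.\<close>

lemma S_cyclic:
  assumes "f \<in> S al" "f \<noteq> 0" "g \<in> S al"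
  shows "\<exists>p. act1 al p f = g"
proof -
  obtain p c where p: "c \<noteq> 0" "act1 al p f = sc c (mon al 0 0)" using lower_to_top[OF assms(1,2)] by blast
  show ?thesis using assms(3)
  proof (induction g rule: S_induct)
    case zero show ?case using assms(1) by (intro exI[of _ 0]) (simp add: act1_ring)
  next
    case (monomial a b d)

    obtain e where e: "e \<noteq> 0" "act1 al (gen (2, 1) ^ a * gen (3, 1) ^ b) (mon al 0 0) = sc e (mon al a b)"
      using raise_mon[OF monomial] by blast
    let ?q = "gen (2, 1) ^ a * gen (3, 1) ^ b :: T"
    have "act1 al (sc (d / (c * e)) (?q * p)) f = sc (d / (c * e)) (act1 al ?q (act1 al p f))"
      by (simp only: act1_sc(1)[OF assms(1)] act1_simps(5)[OF assms(1), of ?q p])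
    also have "act1 al ?q (act1 al p f) = sc c (sc e (mon al a b))"
      by (simp only: p(2) act1_sc(2)[OF mon_in_S[OF idx_00]] e(2))
    also have "sc (d / (c * e)) \<dots> = sc d (mon al a b)" using p(1) e(1) by (simp only: sc_sc) simp
    finally show ?case by blast
  next
    case (add g h)
    then obtain q r where "act1 al q f = g" "act1 al r f = h" by blast
    then show ?case using assms(1) by (intro exI[of _ "q + r"]) (simp add: act1_ring)
  qed
qed

lemma gsubmoduleD:
  assumes "gsubmodule N (S_mod al)"
  shows "N \<subseteq> S al" "0 \<in> N" "f \<in> N ==> g \<in> N ==> f + g \<in> N" "f \<in> N ==> sc c f \<in> N"
    "f \<in> N ==> act1 al p f \<in> N"
proof -
  interpret M: module \<CC> "S_mod al" by (rule S_mod_module)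
  have sub: "submodule N \<CC> (S_mod al)" and ac: "\<And>x m. m \<in> N ==> act (S_mod al) x m \<in> N"
    using assms by (auto simp: gsubmodule_def)
  note E = M.submoduleE[OF sub]
  show S: "N \<subseteq> S al" by (rule E(1))
  show sc: "f \<in> N ==> sc c f \<in> N" for f c using E(4)[of c f] by (simp add: S_mod_simps)
  show add: "f \<in> N ==> g \<in> N ==> f + g \<in> N" for f g using E(5)[of f g] by (simp add: S_mod_simps)
  obtain f where "f \<in> N" using E(2) by blast
  then show z: "0 \<in> N" using sc[of f 0] by simp
  have "p \<in> words UNIV" by simp
  then show "f \<in> N ==> act1 al p f \<in> N" for f
  proof (induction p arbitrary: f rule: free_induct)
    case one then show ?case using S by (auto simp: act1_simps(3))
  next
    case (gen x q)
    obtain i j where x: "x = (i, j)" by fastforce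
    have f: "f \<in> S al" using S gen by blast
    then have "act1 al q f \<in> S al" by simp
    then have "act1 al (Defs.gen x * q) f = act (S_mod al) (matrix_unit i j) (act1 al q f)"
      by (simp only: x act1_simps(1) act1_simps(5)[OF f] act_unit)
    then show ?case using ac gen by simp
  next
    case (sc c q)
    then have "f \<in> S al" using S by blast
    then show ?case using sc.IH[OF sc.prems] \<open>\<And>f c. f \<in> N ==> sc c f \<in> N\<close> by (simp only: act1_sc)
  next
    case (add p q)
    then have "f \<in> S al" using S by blast
    then show ?case using add.IH[OF add.prems] \<open>\<And>f g. f \<in> N ==> g \<in> N ==> f + g \<in> N\<close> by (simp only: act1_simps)
  qed
qed

theorem S_mod_irreducible: "irreducible_gmod (S_mod al)"
  unfolding irreducible_gmod_def
proof (intro conjI allI impI)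
  show "gmodule (S_mod al)" by (rule S_mod_gmodule)
  have "mon al 0 0 \<in> S al" "mon al 0 0 \<noteq> 0" using mon_nonzero[of 1 al 0 0] by auto
  then show "S al \<noteq> {\<zero>\<^bsub>S_mod al\<^esub>}" by (metis S_mod_simps(4) singletonD)
  fix N assume N: "gsubmodule N (S_mod al)"
  note D = gsubmoduleD[OF N]
  have "N = S al" if "f \<in> N" "f \<noteq> 0" for f
  proof
    have "f \<in> S al" using D(1) that by blast
    then show "S al \<subseteq> N" using S_cyclic[of f al] D(5)[OF that(1)] that(2) by blast
  qed (rule D(1))
  then show "N = {\<zero>\<^bsub>S_mod al\<^esub>} \<or> N = S al" unfolding S_mod_simps(4) using D(2) by blast
qed

lemma act1_zero_iff: "(\<forall>f\<in>S al. act1 al p f = 0) \<longleftrightarrow> \<pi> p \<in> J al"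
proof -
  interpret E: alg_map "End_alg (S_mod al)" UNIV "rep (S_mod al)" by (rule rep_alg_map[OF S_mod_gmodule])
  have "rep (S_mod al) p = \<zero>\<^bsub>End_alg (S_mod al)\<^esub> \<longleftrightarrow> (\<forall>f\<in>S al. rep (S_mod al) p f = 0)"
  proof
    assume z: "\<forall>f\<in>S al. rep (S_mod al) p f = 0"
    have c: "rep (S_mod al) p \<in> carrier (End_alg (S_mod al))" by simp
    show "rep (S_mod al) p = \<zero>\<^bsub>End_alg (S_mod al)\<^esub>"
    proof
      fix f show "rep (S_mod al) p f = \<zero>\<^bsub>End_alg (S_mod al)\<^esub> f"
        using c z unfolding End_alg_def S_mod_simps(4) by (cases "f \<in> S al") (auto simp: PiE_def extensional_def simp del: E.map_closed)
    qed
  qed (simp add: End_alg_def S_mod_simps)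
  then show ?thesis using P.map_closed[of p] by (auto simp: J_def a_kernel_def' act1_def rep_def)
qed

section \<open>The adjoint action on words and its invariant Hermitian form\<close>

definition lext :: "('k => 'l::monoid_add \<Rightarrow>\<^sub>0 complex) => ('k \<Rightarrow>\<^sub>0 complex) => ('l \<Rightarrow>\<^sub>0 complex)" where
  "lext f p = (\<Sum>k\<in>keys p. sc (lookup p k) (f k))"

lemma lext_superset:
  assumes "finite F" "keys p \<subseteq> F"
  shows "lext f p = (\<Sum>k\<in>F. sc (lookup p k) (f k))"
  unfolding lext_def using assms by (intro sum.mono_neutral_left) (auto simp: in_keys_iff)

lemma lext_add: "lext f (p + q) = lext f p + lext f q"
proof -
  let ?F = "keys p \<union> keys q"
  have "keys (p + q) \<subseteq> ?F" by (rule Poly_Mapping.keys_add)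
  then show ?thesis
    by (simp add: lext_superset[of ?F] lookup_add sc_add_left sum.distrib)
qed

lemma lext_sc: "lext f (sc c p) = sc c (lext f (p :: 'k::monoid_add \<Rightarrow>\<^sub>0 complex))"
  by (simp only: lext_superset[of "keys p", OF finite_keys] lext_def[of f p] keys_sc lookup_sc
      sum_distrib_left sc_sc)

lemma lext_single: "lext f (single k c) = sc c (f k)"
  by (subst lext_superset[of "{k}"]) simp_all

lemma lext_zero [simp]: "lext f 0 = 0" by (simp add: lext_def)

fun ad_letter :: "3 => 3 => 3 \<times> 3 => T" where
  "ad_letter i j (k, l) = (if j = k then gen (i, l) else 0) - (if l = i then gen (k, j) else 0)"

primrec ad_word :: "3 => 3 => (3 \<times> 3) list => T" where
  "ad_word i j [] = 0"
| "ad_word i j (x # w) = ad_letter i j x * single w 1 + gen x * ad_word i j w"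

text \<open>The adjoint action lifted to words: the derivation of the free algebra extending the bracket on
  letters. Unlike the commutator in the free algebra it preserves the length of words.\<close>

definition D :: "3 => 3 => T => T" where
  "D i j = lext (ad_word i j)"

lemma D_add: "D i j (p + q) = D i j p + D i j q"
  and D_sc: "D i j (sc c p) = sc c (D i j p)"
  and D_zero [simp]: "D i j 0 = 0"
  and D_single: "D i j (single w c) = sc c (ad_word i j w)"
  unfolding D_def by (rule lext_add lext_sc lext_zero lext_single)+

lemma D_uminus: "D i j (- p) = - D i j p"
  using D_sc[of i j "-1" p] by (simp only: sc_minus_one)

lemma D_diff: "D i j (p - q) = D i j p - D i j q"
  using D_add[of i j p "- q"] by (simp add: D_uminus)

lemma D_sum: "D i j (sum h F) = (\<Sum>x\<in>F. D i j (h x))"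
  by (induction F rule: infinite_finite_induct) (auto simp: D_add)

lemma D_gen: "D i j (gen x) = ad_letter i j x"
  by (simp only: gen_def D_single ad_word.simps single_Nil single_one mult_zero_right mult_1_right mult_1_left add_0_right)

lemma D_one: "D i j 1 = 0"
  using D_single[of i j "[]" 1] by (simp only: single_Nil sc_one ad_word.simps mult_zero_right)

lemma D_gen_mult: "D i j (gen x * p) = ad_letter i j x * p + gen x * D i j p"
proof (induction p rule: poly_mapping_induct)
  case (single w c)
  have "D i j (gen x * single w c) = sc c (ad_letter i j x * single w 1 + gen x * ad_word i j w)"
    by (simp only: single_Cons[symmetric] D_single ad_word.simps)
  also have "\<dots> = ad_letter i j x * single w c + gen x * sc c (ad_word i j w)"
    using sc_mult_right[of "ad_letter i j x" c "single w 1"] sc_mult_right[of "gen x" c "ad_word i j w"]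
    by (simp add: distrib_left)
  finally show ?case by (simp add: D_single)
next
  case (add p q) then show ?case by (simp add: D_add algebra_simps)
qed simp

lemma D_mult: "D i j (p * q) = D i j p * q + p * D i j q"
proof -
  have "p \<in> words UNIV" by simp
  then show ?thesis
  proof (induction p rule: free_induct)
    case one show ?case by (simp add: D_one)
  next
    case (gen x p) then show ?case by (simp add: mult.assoc D_gen_mult) (simp add: algebra_simps)
  next
    case (sc c p)
    have "D i j (sc c p * q) = sc c (D i j (p * q))" by (simp only: mult.assoc D_sc)
    then show ?case using sc by (simp only: D_sc distrib_left mult.assoc)
  next
    case (add p p') then show ?case by (simp add: D_add algebra_simps)
  qed
qed

text \<open>Both sides are derivations in \<open>p\<close> and agree on letters by the relations of the enveloping algebra.\<close>

lemma \<pi>_D: "\<pi> (D i j p) = \<pi> (gen (i, j) * p - p * gen (i, j))"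
proof -
  have "p \<in> words UNIV" by simp
  then show ?thesis
  proof (induction p rule: free_induct)
    case one show ?case by (simp add: D_one)
  next
    case (gen x p)
    obtain k l where x: "x = (k, l)" by fastforce
    have "\<pi> (D i j (Defs.gen x * p)) = \<pi> (ad_letter i j x) \<otimes>\<^bsub>U\<^esub> \<pi> p \<oplus>\<^bsub>U\<^esub> \<pi> (Defs.gen x) \<otimes>\<^bsub>U\<^esub> \<pi> (D i j p)"
      by (simp add: D_gen_mult P.map_add P.map_mult)
    also have "\<pi> (ad_letter i j x) = \<pi> (Defs.gen (i, j) * Defs.gen x - Defs.gen x * Defs.gen (i, j))"
      using \<pi>_comm[of i j k l] by (simp add: x)
    also have "\<pi> (D i j p) = \<pi> (Defs.gen (i, j) * p - p * Defs.gen (i, j))" by (rule gen)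
    finally have "\<pi> (D i j (Defs.gen x * p)) =
      \<pi> ((Defs.gen (i, j) * Defs.gen x - Defs.gen x * Defs.gen (i, j)) * p + Defs.gen x * (Defs.gen (i, j) * p - p * Defs.gen (i, j)))"
      by (simp only: P.map_add[OF UNIV_I UNIV_I] P.map_mult[OF UNIV_I UNIV_I])
    then show ?case by (simp add: algebra_simps)
  next
    case (sc c p)
    have "\<pi> (D i j (sc c p)) = c \<odot>\<^bsub>U\<^esub> \<pi> (D i j p)" by (simp only: D_sc P.map_sc[OF UNIV_I])
    also have "\<dots> = \<pi> (sc c (gen (i, j) * p - p * gen (i, j)))"
      unfolding sc(2) by (simp only: P.map_sc[OF UNIV_I])
    finally show ?case
      by (simp only: right_diff_distrib sc_mult_right mult.assoc)
  next
    case (add p q)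
    have "\<pi> (D i j (p + q)) = \<pi> ((gen (i, j) * p - p * gen (i, j)) + (gen (i, j) * q - q * gen (i, j)))"
      by (simp only: D_add P.map_add[OF UNIV_I UNIV_I] add)
    then show ?case by (simp add: algebra_simps)
  qed
qed

text \<open>The Hermitian form with the words as an orthonormal basis. Its positivity gives the complements from
  which complete reducibility is deduced.\<close>

definition ip :: "('k \<Rightarrow>\<^sub>0 complex) => ('k \<Rightarrow>\<^sub>0 complex) => complex" where
  "ip p q = (\<Sum>k\<in>keys p. lookup p k * cnj (lookup q k))"

lemma ip_superset:
  assumes "finite F" "keys p \<subseteq> F"
  shows "ip p q = (\<Sum>k\<in>F. lookup p k * cnj (lookup q k))"
  unfolding ip_def using assms by (intro sum.mono_neutral_left) (auto simp: in_keys_iff)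

lemma ip_add_left: "ip (p + q) r = ip p r + ip q r"
proof -
  let ?F = "keys p \<union> keys q"
  have "keys (p + q) \<subseteq> ?F" by (rule Poly_Mapping.keys_add)
  then show ?thesis
    by (simp add: ip_superset[of ?F] lookup_add algebra_simps sum.distrib)
qed

lemma ip_sym: "ip q p = cnj (ip p q)"
proof -
  let ?F = "keys p \<union> keys q"
  show ?thesis by (simp add: ip_superset[of ?F] mult.commute)
qed

lemma ip_add_right: "ip r (p + q) = ip r p + ip r q"
  by (metis ip_add_left ip_sym complex_cnj_add)

lemma ip_sc_left: "ip (sc c p) q = c * ip p (q :: 'k::monoid_add \<Rightarrow>\<^sub>0 complex)"
  by (simp only: ip_superset[of "keys p", OF finite_keys] ip_def[of p q] keys_sc lookup_sc
      sum_distrib_left mult.assoc)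

lemma ip_sc_right: "ip p (sc c q) = cnj c * ip p (q :: 'k::monoid_add \<Rightarrow>\<^sub>0 complex)"
  using arg_cong[OF ip_sc_left[of c q p], of cnj] by (simp only: ip_sym[symmetric] complex_cnj_mult)

lemma ip_zero [simp]: "ip 0 q = 0" "ip p 0 = 0" by (simp_all add: ip_def)

lemma ip_diff_left: "ip (p - q) r = ip p r - ip q r"
  using ip_add_left[of "p - q" q r] by simp

lemma ip_sum_right: "ip r (sum h F) = (\<Sum>x\<in>F. ip r (h x))"
  by (induction F rule: infinite_finite_induct) (auto simp: ip_add_right)

lemma ip_self_zero: "ip p p = 0 ==> p = 0"
proof (rule ccontr)
  assume z: "ip p p = 0" and "p \<noteq> 0"
  have "ip p p = complex_of_real (\<Sum>k\<in>keys p. (cmod (lookup p k))\<^sup>2)"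
    by (simp only: ip_def complex_norm_square of_real_sum)
  then have "(\<Sum>k\<in>keys p. (cmod (lookup p k))\<^sup>2) = 0" using z by (metis of_real_eq_0_iff)
  then have "\<forall>k\<in>keys p. lookup p k = 0" by (simp add: sum_nonneg_eq_0_iff)
  then have "p = 0" by (intro poly_mapping_eqI) (auto simp: in_keys_iff)
  then show False using \<open>p \<noteq> 0\<close> by simp
qed

lemma ip_singles: "ip (single v c) (single w d) = (if v = w then c * cnj d else 0)"
  by (simp add: ip_superset[of "{v}"] lookup_single when_def)

lemma lookup_gen_mult: "lookup (gen x * p) [] = 0"
  "lookup (gen x * p) (y # v) = (if x = y then lookup p v else 0)"
proof -
  have "lookup (gen x * p) [] = 0 \<and>
    lookup (gen x * p) (y # v) = (if x = y then lookup p v else 0)"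
    by (induction p rule: poly_mapping_induct)
       (auto simp: gen_def mult_single plus_list_def lookup_single when_def distrib_left lookup_add)
  then show "lookup (gen x * p) [] = 0"
    "lookup (gen x * p) (y # v) = (if x = y then lookup p v else 0)" by auto
qed

fun ad_coeff :: "3 => 3 => 3 \<times> 3 => 3 \<times> 3 => complex" where
  "ad_coeff i j (k, l) (k', l') =
     of_bool (j = k \<and> k' = i \<and> l' = l) - of_bool (l = i \<and> k' = k \<and> l' = j)"

lemma ad_coeff_sym: "cnj (ad_coeff j i y x) = ad_coeff i j x y"
proof -
  obtain k l k' l' where xy: "x = (k, l)" "y = (k', l')" by (metis surj_pair)
  have "(i = k' \<and> k = j \<and> l = l') = (j = k \<and> k' = i \<and> l' = l)"
    "(l' = j \<and> k = k' \<and> l = i) = (l = i \<and> k' = k \<and> l' = j)" by blast+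
  moreover have "cnj (of_bool P - of_bool Q) = of_bool P - of_bool Q" for P Q by (cases P; cases Q) auto
  ultimately show ?thesis unfolding xy ad_coeff.simps by simp
qed

lemma lookup_ad_letter_mult:
  "lookup (ad_letter i j x * p) [] = 0"
  "lookup (ad_letter i j x * p) (y # v) = ad_coeff i j x y * lookup p v"
proof -
  obtain k l k' l' where "x = (k, l)" "y = (k', l')" by (metis surj_pair)
  then show "lookup (ad_letter i j x * p) [] = 0"
    "lookup (ad_letter i j x * p) (y # v) = ad_coeff i j x y * lookup p v"
    by (auto simp: left_diff_distrib lookup_minus lookup_gen_mult)
qed

lemma ad_word_adjoint:
  "lookup (ad_word i j u) v = cnj (lookup (ad_word j i v) u)"
proof (induction u arbitrary: v)
  case Nil
  show ?case
  proof (cases v)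
    case (Cons y v') then show ?thesis by (simp add: lookup_add lookup_ad_letter_mult lookup_gen_mult)
  qed simp
next
  case (Cons x u)
  show ?case
  proof (cases v)
    case Nil then show ?thesis by (simp add: lookup_add lookup_ad_letter_mult lookup_gen_mult)
  next
    case (Cons y v')
    have "lookup (single u 1) v' = (if u = v' then 1 else 0 :: complex)"
      "lookup (single v' 1) u = (if u = v' then 1 else 0 :: complex)"
      by (auto simp: lookup_single when_def)
    then show ?thesis unfolding Cons ad_word.simps lookup_add lookup_ad_letter_mult(2) lookup_gen_mult(2)
      using Cons.IH[of v'] ad_coeff_sym[of j i y x] by simp
  qed
qed

text \<open>On letters this is the invariance of the Hermitian form \<open>tr (x y\<^sup>*)\<close> on matrices, and the action
  on words is the one on tensor powers.\<close>

lemma D_adjoint: "ip (D i j p) q = ip p (D j i q)"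
proof (induction p rule: poly_mapping_induct)
  case (single u c)
  show ?case
  proof (induction q rule: poly_mapping_induct)
    case (single v d)
    have l: "ip (sc a p) (single v b) = a * lookup p v * cnj b" for a b v and p :: T
    proof (induction p rule: poly_mapping_induct)
      case (single k c) then show ?case by (simp add: ip_singles lookup_single when_def)
    next
      case (add p q) then show ?case by (simp add: distrib_left ip_add_left lookup_add algebra_simps)
    qed simp
    have "ip (D i j (single u c)) (single v d) = c * lookup (ad_word i j u) v * cnj d"
      by (simp only: D_single l)
    moreover have "ip (single u c) (D j i (single v d)) = cnj (d * lookup (ad_word j i v) u * cnj c)"
      by (subst ip_sym) (simp only: D_single l)
    ultimately show ?case using ad_word_adjoint[of i j u v] by simp
  next
    case (add p q) then show ?case by (simp add: D_add ip_add_right)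
  qed simp
next
  case (add p p') then show ?case by (simp add: D_add ip_add_left)
qed simp

section \<open>Orthogonal complements and highest weight vectors\<close>

definition adsub :: "T set => bool" where
  "adsub N \<longleftrightarrow> 0 \<in> N \<and> (\<forall>p\<in>N. \<forall>q\<in>N. p + q \<in> N) \<and> (\<forall>c. \<forall>p\<in>N. sc c p \<in> N) \<and> (\<forall>i j. \<forall>p\<in>N. D i j p \<in> N)"

definition subsp :: "('k::monoid_add \<Rightarrow>\<^sub>0 complex) set => bool" where
  "subsp N \<longleftrightarrow> 0 \<in> N \<and> (\<forall>p\<in>N. \<forall>q\<in>N. p + q \<in> N) \<and> (\<forall>c. \<forall>p\<in>N. sc c p \<in> N)"

lemma adsub_subsp: "adsub N \<longleftrightarrow> subsp N \<and> (\<forall>i j. \<forall>p\<in>N. D i j p \<in> N)"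
  unfolding adsub_def subsp_def by blast

lemma subspD:
  assumes "subsp N"
  shows "0 \<in> N" "p \<in> N ==> q \<in> N ==> p + q \<in> N" "p \<in> N ==> sc c p \<in> N"
    "p \<in> N ==> - p \<in> N" "p \<in> N ==> q \<in> N ==> p - q \<in> N"
    "(\<And>x. x \<in> F ==> h x \<in> N) ==> sum h F \<in> N"
proof -
  show z: "0 \<in> N" and a: "p \<in> N ==> q \<in> N ==> p + q \<in> N" and s: "p \<in> N ==> sc c p \<in> N" for p q c
    using assms unfolding subsp_def by blast+
  show m: "p \<in> N ==> - p \<in> N" for p using s[of p "-1"] by (simp only: sc_minus_one)
  show "p \<in> N ==> q \<in> N ==> p - q \<in> N" using a[of p "- q"] m[of q] by simp
  show "(\<And>x. x \<in> F ==> h x \<in> N) ==> sum h F \<in> N"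
    by (induction F rule: infinite_finite_induct) (auto simp: z a)
qed

text \<open>Finite support makes the subspace finite-dimensional, so that an orthogonal projection exists.\<close>

lemma projection_exists:
  fixes K :: "('k::monoid_add \<Rightarrow>\<^sub>0 complex) set"
  assumes "finite F" "subsp K" "\<And>p. p \<in> K ==> keys p \<subseteq> F"
  shows "\<exists>k\<in>K. \<forall>p\<in>K. ip (q - k) p = 0"
  using assms
proof (induction F arbitrary: K q rule: finite_induct)
  case empty
  then have z: "p = 0" if "p \<in> K" for p using that by (metis keys_eq_empty subset_empty)
  have "ip (q - 0) p = 0" if "p \<in> K" for p using z[OF that] by simp
  then show ?case using subspD(1)[OF empty(1)] by blast
next
  case (insert w F)
  define K' where "K' = {p \<in> K. lookup p w = 0}"
  note K = subspD[OF insert.prems(1)]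
  have K': "subsp K'" using K unfolding subsp_def K'_def by (auto simp: lookup_add)
  have kF: "keys p \<subseteq> F" if "p \<in> K'" for p
    using that insert.prems(2)[of p] by (auto simp: K'_def in_keys_iff)
  note IH = insert.IH[OF K' kF]
  show ?case
  proof (cases "K' = K")
    case True then show ?thesis using IH by simp
  next
    case False
    then obtain e0 where e0: "e0 \<in> K" "lookup e0 w \<noteq> 0" by (auto simp: K'_def)
    obtain f where f: "f \<in> K'" "\<And>p. p \<in> K' ==> ip (e0 - f) p = 0" using IH[of e0] by blast
    define e where "e = e0 - f"
    have eK: "e \<in> K" using e0 f K(5) by (auto simp: e_def K'_def)
    have ew: "lookup e w \<noteq> 0" using e0 f by (auto simp: e_def K'_def lookup_minus)
    then have "e \<noteq> 0" by auto
    then have ee: "ip e e \<noteq> 0" using ip_self_zero by blast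
    obtain g where g: "g \<in> K'" "\<And>p. p \<in> K' ==> ip (q - g) p = 0" using IH[of q] by blast
    define c where "c = ip q e / ip e e"
    have ge: "ip g e = 0" using f(2)[OF g(1)] ip_sym[of g e] by (simp add: e_def)
    have "ip (q - (g + sc c e)) p = 0" if p: "p \<in> K" for p
    proof -
      define d where "d = lookup p w / lookup e w"
      have p': "p - sc d e \<in> K'"
        using p eK ew K(5)[OF p K(3)[OF eK]] unfolding K'_def by (simp add: lookup_minus d_def)
      have "ip (q - (g + sc c e)) e = 0"
        using ee by (simp add: ip_diff_left ip_add_left ip_sc_left ge c_def)
      moreover have "ip (q - (g + sc c e)) (p - sc d e) = 0"
      proof -
        have "q - (g + sc c e) = (q - g) - sc c e" by (simp add: algebra_simps)
        then show ?thesis using g(2)[OF p'] f(2)[OF p'] by (simp only: ip_diff_left ip_sc_left e_def[symmetric])  simp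
      qed
      moreover have "p = (p - sc d e) + sc d e" by simp
      ultimately show ?thesis by (metis ip_add_right ip_sc_right mult_zero_right add.right_neutral)
    qed
    moreover have "g + sc c e \<in> K" using g(1) eK K(2,3) unfolding K'_def by blast
    ultimately show ?thesis by blast
  qed
qed

definition bounded_words :: "nat => T set" where
  "bounded_words n = {p. keys p \<subseteq> {w. length w \<le> n}}"

lemma finite_word_set: "finite {w :: (3 \<times> 3) list. length w \<le> n}"
  using finite_lists_length_le[of "UNIV :: (3 \<times> 3) set" n] by simp

lemma keys_lext: "keys (lext f p) \<subseteq> (\<Union>k\<in>keys p. keys (f k))"
proof -
  have "keys (lext f p) \<subseteq> (\<Union>k\<in>keys p. keys (sc (lookup p k) (f k)))"
    unfolding lext_def by (rule Poly_Mapping.keys_sum)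
  then show ?thesis using keys_sc by blast
qed

definition wt :: "(3 \<times> 3) list => 3 => int" where
  "wt w m = (\<Sum>(k, l)\<leftarrow>w. of_bool (m = k) - of_bool (m = l))"

lemma wt_Cons: "wt ((k, l) # w) m = of_bool (m = k) - of_bool (m = l) + wt w m"
  by (simp add: wt_def)

lemma keys_ad_letter: "y \<in> keys (ad_letter i j x) ==> 
   \<exists>k l. y = [(k, l)] \<and> (\<forall>m. wt y m = wt [x] m + of_bool (m = i) - of_bool (m = j))"
proof -
  obtain k l where x: "x = (k, l)" by fastforce
  assume "y \<in> keys (ad_letter i j x)"
  then have "y = [(i, l)] \<and> j = k \<or> y = [(k, j)] \<and> l = i"
    using Poly_Mapping.keys_diff[of "if j = k then gen (i, l) else 0" "if l = i then gen (k, j) else 0"]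
    by (auto simp: x gen_def split: if_splits)
  then show ?thesis by (auto simp: x wt_def)
qed

lemma keys_ad_word:
  "v \<in> keys (ad_word i j w) ==>
    length v = length w \<and> (\<forall>m. wt v m = wt w m + of_bool (m = i) - of_bool (m = j))"
proof (induction w arbitrary: v)
  case (Cons x w)
  obtain k l where x: "x = (k, l)" by fastforce
  have "v \<in> keys (ad_letter i j x * single w 1) \<union> keys (gen x * ad_word i j w)"
    using Cons(2) unfolding ad_word.simps by (rule subsetD[OF Poly_Mapping.keys_add])
  then consider y where "y \<in> keys (ad_letter i j x)" "v = y @ w"
    | u where "u \<in> keys (ad_word i j w)" "v = x # u"
    using keys_mult[of "ad_letter i j x" "single w 1"] keys_mult[of "gen x" "ad_word i j w"]
    by (auto simp: gen_def plus_list_def)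
  then show ?case
  proof cases
    case 1
    then obtain k' l' where "y = [(k', l')]" "\<forall>m. wt y m = wt [x] m + of_bool (m = i) - of_bool (m = j)"
      using keys_ad_letter by blast
    then show ?thesis using 1 by (simp add: wt_def x)
  next
    case 2
    then show ?thesis using Cons(1)[of u] by (simp add: wt_Cons x)
  qed
qed simp

lemma D_keys:
  assumes "v \<in> keys (D i j p)"
  obtains w where "w \<in> keys p" "length v = length w"
    "\<And>m. wt v m = wt w m + of_bool (m = i) - of_bool (m = j)"
proof -
  have "v \<in> (\<Union>k\<in>keys p. keys (ad_word i j k))"
    using assms unfolding D_def by (rule subsetD[OF keys_lext])
  then obtain w where w: "w \<in> keys p" "v \<in> keys (ad_word i j w)" by (rule UN_E)
  show ?thesis using that[OF w(1)] keys_ad_word[OF w(2)] by simp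
qed

lemma bounded_words_adsub: "adsub (bounded_words n)"
proof -
  have "D i j p \<in> bounded_words n" if "p \<in> bounded_words n" for i j p
    using that by (auto simp: bounded_words_def elim!: D_keys)
  moreover have "subsp (bounded_words n)"
    unfolding subsp_def bounded_words_def mem_Collect_eq
    by (intro conjI ballI allI) (simp_all only: mem_Collect_eq subalg_like_S keys_zero empty_subsetI)
  ultimately show ?thesis unfolding adsub_subsp by blast
qed

lemma bounded_words_ex: "\<exists>n. p \<in> bounded_words n"
  by (intro exI[of _ "Max (length ` keys p)"]) (auto simp: bounded_words_def)

lemma bounded_words_mono: "p \<in> bounded_words n ==> n \<le> m ==> p \<in> bounded_words m"
  by (auto simp: bounded_words_def)

lemma adsub_Int: "adsub M ==> adsub N ==> adsub (M \<inter> N)"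
  unfolding adsub_def by blast

text \<open>Only the part of \<open>K\<close> in bounded length is finite-dimensional, so the projection is taken there.\<close>

lemma bounded_projection:
  assumes "subsp K"
  shows "\<exists>k\<in>K \<inter> bounded_words n. \<forall>p\<in>K \<inter> bounded_words n. ip (q - k) p = 0"
proof -
  have b: "subsp (bounded_words n)" using bounded_words_adsub adsub_subsp by blast
  have "subsp (K \<inter> bounded_words n)" using assms b unfolding subsp_def by blast
  then show ?thesis
    by (intro projection_exists[OF finite_word_set[of n]]) (auto simp: bounded_words_def)
qed

lemma ad_word_weight: "ad_word i i w = sc (of_int (wt w i)) (single w 1)"
proof (induction w)
  case (Cons x w)
  have l: "ad_letter i i x = sc (of_int (wt [x] i)) (gen x)"
    by (cases x) (auto simp: wt_def single_uminus)
  have "wt (x # w) i = wt [x] i + wt w i" by (cases x) (simp add: wt_def)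
  moreover have "gen x * sc c (single w 1) = sc c (single (x # w) 1)" for c
    by (simp only: sc_mult_right single_Cons)
  moreover have "sc c (gen x) * single w 1 = sc c (single (x # w) 1)" for c
    by (simp only: mult.assoc single_Cons)
  ultimately show ?case by (simp only: ad_word.simps of_int_add sc_add_left Cons l)
qed (simp add: wt_def)

lemma lookup_D_diag: "lookup (D i i p) w = of_int (wt w i) * lookup p w"
proof (induction p rule: poly_mapping_induct)
  case (single v c)
  show ?case by (simp only: D_single ad_word_weight lookup_sc) (simp add: lookup_single when_def)
next
  case (add p q) then show ?case by (simp add: D_add lookup_add algebra_simps)
qed simp

lemma D_weight:
  assumes "\<And>w. w \<in> keys p ==> wt w i = m"
  shows "D i i p = sc (of_int m) p"
  by (intro poly_mapping_eqI) (use assms in \<open>force simp: lookup_D_diag in_keys_iff\<close>)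

text \<open>A grading of the weights that every raising operator strictly increases.\<close>

definition height :: "(3 => int) => int" where
  "height \<mu> = - (\<mu> 1 + 2 * \<mu> 2 + 3 * \<mu> 3)"

lemma height_bound: "height (wt w) \<le> 2 * int (length w)"
proof (induction w)
  case (Cons x w)
  obtain k l where x: "x = (k, l)" by fastforce
  have "height (wt (x # w)) = height (wt [x]) + height (wt w)"
    by (simp add: height_def x wt_def algebra_simps)
  moreover have "height (wt [x]) \<le> 2"
    using exhaust_3[of k] exhaust_3[of l] by (auto simp: x wt_def height_def)
  ultimately show ?case using Cons by simp
qed (simp add: wt_def height_def)

text \<open>Shrinking the set of weights of an element leads to a weight vector. Among weight vectors one of largest
  height is killed by the raising operators; heights are bounded for words of bounded length.\<close>

lemma highest_weight_exists:
  assumes N: "adsub N" and b: "N \<subseteq> bounded_words n" and r: "r \<in> N" "r \<noteq> 0"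
  obtains p \<mu> where "p \<in> N" "p \<noteq> 0" "D 1 2 p = 0" "D 1 3 p = 0" "D 2 3 p = 0"
    "\<And>w. w \<in> keys p ==> wt w = \<mu>"
proof -
  note NS = subspD[OF N[unfolded adsub_subsp, THEN conjunct1]]
  have ND: "p \<in> N ==> D i j p \<in> N" for p i j using N unfolding adsub_def by blast
  define wv where "wv p \<longleftrightarrow> p \<in> N \<and> p \<noteq> 0 \<and> (\<exists>\<mu>. \<forall>w\<in>keys p. wt w = \<mu>)" for p
  have "\<exists>p. wv p"
  proof -
    let ?m = "\<lambda>p. card (wt ` keys p)"
    obtain p where p: "p \<in> N" "p \<noteq> 0" and least: "\<And>q. q \<in> N ==> q \<noteq> 0 ==> ?m p \<le> ?m q"
      using ex_has_least_nat[of "\<lambda>p. p \<in> N \<and> p \<noteq> 0" r ?m] r by blast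
    have "wt w1 = wt w2" if w: "w1 \<in> keys p" "w2 \<in> keys p" for w1 w2
    proof (rule ccontr)
      assume "wt w1 \<noteq> wt w2"
      then obtain i where i: "wt w1 i \<noteq> wt w2 i" by blast
      define q where "q = D i i p - sc (of_int (wt w1 i)) p"
      have q: "lookup q w = of_int (wt w i - wt w1 i) * lookup p w" for w
        by (simp add: q_def lookup_minus lookup_D_diag algebra_simps)
      have "q \<in> N" unfolding q_def by (rule NS(5)[OF ND[OF p(1)] NS(3)[OF p(1)]])
      moreover have "w2 \<in> keys q" using i w by (simp add: in_keys_iff q)
      then have "q \<noteq> 0" by auto
      moreover have "wt ` keys q \<subset> wt ` keys p"
      proof
        show "wt ` keys q \<subseteq> wt ` keys p" by (auto simp: in_keys_iff q)
        have "wt w1 \<notin> wt ` keys q" by (auto simp: in_keys_iff q)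
        then show "wt ` keys q \<noteq> wt ` keys p" using w by blast
      qed
      then have "?m q < ?m p" by (intro psubset_card_mono) auto
      ultimately show False using least[of q] by simp
    qed
    then have "wv p" using p unfolding wv_def by metis
    then show ?thesis ..
  qed
  then obtain p0 where p0: "wv p0" by blast
  let ?h = "\<lambda>p. nat (2 * int n - height (wt (SOME w. w \<in> keys p)))"
  obtain p where p: "wv p" and least: "\<And>q. wv q ==> ?h p \<le> ?h q"
    using ex_has_least_nat[of wv p0 ?h] p0 by blast
  obtain \<mu> where \<mu>: "\<And>w. w \<in> keys p ==> wt w = \<mu>" using p unfolding wv_def by blast
  have h: "?h q = nat (2 * int n - height \<nu>)" "height \<nu> \<le> 2 * int n"
    if "q \<in> N" "q \<noteq> 0" "\<And>w. w \<in> keys q ==> wt w = \<nu>" for q \<nu>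
  proof -
    have "\<exists>w. w \<in> keys q" using that(2) by (metis ex_in_conv keys_eq_empty)
    then have s: "(SOME w. w \<in> keys q) \<in> keys q" by (rule someI_ex)
    then show "?h q = nat (2 * int n - height \<nu>)" using that(3) by simp
    have "length (SOME w. w \<in> keys q) \<le> n" using s that(1) b by (auto simp: bounded_words_def)
    then show "height \<nu> \<le> 2 * int n" using height_bound[of "SOME w. w \<in> keys q"] that(3)[OF s] by simp
  qed
  have kill: "D i j p = 0" if ij: "(i, j) \<in> {(1, 2), (1, 3), (2, 3)}" for i j
  proof (rule ccontr)
    assume nz: "D i j p \<noteq> 0"
    define \<nu> where "\<nu> = (\<lambda>m. \<mu> m + of_bool (m = i) - of_bool (m = j))"
    have wt: "wt v = \<nu>" if v: "v \<in> keys (D i j p)" for v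
    proof -
      obtain w where "w \<in> keys p" "\<And>m. wt v m = wt w m + of_bool (m = i) - of_bool (m = j)"
        using D_keys[OF v] by metis
      then show ?thesis using \<mu> by (auto simp: \<nu>_def)
    qed
    have DN: "D i j p \<in> N" using p ND by (simp add: wv_def)
    then have "wv (D i j p)" using nz wt unfolding wv_def by blast
    then have "?h p \<le> ?h (D i j p)" by (rule least)
    moreover have "?h (D i j p) = nat (2 * int n - height \<nu>)" "height \<nu> \<le> 2 * int n"
      using h[OF DN nz wt] by auto
    moreover have "?h p = nat (2 * int n - height \<mu>)" using h(1)[of p \<mu>] p \<mu> by (simp add: wv_def)
    moreover have "height \<nu> > height \<mu>" using ij by (auto simp: \<nu>_def height_def)
    ultimately show False by linarith
  qed
  show ?thesis using that[of p \<mu>] p \<mu> kill by (auto simp: wv_def)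
qed

definition ortho :: "T set => nat => T set" where
  "ortho K n = {p \<in> bounded_words n. \<forall>q\<in>K \<inter> bounded_words n. ip p q = 0}"

lemma ortho_adsub: "adsub K ==> adsub (ortho K n)"
  using bounded_words_adsub[of n] unfolding adsub_def ortho_def
  by (auto simp: ip_add_left ip_sc_left D_adjoint)

lemma ortho_disjoint: "p \<in> K ==> p \<in> ortho K n ==> p = 0"
  unfolding ortho_def using ip_self_zero by blast

lemma ortho_decomp:
  assumes "adsub K" "p \<in> bounded_words n"
  obtains k where "k \<in> K" "k \<in> bounded_words n" "p - k \<in> ortho K n"
proof -
  have "subsp K" using assms adsub_subsp by blast
  from bounded_projection[OF this, of n p] obtain k where k: "k \<in> K \<inter> bounded_words n"
    "\<And>q. q \<in> K \<inter> bounded_words n ==> ip (p - k) q = 0" by blast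
  have "p - k \<in> bounded_words n"
    using subspD(5)[of "bounded_words n" p k] bounded_words_adsub[of n] k assms(2) adsub_subsp by blast
  then show ?thesis using that[of k] k by (auto simp: ortho_def)
qed

text \<open>The part of an element outside \<open>K\<close> that is orthogonal to \<open>K\<close> generates a submodule
  orthogonal to \<open>K\<close>. A highest weight vector of that submodule cannot lie in \<open>K\<close>.\<close>

lemma highest_weight_between:
  assumes K: "adsub K" and N: "adsub N" and KN: "K \<subseteq> N" and q: "q \<in> N" "q \<notin> K"
  obtains p \<mu> where "p \<in> N" "p \<notin> K" "D 1 2 p = 0" "D 1 3 p = 0" "D 2 3 p = 0"
    "\<And>i. D i i p = sc (of_int (\<mu> i)) p"
proof -
  obtain n where n: "q \<in> bounded_words n" using bounded_words_ex by blast
  obtain k where k: "k \<in> K" "q - k \<in> ortho K n" using ortho_decomp[OF K n] by blast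
  have r: "q - k \<in> N" using q k KN subspD(5) N adsub_subsp by blast
  have "q - k \<noteq> 0" using q k by auto
  then obtain p \<mu> where p: "p \<in> N \<inter> ortho K n" "p \<noteq> 0" "D 1 2 p = 0" "D 1 3 p = 0" "D 2 3 p = 0"
    "\<And>w. w \<in> keys p ==> wt w = \<mu>"
    using highest_weight_exists[OF adsub_Int[OF N ortho_adsub[OF K, of n]], of n "q - k"] r k
    by (auto simp: ortho_def)
  have "p \<notin> K" using p ortho_disjoint by blast
  moreover have "D i i p = sc (of_int (\<mu> i)) p" for i using p(6) by (intro D_weight) auto
  ultimately show ?thesis using that[of p \<mu>] p by blast
qed

text \<open>The orthogonal complement of the images of all \<open>D i j\<close> is the common kernel of their adjoints \<open>D j i\<close>,
  that is, the space of invariants.\<close>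

lemma invariant_decomposition:
  assumes N: "adsub N" and p: "p \<in> N"
  obtains z q where "z \<in> N" "\<And>i j. D i j z = 0" "\<And>i j. q i j \<in> N"
    "p = z + (\<Sum>i\<in>UNIV. \<Sum>j\<in>UNIV. D i j (q i j))"
proof -
  obtain n where n: "p \<in> bounded_words n" using bounded_words_ex by blast
  define M where "M = N \<inter> bounded_words n"
  have M: "adsub M" unfolding M_def by (rule adsub_Int[OF N bounded_words_adsub])
  note MS = subspD[OF M[unfolded adsub_subsp, THEN conjunct1]]
  have MD: "p \<in> M ==> D i j p \<in> M" for p i j using M unfolding adsub_def by blast
  define G where "G = {\<Sum>i\<in>UNIV. \<Sum>j\<in>UNIV. D i j (q i j) | q. \<forall>i j. q i j \<in> M}"
  have GI: "(\<Sum>i\<in>UNIV. \<Sum>j\<in>UNIV. D i j (q i j)) \<in> G" if "\<And>i j. q i j \<in> M" for q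
    unfolding G_def using that by blast
  have G: "subsp G"
    unfolding subsp_def
  proof (intro conjI ballI allI)
    show "0 \<in> G" using GI[of "\<lambda>i j. 0"] MS(1) by simp
    fix x assume "x \<in> G"
    then obtain q where q: "\<And>i j. q i j \<in> M" "x = (\<Sum>i\<in>UNIV. \<Sum>j\<in>UNIV. D i j (q i j))" unfolding G_def by blast
    have "sc c x = (\<Sum>i\<in>UNIV. \<Sum>j\<in>UNIV. D i j (sc c (q i j)))" for c
      by (simp only: q D_sc sum_distrib_left)
    then show "sc c x \<in> G" for c using GI[of "\<lambda>i j. sc c (q i j)"] q(1) MS(3) by simp
    fix y assume "y \<in> G"
    then obtain q' where q': "\<And>i j. q' i j \<in> M" "y = (\<Sum>i\<in>UNIV. \<Sum>j\<in>UNIV. D i j (q' i j))" unfolding G_def by blast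
    have "x + y = (\<Sum>i\<in>UNIV. \<Sum>j\<in>UNIV. D i j (q i j + q' i j))"
      by (simp only: q q' D_add sum.distrib)
    then show "x + y \<in> G" using GI[of "\<lambda>i j. q i j + q' i j"] q(1) q'(1) MS(2) by simp
  qed
  have GM: "G \<subseteq> M" by (auto simp: G_def intro!: MS(6) MD)
  obtain g where g: "g \<in> G" "\<And>x. x \<in> G ==> ip (p - g) x = 0"
    using bounded_projection[OF G, of n p] GM unfolding M_def by blast
  have "p \<in> M" using p n by (simp add: M_def)
  then have z: "p - g \<in> M" using g(1) GM by (intro MS(5)) auto
  have DG: "D i j x \<in> G" if x: "x \<in> M" for i j x
  proof -
    have "D i j x = (\<Sum>k\<in>UNIV. if k = i then \<Sum>l\<in>UNIV. if l = j then D k l x else 0 else 0)" by simp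
    also have "\<dots> = (\<Sum>k\<in>UNIV. \<Sum>l\<in>UNIV. D k l (if k = i then if l = j then x else 0 else 0))"
    proof (intro sum.cong refl)
      fix k
      show "(if k = i then \<Sum>l\<in>UNIV. if l = j then D k l x else 0 else 0) =
        (\<Sum>l\<in>UNIV. D k l (if k = i then if l = j then x else 0 else 0))"
      proof (cases "k = i")
        case True
        have "(\<Sum>l\<in>UNIV. if l = j then D k l x else 0) = (\<Sum>l\<in>UNIV. D k l (if l = j then x else 0))"
          by (intro sum.cong refl) auto
        then show ?thesis using True by (simp only: if_True simp_thms)
      qed simp
    qed
    finally have "D i j x = (\<Sum>k\<in>UNIV. \<Sum>l\<in>UNIV. D k l (if k = i then if l = j then x else 0 else 0))" .
    then show ?thesis using GI[of "\<lambda>k l. if k = i then if l = j then x else 0 else 0"] x MS(1) by (simp only: split: if_splits) simp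
  qed
  have "D i j (p - g) = 0" for i j
  proof -
    have "ip (D i j (p - g)) (D i j (p - g)) = ip (p - g) (D j i (D i j (p - g)))" by (rule D_adjoint)
    also have "\<dots> = 0" by (rule g(2)[OF DG[OF MD[OF z]]])
    finally show ?thesis by (rule ip_self_zero)
  qed
  moreover obtain q where "\<And>i j. q i j \<in> M" "g = (\<Sum>i\<in>UNIV. \<Sum>j\<in>UNIV. D i j (q i j))" using g(1) unfolding G_def by blast
  ultimately show ?thesis using that[of "p - g" q] z unfolding M_def by simp
qed

text \<open>The other half of the orthogonality of invariants and images, relative to a submodule \<open>K\<close>: an
  invariant that is a sum of images is orthogonal to itself.\<close>

lemma invariant_unique:
  assumes K: "adsub K" and inv: "\<And>i j. D i j p \<in> K" and com: "p - (\<Sum>i\<in>UNIV. \<Sum>j\<in>UNIV. D i j (q i j)) \<in> K"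
  shows "p \<in> K"
proof -
  note KS = subspD[OF K[unfolded adsub_subsp, THEN conjunct1]]
  have KD: "p \<in> K ==> D i j p \<in> K" for p i j using K unfolding adsub_def by blast
  obtain f where f: "\<And>x. x \<in> bounded_words (f x)" using bounded_words_ex by metis
  define n where "n = max (f p) (Max ((\<lambda>(i, j). f (q i j)) ` UNIV))"
  have "f (q i j) \<le> Max ((\<lambda>(i, j). f (q i j)) ` UNIV)" for i j
    by (rule Max_ge) (auto intro!: image_eqI[of _ _ "(i, j)"])
  then have "f (q i j) \<le> n" for i j unfolding n_def by (simp add: le_max_iff_disj)
  then have qn: "q i j \<in> bounded_words n" for i j using f bounded_words_mono by blast
  have pn: "p \<in> bounded_words n" using f[of p] by (rule bounded_words_mono) (simp add: n_def)
  obtain k where k: "k \<in> K" "p - k \<in> ortho K n" using ortho_decomp[OF K pn] by blast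
  have "\<forall>i j. \<exists>l. l \<in> K \<and> q i j - l \<in> ortho K n" using ortho_decomp[OF K qn] by blast
  then obtain l where l: "\<And>i j. l i j \<in> K" "\<And>i j. q i j - l i j \<in> ortho K n" by metis
  define p' where "p' = p - k"
  define q' where "q' i j = q i j - l i j" for i j
  have O: "adsub (ortho K n)" by (rule ortho_adsub[OF K])
  note OS = subspD[OF O[unfolded adsub_subsp, THEN conjunct1]]
  have OD: "p \<in> ortho K n ==> D i j p \<in> ortho K n" for p i j using O unfolding adsub_def by blast
  have o: "p' \<in> ortho K n" "q' i j \<in> ortho K n" for i j using k l by (auto simp: p'_def q'_def)
  have "D i j p' = 0" for i j
    by (rule ortho_disjoint[OF _ OD[OF o(1)]]) (use inv k KD KS(5) in \<open>auto simp: p'_def D_diff\<close>)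
  moreover have "p' - (\<Sum>i\<in>UNIV. \<Sum>j\<in>UNIV. D i j (q' i j)) = 0"
  proof (rule ortho_disjoint[where K = K and n = n])
    show "p' - (\<Sum>i\<in>UNIV. \<Sum>j\<in>UNIV. D i j (q' i j)) \<in> ortho K n" by (rule OS(5)[OF o(1) OS(6)[OF OS(6)[OF OD[OF o(2)]]]])
    have "p' - (\<Sum>i\<in>UNIV. \<Sum>j\<in>UNIV. D i j (q' i j)) =
      (p - (\<Sum>i\<in>UNIV. \<Sum>j\<in>UNIV. D i j (q i j))) - (k - (\<Sum>i\<in>UNIV. \<Sum>j\<in>UNIV. D i j (l i j)))"
      by (simp add: p'_def q'_def D_diff sum_subtractf)
    also have "\<dots> \<in> K" by (rule KS(5)[OF com KS(5)[OF k(1) KS(6)[OF KS(6)[OF KD[OF l(1)]]]]])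
    finally show "p' - (\<Sum>i\<in>UNIV. \<Sum>j\<in>UNIV. D i j (q' i j)) \<in> K" .
  qed
  then have "ip p' p' = (\<Sum>i\<in>UNIV. \<Sum>j\<in>UNIV. ip p' (D i j (q' i j)))"
    by (simp add: ip_sum_right[symmetric])
  moreover have "ip p' (D i j (q' i j)) = ip (D j i p') (q' i j)" for i j by (simp add: D_adjoint)
  ultimately have "ip p' p' = 0" by simp
  then have "p' = 0" by (rule ip_self_zero)
  then show ?thesis using k by (simp add: p'_def)
qed

section \<open>The kernel and its highest weight vectors\<close>

definition Jp :: "complex => T set" where
  "Jp al = {p. \<forall>f\<in>S al. act1 al p f = 0}"

lemma Jp_iff: "p \<in> Jp al \<longleftrightarrow> \<pi> p \<in> J al"
  using act1_zero_iff by (simp add: Jp_def)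

lemma Jp_ideal:
  "0 \<in> Jp al" "p \<in> Jp al ==> q \<in> Jp al ==> p + q \<in> Jp al"
  "p \<in> Jp al ==> p - p' \<in> Jp al \<longleftrightarrow> p' \<in> Jp al"
  "p \<in> Jp al ==> q * p \<in> Jp al" "p \<in> Jp al ==> p * q \<in> Jp al"
  by (simp_all add: Jp_def act1_ring)

lemma act1_\<pi>: "\<pi> p = \<pi> q ==> act1 al p = act1 al q"
  by (simp add: act1_def rep_def)

lemma act1_D:
  "f \<in> S al ==> act1 al (D i j p) f = act1 al (gen (i, j)) (act1 al p f) - act1 al p (act1 al (gen (i, j)) f)"
  using act1_\<pi>[OF \<pi>_D[of i j p], of al] by (simp add: act1_ring)

lemma Jp_adsub: "adsub (Jp al)"
  unfolding adsub_def by (auto simp: Jp_def act1_D act1_simps(2,4) act1_sc)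

lemma Jp_monI: "(\<And>a b. (a, b) \<in> idx al ==> act1 al p (mon al a b) = 0) ==> p \<in> Jp al"
  unfolding Jp_def using act1_eqI[of al p 0] by (simp add: act1_ring)

lemma Jp_one: "1 \<notin> Jp al"
proof
  assume "1 \<in> Jp al"
  then have "act1 al 1 (mon al 0 0) = 0" unfolding Jp_def by simp
  then show False using mon_nonzero[of 1 al 0 0] by (simp add: act1_ring)
qed

lemma lookup_E12: "f \<in> S al ==>
  lookup (act1 al (gen (1, 2)) f) (ex al a b) = of_nat (a + 1) * lookup f (ex al (a + 1) b)"
proof (induction f rule: S_induct)
  case (monomial a' b' c)
  then show ?case by (cases a') (auto simp: act1_sc mon_step lookup_mon)
next
  case (add f g) then show ?case by (simp add: act1_ring lookup_add algebra_simps)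
qed simp

lemma lookup_E13: "f \<in> S al ==>
  lookup (act1 al (gen (1, 3)) f) (ex al a b) = of_nat (b + 1) * lookup f (ex al a (b + 1))"
proof (induction f rule: S_induct)
  case (monomial a' b' c)
  then show ?case by (cases b') (auto simp: act1_sc mon_step lookup_mon)
next
  case (add f g) then show ?case by (simp add: act1_ring lookup_add algebra_simps)
qed simp

lemma killed_by_raising:
  assumes f: "f \<in> S al" and k: "act1 al (gen (1, 2)) f = 0" "act1 al (gen (1, 3)) f = 0"
  shows "\<exists>c. f = sc c (mon al 0 0)"
proof
  have z: "lookup f (ex al a b) = 0" if nz: "a \<noteq> 0 \<or> b \<noteq> 0" for a b
  proof (cases a)
    case 0
    then obtain b' where "b = Suc b'" using nz 0 by (cases b) auto
    then show ?thesis using lookup_E13[OF f, of a b'] k by (simp add: algebra_simps del: of_nat_Suc)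
  next
    case (Suc a')
    then show ?thesis using lookup_E12[OF f, of a' b] k by (simp add: algebra_simps del: of_nat_Suc)
  qed
  show "f = sc (lookup f (ex al 0 0)) (mon al 0 0)"
  proof (intro poly_mapping_eqI)
    fix k
    show "lookup f k = lookup (sc (lookup f (ex al 0 0)) (mon al 0 0)) k"
    proof (cases "k \<in> keys f")
      case True
      then obtain a b where "k = ex al a b" using S_keys[OF f] by blast
      then show ?thesis using z[of a b] by (simp add: lookup_mon)
    next
      case False
      then show ?thesis by (cases "k = ex al 0 0") (auto simp: in_keys_iff mon_def lookup_single when_def)
    qed
  qed
qed

definition hwv :: "T => (3 => int) => bool" where
  "hwv p \<mu> \<longleftrightarrow> D 1 2 p = 0 \<and> D 1 3 p = 0 \<and> D 2 3 p = 0 \<and> (\<forall>i. D i i p = sc (of_int (\<mu> i)) p)"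

text \<open>An operator commuting with the raising operators sends a monomial of least degree outside its
  kernel to a multiple of the highest weight vector; commuting with \<open>E\<^sub>2\<^sub>3\<close> excludes the second variable.\<close>

lemma hwv_least_degree:
  assumes h: "hwv p \<mu>" and p: "p \<notin> Jp al"
  obtains k c where "(0, k) \<in> idx al" "c \<noteq> 0" "act1 al p (mon al 0 k) = sc c (mon al 0 0)"
    "\<mu> 1 = int k" "\<mu> 2 = 0" "\<mu> 3 = - int k"
proof -
  have com: "act1 al (gen (i, j)) (act1 al p f) = act1 al p (act1 al (gen (i, j)) f)"
    if "(i, j) \<in> {(1, 2), (1, 3), (2, 3)}" "f \<in> S al" for i j f
    using that h act1_D[of f al i j p] by (auto simp: hwv_def act1_ring)
  obtain x0 where x0: "x0 \<in> idx al" "act1 al p (mon al (fst x0) (snd x0)) \<noteq> 0"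
    using Jp_monI[of al p] p by force
  obtain x where "x \<in> idx al \<and> act1 al p (mon al (fst x) (snd x)) \<noteq> 0"
    and least: "\<And>y. y \<in> idx al \<and> act1 al p (mon al (fst y) (snd y)) \<noteq> 0 ==> fst x + snd x \<le> fst y + snd y"
    using ex_has_least_nat[of "\<lambda>x. x \<in> idx al \<and> act1 al p (mon al (fst x) (snd x)) \<noteq> 0" x0 "\<lambda>x. fst x + snd x"] x0
    by blast
  then obtain a b where ab: "(a, b) \<in> idx al" "act1 al p (mon al a b) \<noteq> 0" "x = (a, b)" by (cases x) auto
  have low: "act1 al p (mon al a' b') = 0" if "a' + b' < a + b" for a' b'
  proof -
    have "(a', b') \<in> idx al" using idx_down[OF ab(1), of a' b'] that by simp
    then show ?thesis using least[of "(a', b')"] that ab(3) by force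
  qed
  have top: "\<exists>c. act1 al p (mon al a' b') = sc c (mon al 0 0)" if s: "a' + b' = a + b" for a' b'
  proof (rule killed_by_raising)
    have i: "(a', b') \<in> idx al" using idx_down[OF ab(1), of a' b'] s by simp
    then show "act1 al p (mon al a' b') \<in> S al" by simp
    have m: "mon al (a' - 1) b' \<in> S al" "mon al a' (b' - 1) \<in> S al"
      using idx_down[OF i, of "a' - 1" b'] idx_down[OF i, of a' "b' - 1"] by auto
    have "act1 al p (sc (of_nat a') (mon al (a' - 1) b')) = 0"
    proof (cases "a' = 0")
      case False
      then have "act1 al p (mon al (a' - 1) b') = 0" using s by (intro low) simp
      then show ?thesis by (simp only: act1_sc(2)[OF m(1)] mult_zero_right)
    qed simp
    then show "act1 al (gen (1, 2)) (act1 al p (mon al a' b')) = 0" using com[of 1 2] i by (simp add: mon_step)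
    have "act1 al p (sc (of_nat b') (mon al a' (b' - 1))) = 0"
    proof (cases "b' = 0")
      case False
      then have "act1 al p (mon al a' (b' - 1)) = 0" using s by (intro low) simp
      then show ?thesis by (simp only: act1_sc(2)[OF m(2)] mult_zero_right)
    qed simp
    then show "act1 al (gen (1, 3)) (act1 al p (mon al a' b')) = 0" using com[of 1 3] i by (simp add: mon_step)
  qed
  have a0: "a = 0"
  proof (rule ccontr)
    assume "a \<noteq> 0"
    then obtain a' where a': "a = Suc a'" by (cases a) auto
    have i: "(a', b + 1) \<in> idx al" using idx_down[OF ab(1), of a' "b + 1"] a' by simp
    obtain c where "act1 al p (mon al a' (b + 1)) = sc c (mon al 0 0)" using top[of a' "b + 1"] a' by auto
    then have "act1 al p (sc (of_nat (b + 1)) (mon al a b)) = 0"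
      using com[of 2 3 "mon al a' (b + 1)"] i by (simp add: mon_step act1_sc a' del: of_nat_Suc of_nat_add)
    then have "sc (of_nat (b + 1)) (act1 al p (mon al a b)) = 0" using ab by (simp only: act1_sc mon_in_S)
    then have "sc (1 / of_nat (b + 1)) (sc (of_nat (b + 1)) (act1 al p (mon al a b))) = 0" by (simp only: mult_zero_right)
    then show False using ab(2) by (simp add: mult_single mult.assoc[symmetric] del: of_nat_Suc of_nat_add)
  qed
  obtain c where c: "act1 al p (mon al 0 b) = sc c (mon al 0 0)" using top[of 0 b] a0 by auto
  have c0: "c \<noteq> 0" using ab(2) c a0 by auto
  have b: "(0, b) \<in> idx al" using ab a0 by simp
  have wt: "sc (of_int (\<mu> i)) (sc c (mon al 0 0)) = act1 al (gen (i, i)) (sc c (mon al 0 0)) - act1 al p (act1 al (gen (i, i)) (mon al 0 b))" for i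
    using h act1_D[of "mon al 0 b" al i i p] b by (simp add: hwv_def act1_sc c)
  have eq: "m = n" if "sc m (sc c (mon al 0 0)) = sc n (sc c (mon al 0 0))" for m n
  proof -
    have "lookup (sc m (sc c (mon al 0 0))) (ex al 0 0) = lookup (sc n (sc c (mon al 0 0))) (ex al 0 0)"
      by (simp only: that)
    then show ?thesis using c0 by (simp only: lookup_sc lookup_mon) simp
  qed
  have "sc (of_int (\<mu> 1)) (sc c (mon al 0 0)) = sc (of_nat b) (sc c (mon al 0 0))"
  proof -
    have "sc (of_int (\<mu> 1)) (sc c (mon al 0 0)) = sc c (sc (al - of_nat 0 - of_nat 0) (mon al 0 0)) - sc (al - of_nat 0 - of_nat b) (sc c (mon al 0 0))"
      using wt[of 1] unfolding act1_sc(2)[OF mon_in_S[OF idx_00]] mon_step(1)[OF idx_00] mon_step(1)[OF b]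
        act1_sc(2)[OF mon_in_S[OF b]] c .
    also have "\<dots> = sc (c * al - (al - of_nat b) * c) (mon al 0 0)"
      by (simp only: sc_sc single_diff left_diff_distrib) simp
    also have "c * al - (al - of_nat b) * c = of_nat b * c" by (simp add: algebra_simps)
    finally show ?thesis by (simp only: sc_sc)
  qed
  then have "of_int (\<mu> 1) = (of_nat b :: complex)" by (rule eq)
  then have 1: "\<mu> 1 = int b" by (metis of_int_eq_iff of_int_of_nat_eq)
  have "sc (of_int (\<mu> 2)) (sc c (mon al 0 0)) = sc 0 (sc c (mon al 0 0))"
    using wt[of 2] b by (simp add: mon_step act1_sc c)
  then have "of_int (\<mu> 2) = (0 :: complex)" by (rule eq)
  then have 2: "\<mu> 2 = 0" by simp
  have "sc (of_int (\<mu> 3)) (sc c (mon al 0 0)) = sc (- of_nat b) (sc c (mon al 0 0))"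
  proof -
    have "sc (of_int (\<mu> 3)) (sc c (mon al 0 0)) = sc c (sc (of_nat 0) (mon al 0 0)) - sc (of_nat b) (sc c (mon al 0 0))"
      using wt[of 3] unfolding act1_sc(2)[OF mon_in_S[OF idx_00]] mon_step(3)[OF idx_00] mon_step(3)[OF b]
        act1_sc(2)[OF mon_in_S[OF b]] c .
    then show ?thesis by (simp add: single_uminus)
  qed
  then have "of_int (\<mu> 3) = (- of_nat b :: complex)" by (rule eq)
  then have 3: "\<mu> 3 = - int b" by (metis of_int_eq_iff of_int_of_nat_eq of_int_minus)
  show ?thesis using that[OF b c0 c 1 2 3] .
qed

abbreviation e13 :: "nat => T" where "e13 k \<equiv> gen (1, 3) ^ k"

lemma hwv_e13: "hwv (e13 k) (\<lambda>i. int k * (of_bool (i = 1) - of_bool (i = 3)))"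
proof -
  have n: "(1::3) \<noteq> 2" "(1::3) \<noteq> 3" "(2::3) \<noteq> 3" "(3::3) \<noteq> 1" "(3::3) \<noteq> 2" "(2::3) \<noteq> 1" by simp_all
  have z: "D i j (e13 k) = 0" if "D i j (gen (1, 3)) = 0" for i j
    using that by (induction k) (auto simp: D_one D_mult)
  have w: "D i i (e13 k) = sc (of_int (int k * (of_bool (i = 1) - of_bool (i = 3)))) (e13 k)" for i
  proof (induction k)
    case 0 then show ?case by (simp add: D_one)
  next
    case (Suc k)
    have g: "D i i (gen (1, 3)) = sc (of_int (of_bool (i = 1) - of_bool (i = 3))) (gen (1, 3))"
      by (auto simp: D_gen single_uminus)
    have "D i i (e13 (Suc k)) = sc (of_int (of_bool (i = 1) - of_bool (i = 3))) (gen (1, 3)) * e13 k + gen (1, 3) * sc (of_int (int k * (of_bool (i = 1) - of_bool (i = 3)))) (e13 k)"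
      by (simp only: power_Suc D_mult g Suc)
    also have "\<dots> = sc (of_int (of_bool (i = 1) - of_bool (i = 3)) + of_int (int k * (of_bool (i = 1) - of_bool (i = 3)))) (e13 (Suc k))"
      by (simp only: sc_mult_right mult.assoc power_Suc sc_add_left)
    finally show ?case by (simp only: of_int_add[symmetric]) (simp add: algebra_simps)
  qed
  show ?thesis unfolding hwv_def using w by (auto intro!: z simp: D_gen n)
qed

text \<open>The weight determines the monomial of least degree that is not killed. Subtracting the multiple of \<open>e13 k\<close>
  with the same value there leaves a vector of the same weight that kills this monomial, hence everything.\<close>

lemma hwv_unique:
  assumes h: "hwv p \<mu>" and p: "p \<notin> Jp al"
  obtains k c where "c \<noteq> 0" "p - sc c (e13 k) \<in> Jp al" "\<mu> = (\<lambda>i. int k * (of_bool (i = 1) - of_bool (i = 3)))"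
proof -
  obtain k c where k: "(0, k) \<in> idx al" "c \<noteq> 0" "act1 al p (mon al 0 k) = sc c (mon al 0 0)"
    "\<mu> 1 = int k" "\<mu> 2 = 0" "\<mu> 3 = - int k"
    using hwv_least_degree[OF h p] by blast
  have mu: "\<mu> = (\<lambda>i. int k * (of_bool (i = 1) - of_bool (i = 3)))"
  proof
    fix i :: 3 show "\<mu> i = int k * (of_bool (i = 1) - of_bool (i = 3))"
      using exhaust_3[of i] k by auto
  qed
  define q where "q = p - sc (c / ffact k k) (e13 k)"
  have "hwv q \<mu>"
    using h hwv_e13[of k] unfolding mu hwv_def q_def
    by (simp add: D_diff D_sc right_diff_distrib) (simp add: mult_single mult.commute flip: mult.assoc)
  moreover have "act1 al q (mon al 0 k) = 0"
  proof -
    note m = mon_in_S[OF k(1)]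
    have "act1 al q (mon al 0 k) = sc c (mon al 0 0) - sc (c / ffact k k) (sc (ffact k k) (mon al 0 (k - k)))"
      by (simp only: q_def act1_simps(7)[OF m] act1_sc(1)[OF m] E13_power[OF k(1)] k(3))
    then show ?thesis using ffact_nonzero[of k k] by simp
  qed
  ultimately have "q \<in> Jp al"
  proof (rule_tac ccontr)
    assume "hwv q \<mu>" "act1 al q (mon al 0 k) = 0" "q \<notin> Jp al"
    then obtain k' c' where "c' \<noteq> 0" "act1 al q (mon al 0 k') = sc c' (mon al 0 0)" "\<mu> 1 = int k'"
      using hwv_least_degree[of q \<mu> al] by blast
    then show False using k(4) \<open>act1 al q (mon al 0 k) = 0\<close> mon_nonzero[of c' al 0 0] by simp
  qed
  then show ?thesis using that[of "c / ffact k k" k] k(2) ffact_nonzero[of k k] mu by (simp add: q_def)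
qed

lemma e13_in_Jp: "e13 k \<in> Jp al \<longleftrightarrow> (\<exists>n. al = of_nat n \<and> n < k)"
proof
  assume "\<exists>n. al = of_nat n \<and> n < k"
  then obtain n where n: "al = of_nat n" "n < k" by blast
  show "e13 k \<in> Jp al"
  proof (rule Jp_monI)
    fix a b assume ab: "(a, b) \<in> idx al"
    then have "b < k" using n by (auto simp: idx_def)
    then show "act1 al (e13 k) (mon al a b) = 0" using ab by (simp add: E13_power ffact_zero)
  qed
next
  assume e: "e13 k \<in> Jp al"
  show "\<exists>n. al = of_nat n \<and> n < k"
  proof (rule ccontr)
    assume "\<not> ?thesis"
    then have i: "(0, k) \<in> idx al" by (force simp: idx_def)
    then have "act1 al (e13 k) (mon al 0 k) = 0" using e by (simp add: Jp_def)
    then show False using i ffact_nonzero[of k k] mon_nonzero by (simp add: E13_power)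
  qed
qed

section \<open>The Casimir operator\<close>

lemma D_comm: "D i j (D k l p) - D k l (D i j p) = (if j = k then D i l p else 0) - (if l = i then D k j p else 0)"
proof -
  have "p \<in> words UNIV" by simp
  then show ?thesis
  proof (induction p rule: free_induct)
    case one show ?case by (simp add: D_one)
  next
    case (gen x p)
    obtain a b where x: "x = (a, b)" by fastforce
    have g: "D i j (ad_letter k l x) - D k l (ad_letter i j x) = (if j = k then ad_letter i l x else 0) - (if l = i then ad_letter k j x else 0)"
      unfolding x by (auto simp: D_diff D_gen)
    have "D i j (D k l (Defs.gen x * p)) - D k l (D i j (Defs.gen x * p)) =
      (D i j (ad_letter k l x) - D k l (ad_letter i j x)) * p + Defs.gen x * (D i j (D k l p) - D k l (D i j p))"
      by (simp add: D_mult D_add D_gen algebra_simps)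
    then show ?case unfolding g gen by (auto simp: D_mult D_gen algebra_simps)
  next
    case (sc c p)
    have "D i j (D k l (sc c p)) - D k l (D i j (sc c p)) = sc c (D i j (D k l p) - D k l (D i j p))"
      by (simp only: D_sc right_diff_distrib)
    then show ?case unfolding sc(2) by (cases "j = k"; cases "l = i") (simp_all add: D_sc right_diff_distrib)
  next
    case (add p q)
    have "D i j (D k l (p + q)) - D k l (D i j (p + q)) = (D i j (D k l p) - D k l (D i j p)) + (D i j (D k l q) - D k l (D i j q))"
      by (simp add: D_add)
    then show ?case unfolding add by (simp add: D_add)
  qed
qed

text \<open>The quadratic Casimir operator of the adjoint action. It commutes with every \<open>D a b\<close>, so it is constant
  on a module generated by a highest weight vector.\<close>

definition casimir :: "T => T" where
  "casimir p = (\<Sum>i\<in>UNIV. \<Sum>j\<in>UNIV. D i j (D j i p))"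

lemma casimir_linear:
  "casimir (p + q) = casimir p + casimir q" "casimir (sc c p) = sc c (casimir p)" "casimir 0 = 0"
  by (simp_all only: casimir_def D_add D_sc sum.distrib sum_distrib_left D_zero sum.neutral_const)

lemma casimir_sum: "casimir (sum h F) = (\<Sum>x\<in>F. casimir (h x))"
  by (induction F rule: infinite_finite_induct) (auto simp: casimir_linear)

lemma casimir_D: "casimir (D a b p) = D a b (casimir p)"
proof -
  have 1: "D a b (D i j q) = D i j (D a b q) + ((if b = i then D a j q else 0) - (if j = a then D i b q else 0))" for i j q
    using D_comm[of a b i j q] by (simp add: algebra_simps)
  have d: "D i j (if P then x else 0) = (if P then D i j x else 0)" for i j P x by simp
  have "D a b (casimir p) = (\<Sum>i\<in>UNIV. \<Sum>j\<in>UNIV. D i j (D j i (D a b p)) +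
     (D i j (if b = j then D a i p else 0) - D i j (if i = a then D j b p else 0)) +
     ((if b = i then D a j (D j i p) else 0) - (if j = a then D i b (D j i p) else 0)))"
    unfolding casimir_def D_sum by (simp only: 1 D_add D_diff add.assoc)
  also have "\<dots> = casimir (D a b p) + (\<Sum>i\<in>UNIV. \<Sum>j\<in>UNIV. if b = j then D i j (D a i p) else 0)
    - (\<Sum>i\<in>UNIV. \<Sum>j\<in>UNIV. if i = a then D i j (D j b p) else 0)
    + (\<Sum>i\<in>UNIV. \<Sum>j\<in>UNIV. if b = i then D a j (D j i p) else 0)
    - (\<Sum>i\<in>UNIV. \<Sum>j\<in>UNIV. if j = a then D i b (D j i p) else 0)"
    by (simp only: casimir_def sum.distrib sum_subtractf d) (simp only: algebra_simps)
  also have "(\<Sum>i\<in>UNIV. \<Sum>j\<in>UNIV. if b = j then D i j (D a i p) else 0) = (\<Sum>i\<in>UNIV. D i b (D a i p))" by simp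
  also have "(\<Sum>i\<in>UNIV. \<Sum>j\<in>UNIV. if j = a then D i b (D j i p) else 0) = (\<Sum>i\<in>UNIV. D i b (D a i p))" by simp
  also have "(\<Sum>i\<in>UNIV. \<Sum>j\<in>UNIV. if i = a then D i j (D j b p) else 0) = (\<Sum>j\<in>UNIV. D a j (D j b p))"
    by (subst sum.swap) simp
  also have "(\<Sum>i\<in>UNIV. \<Sum>j\<in>UNIV. if b = i then D a j (D j i p) else 0) = (\<Sum>j\<in>UNIV. D a j (D j b p))"
    by (subst sum.swap) simp
  finally show ?thesis by simp
qed

lemma casimir_hwv:
  assumes "hwv p \<mu>"
  shows "casimir p = sc (of_int ((\<mu> 1)\<^sup>2 + (\<mu> 2)\<^sup>2 + (\<mu> 3)\<^sup>2 + 2 * \<mu> 1 - 2 * \<mu> 3)) p"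
proof -
  have h: "D 1 2 p = 0" "D 1 3 p = 0" "D 2 3 p = 0" "D i i p = sc (of_int (\<mu> i)) p" for i
    using assms by (auto simp: hwv_def)
  have 1: "D i j (D j i p) = D j i (D i j p) + (D i i p - D j j p)" for i j
    using D_comm[of i j j i p] by (simp add: algebra_simps)
  have "casimir p = D 1 1 (D 1 1 p) + D 2 2 (D 2 2 p) + D 3 3 (D 3 3 p)
     + (D 1 2 (D 2 1 p) + D 2 1 (D 1 2 p)) + (D 1 3 (D 3 1 p) + D 3 1 (D 1 3 p)) + (D 2 3 (D 3 2 p) + D 3 2 (D 2 3 p))"
    by (simp add: casimir_def sum_3 algebra_simps)
  also have "\<dots> = sc ((of_int (\<mu> 1))\<^sup>2) p + sc ((of_int (\<mu> 2))\<^sup>2) p + sc ((of_int (\<mu> 3))\<^sup>2) p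
     + (sc (of_int (\<mu> 1)) p - sc (of_int (\<mu> 2)) p) + (sc (of_int (\<mu> 1)) p - sc (of_int (\<mu> 3)) p)
     + (sc (of_int (\<mu> 2)) p - sc (of_int (\<mu> 3)) p)"
    by (simp only: 1[of 1 2] 1[of 1 3] 1[of 2 3] h D_sc D_zero add_0_left add_0_right sc_sc power2_eq_square[symmetric])
  also have "\<dots> = sc (of_int ((\<mu> 1)\<^sup>2 + (\<mu> 2)\<^sup>2 + (\<mu> 3)\<^sup>2 + 2 * \<mu> 1 - 2 * \<mu> 3)) p"
  proof -
    have "2 * x = x + x" for x :: int by simp
    then show ?thesis
      by (simp only: of_int_add of_int_diff of_int_power single_add single_diff distrib_right left_diff_distrib) (simp only: algebra_simps)
  qed
  finally show ?thesis .
qed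

text \<open>The submodule generated by \<open>E\<^sub>1\<^sub>3\<^sup>k\<close>; its image in the quotient will be \<open>L\<^sup>k\<^sup>\<theta>\<close>.\<close>

definition Mk :: "nat => T set" where
  "Mk k = \<Inter>{N. adsub N \<and> e13 k \<in> N}"

lemma Mk_adsub: "adsub (Mk k)"
  unfolding Mk_def adsub_def by blast

lemma Mk_e13: "e13 k \<in> Mk k"
  unfolding Mk_def by blast

lemma Mk_least: "adsub N ==> e13 k \<in> N ==> Mk k \<subseteq> N"
  unfolding Mk_def by blast

lemmas Mk_subsp = subspD[OF Mk_adsub[unfolded adsub_subsp, THEN conjunct1]]

lemmas Jp_subsp = subspD[OF Jp_adsub[unfolded adsub_subsp, THEN conjunct1]]

lemma Mk_D: "p \<in> Mk k ==> D i j p \<in> Mk k"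
  using Mk_adsub[of k] unfolding adsub_def by blast

lemma Jp_D: "p \<in> Jp al ==> D i j p \<in> Jp al"
  using Jp_adsub[of al] unfolding adsub_def by blast

definition cas_ev :: "nat => complex" where
  "cas_ev k = of_nat (2 * k * k + 4 * k)"

lemma cas_ev_inj: "cas_ev k = cas_ev l ==> k = l"
proof -
  assume "cas_ev k = cas_ev l"
  then have e: "2 * k * k + 4 * k = 2 * l * l + 4 * l" unfolding cas_ev_def of_nat_eq_iff .
  have m: "2 * x * x + 4 * x < 2 * y * y + 4 * y" if "x < y" for x y :: nat
    using mult_mono[of x y x y] that by simp
  show ?thesis using m[of k l] m[of l k] e by (cases k l rule: linorder_cases) auto
qed

lemma casimir_e13: "casimir (e13 k) = sc (cas_ev k) (e13 k)"
proof -
  let ?\<mu> = "\<lambda>i. int k * (of_bool (i = 1) - of_bool (i = (3::3)))"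
  have "of_int ((?\<mu> 1)\<^sup>2 + (?\<mu> 2)\<^sup>2 + (?\<mu> 3)\<^sup>2 + 2 * ?\<mu> 1 - 2 * ?\<mu> 3) = cas_ev k"
    by (simp add: cas_ev_def power2_eq_square algebra_simps)
  then show ?thesis using casimir_hwv[OF hwv_e13[of k]] by (simp only:)
qed

lemma casimir_Mk: "p \<in> Mk k ==> casimir p = sc (cas_ev k) p"
proof -
  have "adsub {p. casimir p = sc (cas_ev k) p}"
    unfolding adsub_def
  proof (intro conjI ballI allI; simp only: mem_Collect_eq casimir_linear casimir_D D_sc distrib_left mult_zero_right)
    fix p c assume "casimir p = sc (cas_ev k) p"
    then show "sc c (sc (cas_ev k) p) = sc (cas_ev k) (sc c p)" by (simp only: sc_sc mult.commute)
  qed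
  then have "Mk k \<subseteq> {p. casimir p = sc (cas_ev k) p}" by (rule Mk_least) (simp add: casimir_e13)
  then show "p \<in> Mk k ==> casimir p = sc (cas_ev k) p" by blast
qed

lemma casimir_Jp: "p \<in> Jp al ==> casimir p \<in> Jp al"
  unfolding casimir_def by (intro Jp_subsp(6) Jp_D)

text \<open>The Casimir operator has different eigenvalues on different \<open>Mk\<close>, which separates the summands.\<close>

lemma Mk_independent:
  assumes "finite F" "\<And>k. k \<in> F ==> m k \<in> Mk k" "sum m F \<in> Jp al"
  shows "\<forall>k\<in>F. m k \<in> Jp al"
  using assms
proof (induction F arbitrary: m rule: finite_induct)
  case (insert x F)
  let ?m = "\<lambda>k. sc (cas_ev k - cas_ev x) (m k)"
  have ev: "casimir (m k) = sc (cas_ev k) (m k)" if "k \<in> insert x F" for k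
    using casimir_Mk insert.prems(1) that by blast
  have "sum ?m F = casimir (sum m (insert x F)) - sc (cas_ev x) (sum m (insert x F))"
  proof -
    have "casimir (sum m (insert x F)) - sc (cas_ev x) (sum m (insert x F)) = sum ?m (insert x F)"
      by (simp only: casimir_sum sum_distrib_left sum_subtractf[symmetric] single_diff left_diff_distrib)
         (intro sum.cong refl, simp only: ev)
    also have "\<dots> = sum ?m F" using insert.hyps by simp
    finally show ?thesis by simp
  qed
  also have "\<dots> \<in> Jp al" by (rule Jp_subsp(5)[OF casimir_Jp[OF insert.prems(2)] Jp_subsp(3)[OF insert.prems(2)]])
  finally have "\<forall>k\<in>F. ?m k \<in> Jp al" using insert.IH[of ?m] insert.prems(1) Mk_subsp(3) by blast
  then have F: "m k \<in> Jp al" if k: "k \<in> F" for k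
  proof -
    have nz: "cas_ev k - cas_ev x \<noteq> 0" using k insert.hyps cas_ev_inj by auto
    have "?m k \<in> Jp al" using \<open>\<forall>k\<in>F. ?m k \<in> Jp al\<close> k by (rule bspec)
    then have "sc (1 / (cas_ev k - cas_ev x)) (?m k) \<in> Jp al" by (rule Jp_subsp(3))
    moreover have "sc (1 / (cas_ev k - cas_ev x)) (?m k) = m k" using nz by (simp only: sc_sc) simp
    ultimately show ?thesis by (simp only:)
  qed
  have "m x = sum m (insert x F) - sum m F" using insert.hyps by simp
  also have "\<dots> \<in> Jp al" by (rule Jp_subsp(5)[OF insert.prems(2) Jp_subsp(6)[OF F]])
  finally show ?case using F by blast
qed simp

text \<open>A highest weight vector outside the sum would be a multiple of some \<open>e13 k\<close>, which lies in the sum.\<close>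

lemma Mk_span: "\<exists>n m. (\<forall>k. m k \<in> Mk k) \<and> p - (\<Sum>k<n. m k) \<in> Jp al"
proof -
  define N where "N = {p. \<exists>n m. (\<forall>k. m k \<in> Mk k) \<and> p - (\<Sum>k<n. m k) \<in> Jp al}"
  have I: "p \<in> N" if "\<And>k. m k \<in> Mk k" "p - (\<Sum>k<n. m k) \<in> Jp al" for p m n
    unfolding N_def using that by blast
  have pad: "(\<Sum>k<n. m k) = (\<Sum>k<l. if k < n then m k else 0)" if "n \<le> l" for n l and m :: "nat => T"
  proof -
    have "(\<Sum>k<l. if k < n then m k else 0) = (\<Sum>k\<in>{k \<in> {..<l}. k < n}. m k)"
      by (rule sum.inter_filter[symmetric]) simp
    also have "{k \<in> {..<l}. k < n} = {..<n}" using that by auto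
    finally show ?thesis by simp
  qed
  have "adsub N"
    unfolding adsub_def
  proof (intro conjI ballI allI)
    show "0 \<in> N" by (rule I[of "\<lambda>k. 0" _ 0]) (auto simp: Mk_subsp Jp_subsp)
    fix p assume "p \<in> N"
    then obtain n m where m: "\<And>k. m k \<in> Mk k" "p - (\<Sum>k<n. m k) \<in> Jp al" unfolding N_def by blast
    show "sc c p \<in> N" for c
    proof (rule I[of "\<lambda>k. sc c (m k)" _ n])
      have "sc c p - (\<Sum>k<n. sc c (m k)) = sc c (p - (\<Sum>k<n. m k))"
        by (simp only: right_diff_distrib sum_distrib_left)
      then show "sc c p - (\<Sum>k<n. sc c (m k)) \<in> Jp al" using Jp_subsp(3)[OF m(2), of c] by (simp only:)
    qed (rule Mk_subsp(3)[OF m(1)])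
    show "D i j p \<in> N" for i j
    proof (rule I[of "\<lambda>k. D i j (m k)" _ n])
      have "D i j p - (\<Sum>k<n. D i j (m k)) = D i j (p - (\<Sum>k<n. m k))"
        by (simp only: D_diff D_sum)
      then show "D i j p - (\<Sum>k<n. D i j (m k)) \<in> Jp al" using Jp_D[OF m(2), of i j] by (simp only:)
    qed (rule Mk_D[OF m(1)])
    fix q assume "q \<in> N"
    then obtain n' m' where m': "\<And>k. m' k \<in> Mk k" "q - (\<Sum>k<n'. m' k) \<in> Jp al" unfolding N_def by blast
    show "p + q \<in> N"
    proof (rule I[of "\<lambda>k. (if k < n then m k else 0) + (if k < n' then m' k else 0)" _ "max n n'"])
      show "(if k < n then m k else 0) + (if k < n' then m' k else 0) \<in> Mk k" for k
        using m(1)[of k] m'(1)[of k] Mk_subsp(1)[of k] Mk_subsp(2)[of _ k] by auto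
      have "p + q - (\<Sum>k<max n n'. (if k < n then m k else 0) + (if k < n' then m' k else 0)) = (p - (\<Sum>k<n. m k)) + (q - (\<Sum>k<n'. m' k))"
        using pad[of n "max n n'" m] pad[of n' "max n n'" m'] by (simp add: sum.distrib)
      then show "p + q - (\<Sum>k<max n n'. (if k < n then m k else 0) + (if k < n' then m' k else 0)) \<in> Jp al"
        using Jp_subsp(2)[OF m(2) m'(2)] by (simp only:)
    qed
  qed
  moreover have eN: "e13 k \<in> N" for k
  proof (rule I[of "\<lambda>l. if l = k then e13 k else 0" _ "Suc k"])
    show "(if l = k then e13 k else 0) \<in> Mk l" for l using Mk_e13 Mk_subsp(1) by simp
  qed (simp add: Jp_subsp)
  moreover have JN: "Jp al \<subseteq> N"
  proof
    fix p assume "p \<in> Jp al"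
    then show "p \<in> N" by (intro I[of "\<lambda>k. 0" _ 0]) (auto simp: Mk_subsp)
  qed
  ultimately have "N = UNIV"
  proof (rule_tac ccontr)
    assume N: "adsub N" and "N \<noteq> UNIV"
    then obtain q where "q \<notin> N" by blast
    moreover have "adsub UNIV" by (simp add: adsub_def)
    ultimately obtain p \<mu> where p: "p \<notin> N" "D 1 2 p = 0" "D 1 3 p = 0" "D 2 3 p = 0" "\<And>i. D i i p = sc (of_int (\<mu> i)) p"
      using highest_weight_between[OF N, of UNIV q] by blast
    then have "hwv p \<mu>" unfolding hwv_def by blast
    moreover have "p \<notin> Jp al" using p JN by blast
    ultimately obtain k c where "p - sc c (e13 k) \<in> Jp al" using hwv_unique by blast
    then have "(p - sc c (e13 k)) + sc c (e13 k) \<in> N"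
      using JN subspD(2,3)[of N] N eN[of k] unfolding adsub_subsp by blast
    then show False using p by simp
  qed
  then show ?thesis unfolding N_def by blast
qed

text \<open>A submodule larger than the kernel contains a highest weight vector, a multiple of some \<open>e13 l\<close>; independence
  of the summands gives \<open>l = k\<close>, and \<open>e13 k\<close> generates everything.\<close>

lemma Mk_simple:
  assumes N: "adsub N" and JN: "Jp al \<subseteq> N" and NM: "\<And>p. p \<in> N ==> \<exists>m\<in>Mk k. p - m \<in> Jp al"
    and q: "q \<in> N" "q \<notin> Jp al"
  shows "Mk k \<subseteq> N"
proof -
  obtain p \<mu> where p: "p \<in> N" "p \<notin> Jp al" "D 1 2 p = 0" "D 1 3 p = 0" "D 2 3 p = 0" "\<And>i. D i i p = sc (of_int (\<mu> i)) p"
    using highest_weight_between[OF Jp_adsub N JN q] by blast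
  then have h: "hwv p \<mu>" unfolding hwv_def by blast
  obtain l c where l: "c \<noteq> 0" "p - sc c (e13 l) \<in> Jp al" using hwv_unique[OF h p(2)] by blast
  obtain m where m: "m \<in> Mk k" "p - m \<in> Jp al" using NM[OF p(1)] by blast
  have NS: "subsp N" using N adsub_subsp by blast
  have "p - (p - sc c (e13 l)) \<in> N" using subspD(5)[OF NS p(1)] l JN by blast
  then have cl: "sc c (e13 l) \<in> N" by simp
  then have "sc (1 / c) (sc c (e13 l)) \<in> N" by (rule subspD(3)[OF NS])
  then have eN: "e13 l \<in> N" using l(1) by (simp only: sc_sc) simp
  have "l = k"
  proof (rule ccontr)
    assume "l \<noteq> k"
    let ?m = "\<lambda>i. if i = k then - m else sc c (e13 l)"
    have "(p - m) - (p - sc c (e13 l)) \<in> Jp al" by (rule Jp_subsp(5)[OF m(2) l(2)])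
    moreover have "sum ?m {k, l} = (p - m) - (p - sc c (e13 l))" using \<open>l \<noteq> k\<close> by simp
    ultimately have "sum ?m {k, l} \<in> Jp al" by simp
    moreover have "?m i \<in> Mk i" if "i \<in> {k, l}" for i
      using that \<open>l \<noteq> k\<close> Mk_subsp(4)[OF m(1)] Mk_subsp(3)[OF Mk_e13] by auto
    ultimately have "\<forall>i\<in>{k, l}. ?m i \<in> Jp al" by (intro Mk_independent) auto
    then have "- m \<in> Jp al" by simp
    then have "(p - m) - (- m) \<in> Jp al" by (intro Jp_subsp(5) m(2))
    then show False using p(2) by simp
  qed
  then show ?thesis using Mk_least[OF N] eN by blast
qed

section \<open>The quotient algebra and its adjoint module\<close>

lemma cover_idealI:
  assumes "cover A C \<phi>" and K: "K \<subseteq> C" "0 \<in> K" "\<And>p q. p \<in> K ==> q \<in> K ==> p + q \<in> K"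
    "\<And>p q. p \<in> K ==> q \<in> C ==> q * p \<in> K" "\<And>p q. p \<in> K ==> q \<in> C ==> p * q \<in> K"
  shows "ideal (\<phi> ` K) A"
proof -
  interpret cover A C \<phi> by fact
  have neg: "- p \<in> K" if "p \<in> K" for p
    using K(4)[OF that, of "- 1"] by simp
  show ?thesis
  proof (rule idealI[OF ring_axioms])
    show "subgroup (\<phi> ` K) (add_monoid A)"
    proof (rule add.subgroupI)
      show "\<phi> ` K \<subseteq> carrier A" using K(1) by auto
      show "\<phi> ` K \<noteq> {}" using K(2) by auto
      show "\<ominus>\<^bsub>A\<^esub> a \<in> \<phi> ` K" if a: "a \<in> \<phi> ` K" for a
      proof -
        obtain p where p: "p \<in> K" "a = \<phi> p" using a by auto
        then have "\<ominus>\<^bsub>A\<^esub> a = \<phi> (- p)" using K(1) by (auto simp: map_uminus)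
        then show ?thesis using neg[OF p(1)] by simp
      qed
      show "a \<oplus>\<^bsub>A\<^esub> b \<in> \<phi> ` K" if a: "a \<in> \<phi> ` K" and b: "b \<in> \<phi> ` K" for a b
      proof -
        obtain p q where p: "p \<in> K" "a = \<phi> p" "q \<in> K" "b = \<phi> q" using a b by auto
        then have "p \<in> C" "q \<in> C" using K(1) by auto
        then have "a \<oplus>\<^bsub>A\<^esub> b = \<phi> (p + q)" using p by (simp add: map_add)
        then show ?thesis using K(3)[OF p(1,3)] by simp
      qed
    qed
    fix a x assume a: "a \<in> \<phi> ` K" and x: "x \<in> carrier A"
    obtain p q where p: "p \<in> K" "a = \<phi> p" "q \<in> C" "x = \<phi> q" using a x surj by auto
    then have "p \<in> C" using K(1) by auto
    then have "x \<otimes>\<^bsub>A\<^esub> a = \<phi> (q * p)" "a \<otimes>\<^bsub>A\<^esub> x = \<phi> (p * q)" using p by (simp_all add: map_mult)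
    then show "x \<otimes>\<^bsub>A\<^esub> a \<in> \<phi> ` K" "a \<otimes>\<^bsub>A\<^esub> x \<in> \<phi> ` K" using K(4,5)[OF p(1,3)] by auto
  qed
qed

lemma cover_idealD:
  assumes "cover A C \<phi>" and I: "ideal I A"
  shows "\<phi> 0 \<in> I" "p \<in> C ==> q \<in> C ==> \<phi> p \<in> I ==> \<phi> q \<in> I ==> \<phi> (p + q) \<in> I"
    "p \<in> C ==> q \<in> C ==> \<phi> p \<in> I ==> \<phi> (p * q) \<in> I" "p \<in> C ==> q \<in> C ==> \<phi> p \<in> I ==> \<phi> (q * p) \<in> I"
    "p \<in> C ==> \<phi> p \<in> I ==> \<phi> (sc c p) \<in> I" "p \<in> C ==> \<phi> p \<in> I ==> \<phi> (- p) \<in> I"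
proof -
  interpret cover A C \<phi> by fact
  interpret I: ideal I A by fact
  show "\<phi> 0 \<in> I" by (simp add: I.zero_closed)
  show "p \<in> C ==> q \<in> C ==> \<phi> p \<in> I ==> \<phi> q \<in> I ==> \<phi> (p + q) \<in> I" by (simp add: map_add I.a_closed)
  show "p \<in> C ==> q \<in> C ==> \<phi> p \<in> I ==> \<phi> (p * q) \<in> I" by (simp add: map_mult I.I_r_closed)
  show l: "p \<in> C ==> q \<in> C ==> \<phi> p \<in> I ==> \<phi> (q * p) \<in> I" for p q by (simp add: map_mult I.I_l_closed)
  show "p \<in> C ==> \<phi> p \<in> I ==> \<phi> (sc c p) \<in> I"
    using l[of p "sc c 1"] C_sc[OF C_one, of c] by (simp add: mult.assoc)
  show "p \<in> C ==> \<phi> p \<in> I ==> \<phi> (- p) \<in> I" using l[of p "- 1"] by simp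
qed

lemma J_eq: "J al = \<pi> ` Jp al"
proof
  show "J al \<subseteq> \<pi> ` Jp al"
  proof
    fix u assume u: "u \<in> J al"
    then have "u \<in> carrier U" by (simp add: J_def a_kernel_def')
    then obtain p where "u = \<pi> p" using P.surj by auto
    then show "u \<in> \<pi> ` Jp al" using u Jp_iff by blast
  qed
qed (auto simp: Jp_iff)

lemma J_ideal: "ideal (J al) U"
  unfolding J_eq by (rule cover_idealI[OF \<pi>_cover]) (use Jp_ideal in auto)

definition \<kappa> :: "complex => T => Uelt set" where
  "\<kappa> al p = \<AA>_class al (\<pi> p)"

lemma \<kappa>_fun: "\<kappa> al = (\<lambda>p. J al +>\<^bsub>U\<^esub> \<pi> p)"
  by (simp add: fun_eq_iff \<kappa>_def \<AA>_class_def)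

lemma \<kappa>_cover: "cover (\<AA> al) UNIV (\<kappa> al)"
  unfolding \<kappa>_fun \<AA>_def by (rule cover_quot(1)[OF \<pi>_cover J_ideal])

lemma \<kappa>_eq: "\<kappa> al p = \<kappa> al q \<longleftrightarrow> p - q \<in> Jp al"
  unfolding \<kappa>_fun Jp_iff by (rule cover_quot(2)[OF \<pi>_cover J_ideal UNIV_I UNIV_I])

lemma \<kappa>_zero: "\<kappa> al p = \<zero>\<^bsub>\<AA> al\<^esub> \<longleftrightarrow> p \<in> Jp al"
  unfolding \<kappa>_fun Jp_iff \<AA>_def by (rule cover_quot(3)[OF \<pi>_cover J_ideal UNIV_I])

definition lf :: "gl3 => T" where
  "lf x = (\<Sum>i\<in>UNIV. \<Sum>j\<in>UNIV. sc (x $ i $ j) (gen (i, j)))"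

lemma lf_linear: "lf (x + y) = lf x + lf y" "lf (gl3_scale c x) = sc c (lf x)"
  by (simp_all only: lf_def vector_add_component sc_add_left sum.distrib gl3_scale_def vec_lambda_beta sum_distrib_left sc_sc)

lemma lf_unit: "lf (matrix_unit i j) = gen (i, j)"
proof -
  have "lf (matrix_unit i j) = (\<Sum>k\<in>UNIV. if k = i then \<Sum>l\<in>UNIV. if l = j then gen (k, l) else 0 else 0)"
    unfolding lf_def matrix_unit_def vec_lambda_beta
  proof (intro sum.cong refl)
    fix k
    show "(\<Sum>l\<in>UNIV. sc (if k = i \<and> l = j then 1 else 0) (gen (k, l))) = (if k = i then \<Sum>l\<in>UNIV. if l = j then gen (k, l) else 0 else 0 :: T)"
    proof (cases "k = i")
      case True
      have "(\<Sum>l\<in>UNIV. sc (if l = j then 1 else 0) (gen (k, l))) = (\<Sum>l\<in>UNIV. if l = j then gen (k, l) else 0 :: T)"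
        by (intro sum.cong refl) auto
      then show ?thesis using True by (simp only: simp_thms if_True)
    qed simp
  qed
  then show ?thesis by simp
qed

lemma \<pi>_lf: "\<pi> (lf x) = \<iota> x"
proof (induction x rule: gl3_induct)
  case (unit i j) show ?case by (simp add: lf_unit \<pi>_gen)
next
  case (scale c x) then show ?case using iota_lie_map unfolding lf_linear P.map_sc[OF UNIV_I] by (simp add: lie_map_def)
next
  case (add x y) then show ?case using iota_lie_map unfolding lf_linear P.map_add[OF UNIV_I UNIV_I] by (simp add: lie_map_def)
qed

definition adx :: "gl3 => T => T" where
  "adx x p = lf x * p - p * lf x"

lemma adx_D: "\<pi> (adx x p) = \<pi> (\<Sum>i\<in>UNIV. \<Sum>j\<in>UNIV. sc (x $ i $ j) (D i j p))"
proof -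
  have s: "\<pi> (\<Sum>i\<in>UNIV. \<Sum>j\<in>UNIV. sc (x $ i $ j) (h i j)) = (\<Oplus>\<^bsub>U\<^esub>i\<in>UNIV. \<Oplus>\<^bsub>U\<^esub>j\<in>UNIV. x $ i $ j \<odot>\<^bsub>U\<^esub> \<pi> (h i j))" for h
    by (simp only: P.map_sum[OF UNIV_I] P.map_sc[OF UNIV_I])
  have "adx x p = (\<Sum>i\<in>UNIV. \<Sum>j\<in>UNIV. sc (x $ i $ j) (gen (i, j) * p - p * gen (i, j)))"
    unfolding adx_def lf_def sum_distrib_right sum_distrib_left sum_subtractf[symmetric]
    by (intro sum.cong refl) (simp only: right_diff_distrib sc_mult_right mult.assoc)
  then show ?thesis by (simp only: s \<pi>_D)
qed

lemma lf_bracket: "lf (gl3_bracket x y) - (lf x * lf y - lf y * lf x) \<in> Jp al"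
proof -
  have "\<pi> (lf (gl3_bracket x y)) = \<pi> (lf x * lf y - lf y * lf x)"
    using iota_lie_map by (simp add: \<pi>_lf P.map_diff P.map_mult lie_map_def)
  then show ?thesis unfolding Jp_def using act1_\<pi>[of "lf (gl3_bracket x y)" "lf x * lf y - lf y * lf x" al]
    by (simp add: act1_simps(7))
qed

lemma \<AA>_adjoint_simps:
  "carrier (\<AA>_adjoint al) = carrier (\<AA> al)" "a \<oplus>\<^bsub>\<AA>_adjoint al\<^esub> b = a \<oplus>\<^bsub>\<AA> al\<^esub> b"
  "a \<otimes>\<^bsub>\<AA>_adjoint al\<^esub> b = a \<otimes>\<^bsub>\<AA> al\<^esub> b" "c \<odot>\<^bsub>\<AA>_adjoint al\<^esub> b = c \<odot>\<^bsub>\<AA> al\<^esub> b"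
  "\<zero>\<^bsub>\<AA>_adjoint al\<^esub> = \<zero>\<^bsub>\<AA> al\<^esub>" "\<one>\<^bsub>\<AA>_adjoint al\<^esub> = \<one>\<^bsub>\<AA> al\<^esub>"
  "act (\<AA>_adjoint al) x a = \<AA>_class al (\<iota> x) \<otimes>\<^bsub>\<AA> al\<^esub> a \<ominus>\<^bsub>\<AA> al\<^esub> a \<otimes>\<^bsub>\<AA> al\<^esub> \<AA>_class al (\<iota> x)"
  by (simp_all add: \<AA>_adjoint_def with_act_def module.extend_def gmod.fields_def)

lemma \<kappa>_cover_adjoint: "cover (\<AA>_adjoint al) UNIV (\<kappa> al)"
proof -
  interpret K: cover "\<AA> al" UNIV "\<kappa> al" by (rule \<kappa>_cover)
  show ?thesis
  proof (rule coverI[OF subalg_UNIV])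
    show "\<kappa> al (sc c p) = c \<odot>\<^bsub>\<AA>_adjoint al\<^esub> \<kappa> al p" for c p
      by (simp only: \<AA>_adjoint_simps K.map_sc[OF UNIV_I])
  qed (simp_all only: \<AA>_adjoint_simps K.surj K.map_zero K.map_one K.map_add[OF UNIV_I UNIV_I] K.map_mult[OF UNIV_I UNIV_I])
qed

lemma act_\<kappa>: "act (\<AA>_adjoint al) x (\<kappa> al p) = \<kappa> al (adx x p)"
proof -
  interpret K: cover "\<AA> al" UNIV "\<kappa> al" by (rule \<kappa>_cover)
  have "\<AA>_class al (\<iota> x) = \<kappa> al (lf x)" by (simp add: \<kappa>_def \<pi>_lf)
  then show ?thesis
    by (simp only: \<AA>_adjoint_simps adx_def K.map_diff[OF UNIV_I UNIV_I] K.map_mult[OF UNIV_I UNIV_I])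
qed

lemma \<kappa>_\<pi>: "\<pi> p = \<pi> q ==> \<kappa> al p = \<kappa> al q"
  by (simp add: \<kappa>_def)

lemma act_\<kappa>_unit: "act (\<AA>_adjoint al) (matrix_unit i j) (\<kappa> al p) = \<kappa> al (D i j p)"
  unfolding act_\<kappa> by (rule \<kappa>_\<pi>) (simp add: adx_def lf_unit \<pi>_D)

lemma module_minus:
  assumes "module \<CC> M" "x \<in> carrier M" "y \<in> carrier M"
  shows "x \<ominus>\<^bsub>M\<^esub> y = x \<oplus>\<^bsub>M\<^esub> (-1) \<odot>\<^bsub>M\<^esub> y"
proof -
  interpret M: module \<CC> M by fact
  have "(-1) \<odot>\<^bsub>M\<^esub> y = \<ominus>\<^bsub>M\<^esub> y" using M.smult_l_minus[of 1 y] M.smult_one[of y] assms(3) by simp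
  then show ?thesis by (simp add: a_minus_def)
qed

lemma \<AA>_adjoint_gmodule: "gmodule (\<AA>_adjoint al)"
proof -
  interpret K: cover "\<AA>_adjoint al" UNIV "\<kappa> al" by (rule \<kappa>_cover_adjoint)
  note m = K.map_diff[OF UNIV_I UNIV_I, symmetric] K.map_add[OF UNIV_I UNIV_I, symmetric] K.map_sc[OF UNIV_I, symmetric]
  have br: "\<kappa> al (adx (gl3_bracket x y) p) = \<kappa> al (adx x (adx y p) - adx y (adx x p))" for x y p
  proof -
    let ?r = "lf (gl3_bracket x y) - (lf x * lf y - lf y * lf x)"
    have "adx (gl3_bracket x y) p - (adx x (adx y p) - adx y (adx x p)) = ?r * p - p * ?r"
      by (simp add: adx_def algebra_simps)
    also have "\<dots> \<in> Jp al" using lf_bracket Jp_ideal(4,5) Jp_subsp(5) by metis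
    finally show ?thesis by (simp only: \<kappa>_eq)
  qed
  have sc1: "adx x (sc c p) = sc c (adx x p)" for x c p
    by (simp only: adx_def right_diff_distrib sc_mult_right mult.assoc)
  have sc2: "adx (gl3_scale c x) p = sc c (adx x p)" for x c p
    by (simp only: adx_def right_diff_distrib sc_mult_right mult.assoc lf_linear)
  have mod: "module \<CC> (\<AA>_adjoint al)" by (rule K.module_axioms)
  have lin: "adx x (p + q) = adx x p + adx x q" "adx (x + y) p = adx x p + adx y p" for x y p q
    by (simp_all add: adx_def lf_linear algebra_simps)
  have cl: "\<exists>p. m = \<kappa> al p" if "m \<in> carrier (\<AA>_adjoint al)" for m using that unfolding K.surj by blast
  show ?thesis
    unfolding gmodule_def
  proof (intro conjI allI ballI mod)
    fix x y c m assume "m \<in> carrier (\<AA>_adjoint al)"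
    then obtain p where p: "m = \<kappa> al p" using cl by blast
    show "act (\<AA>_adjoint al) x m \<in> carrier (\<AA>_adjoint al)" unfolding p act_\<kappa> by simp
    show "act (\<AA>_adjoint al) x (c \<odot>\<^bsub>\<AA>_adjoint al\<^esub> m) = c \<odot>\<^bsub>\<AA>_adjoint al\<^esub> act (\<AA>_adjoint al) x m"
      "act (\<AA>_adjoint al) (gl3_scale c x) m = c \<odot>\<^bsub>\<AA>_adjoint al\<^esub> act (\<AA>_adjoint al) x m"
      "act (\<AA>_adjoint al) (x + y) m = act (\<AA>_adjoint al) x m \<oplus>\<^bsub>\<AA>_adjoint al\<^esub> act (\<AA>_adjoint al) y m"
      "act (\<AA>_adjoint al) (gl3_bracket x y) m = act (\<AA>_adjoint al) x (act (\<AA>_adjoint al) y m) \<ominus>\<^bsub>\<AA>_adjoint al\<^esub> act (\<AA>_adjoint al) y (act (\<AA>_adjoint al) x m)"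
      unfolding p act_\<kappa> m by (simp_all only: act_\<kappa> sc1 sc2 lin br)
    fix n assume "n \<in> carrier (\<AA>_adjoint al)"
    then obtain q where q: "n = \<kappa> al q" using cl by blast
    show "act (\<AA>_adjoint al) x (m \<oplus>\<^bsub>\<AA>_adjoint al\<^esub> n) = act (\<AA>_adjoint al) x m \<oplus>\<^bsub>\<AA>_adjoint al\<^esub> act (\<AA>_adjoint al) x n"
      unfolding p q act_\<kappa> m by (simp only: act_\<kappa> lin)
  qed
qed

lemma gsubmodule_iff:
  assumes "module \<CC> M"
  shows "gsubmodule N M \<longleftrightarrow> N \<subseteq> carrier M \<and> \<zero>\<^bsub>M\<^esub> \<in> N \<and> (\<forall>m\<in>N. \<forall>n\<in>N. m \<oplus>\<^bsub>M\<^esub> n \<in> N) \<and>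
    (\<forall>c. \<forall>m\<in>N. c \<odot>\<^bsub>M\<^esub> m \<in> N) \<and> (\<forall>x. \<forall>m\<in>N. act M x m \<in> N)"
proof
  interpret M: module \<CC> M by fact
  assume g: "gsubmodule N M"
  then have s: "submodule N \<CC> M" by (simp add: gsubmodule_def)
  note E = M.submoduleE[OF s]
  obtain n where n: "n \<in> N" using E(2) by blast
  have "0 \<odot>\<^bsub>M\<^esub> n \<in> N" using E(4)[of 0 n] n by simp
  then have "\<zero>\<^bsub>M\<^esub> \<in> N" using M.smult_l_null[of n] E(1) n by auto
  then show "N \<subseteq> carrier M \<and> \<zero>\<^bsub>M\<^esub> \<in> N \<and> (\<forall>m\<in>N. \<forall>n\<in>N. m \<oplus>\<^bsub>M\<^esub> n \<in> N) \<and>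
    (\<forall>c. \<forall>m\<in>N. c \<odot>\<^bsub>M\<^esub> m \<in> N) \<and> (\<forall>x. \<forall>m\<in>N. act M x m \<in> N)"
    using E(1,4,5) g by (auto simp: gsubmodule_def)
next
  interpret M: module \<CC> M by fact
  assume a: "N \<subseteq> carrier M \<and> \<zero>\<^bsub>M\<^esub> \<in> N \<and> (\<forall>m\<in>N. \<forall>n\<in>N. m \<oplus>\<^bsub>M\<^esub> n \<in> N) \<and>
    (\<forall>c. \<forall>m\<in>N. c \<odot>\<^bsub>M\<^esub> m \<in> N) \<and> (\<forall>x. \<forall>m\<in>N. act M x m \<in> N)"
  have inv: "\<ominus>\<^bsub>M\<^esub> m \<in> N" if "m \<in> N" for m
  proof -
    have "(-1) \<odot>\<^bsub>M\<^esub> m \<in> N" using a that by blast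
    moreover have "m \<in> carrier M" using a that by blast
    ultimately show ?thesis using M.smult_l_minus[of 1 m] M.smult_one[of m] by simp
  qed
  have "submodule N \<CC> M" by (rule M.submoduleI) (use a inv in auto)
  then show "gsubmodule N M" using a by (auto simp: gsubmodule_def)
qed

lemma gsubmodule_gmodule:
  assumes M: "gmodule M" and N: "gsubmodule N M"
  shows "gmodule (M\<lparr>carrier := N\<rparr>)"
    and "gsubmodule N' (M\<lparr>carrier := N\<rparr>) \<longleftrightarrow> gsubmodule N' M \<and> N' \<subseteq> N"
proof -
  have m: "module \<CC> M" using M by (simp add: gmodule_def)
  have s: "submodule N \<CC> M" using N by (simp add: gsubmodule_def)
  have m': "module \<CC> (M\<lparr>carrier := N\<rparr>)" by (rule submodule.submodule_is_module[OF s m])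
  note i = gsubmodule_iff[OF m, of N, THEN iffD1, OF N]
  have "x \<ominus>\<^bsub>M\<lparr>carrier := N\<rparr>\<^esub> y = x \<ominus>\<^bsub>M\<^esub> y" if "x \<in> N" "y \<in> N" for x y
  proof -
    have "x \<in> carrier M" "y \<in> carrier M" using that i by auto
    then show ?thesis using module_minus[OF m', of x y] module_minus[OF m, of x y] that by simp
  qed
  then show "gmodule (M\<lparr>carrier := N\<rparr>)"
    using M m' i unfolding gmodule_def by (simp add: subset_eq)
  show "gsubmodule N' (M\<lparr>carrier := N\<rparr>) \<longleftrightarrow> gsubmodule N' M \<and> N' \<subseteq> N"
    unfolding gsubmodule_iff[OF m] gsubmodule_iff[OF m'] using i by auto
qed

lemma adsub_image:
  assumes "adsub N"
  shows "gsubmodule (\<kappa> al ` N) (\<AA>_adjoint al)"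
proof -
  interpret K: cover "\<AA>_adjoint al" UNIV "\<kappa> al" by (rule \<kappa>_cover_adjoint)
  have S: "subsp N" and DN: "\<And>i j p. p \<in> N ==> D i j p \<in> N" using assms by (auto simp: adsub_def subsp_def)
  note NS = subspD[OF S]
  have "\<kappa> al (adx x p) \<in> \<kappa> al ` N" if "p \<in> N" for x p
    unfolding \<kappa>_\<pi>[OF adx_D, of al] using that by (intro imageI NS(6) NS(3) DN)
  moreover have "\<kappa> al p \<oplus>\<^bsub>\<AA>_adjoint al\<^esub> \<kappa> al q \<in> \<kappa> al ` N" if "p \<in> N" "q \<in> N" for p q
    using NS(2)[OF that] by (simp add: K.map_add[OF UNIV_I UNIV_I, symmetric])
  moreover have "c \<odot>\<^bsub>\<AA>_adjoint al\<^esub> \<kappa> al p \<in> \<kappa> al ` N" if "p \<in> N" for p c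
    using NS(3)[OF that] by (simp add: K.map_sc[OF UNIV_I, symmetric])
  moreover have "\<zero>\<^bsub>\<AA>_adjoint al\<^esub> \<in> \<kappa> al ` N"
    unfolding K.map_zero[symmetric] using NS(1) by (rule imageI)
  moreover have "\<kappa> al ` N \<subseteq> carrier (\<AA>_adjoint al)" unfolding K.surj by blast
  ultimately show ?thesis
    unfolding gsubmodule_iff[OF K.module_axioms] by (auto simp: act_\<kappa>)
qed

lemma adsub_preimage:
  assumes "gsubmodule N (\<AA>_adjoint al)"
  shows "adsub {p. \<kappa> al p \<in> N}" "Jp al \<subseteq> {p. \<kappa> al p \<in> N}"
proof -
  interpret K: cover "\<AA>_adjoint al" UNIV "\<kappa> al" by (rule \<kappa>_cover_adjoint)
  note i = gsubmodule_iff[OF K.module_axioms, of N, THEN iffD1, OF assms]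
  show "adsub {p. \<kappa> al p \<in> N}"
    unfolding adsub_def mem_Collect_eq
    using i by (auto simp: K.map_zero K.map_add[OF UNIV_I UNIV_I] K.map_sc[OF UNIV_I] simp flip: act_\<kappa>_unit)
  have "\<kappa> al p = \<zero>\<^bsub>\<AA>_adjoint al\<^esub>" if "p \<in> Jp al" for p using that by (simp add: \<kappa>_zero \<AA>_adjoint_simps)
  then show "Jp al \<subseteq> {p. \<kappa> al p \<in> N}" using i by auto
qed

lemma finite_spanning_set:
  fixes K :: "('k::monoid_add \<Rightarrow>\<^sub>0 complex) set"
  assumes "finite F" "subsp K" "\<And>p. p \<in> K ==> keys p \<subseteq> F"
  shows "\<exists>B. finite B \<and> B \<subseteq> K \<and> (\<forall>p\<in>K. \<exists>c. p = (\<Sum>b\<in>B. sc (c b) b))"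
  using assms
proof (induction F arbitrary: K rule: finite_induct)
  case empty
  then have z: "p = 0" if "p \<in> K" for p using that by (metis keys_eq_empty subset_empty)
  then show ?case by (intro exI[of _ "{}"]) auto
next
  case (insert w F)
  define K' where "K' = {p \<in> K. lookup p w = 0}"
  note K = subspD[OF insert.prems(1)]
  have K': "subsp K'" using K unfolding subsp_def K'_def by (auto simp: lookup_add)
  have kF: "keys p \<subseteq> F" if "p \<in> K'" for p
    using that insert.prems(2)[of p] by (auto simp: K'_def in_keys_iff)
  obtain B where B: "finite B" "B \<subseteq> K'" "\<And>p. p \<in> K' ==> \<exists>c. p = (\<Sum>b\<in>B. sc (c b) b)"
    using insert.IH[OF K' kF] by blast
  show ?case
  proof (cases "K' = K")
    case True then show ?thesis using B by blast
  next
    case False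
    then obtain e where e: "e \<in> K" "lookup e w \<noteq> 0" by (auto simp: K'_def)
    have eB: "e \<notin> B" using e B(2) by (auto simp: K'_def)
    have "\<exists>c. p = (\<Sum>b\<in>insert e B. sc (c b) b)" if p: "p \<in> K" for p
    proof -
      define d where "d = lookup p w / lookup e w"
      have "p - sc d e \<in> K'"
        using p e K(5)[OF p K(3)[OF e(1)]] unfolding K'_def by (simp add: lookup_minus d_def)
      then obtain c where c: "p - sc d e = (\<Sum>b\<in>B. sc (c b) b)" using B(3) by blast
      have "(\<Sum>b\<in>B. sc ((c(e := d)) b) b) = (\<Sum>b\<in>B. sc (c b) b)"
        using eB by (intro sum.cong) auto
      then have "(\<Sum>b\<in>insert e B. sc ((c(e := d)) b) b) = sc d e + (p - sc d e)"
        using eB B(1) c by simp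
      then have "p = (\<Sum>b\<in>insert e B. sc ((c(e := d)) b) b)" by simp
      then show ?thesis by blast
    qed
    moreover have "insert e B \<subseteq> K" using e B(2) by (auto simp: K'_def)
    ultimately show ?thesis using B(1) by (intro exI[of _ "insert e B"]) auto
  qed
qed

definition Lk :: "complex => nat => Uelt set gmod" where
  "Lk al k = (\<AA>_adjoint al)\<lparr>carrier := \<kappa> al ` Mk k\<rparr>"

lemma Mk_bounded: "Mk k \<subseteq> bounded_words k"
proof (rule Mk_least[OF bounded_words_adsub])
  have "e13 k = single (replicate k (1, 3)) 1"
    by (induction k) (simp_all add: single_Cons single_Nil)
  then show "e13 k \<in> bounded_words k" by (simp add: bounded_words_def)
qed

lemma Lk_simps: "carrier (Lk al k) = \<kappa> al ` Mk k" "a \<oplus>\<^bsub>Lk al k\<^esub> b = a \<oplus>\<^bsub>\<AA> al\<^esub> b" "c \<odot>\<^bsub>Lk al k\<^esub> b = c \<odot>\<^bsub>\<AA> al\<^esub> b"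
  "\<zero>\<^bsub>Lk al k\<^esub> = \<zero>\<^bsub>\<AA> al\<^esub>" "act (Lk al k) = act (\<AA>_adjoint al)"
  by (simp_all add: Lk_def \<AA>_adjoint_simps fun_eq_iff)

lemma Lk_gmodule: "gmodule (Lk al k)"
  and Lk_gsubmodule: "gsubmodule N (Lk al k) \<longleftrightarrow> gsubmodule N (\<AA>_adjoint al) \<and> N \<subseteq> \<kappa> al ` Mk k"
  unfolding Lk_def by (rule gsubmodule_gmodule[OF \<AA>_adjoint_gmodule adsub_image[OF Mk_adsub]])+

lemma Lk_finite_dim: "finite_dim (Lk al k)"
proof -
  interpret K: cover "\<AA>_adjoint al" UNIV "\<kappa> al" by (rule \<kappa>_cover_adjoint)
  interpret L: module \<CC> "Lk al k" using Lk_gmodule by (simp add: gmodule_def)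
  obtain B where B: "finite B" "B \<subseteq> Mk k" "\<And>p. p \<in> Mk k ==> \<exists>c. p = (\<Sum>b\<in>B. sc (c b) b)"
  proof -
    have "\<exists>B. finite B \<and> B \<subseteq> Mk k \<and> (\<forall>p\<in>Mk k. \<exists>c. p = (\<Sum>b\<in>B. sc (c b) b))"
      by (rule finite_spanning_set[OF finite_word_set[of k]])
         (use Mk_adsub[of k] Mk_bounded[of k] in \<open>auto simp: adsub_subsp bounded_words_def\<close>)
    then show ?thesis using that by blast
  qed
  have fs: "(\<Oplus>\<^bsub>Lk al k\<^esub>b\<in>F. c b \<odot>\<^bsub>Lk al k\<^esub> b) = (\<Oplus>\<^bsub>\<AA>_adjoint al\<^esub>b\<in>F. c b \<odot>\<^bsub>\<AA>_adjoint al\<^esub> b)"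
    if "finite F" "F \<subseteq> \<kappa> al ` Mk k" for F c
    using that
  proof (induction F rule: finite_induct)
    case empty then show ?case by (simp add: Lk_simps \<AA>_adjoint_simps)
  next
    case (insert x F)
    have 1: "c b \<odot>\<^bsub>Lk al k\<^esub> b \<in> carrier (Lk al k)" if "b \<in> insert x F" for b
      using that insert(4) L.smult_closed[of "c b" b] by (auto simp: Lk_simps(1))
    have 2: "c b \<odot>\<^bsub>\<AA>_adjoint al\<^esub> b \<in> carrier (\<AA>_adjoint al)" if "b \<in> insert x F" for b
      using that insert(4) by auto
    have "(\<Oplus>\<^bsub>Lk al k\<^esub>b\<in>insert x F. c b \<odot>\<^bsub>Lk al k\<^esub> b) = c x \<odot>\<^bsub>Lk al k\<^esub> x \<oplus>\<^bsub>Lk al k\<^esub> (\<Oplus>\<^bsub>Lk al k\<^esub>b\<in>F. c b \<odot>\<^bsub>Lk al k\<^esub> b)"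
      by (rule L.M.finsum_insert) (use insert 1 in auto)
    moreover have "(\<Oplus>\<^bsub>\<AA>_adjoint al\<^esub>b\<in>insert x F. c b \<odot>\<^bsub>\<AA>_adjoint al\<^esub> b) = c x \<odot>\<^bsub>\<AA>_adjoint al\<^esub> x \<oplus>\<^bsub>\<AA>_adjoint al\<^esub> (\<Oplus>\<^bsub>\<AA>_adjoint al\<^esub>b\<in>F. c b \<odot>\<^bsub>\<AA>_adjoint al\<^esub> b)"
      by (rule K.finsum_insert) (use insert 2 in auto)
    moreover have "(\<Oplus>\<^bsub>Lk al k\<^esub>b\<in>F. c b \<odot>\<^bsub>Lk al k\<^esub> b) = (\<Oplus>\<^bsub>\<AA>_adjoint al\<^esub>b\<in>F. c b \<odot>\<^bsub>\<AA>_adjoint al\<^esub> b)"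
      using insert by blast
    ultimately show ?case by (simp only: Lk_simps \<AA>_adjoint_simps)
  qed
  have "carrier (Lk al k) = lin_span (Lk al k) (\<kappa> al ` B)"
  proof
    show "lin_span (Lk al k) (\<kappa> al ` B) \<subseteq> carrier (Lk al k)"
    proof
      fix x assume "x \<in> lin_span (Lk al k) (\<kappa> al ` B)"
      then obtain F c where F: "finite F" "F \<subseteq> \<kappa> al ` B" "x = (\<Oplus>\<^bsub>Lk al k\<^esub>b\<in>F. c b \<odot>\<^bsub>Lk al k\<^esub> b)"
        unfolding lin_span_def by blast
      have "F \<subseteq> carrier (Lk al k)" using F(2) B(2) by (auto simp: Lk_simps)
      then show "x \<in> carrier (Lk al k)" unfolding F(3)
        by (intro L.M.finsum_closed) (auto intro!: L.smult_closed)
    qed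
    show "carrier (Lk al k) \<subseteq> lin_span (Lk al k) (\<kappa> al ` B)"
    proof
      fix x assume "x \<in> carrier (Lk al k)"
      then obtain p where p: "p \<in> Mk k" "x = \<kappa> al p" by (auto simp: Lk_simps)
      obtain c where c: "p = (\<Sum>b\<in>B. sc (c b) b)" using B(3) p by blast
      define r where "r = inv_into B (\<kappa> al)"
      have r: "\<kappa> al (r y) = y" if "y \<in> \<kappa> al ` B" for y using that by (simp add: r_def f_inv_into_f)
      have "\<kappa> al p = (\<Oplus>\<^bsub>\<AA>_adjoint al\<^esub>b\<in>B. c b \<odot>\<^bsub>\<AA>_adjoint al\<^esub> \<kappa> al b)"
        unfolding c by (simp only: K.map_sum[OF UNIV_I] K.map_sc[OF UNIV_I])
      also have "\<dots> = (\<Oplus>\<^bsub>\<AA>_adjoint al\<^esub>b\<in>B. c b \<odot>\<^bsub>\<AA>_adjoint al\<^esub> \<kappa> al (r (\<kappa> al b)))"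
        by (intro K.finsum_cong') (auto simp: r)
      also have "\<dots> = \<kappa> al (\<Sum>b\<in>B. sc (c b) (r (\<kappa> al b)))"
        by (simp only: K.map_sum[OF UNIV_I] K.map_sc[OF UNIV_I])
      also have "(\<Sum>b\<in>B. sc (c b) (r (\<kappa> al b))) = (\<Sum>y\<in>\<kappa> al ` B. \<Sum>b | b \<in> B \<and> \<kappa> al b = y. sc (c b) (r (\<kappa> al b)))"
        by (rule sum.image_gen[OF B(1)])
      also have "\<dots> = (\<Sum>y\<in>\<kappa> al ` B. sc (\<Sum>b | b \<in> B \<and> \<kappa> al b = y. c b) (r y))"
      proof (intro sum.cong refl)
        fix y
        have "sc (\<Sum>b\<in>G. c b) q = (\<Sum>b\<in>G. sc (c b) q)" if "finite G" for G and q :: T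
          using that by (induction G) (auto simp: sc_add_left)
        then show "(\<Sum>b | b \<in> B \<and> \<kappa> al b = y. sc (c b) (r (\<kappa> al b))) = sc (\<Sum>b | b \<in> B \<and> \<kappa> al b = y. c b) (r y)"
          using B(1) by simp
      qed
      also have "\<kappa> al \<dots> = (\<Oplus>\<^bsub>\<AA>_adjoint al\<^esub>y\<in>\<kappa> al ` B. (\<Sum>b | b \<in> B \<and> \<kappa> al b = y. c b) \<odot>\<^bsub>\<AA>_adjoint al\<^esub> \<kappa> al (r y))"
        by (simp only: K.map_sum[OF UNIV_I] K.map_sc[OF UNIV_I])
      also have "\<dots> = (\<Oplus>\<^bsub>\<AA>_adjoint al\<^esub>y\<in>\<kappa> al ` B. (\<Sum>b | b \<in> B \<and> \<kappa> al b = y. c b) \<odot>\<^bsub>\<AA>_adjoint al\<^esub> y)"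
        by (intro K.finsum_cong') (auto simp: r)
      also have "\<dots> = (\<Oplus>\<^bsub>Lk al k\<^esub>y\<in>\<kappa> al ` B. (\<Sum>b | b \<in> B \<and> \<kappa> al b = y. c b) \<odot>\<^bsub>Lk al k\<^esub> y)"
        using B by (intro fs[symmetric]) auto
      finally show "x \<in> lin_span (Lk al k) (\<kappa> al ` B)"
        unfolding lin_span_def p(2) mem_Collect_eq using B(1)
        by (intro exI[of _ "\<kappa> al ` B"] exI[of _ "\<lambda>y. \<Sum>b | b \<in> B \<and> \<kappa> al b = y. c b"] conjI) simp_all
    qed
  qed
  moreover have "\<kappa> al ` B \<subseteq> carrier (Lk al k)" using B(2) by (auto simp: Lk_simps)
  ultimately show ?thesis unfolding finite_dim_def using B(1) by blast
qed

lemma Lk_is_L_theta: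
  assumes "e13 k \<notin> Jp al"
  shows "is_L_theta k (Lk al k)"
proof -
  interpret K: cover "\<AA>_adjoint al" UNIV "\<kappa> al" by (rule \<kappa>_cover_adjoint)
  have z: "\<kappa> al p = \<zero>\<^bsub>Lk al k\<^esub> \<longleftrightarrow> p \<in> Jp al" for p by (simp add: Lk_simps \<kappa>_zero)
  have top: "N = carrier (Lk al k)" if N: "gsubmodule N (Lk al k)" and M: "Mk k \<subseteq> {p. \<kappa> al p \<in> N}" for N
    using N M unfolding Lk_gsubmodule Lk_simps by blast
  have irr: "N = {\<zero>\<^bsub>Lk al k\<^esub>} \<or> N = carrier (Lk al k)" if N: "gsubmodule N (Lk al k)" for N
  proof (cases "{p. \<kappa> al p \<in> N} \<subseteq> Jp al")
    case True
    have "N \<subseteq> \<kappa> al ` Mk k" "gsubmodule N (\<AA>_adjoint al)" using N unfolding Lk_gsubmodule by auto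
    then have "N \<subseteq> {\<zero>\<^bsub>Lk al k\<^esub>}" "\<zero>\<^bsub>Lk al k\<^esub> \<in> N"
      using True z gsubmodule_iff[OF K.module_axioms, of N] by (auto simp: Lk_simps \<AA>_adjoint_simps)
    then show ?thesis by blast
  next
    case False
    then obtain q where q: "q \<in> {p. \<kappa> al p \<in> N}" "q \<notin> Jp al" by blast
    have N': "gsubmodule N (\<AA>_adjoint al)" "N \<subseteq> \<kappa> al ` Mk k" using N unfolding Lk_gsubmodule by auto
    have "Mk k \<subseteq> {p. \<kappa> al p \<in> N}"
    proof (rule Mk_simple[OF adsub_preimage[OF N'(1)] _ q])
      fix p assume "p \<in> {p. \<kappa> al p \<in> N}"
      then obtain m where "m \<in> Mk k" "\<kappa> al p = \<kappa> al m" using N'(2) by blast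
      then show "\<exists>m\<in>Mk k. p - m \<in> Jp al" unfolding \<kappa>_eq by blast
    qed
    then show ?thesis using top[OF N] by blast
  qed
  have v: "\<kappa> al (e13 k) \<in> carrier (Lk al k)" "\<kappa> al (e13 k) \<noteq> \<zero>\<^bsub>Lk al k\<^esub>"
    using assms Mk_e13 z by (auto simp: Lk_simps(1))
  have "irreducible_gmod (Lk al k)"
    unfolding irreducible_gmod_def using Lk_gmodule irr v by blast
  moreover have "highest_weight_vector (Lk al k) (of_nat k *s \<theta>) (\<kappa> al (e13 k))"
  proof -
    note h = hwv_e13[of k, unfolded hwv_def]
    have "act (Lk al k) (matrix_unit i i) (\<kappa> al (e13 k)) = ((of_nat k *s \<theta>) $ i) \<odot>\<^bsub>Lk al k\<^esub> \<kappa> al (e13 k)" for i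
    proof -
      have "(of_nat k *s \<theta>) $ i = of_int (int k * (of_bool (i = 1) - of_bool (i = 3)))"
        using exhaust_3[of i] by (auto simp: \<theta>_def vector_3)
      moreover have "act (Lk al k) (matrix_unit i i) (\<kappa> al (e13 k)) = \<kappa> al (sc (of_int (int k * (of_bool (i = 1) - of_bool (i = 3)))) (e13 k))"
        using h unfolding Lk_simps act_\<kappa>_unit by (simp only:)
      moreover have "\<kappa> al (sc c p) = c \<odot>\<^bsub>Lk al k\<^esub> \<kappa> al p" for c p
        unfolding K.map_sc[OF UNIV_I] by (simp add: Lk_simps \<AA>_adjoint_simps)
      ultimately show ?thesis by (simp only:)
    qed
    then show ?thesis unfolding highest_weight_vector_def
      using v h z[of 0] Jp_ideal(1) by (auto simp: Lk_simps(5) act_\<kappa>_unit)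
  qed
  then have "highest_weight_module (of_nat k *s \<theta>) (Lk al k)"
    unfolding highest_weight_module_def
  proof (intro conjI Lk_gmodule exI allI impI)
    fix N assume N: "gsubmodule N (Lk al k) \<and> \<kappa> al (e13 k) \<in> N"
    then have "Mk k \<subseteq> {p. \<kappa> al p \<in> N}" unfolding Lk_gsubmodule by (intro Mk_least adsub_preimage) auto
    then show "N = carrier (Lk al k)" using top N by blast
  qed
  ultimately show ?thesis unfolding is_L_theta_def using Lk_finite_dim by blast
qed

section \<open>Decomposition of the adjoint module\<close>

definition decomp :: "complex => nat set => T => (nat => T) => bool" where
  "decomp al K p m \<longleftrightarrow> (\<forall>k. m k \<in> Mk k) \<and> finite {k. m k \<noteq> 0} \<and> (\<forall>k. k \<notin> K --> m k = 0)
     \<and> p - (\<Sum>k | m k \<noteq> 0. m k) \<in> Jp al"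

lemma decomp_superset:
  assumes "finite F" "{k. m k \<noteq> 0} \<subseteq> F"
  shows "(\<Sum>k | m k \<noteq> 0. m k) = sum m F"
  using assms by (intro sum.mono_neutral_left) auto

lemma decompI:
  assumes "\<And>k. m k \<in> Mk k" "finite F" "{k. m k \<noteq> 0} \<subseteq> F" "\<And>k. k \<notin> K ==> m k = 0" "p - sum m F \<in> Jp al"
  shows "decomp al K p m"
  using assms decomp_superset[OF assms(2,3)] finite_subset[OF assms(3,2)] unfolding decomp_def by simp

lemma decomp_exists:
  assumes K: "\<And>k. k \<notin> K ==> e13 k \<in> Jp al"
  shows "\<exists>m. decomp al K p m"
proof -
  obtain n m where m: "\<And>k. m k \<in> Mk k" "p - (\<Sum>k<n. m k) \<in> Jp al" using Mk_span[of p al] by blast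
  define m' where "m' k = (if k \<in> K \<and> k < n then m k else 0)" for k
  have z: "m k \<in> Jp al" if "k \<notin> K" for k
    using m(1)[of k] Mk_least[OF Jp_adsub K[OF that]] by blast
  have "(p - (\<Sum>k<n. m k)) + (\<Sum>k<n. m k - m' k) \<in> Jp al"
    by (intro Jp_subsp(2)[OF m(2)] Jp_subsp(6)) (auto simp: m'_def z Jp_subsp(1))
  then have "p - sum m' {..<n} \<in> Jp al" by (simp add: sum_subtractf)
  then have "decomp al K p m'"
    by (intro decompI[where F = "{..<n}"]) (auto simp: m'_def m(1) Mk_subsp(1))
  then show ?thesis by blast
qed

lemma decomp_lin:
  assumes "decomp al K p m" "decomp al K q l"
  shows "decomp al K (p + q) (\<lambda>k. m k + l k)" "decomp al K (sc c p) (\<lambda>k. sc c (m k))"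
    "decomp al K (D i j p) (\<lambda>k. D i j (m k))" "decomp al K (p - q) (\<lambda>k. m k - l k)"
proof -
  let ?F = "{k. m k \<noteq> 0} \<union> {k. l k \<noteq> 0}"
  have m: "\<And>k. m k \<in> Mk k" "finite ?F" "\<And>k. k \<notin> K ==> m k = 0" "p - sum m ?F \<in> Jp al"
    and l: "\<And>k. l k \<in> Mk k" "\<And>k. k \<notin> K ==> l k = 0" "q - sum l ?F \<in> Jp al"
    using assms decomp_superset[of ?F m] decomp_superset[of ?F l] unfolding decomp_def by auto
  show "decomp al K (p + q) (\<lambda>k. m k + l k)"
  proof (rule decompI[OF _ m(2)])
    have "p + q - (\<Sum>k\<in>?F. m k + l k) = (p - sum m ?F) + (q - sum l ?F)" by (simp add: sum.distrib)
    then show "p + q - (\<Sum>k\<in>?F. m k + l k) \<in> Jp al" using Jp_subsp(2)[OF m(4) l(3)] by (simp only:)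
  qed (use m l Mk_subsp(2) in auto)
  show "decomp al K (p - q) (\<lambda>k. m k - l k)"
  proof (rule decompI[OF _ m(2)])
    have "p - q - (\<Sum>k\<in>?F. m k - l k) = (p - sum m ?F) - (q - sum l ?F)" by (simp add: sum_subtractf)
    then show "p - q - (\<Sum>k\<in>?F. m k - l k) \<in> Jp al" using Jp_subsp(5)[OF m(4) l(3)] by (simp only:)
  qed (use m l Mk_subsp(5) in auto)
  show "decomp al K (sc c p) (\<lambda>k. sc c (m k))"
  proof (rule decompI[OF _ m(2)])
    have "sc c p - (\<Sum>k\<in>?F. sc c (m k)) = sc c (p - sum m ?F)" by (simp only: right_diff_distrib sum_distrib_left)
    then show "sc c p - (\<Sum>k\<in>?F. sc c (m k)) \<in> Jp al" using Jp_subsp(3)[OF m(4), of c] by (simp only:)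
  qed (use m Mk_subsp(3) in auto)
  show "decomp al K (D i j p) (\<lambda>k. D i j (m k))"
  proof (rule decompI[OF _ m(2)])
    have "D i j p - (\<Sum>k\<in>?F. D i j (m k)) = D i j (p - sum m ?F)" by (simp only: D_diff D_sum)
    then show "D i j p - (\<Sum>k\<in>?F. D i j (m k)) \<in> Jp al" using Jp_D[OF m(4), of i j] by (simp only:)
  qed (use m Mk_D in auto)
qed

lemma decomp_Jp:
  assumes "decomp al K p m" 
  shows "p \<in> Jp al \<longleftrightarrow> (\<forall>k. m k \<in> Jp al)"
proof
  let ?F = "{k. m k \<noteq> 0}"
  have m: "\<And>k. m k \<in> Mk k" "finite ?F" "p - sum m ?F \<in> Jp al" using assms unfolding decomp_def by auto
  show "\<forall>k. m k \<in> Jp al" if p: "p \<in> Jp al"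
  proof
    have "p - (p - sum m ?F) \<in> Jp al" by (rule Jp_subsp(5)[OF p m(3)])
    then have "sum m ?F \<in> Jp al" by simp
    then have "\<forall>k\<in>?F. m k \<in> Jp al" using m by (intro Mk_independent) auto
    then show "m k \<in> Jp al" for k using Jp_subsp(1) by (cases "m k = 0") auto
  qed
  assume a: "\<forall>k. m k \<in> Jp al"
  have "(p - sum m ?F) + sum m ?F \<in> Jp al" by (rule Jp_subsp(2)[OF m(3) Jp_subsp(6)]) (use a in blast)
  then show "p \<in> Jp al" by simp
qed

lemma decomp_\<kappa>:
  assumes "decomp al K p m" "decomp al K q l"
  shows "\<kappa> al p = \<kappa> al q \<longleftrightarrow> (\<forall>k. \<kappa> al (m k) = \<kappa> al (l k))"
  unfolding \<kappa>_eq by (rule decomp_Jp[OF decomp_lin(4)[OF assms]])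

theorem \<AA>_adjoint_decomposition:
  assumes K: "\<And>k. k \<notin> K ==> e13 k \<in> Jp al"
  shows "gmod_iso (\<AA>_adjoint al) (gmod_sum K (Lk al)) \<noteq> {}"
proof -
  interpret C: cover "\<AA>_adjoint al" UNIV "\<kappa> al" by (rule \<kappa>_cover_adjoint)
  define cmp where "cmp a = (SOME (p, m). \<kappa> al p = a \<and> decomp al K p m)" for a
  have cmp: "\<exists>p m. cmp (\<kappa> al q) = (p, m) \<and> \<kappa> al p = \<kappa> al q \<and> decomp al K p m" for q
  proof -
    obtain m where "decomp al K q m" using decomp_exists[of K al q] K by blast
    then have "\<exists>x. case x of (p, m) => \<kappa> al p = \<kappa> al q \<and> decomp al K p m" by (intro exI[of _ "(q, m)"]) simp
    then have "case cmp (\<kappa> al q) of (p, m) => \<kappa> al p = \<kappa> al q \<and> decomp al K p m"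
      unfolding cmp_def by (rule someI_ex)
    then show ?thesis by (auto split: prod.splits)
  qed
  define f where "f a = (\<lambda>k\<in>K. \<kappa> al (snd (cmp a) k))" for a
  have f: "f (\<kappa> al p) = (\<lambda>k\<in>K. \<kappa> al (m k))" if d: "decomp al K p m" for p m
  proof -
    obtain p' m' where m': "cmp (\<kappa> al p) = (p', m')" "\<kappa> al p' = \<kappa> al p" "decomp al K p' m'" using cmp by blast
    then have "\<kappa> al (m' k) = \<kappa> al (m k)" for k using decomp_\<kappa>[OF m'(3) d] by blast
    then show ?thesis by (simp add: f_def m'(1))
  qed
  have cl: "\<exists>p m. a = \<kappa> al p \<and> decomp al K p m" if "a \<in> carrier (\<AA>_adjoint al)" for a
    using that K decomp_exists[of K al] unfolding C.surj by blast
  have z: "\<zero>\<^bsub>Lk al k\<^esub> = \<kappa> al 0" for k using C.map_zero by (simp add: Lk_simps \<AA>_adjoint_simps)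
  have Lop: "\<kappa> al p \<oplus>\<^bsub>Lk al k\<^esub> \<kappa> al q = \<kappa> al (p + q)" "c \<odot>\<^bsub>Lk al k\<^esub> \<kappa> al p = \<kappa> al (sc c p)" for p q c k
    unfolding C.map_add[OF UNIV_I UNIV_I] C.map_sc[OF UNIV_I] by (simp_all add: Lk_simps \<AA>_adjoint_simps)
  have "f \<in> gmod_iso (\<AA>_adjoint al) (gmod_sum K (Lk al))"
    unfolding gmod_iso_def mem_Collect_eq
  proof (intro conjI allI ballI)
    fix a assume "a \<in> carrier (\<AA>_adjoint al)"
    then obtain p m where a: "a = \<kappa> al p" and p: "decomp al K p m" using cl by blast
    have "f (\<kappa> al (sc c p)) = (\<lambda>k\<in>K. c \<odot>\<^bsub>Lk al k\<^esub> f (\<kappa> al p) k)" for c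
      unfolding f[OF decomp_lin(2)[OF p p]] f[OF p] by (simp add: Lop fun_eq_iff)
    then show "f (c \<odot>\<^bsub>\<AA>_adjoint al\<^esub> a) = c \<odot>\<^bsub>gmod_sum K (Lk al)\<^esub> f a" for c
      unfolding a C.map_sc[OF UNIV_I, symmetric] by (simp add: gmod_sum_def)
    show "f (act (\<AA>_adjoint al) x a) = act (gmod_sum K (Lk al)) x (f a)" for x
    proof -
      have "\<exists>l. decomp al K (\<Sum>i\<in>F. h i) l \<and> (\<forall>k. l k = (\<Sum>i\<in>F. g i k))"
        if "\<And>i. decomp al K (h i) (g i)" for F :: "3 set" and h g
      proof (induction F rule: infinite_finite_induct)
        case (insert i F)
        then obtain l where l: "decomp al K (\<Sum>i\<in>F. h i) l" "\<And>k. l k = (\<Sum>i\<in>F. g i k)" by blast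
        show ?case using decomp_lin(1)[OF that[of i] l(1)] insert(1,2) l(2)
          by (intro exI[of _ "\<lambda>k. g i k + l k"]) simp
      qed (auto intro!: exI[of _ "\<lambda>k. 0"] decompI[where F = "{}"] simp: Mk_subsp(1) Jp_subsp(1))
      then have ds: "decomp al K (\<Sum>i\<in>F. h i) (\<lambda>k. \<Sum>i\<in>F. g i k)"
        if "\<And>i. decomp al K (h i) (g i)" for F :: "3 set" and h g
        using that by (metis (no_types, lifting) ext)
      let ?e = "\<lambda>p. \<Sum>i\<in>UNIV. \<Sum>j\<in>UNIV. sc (x $ i $ j) (D i j p)"
      have "decomp al K (?e p) (\<lambda>k. ?e (m k))"
        by (intro ds decomp_lin(2)[OF decomp_lin(3)[OF p p] p])
      then have "f (\<kappa> al (?e p)) = (\<lambda>k\<in>K. \<kappa> al (?e (m k)))" by (rule f)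
      then show ?thesis
        unfolding a act_\<kappa> \<kappa>_\<pi>[OF adx_D, of al] f[OF p] by (simp add: gmod_sum_def Lk_simps act_\<kappa> \<kappa>_\<pi>[OF adx_D, of al] fun_eq_iff)
    qed
    fix b assume "b \<in> carrier (\<AA>_adjoint al)"
    then obtain q l where b: "b = \<kappa> al q" and q: "decomp al K q l" using cl by blast
    have "f (\<kappa> al (p + q)) = (\<lambda>k\<in>K. f (\<kappa> al p) k \<oplus>\<^bsub>Lk al k\<^esub> f (\<kappa> al q) k)"
      unfolding f[OF decomp_lin(1)[OF p q]] f[OF p] f[OF q] by (simp add: Lop fun_eq_iff)
    then show "f (a \<oplus>\<^bsub>\<AA>_adjoint al\<^esub> b) = f a \<oplus>\<^bsub>gmod_sum K (Lk al)\<^esub> f b"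
      unfolding a b C.map_add[OF UNIV_I UNIV_I, symmetric] by (simp add: gmod_sum_def)
  next
    show "bij_betw f (carrier (\<AA>_adjoint al)) (carrier (gmod_sum K (Lk al)))"
      unfolding bij_betw_def
    proof
      show "inj_on f (carrier (\<AA>_adjoint al))"
      proof (rule inj_onI)
        fix a b assume "a \<in> carrier (\<AA>_adjoint al)" "b \<in> carrier (\<AA>_adjoint al)" and e: "f a = f b"
        then obtain p m q l where a: "a = \<kappa> al p" "decomp al K p m" "b = \<kappa> al q" "decomp al K q l" using cl by meson
        have "\<kappa> al (m k) = \<kappa> al (l k)" for k
        proof (cases "k \<in> K")
          case True
          then show ?thesis using fun_cong[OF e, of k] unfolding a(1,3) f[OF a(2)] f[OF a(4)] by simp
        next
          case False then show ?thesis using a(2,4) by (simp add: decomp_def)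
        qed
        then show "a = b" unfolding a(1,3) decomp_\<kappa>[OF a(2,4)] by blast
      qed
      show "f ` carrier (\<AA>_adjoint al) = carrier (gmod_sum K (Lk al))"
      proof (intro equalityI subsetI)
        fix g assume "g \<in> f ` carrier (\<AA>_adjoint al)"
        then obtain p m where p: "g = f (\<kappa> al p)" "decomp al K p m" using cl by blast
        have "finite {k \<in> K. \<kappa> al (m k) \<noteq> \<zero>\<^bsub>Lk al k\<^esub>}"
          by (rule finite_subset[of _ "{k. m k \<noteq> 0}"]) (use p(2) z in \<open>auto simp: decomp_def\<close>)
        then have "finite {k \<in> K. g k \<noteq> \<zero>\<^bsub>Lk al k\<^esub>}"
          unfolding p(1) f[OF p(2)] by (rule rev_finite_subset) auto
        then show "g \<in> carrier (gmod_sum K (Lk al))"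
          using p(2) unfolding p(1) f[OF p(2)] by (auto simp: gmod_sum_def Lk_simps(1) decomp_def)
      next
        fix g assume g: "g \<in> carrier (gmod_sum K (Lk al))"
        define m where "m k = (if k \<in> K \<and> g k \<noteq> \<zero>\<^bsub>Lk al k\<^esub> then SOME p. p \<in> Mk k \<and> \<kappa> al p = g k else 0)" for k
        have some: "(SOME p. p \<in> Mk k \<and> \<kappa> al p = g k) \<in> Mk k \<and> \<kappa> al (SOME p. p \<in> Mk k \<and> \<kappa> al p = g k) = g k"
          if "k \<in> K" for k
        proof -
          have "g k \<in> \<kappa> al ` Mk k" using g that by (auto simp: gmod_sum_def Lk_simps(1))
          then have "\<exists>p. p \<in> Mk k \<and> \<kappa> al p = g k" by blast
          then show ?thesis by (rule someI_ex)
        qed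
        have fin: "finite {k \<in> K. g k \<noteq> \<zero>\<^bsub>Lk al k\<^esub>}" using g by (simp add: gmod_sum_def)
        have d: "decomp al K (sum m {k \<in> K. g k \<noteq> \<zero>\<^bsub>Lk al k\<^esub>}) m"
          by (rule decompI[OF _ fin]) (use some in \<open>auto simp: m_def Mk_subsp(1) Jp_subsp(1)\<close>)
        have "g = f (\<kappa> al (sum m {k \<in> K. g k \<noteq> \<zero>\<^bsub>Lk al k\<^esub>}))"
        proof
          fix k
          show "g k = f (\<kappa> al (sum m {k \<in> K. g k \<noteq> \<zero>\<^bsub>Lk al k\<^esub>})) k"
          proof (cases "k \<in> K")
            case True
            then show ?thesis using some[OF True] unfolding f[OF d] by (simp add: m_def z)
          next
            case False
            then show ?thesis using g unfolding f[OF d] by (auto simp: gmod_sum_def PiE_def extensional_def)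
          qed
        qed
        then show "g \<in> f ` carrier (\<AA>_adjoint al)" by (rule image_eqI) simp
      qed
    qed
  qed
  then show ?thesis by blast
qed

section \<open>Maximality of the kernel\<close>

lemma act1_up:
  assumes "(a, b) \<in> idx al"
  shows "act1 al p (act1 al (gen (2, 1)) (mon al a b)) = sc (al - of_nat a - of_nat b) (act1 al p (mon al (a + 1) b))"
    and "act1 al p (act1 al (gen (3, 1)) (mon al a b)) = sc (al - of_nat a - of_nat b) (act1 al p (mon al a (b + 1)))"
  using idx_up[OF assms] by (auto simp: mon_step[OF assms] act1_sc)

lemma ffact_Suc: "ffact b (Suc n) = ffact b n * (of_nat b - of_nat n)"
  by (simp add: ffact_def)

lemma ffact_Suc_Suc: "ffact (Suc b) (Suc n) = of_nat (Suc b) * ffact b n"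
proof (induction n)
  case (Suc n)
  have "ffact (Suc b) (Suc (Suc n)) = ffact (Suc b) (Suc n) * (of_nat (Suc b) - of_nat (Suc n))" by (rule ffact_Suc)
  also have "\<dots> = of_nat (Suc b) * (ffact b n * (of_nat b - of_nat n))" using Suc by simp
  finally show ?case by (simp only: ffact_Suc)
qed (simp add: ffact_def)

lemma sc_mon_eqI: "c = d \<or> False ==> sc c (mon al a b) = sc d (mon al a b)" by simp

lemma lower_Suc:
  fixes g :: "complex => complex"
  shows
  "sc (ffact b (Suc n)) (sc (g (of_nat (b - Suc n))) (mon al a (b - Suc n + 1))) =
   sc (ffact b (Suc n) * g (of_nat b - of_nat n - 1)) (mon al a (b - n))"
proof (cases "b \<le> n")
  case True
  then have "ffact b (Suc n) = 0" by (intro ffact_zero) simp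
  then show ?thesis by simp
next
  case False
  then have e: "b - Suc n + 1 = b - n" "of_nat (b - Suc n) = (of_nat b - of_nat n - 1 :: complex)" by (simp_all add: of_nat_diff)
  show ?thesis unfolding e by (simp only: sc_sc)
qed

text \<open>The commutators of \<open>e13 (n + 1)\<close> with lowering operators, as operators on monomials.\<close>

definition lowA :: "nat => T" where
  "lowA n = e13 (Suc n) * gen (3, 2) - gen (3, 2) * e13 (Suc n)"

definition lowQ1 :: "nat => T" where
  "lowQ1 n = gen (3, 1) * e13 (Suc n) - e13 (Suc n) * gen (3, 1)"

lemma act_lowA:
  assumes ab: "(a, b) \<in> idx al"
  shows "act1 al (lowA n) (mon al a b) = sc (of_nat (Suc n) * of_nat a * ffact b n) (mon al (a - 1) (b - n))"
proof (cases "a = 0")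
  case True
  have i: "(a, b - Suc n) \<in> idx al" using idx_down[OF ab] by simp
  have "act1 al (lowA n) (mon al a b) = act1 al (e13 (Suc n)) (act1 al (gen (3, 2)) (mon al a b)) - act1 al (gen (3, 2)) (act1 al (e13 (Suc n)) (mon al a b))"
    unfolding lowA_def act1_simps(7)[OF mon_in_S[OF ab]] act1_simps(5)[OF mon_in_S[OF ab]] ..
  then show ?thesis using True
    unfolding E13_power[OF ab] act1_sc(2)[OF mon_in_S[OF i]] mon_step[OF i] mon_step[OF ab] by simp
next
  case False
  have i: "(a, b - Suc n) \<in> idx al" using idx_down[OF ab] by simp
  have j: "(a - 1, b + 1) \<in> idx al" using idx_down[OF ab, of "a - 1" "b + 1"] False by simp
  have "act1 al (lowA n) (mon al a b) = act1 al (e13 (Suc n)) (act1 al (gen (3, 2)) (mon al a b)) - act1 al (gen (3, 2)) (act1 al (e13 (Suc n)) (mon al a b))"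
    unfolding lowA_def act1_simps(7)[OF mon_in_S[OF ab]] act1_simps(5)[OF mon_in_S[OF ab]] ..
  also have "\<dots> = sc (of_nat a) (sc (ffact (b + 1) (Suc n)) (mon al (a - 1) (b + 1 - Suc n))) - sc (ffact b (Suc n)) (sc (of_nat a) (mon al (a - 1) (b - Suc n + 1)))"
    unfolding E13_power[OF ab] act1_sc(2)[OF mon_in_S[OF i]] mon_step(7)[OF i] mon_step(7)[OF ab]
      act1_sc(2)[OF mon_in_S[OF j]] E13_power[OF j] ..
  also have "\<dots> = sc (of_nat (Suc n) * of_nat a * ffact b n) (mon al (a - 1) (b - n))"
    unfolding lower_Suc[where g = "\<lambda>x. of_nat a"]
    by (simp only: Suc_eq_plus1[symmetric] ffact_Suc_Suc ffact_Suc[of b n] sc_sc diff_Suc_Suc left_diff_distrib[symmetric] single_diff[symmetric])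
      (rule sc_mon_eqI, simp add: algebra_simps)
  finally show ?thesis .
qed

lemma act_lowQ1:
  assumes ab: "(a, b) \<in> idx al"
  shows "act1 al (lowQ1 n) (mon al a b) =
    sc (of_nat (Suc n) * ffact b n * (of_nat b - (al - of_nat a - of_nat b) - of_nat n)) (mon al a (b - n))"
proof -
  let ?m = "al - of_nat a - of_nat b"
  have i: "(a, b - Suc n) \<in> idx al" using idx_down[OF ab] by simp
  have "act1 al (lowQ1 n) (mon al a b) = act1 al (gen (3, 1)) (act1 al (e13 (Suc n)) (mon al a b)) - act1 al (e13 (Suc n)) (act1 al (gen (3, 1)) (mon al a b))"
    unfolding lowQ1_def act1_simps(7)[OF mon_in_S[OF ab]] act1_simps(5)[OF mon_in_S[OF ab]] ..
  also have "\<dots> = sc (ffact b (Suc n)) (sc (al - of_nat a - of_nat (b - Suc n)) (mon al a (b - Suc n + 1))) - sc ?m (sc (ffact (b + 1) (Suc n)) (mon al a (b + 1 - Suc n)))"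
  proof -
    have "act1 al (e13 (Suc n)) (act1 al (gen (3, 1)) (mon al a b)) = sc ?m (sc (ffact (b + 1) (Suc n)) (mon al a (b + 1 - Suc n)))"
      unfolding act1_up[OF ab] using idx_up[OF ab] E13_power[of a "b + 1" al "Suc n"] by auto
    then show ?thesis unfolding E13_power[OF ab] act1_sc(2)[OF mon_in_S[OF i]] mon_step(9)[OF i] by (simp only:)
  qed
  also have "\<dots> = sc (of_nat (Suc n) * ffact b n * (of_nat b - ?m - of_nat n)) (mon al a (b - n))"
    unfolding lower_Suc[where g = "\<lambda>x. al - of_nat a - x"]
    by (simp only: Suc_eq_plus1[symmetric] ffact_Suc_Suc ffact_Suc[of b n] sc_sc diff_Suc_Suc left_diff_distrib[symmetric] single_diff[symmetric])
      (rule sc_mon_eqI, simp add: algebra_simps)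
  finally show ?thesis .
qed

definition lowQ2 :: "nat => T" where
  "lowQ2 n = lowA n * gen (2, 1) - gen (2, 1) * lowA n"

lemma act_lowA_21:
  assumes ab: "(a, b) \<in> idx al"
  shows "act1 al (lowA n * gen (2, 1)) (mon al a b) =
    sc (of_nat (Suc n) * ffact b n * ((al - of_nat a - of_nat b) * (of_nat a + 1))) (mon al a (b - n))"
proof -
  have "act1 al (lowA n * gen (2, 1)) (mon al a b) = sc (al - of_nat a - of_nat b) (act1 al (lowA n) (mon al (a + 1) b))"
    unfolding act1_simps(5)[OF mon_in_S[OF ab]] by (rule act1_up[OF ab])
  then show ?thesis using idx_up[OF ab] act_lowA[of "a + 1" b al n] by (auto simp: algebra_simps)
qed

lemma act_lowQ2:
  assumes ab: "(a, b) \<in> idx al"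
  shows "act1 al (lowQ2 n) (mon al a b) =
    sc (of_nat (Suc n) * ffact b n * ((al - of_nat a - of_nat b) - of_nat (Suc n) * of_nat a)) (mon al a (b - n))"
proof -
  have i: "(a - 1, b - n) \<in> idx al" using idx_down[OF ab] by simp
  have "act1 al (gen (2, 1) * lowA n) (mon al a b) = sc (of_nat (Suc n) * of_nat a * ffact b n) (sc (al - of_nat (a - 1) - of_nat (b - n)) (mon al (a - 1 + 1) (b - n)))"
    unfolding act1_simps(5)[OF mon_in_S[OF ab]] act_lowA[OF ab] act1_sc(2)[OF mon_in_S[OF i]] mon_step(8)[OF i] ..
  also have "\<dots> = sc (of_nat (Suc n) * ffact b n * (of_nat a * (al - of_nat a - of_nat b + of_nat n + 1))) (mon al a (b - n))"
  proof (cases "a = 0 \<or> b < n")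
    case True then show ?thesis using ffact_zero[of b n] by auto
  next
    case False
    then have "a - 1 + 1 = a" "of_nat (a - 1) = (of_nat a - 1 :: complex)" "of_nat (b - n) = (of_nat b - of_nat n :: complex)"
      by (simp_all add: of_nat_diff)
    then show ?thesis by (simp only: sc_sc) (rule sc_mon_eqI, simp add: algebra_simps)
  qed
  finally have "act1 al (lowQ2 n) (mon al a b) =
    sc (of_nat (Suc n) * ffact b n * ((al - of_nat a - of_nat b) * (of_nat a + 1))) (mon al a (b - n)) - sc (of_nat (Suc n) * ffact b n * (of_nat a * (al - of_nat a - of_nat b + of_nat n + 1))) (mon al a (b - n))"
    unfolding lowQ2_def act1_simps(7)[OF mon_in_S[OF ab]] act_lowA_21[OF ab] by (simp only:)
  also have "\<dots> = sc (of_nat (Suc n) * ffact b n * ((al - of_nat a - of_nat b) - of_nat (Suc n) * of_nat a)) (mon al a (b - n))"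
    by (simp only: left_diff_distrib[symmetric] single_diff[symmetric]) (rule sc_mon_eqI, simp add: algebra_simps)
  finally show ?thesis .
qed

text \<open>Contracting \<open>L\<^sup>(\<^sup>n\<^sup>+\<^sup>1\<^sup>)\<^sup>\<theta>\<close> with the adjoint representation back to highest weight \<open>n\<theta>\<close>: the contraction
  is a multiple of \<open>e13 n\<close> whose factor vanishes exactly for \<open>al = n\<close> and \<open>al = - n - 3\<close>.\<close>

lemma descent:
  fixes K :: "T set"
  assumes K: "Jp al \<subseteq> K" "\<And>p q. p \<in> K ==> q \<in> K ==> p + q \<in> K" "\<And>p q. p \<in> K ==> q * p \<in> K" "\<And>p q. p \<in> K ==> p * q \<in> K"
    and e: "e13 (Suc n) \<in> K" and nz: "al \<noteq> of_nat n" "al \<noteq> - of_nat (n + 3)"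
  shows "e13 n \<in> K"
proof -
  have um: "- p \<in> K" if "p \<in> K" for p using K(3)[OF that, of "- 1"] by simp
  have diff: "p - q \<in> K" if "p \<in> K" "q \<in> K" for p q using K(2)[OF that(1) um[OF that(2)]] by simp
  have A: "lowA n \<in> K" and Q1: "lowQ1 n \<in> K" unfolding lowA_def lowQ1_def using e K diff by blast+
  have Q2: "lowQ2 n \<in> K" unfolding lowQ2_def using A K(3,4) diff by blast
  define k where "k = (of_nat (Suc n) :: complex)"
  define d where "d = 2 * k + 1"
  have "d = of_nat (2 * n + 3)" by (simp add: d_def k_def)
  then have d: "d \<noteq> 0" by (metis of_nat_eq_0_iff add_is_0 zero_neq_numeral)
  define s where "s = (al - of_nat n) / d"
  have al: "al = d * s + of_nat n" using d by (simp add: s_def)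
  have k0: "k \<noteq> 0" unfolding k_def by (metis of_nat_eq_0_iff nat.distinct(2))
  have s0: "s \<noteq> 0" using nz(1) d by (simp add: s_def)
  have s1: "s + 1 \<noteq> 0"
  proof
    assume "s + 1 = 0"
    then have "s = -1" by (simp add: add_eq_0_iff2)
    then have "al = - of_nat (n + 3)" using al by (simp add: d_def k_def)
    then show False using nz(2) by simp
  qed
  define contr where "contr = sc d (lowA n * gen (2, 1)) - sc d (lowQ2 n * (gen (2, 2) + 1))
     + sc k ((sc 2 (lowQ2 n) + lowQ1 n) * (gen (2, 2) + sc (s + 1) 1))"
  have contrK: "contr \<in> K" unfolding contr_def
    by (rule K(2)[OF diff[OF K(3)[OF K(4)[OF A]] K(3)[OF K(4)[OF Q2]]] K(3)[OF K(4)[OF K(2)[OF K(3)[OF Q2] Q1]]]])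
  have "contr - sc (d * k * k * s * (s + 1)) (e13 n) \<in> Jp al"
  proof (rule Jp_monI)
    fix a b assume ab: "(a, b) \<in> idx al"
    note m = mon_in_S[OF ab]
    let ?f = "k * ffact b n" and ?m1 = "al - of_nat a - of_nat b" and ?v = "mon al a (b - n)"
    have E22: "act1 al (p * (gen (2, 2) + sc c 1)) (mon al a b) = sc (of_nat a + c) (act1 al p (mon al a b))" for p c
    proof -
      have "act1 al (gen (2, 2) + sc c 1) (mon al a b) = sc (of_nat a + c) (mon al a b)"
        by (simp only: act1_simps(2)[OF m] act1_sc(1)[OF m] act1_simps(3)[OF m] mon_step(2)[OF ab] sc_add_left)
      then show ?thesis by (simp only: act1_simps(5)[OF m] act1_sc(2)[OF m])
    qed
    have E22': "act1 al (p * (gen (2, 2) + 1)) (mon al a b) = sc (of_nat a + 1) (act1 al p (mon al a b))" for p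
      using E22[of p 1] by (simp only: sc_one)
    have e: "act1 al (e13 n) (mon al a b) = sc (ffact b n) ?v" by (rule E13_power[OF ab])
    have "act1 al contr (mon al a b) =
       sc d (sc (?f * (?m1 * (of_nat a + 1))) ?v) - sc d (sc (of_nat a + 1) (sc (?f * (?m1 - k * of_nat a)) ?v))
       + sc k (sc (of_nat a + (s + 1)) (sc 2 (sc (?f * (?m1 - k * of_nat a)) ?v) + sc (?f * (of_nat b - ?m1 - of_nat n)) ?v))"
      unfolding contr_def k_def
      by (simp only: act1_simps(2)[OF m] act1_simps(7)[OF m] act1_sc(1)[OF m] E22 E22' act_lowA_21[OF ab] act_lowQ2[OF ab] act_lowQ1[OF ab])
    also have "\<dots> = sc (d * (?f * (?m1 * (of_nat a + 1))) - d * ((of_nat a + 1) * (?f * (?m1 - k * of_nat a)))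
       + k * ((of_nat a + (s + 1)) * (2 * (?f * (?m1 - k * of_nat a)) + ?f * (of_nat b - ?m1 - of_nat n)))) ?v"
      by (simp only: sc_sc sc_add_left[symmetric] left_diff_distrib[symmetric] single_diff[symmetric])
    also have "\<dots> = sc (d * k * k * s * (s + 1) * ffact b n) ?v"
    proof (rule sc_mon_eqI, rule disjI1)
      have n: "of_nat n = k - 1" by (simp add: k_def)
      show "d * (?f * (?m1 * (of_nat a + 1))) - d * ((of_nat a + 1) * (?f * (?m1 - k * of_nat a)))
       + k * ((of_nat a + (s + 1)) * (2 * (?f * (?m1 - k * of_nat a)) + ?f * (of_nat b - ?m1 - of_nat n))) = d * k * k * s * (s + 1) * ffact b n"
        unfolding al d_def n by (simp add: algebra_simps)
    qed
    finally show "act1 al (contr - sc (d * k * k * s * (s + 1)) (e13 n)) (mon al a b) = 0"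
      by (simp only: act1_simps(7)[OF m] act1_sc(1)[OF m] e sc_sc) simp
  qed
  then have "contr - (contr - sc (d * k * k * s * (s + 1)) (e13 n)) \<in> K" by (rule diff[OF contrK subsetD[OF K(1)]])
  then have "sc (d * k * k * s * (s + 1)) (e13 n) \<in> K" by simp
  then have "sc (1 / (d * k * k * s * (s + 1))) (sc (d * k * k * s * (s + 1)) (e13 n)) \<in> K" by (rule K(3))
  moreover have "d * k * k * s * (s + 1) \<noteq> 0" using d k0 s0 s1 by (simp only: mult_eq_0_iff) blast
  ultimately show ?thesis by (simp only: sc_sc) simp
qed

lemma ideal_adsub:
  assumes "ideal I U"
  shows "adsub {p. \<pi> p \<in> I}"
proof -
  note D = cover_idealD[OF \<pi>_cover assms]
  have "\<pi> (D i j p) \<in> I" if "\<pi> p \<in> I" for i j p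
  proof -
    have "\<pi> (gen (i, j) * p + - (p * gen (i, j))) \<in> I"
      using that by (intro D(2) D(3) D(4) D(6)) auto
    then show ?thesis by (simp add: \<pi>_D)
  qed
  then show ?thesis unfolding adsub_def using D by auto
qed

text \<open>By \<open>descent\<close> an ideal beyond the annihilator contains lower and lower powers of \<open>E\<^sub>1\<^sub>3\<close>; the factors
  vanish only where the power itself is zero or for negative integers.\<close>

theorem J_maximal:
  assumes "\<nexists>m::int. m < 0 \<and> al = of_int m"
  shows "maximalideal (J al) U"
proof (intro maximalideal.intro maximalideal_axioms.intro J_ideal)
  have "\<one>\<^bsub>U\<^esub> \<notin> J al" using Jp_one[of al] Jp_iff[of 1 al] P.map_one by simp
  then show "carrier U \<noteq> J al" using U.one_closed by blast
  fix I assume I: "ideal I U" and JI: "J al \<subseteq> I" and IU: "I \<subseteq> carrier U"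
  note D = cover_idealD[OF \<pi>_cover I]
  let ?K = "{p. \<pi> p \<in> I}"
  have JK: "Jp al \<subseteq> ?K" using JI Jp_iff by blast
  show "I = J al \<or> I = carrier U"
  proof (cases "?K \<subseteq> Jp al")
    case True
    have "I \<subseteq> J al"
    proof
      fix u assume u: "u \<in> I"
      then obtain p where "u = \<pi> p" using IU P.surj by auto
      then show "u \<in> J al" using True u Jp_iff by auto
    qed
    then show ?thesis using JI by blast
  next
    case False
    then obtain q where q: "q \<in> ?K" "q \<notin> Jp al" by blast
    obtain p \<mu> where p: "p \<in> ?K" "p \<notin> Jp al" "D 1 2 p = 0" "D 1 3 p = 0" "D 2 3 p = 0" "\<And>i. D i i p = sc (of_int (\<mu> i)) p"
      using highest_weight_between[OF Jp_adsub ideal_adsub[OF I] JK q] by blast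
    have h: "hwv p \<mu>" using p unfolding hwv_def by blast
    obtain k c where k: "c \<noteq> 0" "p - sc c (e13 k) \<in> Jp al" using hwv_unique[OF h p(2)] by blast
    have "\<pi> (p + - (p - sc c (e13 k))) \<in> I" using p(1) k(2) JK by (intro D(2) D(6)) auto
    then have "\<pi> (sc c (e13 k)) \<in> I" by simp
    then have "\<pi> (sc (1 / c) (sc c (e13 k))) \<in> I" by (rule D(5)[OF UNIV_I])
    then have ek: "e13 k \<in> ?K" using k(1) by (simp only: sc_sc) simp
    have nJ: "e13 k \<notin> Jp al"
    proof
      assume "e13 k \<in> Jp al"
      then have "(p - sc c (e13 k)) + sc c (e13 k) \<in> Jp al" by (intro Jp_subsp(2)[OF k(2)] Jp_subsp(3))
      then show False using p(2) by simp
    qed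
    have cl: "p + q \<in> ?K" if "p \<in> ?K" "q \<in> ?K" for p q using that D(2)[of p q] by simp
    have "q * p \<in> ?K" "p * q \<in> ?K" if "p \<in> ?K" for p q using that D(3,4)[of p q] by simp_all
    note cl = cl this
    have "e13 j \<in> ?K \<and> j \<le> k" if "j \<le> k" for j
      using that
    proof (induction rule: inc_induct)
      case (step n)
      have "al \<noteq> of_nat n" using nJ step(2) by (auto simp: e13_in_Jp)
      moreover have "al \<noteq> - of_nat (n + 3)"
      proof
        assume "al = - of_nat (n + 3)"
        then have "al = of_int (- int (n + 3))" by simp
        moreover have "- int (n + 3) < 0" by simp
        ultimately show False using assms by blast
      qed
      moreover have "e13 (Suc n) \<in> ?K" using step(3) by blast
      ultimately have "e13 n \<in> ?K" by (metis descent[OF JK cl(1) cl(2) cl(3)])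
      then show ?case using step(2) by simp
    qed (use ek in simp)
    from this[of 0] have "1 \<in> ?K" by simp
    then have "\<one>\<^bsub>U\<^esub> \<in> I" by (simp add: P.map_one)
    then show ?thesis using ideal.one_imp_carrier[OF I] by blast
  qed
qed

section \<open>The projection onto the centre\<close>

text \<open>The relations among words in the matrix units, as a submodule for the adjoint action.\<close>

definition Ker :: "T set" where "Ker = {p. \<pi> p = \<zero>\<^bsub>U\<^esub>}"

lemma \<pi>_eq_iff: "\<pi> p = \<pi> q \<longleftrightarrow> p - q \<in> Ker"
  by (simp add: Ker_def P.map_diff U.minus_eq) (metis P.map_closed UNIV_I U.add.inv_closed U.add.m_comm U.add.inv_equality U.minus_minus U.r_neg)

lemma zero_ideal_U: "ideal {\<zero>\<^bsub>U\<^esub>} U"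
  by (rule U.zeroideal)

lemma Ker_adsub: "adsub Ker"
  using ideal_adsub[OF zero_ideal_U] by (simp add: Ker_def)

lemma Ker_ideal: "p \<in> Ker ==> q * p \<in> Ker" "p \<in> Ker ==> p * q \<in> Ker"
  by (simp_all add: Ker_def P.map_mult)

lemmas Ker_subsp = subspD[OF Ker_adsub[unfolded adsub_subsp, THEN conjunct1]]

abbreviation divg :: "(3 => 3 => T) => T" where
  "divg q \<equiv> (\<Sum>i\<in>UNIV. \<Sum>j\<in>UNIV. D i j (q i j))"

lemma \<pi>_center:
  assumes "\<And>i j. D i j z \<in> Ker"
  shows "\<pi> z \<in> U_center" "\<pi> (z * p) = \<pi> (p * z)"
proof -
  have g: "gen (i, j) * z - z * gen (i, j) \<in> Ker" for i j
    using assms[of i j] \<pi>_D[of i j z] by (simp add: Ker_def)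
  have c: "p * z - z * p \<in> Ker" for p
  proof -
    have "p \<in> words UNIV" by simp
    then show ?thesis
    proof (induction p rule: free_induct)
      case one show ?case using Ker_subsp(1) by simp
    next
      case (gen x p)
      obtain i j where x: "x = (i, j)" by fastforce
      have "Defs.gen x * p * z - z * (Defs.gen x * p) = Defs.gen x * (p * z - z * p) + (Defs.gen x * z - z * Defs.gen x) * p"
        by (simp add: algebra_simps)
      also have "\<dots> \<in> Ker" using gen g[of i j] unfolding x by (intro Ker_subsp(2) Ker_ideal) auto
      finally show ?case .
    next
      case (sc c p)
      have "sc c p * z - z * sc c p = sc c (p * z - z * p)"
        by (simp only: right_diff_distrib sc_mult_right mult.assoc)
      then show ?case using Ker_subsp(3)[OF sc(2), of c] by (simp only:)
    next
      case (add p q)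
      have "(p + q) * z - z * (p + q) = (p * z - z * p) + (q * z - z * q)" by (simp add: algebra_simps)
      then show ?case using Ker_subsp(2)[OF add(3,4)] by (simp only:)
    qed
  qed
  have "z * p - p * z \<in> Ker" for p using Ker_subsp(4)[OF c[of p]] by simp
  then show e: "\<pi> (z * p) = \<pi> (p * z)" for p unfolding \<pi>_eq_iff .
  have "\<pi> z \<otimes>\<^bsub>U\<^esub> u = u \<otimes>\<^bsub>U\<^esub> \<pi> z" if u: "u \<in> carrier U" for u
  proof -
    obtain p where "u = \<pi> p" using u unfolding P.surj by blast
    then show ?thesis using e[of p] by (simp add: P.map_mult)
  qed
  then show "\<pi> z \<in> U_center" by (simp add: U_center_def)
qed

lemma U_center_D: "\<pi> z \<in> U_center ==> D i j z \<in> Ker"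
proof -
  assume "\<pi> z \<in> U_center"
  then have "\<pi> (gen (i, j) * z) = \<pi> (z * gen (i, j))" by (simp add: U_center_def P.map_mult)
  then show ?thesis unfolding \<pi>_eq_iff using \<pi>_D[of i j z] by (simp add: Ker_def)
qed

lemma lin_span_add:
  assumes M: "module \<CC> M" and B: "B \<subseteq> carrier M" and x: "x \<in> lin_span M B" and y: "y \<in> lin_span M B"
  shows "x \<oplus>\<^bsub>M\<^esub> y \<in> lin_span M B"
proof -
  interpret M: module \<CC> M by fact
  obtain F c where F: "finite F" "F \<subseteq> B" "x = (\<Oplus>\<^bsub>M\<^esub>b\<in>F. c b \<odot>\<^bsub>M\<^esub> b)" using x unfolding lin_span_def by blast
  obtain G d where G: "finite G" "G \<subseteq> B" "y = (\<Oplus>\<^bsub>M\<^esub>b\<in>G. d b \<odot>\<^bsub>M\<^esub> b)" using y unfolding lin_span_def by blast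
  have sm: "c \<odot>\<^bsub>M\<^esub> b \<in> carrier M" if "b \<in> carrier M" for c b using that M.smult_closed[of c b] by simp
  let ?c = "\<lambda>b. if b \<in> F then c b else 0" and ?d = "\<lambda>b. if b \<in> G then d b else 0"
  have c: "F \<union> G \<subseteq> carrier M" using F G B by auto
  have s0: "0 \<odot>\<^bsub>M\<^esub> b = \<zero>\<^bsub>M\<^esub>" if "b \<in> carrier M" for b using that M.smult_l_null[of b] by simp
  have "x = (\<Oplus>\<^bsub>M\<^esub>b\<in>F \<union> G. ?c b \<odot>\<^bsub>M\<^esub> b)"
    unfolding F(3) using F(1) G(1) c
    by (intro M.M.add.finprod_mono_neutral_cong_left[unfolded finsum_def[symmetric]]) (auto simp: sm s0)
  moreover have "y = (\<Oplus>\<^bsub>M\<^esub>b\<in>F \<union> G. ?d b \<odot>\<^bsub>M\<^esub> b)"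
    unfolding G(3) using F(1) G(1) c
    by (intro M.M.add.finprod_mono_neutral_cong_left[unfolded finsum_def[symmetric]]) (auto simp: sm s0)
  ultimately have "x \<oplus>\<^bsub>M\<^esub> y = (\<Oplus>\<^bsub>M\<^esub>b\<in>F \<union> G. ?c b \<odot>\<^bsub>M\<^esub> b \<oplus>\<^bsub>M\<^esub> ?d b \<odot>\<^bsub>M\<^esub> b)"
    using c by (subst M.M.finsum_addf) (auto intro!: sm)
  also have "\<dots> = (\<Oplus>\<^bsub>M\<^esub>b\<in>F \<union> G. (?c b + ?d b) \<odot>\<^bsub>M\<^esub> b)"
  proof (rule M.M.finsum_cong'[OF refl])
    show "(\<lambda>b. (?c b + ?d b) \<odot>\<^bsub>M\<^esub> b) \<in> F \<union> G \<rightarrow> carrier M" using c sm by blast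
    fix b assume "b \<in> F \<union> G"
    then have "b \<in> carrier M" using c by blast
    then show "?c b \<odot>\<^bsub>M\<^esub> b \<oplus>\<^bsub>M\<^esub> ?d b \<odot>\<^bsub>M\<^esub> b = (?c b + ?d b) \<odot>\<^bsub>M\<^esub> b"
      using M.smult_l_distr[of "?c b" "?d b" b] by (simp only: carrier_\<CC> UNIV_I)
  qed
  finally show ?thesis unfolding lin_span_def mem_Collect_eq using F(1,2) G(1,2)
    by (intro exI[of _ "F \<union> G"] exI[of _ "\<lambda>b. ?c b + ?d b"]) simp
qed

lemma comm_divg: "\<exists>r. p * q - q * p - divg r \<in> Ker"
proof -
  have "p \<in> words UNIV" by simp
  then show ?thesis
  proof (induction p arbitrary: q rule: free_induct)
    case one show ?case by (intro exI[of _ "\<lambda>i j. 0"]) (simp add: Ker_subsp(1))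
  next
    case (gen x p)
    obtain a b where x: "x = (a, b)" by fastforce
    obtain r where r: "p * (q * Defs.gen x) - (q * Defs.gen x) * p - divg r \<in> Ker" using gen(3) by blast
    define r' where "r' i j = r i j + (if i = a then if j = b then p * q else 0 else 0)" for i j
    have "divg (\<lambda>i j. if i = a then if j = b then p * q else 0 else 0) = (\<Sum>i\<in>UNIV. if i = a then \<Sum>j\<in>UNIV. if j = b then D i j (p * q) else 0 else 0)"
    proof (intro sum.cong refl)
      fix i
      show "(\<Sum>j\<in>UNIV. D i j (if i = a then if j = b then p * q else 0 else 0)) = (if i = a then \<Sum>j\<in>UNIV. if j = b then D i j (p * q) else 0 else 0)"
      proof (cases "i = a")
        case True
        have "(\<Sum>j\<in>UNIV. D i j (if j = b then p * q else 0)) = (\<Sum>j\<in>UNIV. if j = b then D i j (p * q) else 0)"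
          by (intro sum.cong) auto
        then show ?thesis using True by (simp only: if_True simp_thms)
      qed simp
    qed
    then have d: "divg r' = divg r + D a b (p * q)" by (simp add: r'_def D_add sum.distrib)
    have k: "Defs.gen x * (p * q) - (p * q) * Defs.gen x - D a b (p * q) \<in> Ker"
      using \<pi>_D[of a b "p * q"] unfolding x \<pi>_eq_iff using Ker_subsp(4) by fastforce
    have "Defs.gen x * p * q - q * (Defs.gen x * p) - divg r' =
      (Defs.gen x * (p * q) - (p * q) * Defs.gen x - D a b (p * q)) + (p * (q * Defs.gen x) - (q * Defs.gen x) * p - divg r)"
      unfolding d by (simp add: algebra_simps)
    then show ?case using Ker_subsp(2)[OF k r] by (intro exI[of _ r']) (simp only:)
  next
    case (sc c p)
    obtain r where r: "p * q - q * p - divg r \<in> Ker" using sc(2) by blast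
    have "sc c p * q - q * sc c p - divg (\<lambda>i j. sc c (r i j)) = sc c (p * q - q * p - divg r)"
      by (simp only: right_diff_distrib sc_mult_right mult.assoc D_sc sum_distrib_left)
    then show ?case using Ker_subsp(3)[OF r, of c] by (intro exI[of _ "\<lambda>i j. sc c (r i j)"]) (simp only:)
  next
    case (add p p')
    obtain r r' where r: "p * q - q * p - divg r \<in> Ker" "p' * q - q * p' - divg r' \<in> Ker" using add(3,4) by blast
    have "(p + p') * q - q * (p + p') - divg (\<lambda>i j. r i j + r' i j) = (p * q - q * p - divg r) + (p' * q - q * p' - divg r')"
      by (simp add: algebra_simps D_add sum.distrib)
    then show ?case using Ker_subsp(2)[OF r] by (intro exI[of _ "\<lambda>i j. r i j + r' i j"]) (simp only:)
  qed
qed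

text \<open>By \<open>[x y, v] = [x, y v] + [y, v x]\<close> every commutator is a sum of commutators with elements of the
  Lie algebra, so the commutator space consists of the images of the adjoint action.\<close>

lemma U_commutators_iff: "\<pi> p \<in> U_commutators \<longleftrightarrow> (\<exists>r. p - divg r \<in> Ker)"
proof
  let ?B = "{u \<otimes>\<^bsub>U\<^esub> v \<ominus>\<^bsub>U\<^esub> v \<otimes>\<^bsub>U\<^esub> u | u v. u \<in> carrier U \<and> v \<in> carrier U}"
  have B: "\<exists>q r. b = \<pi> q \<and> q - divg r \<in> Ker" if b: "b \<in> ?B" for b
  proof -
    obtain u v where "b = u \<otimes>\<^bsub>U\<^esub> v \<ominus>\<^bsub>U\<^esub> v \<otimes>\<^bsub>U\<^esub> u" "u \<in> carrier U" "v \<in> carrier U" using b by blast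
    moreover then obtain x y where "u = \<pi> x" "v = \<pi> y" unfolding P.surj by blast
    ultimately have "b = \<pi> (x * y - y * x)" by (simp add: P.map_diff P.map_mult)
    then show ?thesis using comm_divg by blast
  qed
  assume "\<pi> p \<in> U_commutators"
  then obtain F c where F: "finite F" "F \<subseteq> ?B" "\<pi> p = (\<Oplus>\<^bsub>U\<^esub>b\<in>F. c b \<odot>\<^bsub>U\<^esub> b)"
    unfolding U_commutators_def lin_span_def by blast
  have "\<forall>b\<in>F. \<exists>x. b = \<pi> (fst x) \<and> fst x - divg (snd x) \<in> Ker"
  proof
    fix b assume "b \<in> F"
    then have "b \<in> ?B" using F(2) by blast
    from B[OF this] obtain q r where "b = \<pi> q" "q - divg r \<in> Ker" by blast
    then show "\<exists>x. b = \<pi> (fst x) \<and> fst x - divg (snd x) \<in> Ker" by (intro exI[of _ "(q, r)"]) simp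
  qed
  from bchoice[OF this] obtain g where g: "\<forall>b\<in>F. b = \<pi> (fst (g b)) \<and> fst (g b) - divg (snd (g b)) \<in> Ker" by blast
  define q r where "q b = fst (g b)" and "r b = snd (g b)" for b
  have q: "b = \<pi> (q b)" "q b - divg (r b) \<in> Ker" if "b \<in> F" for b
    using g that unfolding q_def r_def by blast+
  have "\<pi> p = (\<Oplus>\<^bsub>U\<^esub>b\<in>F. c b \<odot>\<^bsub>U\<^esub> \<pi> (q b))"
    unfolding F(3)
  proof (rule U.finsum_cong'[OF refl])
    fix b assume "b \<in> F"
    then show "c b \<odot>\<^bsub>U\<^esub> b = c b \<odot>\<^bsub>U\<^esub> \<pi> (q b)" using q(1)[of b] by simp
  qed simp
  also have "\<dots> = \<pi> (\<Sum>b\<in>F. sc (c b) (q b))" by (simp only: P.map_sum[OF UNIV_I] P.map_sc[OF UNIV_I])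
  finally have 1: "p - (\<Sum>b\<in>F. sc (c b) (q b)) \<in> Ker" unfolding \<pi>_eq_iff .
  let ?r = "\<lambda>i j. \<Sum>b\<in>F. sc (c b) (r b i j)"
  have "divg ?r = (\<Sum>b\<in>F. sc (c b) (divg (r b)))"
  proof -
    have "divg ?r = (\<Sum>i\<in>UNIV. \<Sum>j\<in>UNIV. \<Sum>b\<in>F. sc (c b) (D i j (r b i j)))" by (simp only: D_sum D_sc)
    also have "\<dots> = (\<Sum>i\<in>UNIV. \<Sum>b\<in>F. \<Sum>j\<in>UNIV. sc (c b) (D i j (r b i j)))"
      by (intro sum.cong refl sum.swap)
    also have "\<dots> = (\<Sum>b\<in>F. \<Sum>i\<in>UNIV. \<Sum>j\<in>UNIV. sc (c b) (D i j (r b i j)))" by (rule sum.swap)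
    finally show ?thesis by (simp only: sum_distrib_left)
  qed
  then have "(\<Sum>b\<in>F. sc (c b) (q b)) - divg ?r = (\<Sum>b\<in>F. sc (c b) (q b - divg (r b)))"
    by (simp only: right_diff_distrib sum_subtractf)
  also have "\<dots> \<in> Ker" by (intro Ker_subsp(6) Ker_subsp(3) q(2))
  finally have "(p - (\<Sum>b\<in>F. sc (c b) (q b))) + ((\<Sum>b\<in>F. sc (c b) (q b)) - divg ?r) \<in> Ker" by (rule Ker_subsp(2)[OF 1])
  then show "\<exists>r. p - divg r \<in> Ker" by (intro exI[of _ ?r]) simp
next
  let ?B = "{u \<otimes>\<^bsub>U\<^esub> v \<ominus>\<^bsub>U\<^esub> v \<otimes>\<^bsub>U\<^esub> u | u v. u \<in> carrier U \<and> v \<in> carrier U}"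
  have BU: "?B \<subseteq> carrier U" by auto
  have z: "\<pi> 0 \<in> U_commutators"
    unfolding U_commutators_def lin_span_def by (auto intro!: exI[of _ "{}"])
  have a: "\<pi> (x + y) \<in> U_commutators" if "\<pi> x \<in> U_commutators" "\<pi> y \<in> U_commutators" for x y
    using lin_span_add[OF U.module_axioms BU] that unfolding U_commutators_def by (simp add: P.map_add)
  have s: "\<pi> (sum h F) \<in> U_commutators" if "\<And>i. \<pi> (h i) \<in> U_commutators" for h and F :: "3 set"
    by (induction F rule: infinite_finite_induct) (use z in \<open>auto simp: a that\<close>)
  have "\<pi> (D i j x) \<in> U_commutators" for i j x
  proof -
    have b: "\<pi> (D i j x) \<in> ?B"
      unfolding \<pi>_D by (intro CollectI exI[of _ "\<pi> (gen (i, j))"] exI[of _ "\<pi> x"]) (simp add: P.map_diff P.map_mult)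
    show ?thesis
      unfolding U_commutators_def lin_span_def mem_Collect_eq
      by (intro exI[of _ "{\<pi> (D i j x)}"] exI[of _ "\<lambda>_. 1"]) (use b in auto)
  qed
  then have d: "\<pi> (divg r) \<in> U_commutators" for r by (intro s)
  assume "\<exists>r. p - divg r \<in> Ker"
  then show "\<pi> p \<in> U_commutators" using d unfolding \<pi>_eq_iff[symmetric] by auto
qed

lemma U_sharp_eq:
  assumes z: "\<And>i j. D i j z \<in> Ker"
  shows "U_sharp (\<pi> (z + divg r)) = \<pi> z"
  unfolding U_sharp_def
proof (rule the_equality)
  have "\<pi> (z + divg r) \<ominus>\<^bsub>U\<^esub> \<pi> z = \<pi> (divg r)" by (simp add: P.map_diff[symmetric])
  moreover have "\<pi> (divg r) \<in> U_commutators" unfolding U_commutators_iff by (intro exI[of _ r]) (simp add: Ker_subsp(1))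
  ultimately show "\<pi> z \<in> U_center \<and> \<pi> (z + divg r) \<ominus>\<^bsub>U\<^esub> \<pi> z \<in> U_commutators"
    using \<pi>_center(1)[OF z] by simp
  fix y assume y: "y \<in> U_center \<and> \<pi> (z + divg r) \<ominus>\<^bsub>U\<^esub> y \<in> U_commutators"
  then obtain y' where y': "y = \<pi> y'" unfolding U_center_def P.surj by blast
  have "\<pi> (z + divg r - y') \<in> U_commutators" using y by (simp add: y' P.map_diff)
  then obtain r' where r': "z + divg r - y' - divg r' \<in> Ker" unfolding U_commutators_iff by blast
  have "z - y' - divg (\<lambda>i j. r' i j - r i j) = z + divg r - y' - divg r'" by (simp add: D_diff sum_subtractf)
  then have c: "z - y' - divg (\<lambda>i j. r' i j - r i j) \<in> Ker" using r' by (simp only:)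
  have inv: "D i j (z - y') \<in> Ker" for i j
    using z[of i j] U_center_D[of y' i j] y y' Ker_subsp(5) by (simp add: D_diff)
  have "z - y' \<in> Ker" by (rule invariant_unique[OF Ker_adsub inv c])
  then show "y = \<pi> z" unfolding y' using \<pi>_eq_iff[of z y'] by simp
qed

section \<open>Central characters of highest weight modules\<close>

definition left_ideal :: "T set => bool" where
  "left_ideal I \<longleftrightarrow> 0 \<in> I \<and> (\<forall>p\<in>I. \<forall>q\<in>I. p + q \<in> I) \<and> (\<forall>p\<in>I. \<forall>q. q * p \<in> I)"

definition verma :: "complex ^ 3 => T set" where
  "verma lam = \<Inter>{I. left_ideal I \<and> Ker \<subseteq> I \<and> gen (1, 2) \<in> I \<and> gen (1, 3) \<in> I \<and> gen (2, 3) \<in> I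
     \<and> (\<forall>i. gen (i, i) - sc (lam $ i) 1 \<in> I)}"

lemma verma_facts:
  "left_ideal (verma lam)" "Ker \<subseteq> verma lam" "gen (1, 2) \<in> verma lam" "gen (1, 3) \<in> verma lam" "gen (2, 3) \<in> verma lam"
  "gen (i, i) - sc (lam $ i) 1 \<in> verma lam"
  unfolding verma_def left_ideal_def by blast+

lemma verma_ops:
  "0 \<in> verma lam" "p \<in> verma lam ==> q \<in> verma lam ==> p + q \<in> verma lam" "p \<in> verma lam ==> q * p \<in> verma lam"
  "p \<in> verma lam ==> sc c p \<in> verma lam" "p \<in> verma lam ==> q \<in> verma lam ==> p - q \<in> verma lam"
proof -
  show "0 \<in> verma lam" and a: "p \<in> verma lam ==> q \<in> verma lam ==> p + q \<in> verma lam" and m: "p \<in> verma lam ==> q * p \<in> verma lam" for p q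
    using verma_facts(1)[of lam] unfolding left_ideal_def by blast+
  show "p \<in> verma lam ==> sc c p \<in> verma lam" by (rule m)
  show "p \<in> verma lam ==> q \<in> verma lam ==> p - q \<in> verma lam" using a[of p "- q"] m[of q "- 1"] by simp
qed

lemma verma_cong: "p - q \<in> verma lam ==> q - r \<in> verma lam ==> p - r \<in> verma lam"
  using verma_ops(2)[of "p - q" lam "q - r"] by simp

text \<open>Combinations of words in the lowering operators, of a given height.\<close>

definition lowering :: "(3 \<times> 3) set" where "lowering = {(2, 1), (3, 1), (3, 2)}"

definition low_words :: "int => T set" where
  "low_words h = {p. \<forall>w\<in>keys p. set w \<subseteq> lowering \<and> height (wt w) = h}"

lemma low_words_subsp: "subsp (low_words h)"
proof -
  have "low_words h = {p. keys p \<subseteq> {w. set w \<subseteq> lowering \<and> height (wt w) = h}}"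
    unfolding low_words_def by blast
  then show ?thesis
    unfolding subsp_def by (simp only: mem_Collect_eq) (intro conjI ballI allI; simp only: mem_Collect_eq subalg_like_S keys_zero empty_subsetI)
qed

lemmas low_words_ops = subspD[OF low_words_subsp]

lemma height_Cons: "height (wt (x # w)) = height (wt [x]) + height (wt w)"
  by (cases x) (simp add: height_def wt_def algebra_simps)

lemma low_words_gen_mult:
  assumes "y \<in> lowering" "p \<in> low_words h"
  shows "gen y * p \<in> low_words (height (wt [y]) + h)"
proof -
  have "set w \<subseteq> lowering \<and> height (wt w) = height (wt [y]) + h" if wk: "w \<in> keys (gen y * p)" for w
  proof -
    obtain v where "v \<in> keys p" "w = y # v"
      using subsetD[OF keys_mult wk] by (auto simp: gen_def plus_list_def)
    then show ?thesis using assms height_Cons[of y v] by (auto simp: low_words_def)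
  qed
  then show ?thesis by (simp add: low_words_def)
qed

lemma letter_cases:
  obtains "x \<in> lowering" | i where "x = (i, i)" | "x \<in> {(1, 2), (1, 3), (2, 3)}"
proof -
  obtain i j where x: "x = (i, j)" by fastforce
  show ?thesis using exhaust_3[of i] exhaust_3[of j] that unfolding x lowering_def by auto
qed

lemma ad_letter_letters: "ad_letter i j y = (if j = fst y then gen (i, snd y) else 0) - (if snd y = i then gen (fst y, j) else 0)"
  by (cases y) simp

lemma lower_word:
  assumes "set v \<subseteq> lowering"
  shows "\<exists>q\<in>low_words (height (wt (x # v))). gen x * single v 1 - q \<in> verma lam"
  using assms
proof (induction v arbitrary: x)
  case Nil
  have e: "single [] 1 = (1 :: T)" by (simp only: single_Nil sc_one)
  show ?case
  proof (cases x rule: letter_cases)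
    case 1
    then have "gen x \<in> low_words (height (wt [x]))" by (simp add: low_words_def gen_def)
    then show ?thesis unfolding e using verma_ops(1) by (intro bexI[of _ "gen x"]) simp_all
  next
    case (2 i)
    have "sc (lam $ i) 1 \<in> low_words (height (wt [x]))"
    proof -
      have "(1 :: T) \<in> low_words (height (wt [x]))"
        unfolding e[symmetric] by (simp add: low_words_def 2 height_def wt_def)
      then show ?thesis by (rule low_words_ops(3))
    qed
    then show ?thesis unfolding e using verma_facts(6)[of i lam] by (intro bexI[of _ "sc (lam $ i) 1"]) (simp_all add: 2)
  next
    case 3
    then have "gen x \<in> verma lam" using verma_facts(3,4,5) by auto
    then show ?thesis unfolding e using low_words_ops(1) by (intro bexI[of _ 0]) simp_all
  qed
next
  case (Cons y v)
  show ?case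
  proof (cases "x \<in> lowering")
    case True
    then have "single (x # y # v) 1 \<in> low_words (height (wt (x # y # v)))"
      using Cons(2) by (simp add: low_words_def)
    then show ?thesis using verma_ops(1) by (intro bexI[of _ "single (x # y # v) 1"]) (simp_all add: single_Cons)
  next
    case False
    obtain i j k l where xy: "x = (i, j)" "y = (k, l)" by fastforce
    let ?V = "single v 1 :: T"
    obtain q1 where q1: "q1 \<in> low_words (height (wt (x # v)))" "gen x * ?V - q1 \<in> verma lam"
      using Cons.IH[of x] Cons.prems by auto
    have hy: "height (wt [y]) + height (wt (x # v)) = height (wt (x # y # v))"
      using height_Cons[of x "y # v"] height_Cons[of y v] height_Cons[of x v] by linarith
    have q1': "gen y * q1 \<in> low_words (height (wt (x # y # v)))"
      using low_words_gen_mult[OF _ q1(1), of y] Cons.prems hy by simp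
    have ex: "\<exists>q\<in>low_words (height (wt (x # y # v))). (if P then gen z else 0) * ?V - q \<in> verma lam"
      if "P ==> height (wt [z]) = height (wt [x]) + height (wt [y])" for P z
    proof (cases P)
      case True
      then have "height (wt (z # v)) = height (wt (x # y # v))"
        using that height_Cons[of x "y # v"] height_Cons[of y v] height_Cons[of z v] by linarith
      then show ?thesis using Cons.IH[of z] Cons.prems True by auto
    next
      case False
      then show ?thesis using low_words_ops(1) verma_ops(1) by (intro bexI[of _ 0]) auto
    qed
    obtain q2 where q2: "q2 \<in> low_words (height (wt (x # y # v)))" "(if j = k then gen (i, l) else 0) * ?V - q2 \<in> verma lam"
      using ex[of "j = k" "(i, l)"] by (auto simp: xy height_def wt_def)
    obtain q3 where q3: "q3 \<in> low_words (height (wt (x # y # v)))" "(if l = i then gen (k, j) else 0) * ?V - q3 \<in> verma lam"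
      using ex[of "l = i" "(k, j)"] by (auto simp: xy height_def wt_def)
    have q: "gen y * q1 + (q2 - q3) \<in> low_words (height (wt (x # y # v)))"
      by (intro low_words_ops(2) low_words_ops(5) q1' q2(1) q3(1))
    have "(gen x * gen y - gen y * gen x) - ad_letter i j y \<in> Ker"
      using \<pi>_comm[of i j k l] unfolding \<pi>_eq_iff xy by simp
    then have c: "((gen x * gen y - gen y * gen x) - ad_letter i j y) * ?V \<in> verma lam"
      using Ker_ideal(2) verma_facts(2) by blast
    have "gen x * single (y # v) 1 - (gen y * q1 + (q2 - q3)) =
      ((gen x * gen y - gen y * gen x) - ad_letter i j y) * ?V + gen y * (gen x * ?V - q1)
      + (((if j = k then gen (i, l) else 0) * ?V - q2) - ((if l = i then gen (k, j) else 0) * ?V - q3))"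
      unfolding single_Cons[of y] ad_letter_letters by (simp add: xy algebra_simps)
    also have "\<dots> \<in> verma lam"
      by (rule verma_ops(2)[OF verma_ops(2)[OF c verma_ops(3)[OF q1(2)]] verma_ops(5)[OF q2(2) q3(2)]])
    finally show ?thesis using q by blast
  qed
qed

lemma lower_low_words:
  assumes "p \<in> low_words h"
  shows "\<exists>q\<in>low_words (height (wt [x]) + h). gen x * p - q \<in> verma lam"
proof -
  have "\<exists>q\<in>low_words (height (wt [x]) + h). gen x * p' - q \<in> verma lam" 
    if "keys p' \<subseteq> keys p" for p'
    using that
  proof (induction "keys p'" arbitrary: p' rule: infinite_finite_induct)
    case empty
    then have "p' = 0" by (metis keys_eq_empty)
    then show ?case using low_words_ops(1) verma_ops(1) by (intro bexI[of _ 0]) auto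
  next
    case (insert w F)
    let ?c = "lookup p' w"
    define p2 where "p2 = p' - single w ?c"
    have k2: "keys p2 = F"
    proof -
      have "v \<in> keys p2 \<longleftrightarrow> v \<in> keys p' \<and> v \<noteq> w" for v
        by (auto simp: p2_def in_keys_iff lookup_minus lookup_single when_def)
      then show ?thesis using insert(2) insert(4) by blast
    qed
    then obtain q where q: "q \<in> low_words (height (wt [x]) + h)" "gen x * p2 - q \<in> verma lam"
      using insert(3)[of p2] insert(4,5) by blast
    have "w \<in> keys p" using insert(4,5) by blast
    then have w: "set w \<subseteq> lowering" "height (wt w) = h" using assms by (auto simp: low_words_def)
    obtain r where r: "r \<in> low_words (height (wt [x]) + h)" "gen x * single w 1 - r \<in> verma lam"
      using lower_word[OF w(1), of x lam] w(2) height_Cons[of x w] by auto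
    have "gen x * p' - (q + sc ?c r) = (gen x * p2 - q) + sc ?c (gen x * single w 1 - r)"
    proof -
      have "p' = p2 + sc ?c (single w 1)" by (simp add: p2_def)
      then have "gen x * p' = gen x * p2 + sc ?c (gen x * single w 1)" by (metis distrib_left sc_mult_right)
      then show ?thesis by (simp add: right_diff_distrib)
    qed
    also have "\<dots> \<in> verma lam" by (rule verma_ops(2)[OF q(2) verma_ops(4)[OF r(2)]])
    finally show ?case using low_words_ops(2)[OF q(1) low_words_ops(3)[OF r(1)]] by blast
  qed simp
  then show ?thesis by blast
qed

lemma reduce_word: "\<exists>q\<in>low_words (height (wt w)). single w 1 - q \<in> verma lam"
proof (induction w)
  case Nil
  have "single [] 1 \<in> low_words (height (wt []))" by (simp add: low_words_def)
  then show ?case using verma_ops(1) by (intro bexI[of _ "single [] 1"]) simp_all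
next
  case (Cons x w)
  then obtain q where q: "q \<in> low_words (height (wt w))" "single w 1 - q \<in> verma lam" by blast
  obtain r where r: "r \<in> low_words (height (wt (x # w)))" "gen x * q - r \<in> verma lam"
    using lower_low_words[OF q(1), of x lam] height_Cons[of x w] by auto
  have "gen x * single w 1 - gen x * q \<in> verma lam"
    using verma_ops(3)[OF q(2), of "gen x"] by (simp add: right_diff_distrib)
  then have "gen x * single w 1 - r \<in> verma lam" using r(2) by (rule verma_cong)
  then show ?case using r(1) by (intro bexI[of _ r]) (simp_all add: single_Cons)
qed

lemma low_words_0:
  assumes "q \<in> low_words 0"
  shows "\<exists>c. q = sc c 1"
proof -
  have "set w \<subseteq> lowering ==> height (wt w) \<le> - int (length w)" for w
  proof (induction w)
    case (Cons x w)
    then have "height (wt [x]) \<le> -1" by (auto simp: lowering_def height_def wt_def)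
    then show ?case using Cons height_Cons[of x w] by simp
  qed (simp add: height_def wt_def)
  then have "w = []" if "w \<in> keys q" for w using assms that by (force simp: low_words_def)
  then have "q = single [] (lookup q [])"
    by (intro poly_mapping_eqI) (auto simp: lookup_single when_def in_keys_iff)
  then show ?thesis unfolding single_Nil by blast
qed

text \<open>Modulo the left ideal of a highest weight vector every word is a combination of words in the lowering
  operators of the same height, and an invariant has height zero. This leaves a scalar that depends only on
  the weight.\<close>

lemma invariant_scalar:
  assumes z: "\<And>i j. D i j z = 0"
  shows "\<exists>c. z - sc c 1 \<in> verma lam"
proof -
  have "wt w i = 0" if "w \<in> keys z" for w i
    using lookup_D_diag[of i z w] z that by (simp add: in_keys_iff)
  then have h: "height (wt w) = 0" if "w \<in> keys z" for w using that by (simp add: height_def)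
  have "\<forall>w. \<exists>q. q \<in> low_words (height (wt w)) \<and> single w 1 - q \<in> verma lam" using reduce_word by blast
  then obtain q where q: "\<And>w. q w \<in> low_words (height (wt w))" "\<And>w. single w 1 - q w \<in> verma lam" by metis
  let ?q = "\<Sum>w\<in>keys z. sc (lookup z w) (q w)"
  have "?q \<in> low_words 0"
  proof (intro low_words_ops(6) low_words_ops(3))
    fix w assume "w \<in> keys z"
    then show "q w \<in> low_words 0" using q(1)[of w] h by simp
  qed
  then obtain c where c: "?q = sc c 1" using low_words_0 by blast
  have s: "sum g F \<in> verma lam" if "\<And>w. g w \<in> verma lam" for g :: "(3 \<times> 3) list => T" and F
    using that by (induction F rule: infinite_finite_induct) (auto simp: verma_ops(1,2))
  have "z - ?q = (\<Sum>w\<in>keys z. single w (lookup z w)) - ?q"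
    by (simp only: poly_mapping_expand[symmetric])
  also have "\<dots> = (\<Sum>w\<in>keys z. sc (lookup z w) (single w 1 - q w))"
    by (simp add: right_diff_distrib sum_subtractf)
  also have "\<dots> \<in> verma lam" by (intro s verma_ops(4) q(2))
  finally show ?thesis unfolding c by blast
qed

text \<open>The element commutes with the Lie algebra, so its scalar on the highest weight vector spreads over
  the module that the vector generates.\<close>

lemma highest_weight_scalar:
  assumes M: "highest_weight_module lam M" and z: "\<And>i j. D i j z \<in> Ker" and c: "z - sc c 1 \<in> verma lam"
    and m: "m \<in> carrier M"
  shows "U_rep M (\<pi> z) m = c \<odot>\<^bsub>M\<^esub> m"
proof -
  have g: "gmodule M" using M by (simp add: highest_weight_module_def)
  then interpret M: module \<CC> M by (simp add: gmodule_def)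
  note F = rep_facts[OF g]
  obtain v where v: "highest_weight_vector M lam v" and gen: "\<And>N. gsubmodule N M ==> v \<in> N ==> N = carrier M"
    using M unfolding highest_weight_module_def by blast
  have vM: "v \<in> carrier M" using v by (simp add: highest_weight_vector_def)
  have sm: "c \<odot>\<^bsub>M\<^esub> x \<in> carrier M" if "x \<in> carrier M" for c x using that M.smult_closed[of c x] by simp
  have neg: "x \<oplus>\<^bsub>M\<^esub> (-1) \<odot>\<^bsub>M\<^esub> x = \<zero>\<^bsub>M\<^esub>" if "x \<in> carrier M" for x
    using module_minus[OF M.module_axioms that that] M.r_neg[OF that] by (simp add: a_minus_def)
  have dz: "rep M (p - q) x = rep M p x \<oplus>\<^bsub>M\<^esub> (-1) \<odot>\<^bsub>M\<^esub> rep M q x" if "x \<in> carrier M" for p q x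
    using F(3)[OF that, of p "- q"] F(7)[OF that, of "-1" q] by (simp only: sc_minus_one) simp
  have ker: "rep M p = rep M q" if "\<pi> p = \<pi> q" for p q using that by (simp add: rep_def)
  let ?I = "{p. rep M p v = \<zero>\<^bsub>M\<^esub>}"
  have "verma lam \<subseteq> ?I"
    unfolding verma_def
  proof (rule Inter_lower, rule CollectI, intro conjI allI)
    show "left_ideal ?I" unfolding left_ideal_def using F(3,4,6,10) vM by simp
    show "Ker \<subseteq> ?I"
    proof
      fix p assume "p \<in> Ker"
      then have "\<pi> p = \<pi> 0" by (simp add: Ker_def)
      then have "rep M p = rep M 0" by (rule ker)
      then show "p \<in> ?I" by (simp add: F(6)[OF vM])
    qed
    show "gen (1, 2) \<in> ?I" "gen (1, 3) \<in> ?I" "gen (2, 3) \<in> ?I"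
      using v F(2)[OF vM] by (auto simp: highest_weight_vector_def)
    fix i
    have "rep M (gen (i, i)) v = (lam $ i) \<odot>\<^bsub>M\<^esub> v" using v F(2)[OF vM] by (simp add: highest_weight_vector_def)
    then have "rep M (gen (i, i) - sc (lam $ i) 1) v = (lam $ i) \<odot>\<^bsub>M\<^esub> v \<oplus>\<^bsub>M\<^esub> (-1) \<odot>\<^bsub>M\<^esub> ((lam $ i) \<odot>\<^bsub>M\<^esub> v)"
      unfolding dz[OF vM] F(7)[OF vM] F(5)[OF vM] by simp
    then show "gen (i, i) - sc (lam $ i) 1 \<in> ?I" using neg[OF sm[OF vM]] by simp
  qed
  then have "rep M (z - sc c 1) v = \<zero>\<^bsub>M\<^esub>" using c by blast
  then have "rep M z v \<oplus>\<^bsub>M\<^esub> (-1) \<odot>\<^bsub>M\<^esub> (c \<odot>\<^bsub>M\<^esub> v) = \<zero>\<^bsub>M\<^esub>" unfolding dz[OF vM] F(7)[OF vM] F(5)[OF vM] .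
  then have zv: "rep M z v = c \<odot>\<^bsub>M\<^esub> v"
    using neg[OF sm[OF vM, of c]] F(1)[OF vM, of z] sm[OF vM, of c] sm[OF sm[OF vM, of c], of "-1"]
    by (metis M.add.r_cancel)
  let ?N = "{m \<in> carrier M. rep M z m = c \<odot>\<^bsub>M\<^esub> m}"
  have com: "rep M z (rep M p x) = rep M p (rep M z x)" if "x \<in> carrier M" for p x
    using ker[OF \<pi>_center(2)[OF z], of p] F(4)[OF that, of z p] F(4)[OF that, of p z] by simp
  have "gsubmodule ?N M"
    unfolding gsubmodule_iff[OF M.module_axioms]
  proof (intro conjI ballI allI)
    show "\<zero>\<^bsub>M\<^esub> \<in> ?N" using F(10)[OF vM, of z] M.smult_r_null[of c] by simp
    fix x assume x: "x \<in> ?N"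
    show "d \<odot>\<^bsub>M\<^esub> x \<in> ?N" for d
      using x sm F(9)[of x z d] M.smult_assoc1[of d c x] M.smult_assoc1[of c d x] by (simp add: mult.commute)
    show "x \<oplus>\<^bsub>M\<^esub> y \<in> ?N" if "y \<in> ?N" for y
      using x that F(8)[of x y z] M.smult_r_distr[of c x y] by simp
    show "act M y x \<in> ?N" for y
    proof -
      have xM: "x \<in> carrier M" using x by simp
      have ay: "act M y x = rep M (lf y) x"
      proof -
        have L: "lie_map (End_alg M) (\<lambda>x. \<lambda>m\<in>carrier M. act M x m)" by (rule gmodule_lie_map[OF g])
        have B: "cx_alg (End_alg M)" using L by (simp add: lie_map_def)
        have "rep M (lf y) = induced_hom (End_alg M) (\<lambda>x. \<lambda>m\<in>carrier M. act M x m) (U_class (gen y))"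
          by (simp add: rep_def U_rep_def \<pi>_lf \<iota>_def)
        also have "\<dots> = free_eval (End_alg M) (\<lambda>x. \<lambda>m\<in>carrier M. act M x m) (gen y)" by (rule induced_hom_U[OF L])
        also have "\<dots> = (\<lambda>m\<in>carrier M. act M y m)" by (rule free_eval_gen[OF B]) (use L in \<open>simp add: lie_map_def\<close>)
        finally show ?thesis using xM by simp
      qed
      show ?thesis using x com[OF xM, of "lf y"] F(1)[OF xM, of "lf y"] F(9)[OF xM, of "lf y" c] unfolding ay by simp
    qed
  qed simp
  then have "?N = carrier M" by (rule gen) (use vM zv in simp)
  then show ?thesis using m by (auto simp: rep_def)
qed

section \<open>The trace form\<close>

definition transport :: "('m => 'n) => 'm gmod => 'n gmod" where
  "transport h M =
     \<lparr>carrier = h ` carrier M, monoid.mult = undefined, monoid.one = undefined,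
      ring.zero = h \<zero>\<^bsub>M\<^esub>,
      ring.add = (\<lambda>a b. h (inv_into (carrier M) h a \<oplus>\<^bsub>M\<^esub> inv_into (carrier M) h b)),
      smult = (\<lambda>c a. h (c \<odot>\<^bsub>M\<^esub> inv_into (carrier M) h a)),
      act = (\<lambda>x a. h (act M x (inv_into (carrier M) h a)))\<rparr>"

lemma transport_simps:
  assumes "inj_on h (carrier M)"
  shows "carrier (transport h M) = h ` carrier M" "\<zero>\<^bsub>transport h M\<^esub> = h \<zero>\<^bsub>M\<^esub>"
    "a \<in> carrier M ==> b \<in> carrier M ==> h a \<oplus>\<^bsub>transport h M\<^esub> h b = h (a \<oplus>\<^bsub>M\<^esub> b)"
    "a \<in> carrier M ==> c \<odot>\<^bsub>transport h M\<^esub> h a = h (c \<odot>\<^bsub>M\<^esub> a)"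
    "a \<in> carrier M ==> act (transport h M) x (h a) = h (act M x a)"
  using assms by (simp_all add: transport_def)

lemma transport_gmodule:
  assumes M: "gmodule M" and h: "inj_on h (carrier M)"
  shows "gmodule (transport h M)"
proof -
  interpret M: module \<CC> M using M by (simp add: gmodule_def)
  note T = transport_simps[OF h]
  have sm: "c \<odot>\<^bsub>M\<^esub> x \<in> carrier M" if "x \<in> carrier M" for c x using that M.smult_closed[of c x] by simp
  have sm1: "(c + d) \<odot>\<^bsub>M\<^esub> x = c \<odot>\<^bsub>M\<^esub> x \<oplus>\<^bsub>M\<^esub> d \<odot>\<^bsub>M\<^esub> x" "(c * d) \<odot>\<^bsub>M\<^esub> x = c \<odot>\<^bsub>M\<^esub> (d \<odot>\<^bsub>M\<^esub> x)" "1 \<odot>\<^bsub>M\<^esub> x = x"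
    if "x \<in> carrier M" for c d x
    using that M.smult_l_distr[of c d x] M.smult_assoc1[of c d x] M.smult_one[of x] by auto
  have sm2: "c \<odot>\<^bsub>M\<^esub> (x \<oplus>\<^bsub>M\<^esub> y) = c \<odot>\<^bsub>M\<^esub> x \<oplus>\<^bsub>M\<^esub> c \<odot>\<^bsub>M\<^esub> y" if "x \<in> carrier M" "y \<in> carrier M" for c x y
    using that M.smult_r_distr[of c x y] by auto
  have ab: "abelian_group (transport h M)"
  proof (rule abelian_groupI)
    show "\<exists>b\<in>carrier (transport h M). b \<oplus>\<^bsub>transport h M\<^esub> a = \<zero>\<^bsub>transport h M\<^esub>" if a: "a \<in> carrier (transport h M)" for a
    proof -
      obtain x where x: "x \<in> carrier M" "a = h x" using a T(1) by auto
      then show ?thesis by (intro bexI[of _ "h (\<ominus>\<^bsub>M\<^esub> x)"]) (simp_all add: T M.l_neg)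
    qed
  qed (unfold T(1), auto simp: T M.a_ac)
  have mod: "module \<CC> (transport h M)"
    by (rule moduleI[OF cring_\<CC> ab]) (unfold T(1), auto simp: T sm sm1 sm2)
  have minus: "h x \<ominus>\<^bsub>transport h M\<^esub> h y = h (x \<ominus>\<^bsub>M\<^esub> y)" if "x \<in> carrier M" "y \<in> carrier M" for x y
    using that module_minus[OF mod, of "h x" "h y"] module_minus[OF M.module_axioms, of x y] sm by (simp add: T)
  show ?thesis
    using M mod unfolding gmodule_def T(1) by (auto simp: T sm minus)
qed

lemma transport_highest_weight:
  assumes M: "highest_weight_module lam M" and h: "inj_on h (carrier M)"
  shows "highest_weight_module lam (transport h M)"
proof -
  have g: "gmodule M" using M by (simp add: highest_weight_module_def)
  then interpret M: module \<CC> M by (simp add: gmodule_def)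
  note T = transport_simps[OF h]
  have g': "gmodule (transport h M)" by (rule transport_gmodule[OF g h])
  then have m': "module \<CC> (transport h M)" by (simp add: gmodule_def)
  obtain v where v: "highest_weight_vector M lam v" and gen: "\<And>N. gsubmodule N M ==> v \<in> N ==> N = carrier M"
    using M unfolding highest_weight_module_def by blast
  have vM: "v \<in> carrier M" using v by (simp add: highest_weight_vector_def)
  have sm: "c \<odot>\<^bsub>M\<^esub> x \<in> carrier M" if "x \<in> carrier M" for c x using that M.smult_closed[of c x] by simp
  have ac: "act M x m \<in> carrier M" if "m \<in> carrier M" for x m using g that by (simp add: gmodule_def)
  have "highest_weight_vector (transport h M) lam (h v)"
    using v inj_on_eq_iff[OF h] unfolding highest_weight_vector_def by (auto simp: T)
  moreover have "N = carrier (transport h M)" if N: "gsubmodule N (transport h M)" and vN: "h v \<in> N" for N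
  proof -
    note i = gsubmodule_iff[OF m', of N, THEN iffD1, OF N]
    let ?N = "{x \<in> carrier M. h x \<in> N}"
    have "gsubmodule ?N M"
      unfolding gsubmodule_iff[OF M.module_axioms]
    proof (intro conjI ballI allI)
      show "\<zero>\<^bsub>M\<^esub> \<in> ?N" using i by (simp add: T)
      fix x assume x: "x \<in> ?N"
      show "c \<odot>\<^bsub>M\<^esub> x \<in> ?N" for c using x i sm by (simp flip: T(4))
      show "act M y x \<in> ?N" for y using x i ac by (simp flip: T(5))
      show "x \<oplus>\<^bsub>M\<^esub> y \<in> ?N" if "y \<in> ?N" for y using x that i by (simp flip: T(3))
    qed blast
    then have "?N = carrier M" by (rule gen) (use vM vN in simp)
    then have "h ` carrier M \<subseteq> N" by blast
    then show ?thesis using i unfolding T(1) by blast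
  qed
  ultimately show ?thesis unfolding highest_weight_module_def using g' by blast
qed

abbreviation top_weight :: "complex => complex ^ 3" where
  "top_weight al \<equiv> vector [al, 0, 0]"

lemma S_mod_highest_weight: "highest_weight_module (top_weight al) (S_mod al)"
  unfolding highest_weight_module_def
proof (intro conjI S_mod_gmodule exI[of _ "mon al 0 0"] allI impI)
  have nz: "mon al 0 0 \<noteq> 0" using mon_nonzero[of 1 al 0 0] by simp
  have a: "act (S_mod al) (matrix_unit i j) (mon al 0 0) = act1 al (gen (i, j)) (mon al 0 0)" for i j
    by (simp add: act1_simps(1) act_unit)
  have "act1 al (gen (i, i)) (mon al 0 0) = sc (top_weight al $ i) (mon al 0 0)" for i
    using exhaust_3[of i] by (auto simp: mon_step)
  then show "highest_weight_vector (S_mod al) (top_weight al) (mon al 0 0)"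
    unfolding highest_weight_vector_def a S_mod_simps(3,4) using nz by (simp add: mon_step)
  fix N assume N: "gsubmodule N (S_mod al) \<and> mon al 0 0 \<in> N"
  then have "N = {\<zero>\<^bsub>S_mod al\<^esub>} \<or> N = S al" using S_mod_irreducible[of al] by (simp add: irreducible_gmod_def)
  then show "N = S al" using N nz by (auto simp: S_mod_simps(4))
qed

text \<open>Without a module of the right highest weight among those over which \<open>harish_chandra\<close> quantifies its value
  would not be unique. The elements of the copy are the sets of operators with a given value at the
  highest weight vector.\<close>

lemma highest_weight_copy: "\<exists>M :: Uelt set gmod. highest_weight_module (top_weight al) M"
proof -
  let ?h = "\<lambda>f. {\<pi> p | p. act1 al p (mon al 0 0) = f}"
  have nz: "mon al 0 0 \<noteq> 0" using mon_nonzero[of 1 al 0 0] by simp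
  have "inj_on ?h (S al)"
  proof (rule inj_onI)
    fix f g assume f: "f \<in> S al" and e: "?h f = ?h g"
    obtain p where p: "act1 al p (mon al 0 0) = f" using S_cyclic[OF mon_in_S[OF idx_00] nz f] by blast
    then have "\<pi> p \<in> ?h g" unfolding e[symmetric] by blast
    then obtain q where "\<pi> p = \<pi> q" "act1 al q (mon al 0 0) = g" by blast
    then show "f = g" using p act1_\<pi>[of p q al] by simp
  qed
  then show ?thesis using transport_highest_weight[OF S_mod_highest_weight] by blast
qed

lemma harish_chandra_eq:
  assumes z: "\<And>i j. D i j z = 0" and c: "act1 al z (mon al 0 0) = sc c (mon al 0 0)"
  shows "harish_chandra (\<pi> z) (top_weight al) = c" "f \<in> S al ==> act1 al z f = sc c f"
proof -
  have zK: "D i j z \<in> Ker" for i j using z Ker_subsp(1) by simp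
  obtain d where d: "z - sc d 1 \<in> verma (top_weight al)" using invariant_scalar[OF z] by blast
  have "act1 al z f = sc d f" if "f \<in> S al" for f
    using highest_weight_scalar[OF S_mod_highest_weight zK d that] by (simp add: act1_def rep_def S_mod_simps(3))
  then have cd: "c = d" and s: "act1 al z f = sc c f" if "f \<in> S al" for f
  proof -
    have "sc c (mon al 0 0) = sc d (mon al 0 0)" using c \<open>\<And>f. f \<in> S al ==> act1 al z f = sc d f\<close>[of "mon al 0 0"] by simp
    then have "lookup (sc c (mon al 0 0)) (ex al 0 0) = lookup (sc d (mon al 0 0)) (ex al 0 0)" by (simp only:)
    then show "c = d" by (simp only: lookup_sc lookup_mon) simp
    then show "act1 al z f = sc c f" using \<open>\<And>f. f \<in> S al ==> act1 al z f = sc d f\<close>[OF that] by simp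
  qed
  show "f \<in> S al ==> act1 al z f = sc c f" by (rule s)
  have cd: "c = d" by (rule cd[OF S_zero])
  show "harish_chandra (\<pi> z) (top_weight al) = c"
    unfolding harish_chandra_def
  proof (rule the_equality)
    show "\<forall>M :: Uelt set gmod. highest_weight_module (top_weight al) M --> (\<forall>m\<in>carrier M. U_rep M (\<pi> z) m = c \<odot>\<^bsub>M\<^esub> m)"
    proof (intro allI impI ballI)
      fix M :: "Uelt set gmod" and m assume M: "highest_weight_module (top_weight al) M" and m: "m \<in> carrier M"
      show "U_rep M (\<pi> z) m = c \<odot>\<^bsub>M\<^esub> m" unfolding cd by (rule highest_weight_scalar[OF M zK d m])
    qed
    fix e assume e: "\<forall>M :: Uelt set gmod. highest_weight_module (top_weight al) M --> (\<forall>m\<in>carrier M. U_rep M (\<pi> z) m = e \<odot>\<^bsub>M\<^esub> m)"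
    obtain M :: "Uelt set gmod" where M: "highest_weight_module (top_weight al) M" using highest_weight_copy by blast
    then interpret M: module \<CC> M by (simp add: highest_weight_module_def gmodule_def)
    obtain v where v: "v \<in> carrier M" "v \<noteq> \<zero>\<^bsub>M\<^esub>" using M unfolding highest_weight_module_def highest_weight_vector_def by blast
    have eq: "e \<odot>\<^bsub>M\<^esub> v = d \<odot>\<^bsub>M\<^esub> v" using e M highest_weight_scalar[OF M zK d v(1)] v(1) by simp
    show "e = c"
    proof (rule ccontr)
      assume "e \<noteq> c"
      then have n: "e - d \<noteq> 0" using cd by simp
      have sm: "x \<odot>\<^bsub>M\<^esub> v \<in> carrier M" for x using v M.smult_closed[of x v] by simp
      have "(e - d) \<odot>\<^bsub>M\<^esub> v = e \<odot>\<^bsub>M\<^esub> v \<oplus>\<^bsub>M\<^esub> (- d) \<odot>\<^bsub>M\<^esub> v"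
        using M.smult_l_distr[of e "- d" v] v by simp
      also have "\<dots> = (d + - d) \<odot>\<^bsub>M\<^esub> v"
        unfolding eq using M.smult_l_distr[of d "- d" v] v by (simp only: carrier_\<CC> UNIV_I)
      also have "\<dots> = \<zero>\<^bsub>M\<^esub>" using M.smult_l_null[of v] v by simp
      finally have "(1 / (e - d)) \<odot>\<^bsub>M\<^esub> ((e - d) \<odot>\<^bsub>M\<^esub> v) = \<zero>\<^bsub>M\<^esub>" using M.smult_r_null[of "1 / (e - d)"] by simp
      then have "1 \<odot>\<^bsub>M\<^esub> v = \<zero>\<^bsub>M\<^esub>" using M.smult_assoc1[of "1 / (e - d)" "e - d" v] v n by simp
      then show False using v M.smult_one[of v] by simp
    qed
  qed
qed

definition tr :: "complex => T => complex" where
  "tr al p = harish_chandra (U_sharp (\<pi> p)) (top_weight al)"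

lemma tr_eq:
  assumes "p - z - divg r \<in> Ker" "\<And>i j. D i j z = 0" "act1 al z (mon al 0 0) = sc c (mon al 0 0)"
  shows "tr al p = c"
proof -
  have "\<pi> p = \<pi> (z + divg r)" unfolding \<pi>_eq_iff using assms(1) by (simp add: algebra_simps)
  moreover have "U_sharp (\<pi> (z + divg r)) = \<pi> z" by (rule U_sharp_eq) (simp add: assms(2) Ker_subsp(1))
  ultimately show ?thesis unfolding tr_def using harish_chandra_eq(1)[OF assms(2,3)] by simp
qed

lemma tr_ex:
  obtains z r where "p = z + divg r" "\<And>i j. D i j z = 0" "act1 al z (mon al 0 0) = sc (tr al p) (mon al 0 0)"
proof -
  obtain z r where z: "\<And>i j. D i j z = 0" "p = z + divg r"
    using invariant_decomposition[of UNIV p] by (auto simp: adsub_def)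
  obtain d where d: "z - sc d 1 \<in> verma (top_weight al)" using invariant_scalar[OF z(1)] by blast
  have zK: "D i j z \<in> Ker" for i j using z Ker_subsp(1) by simp
  have c: "act1 al z (mon al 0 0) = sc d (mon al 0 0)"
    using highest_weight_scalar[OF S_mod_highest_weight zK d mon_in_S[OF idx_00]] by (simp add: act1_def rep_def S_mod_simps(3))
  have "tr al p = d" by (rule tr_eq[OF _ z(1) c, of _ r]) (simp add: z(2) Ker_subsp(1))
  then show ?thesis using that[OF z(2) z(1)] c by simp
qed

lemma tr_add: "tr al (p + q) = tr al p + tr al q"
proof -
  obtain z r where z: "p = z + divg r" "\<And>i j. D i j z = 0" "act1 al z (mon al 0 0) = sc (tr al p) (mon al 0 0)"
    using tr_ex[of p al] by blast
  obtain z' r' where z': "q = z' + divg r'" "\<And>i j. D i j z' = 0" "act1 al z' (mon al 0 0) = sc (tr al q) (mon al 0 0)"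
    using tr_ex[of q al] by blast
  show ?thesis
  proof (rule tr_eq[of _ "z + z'" "\<lambda>i j. r i j + r' i j"])
    have "p + q - (z + z') - divg (\<lambda>i j. r i j + r' i j) = 0" unfolding z(1) z'(1) by (simp add: D_add sum.distrib)
    then show "p + q - (z + z') - divg (\<lambda>i j. r i j + r' i j) \<in> Ker" using Ker_subsp(1) by (simp only:)
    show "D i j (z + z') = 0" for i j by (simp add: D_add z z')
    show "act1 al (z + z') (mon al 0 0) = sc (tr al p + tr al q) (mon al 0 0)"
      by (simp only: act1_simps(2)[OF mon_in_S[OF idx_00]] z(3) z'(3) sc_add_left)
  qed
qed

lemma tr_Jp: "p \<in> Jp al ==> tr al p = 0"
proof -
  assume p: "p \<in> Jp al"
  obtain z r where z: "z \<in> Jp al" "\<And>i j. D i j z = 0" "p = z + divg r"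
    using invariant_decomposition[OF Jp_adsub p] by blast
  show ?thesis
    by (rule tr_eq[OF _ z(2), of _ r]) (use z in \<open>simp_all add: Ker_subsp(1) Jp_def\<close>)
qed

lemma tr_comm: "tr al (p * q) = tr al (q * p)"
proof -
  obtain z r where z: "q * p = z + divg r" "\<And>i j. D i j z = 0" "act1 al z (mon al 0 0) = sc (tr al (q * p)) (mon al 0 0)"
    using tr_ex[of "q * p" al] by blast
  obtain s where s: "p * q - q * p - divg s \<in> Ker" using comm_divg by blast
  have "p * q - z - divg (\<lambda>i j. r i j + s i j) = p * q - q * p - divg s"
    unfolding z(1) by (simp add: D_add sum.distrib)
  then have "p * q - z - divg (\<lambda>i j. r i j + s i j) \<in> Ker" using s by (simp only:)
  then show ?thesis using z(2,3) by (rule tr_eq)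
qed

lemma tr_one: "tr al 1 = 1"
  by (rule tr_eq[of _ 1 "\<lambda>i j. 0"]) (simp_all add: Ker_subsp(1) D_one act1_simps(3))

text \<open>The radical is a two-sided ideal because the trace is symmetric. It contains the annihilator but not 1, so
  maximality of the annihilator applies.\<close>

lemma tr_radical:
  assumes al: "\<nexists>m::int. m < 0 \<and> al = of_int m" and p: "\<And>q. tr al (p * q) = 0"
  shows "p \<in> Jp al"
proof -
  define K where "K = {p. \<forall>q. tr al (p * q) = 0}"
  have z: "tr al 0 = 0" by (rule tr_Jp[OF Jp_subsp(1)])
  have "ideal (\<pi> ` K) U"
  proof (rule cover_idealI[OF \<pi>_cover])
    fix p q assume "p \<in> K"
    then show "q * p \<in> K" unfolding K_def using tr_comm[of al q] by (simp add: mult.assoc)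
  qed (auto simp: K_def z tr_add distrib_right mult.assoc)
  moreover have "J al \<subseteq> \<pi> ` K" unfolding J_eq K_def using tr_Jp Jp_ideal(5) by blast
  moreover have "\<pi> ` K \<subseteq> carrier U" using P.map_closed by blast
  ultimately have "\<pi> ` K = J al \<or> \<pi> ` K = carrier U"
    using maximalideal.I_maximal[OF J_maximal[OF al]] by blast
  moreover have "\<pi> ` K \<noteq> carrier U"
  proof
    assume "\<pi> ` K = carrier U"
    then have "\<pi> 1 \<in> \<pi> ` K" using P.map_closed[of 1] by simp
    then obtain k where k: "\<pi> 1 = \<pi> k" "tr al (k * 1) = 0" unfolding K_def by blast
    then have "tr al 1 = tr al k" by (simp add: tr_def)
    then show False using k tr_one by simp
  qed
  ultimately have "\<pi> p \<in> J al" using p unfolding K_def by blast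
  then show ?thesis by (simp add: Jp_iff)
qed

section \<open>The contravariant form on the module\<close>

text \<open>The norm of a monomial in the form for which \<open>E\<^sub>i\<^sub>j\<close> and \<open>E\<^sub>j\<^sub>i\<close> are adjoint, normalized at the highest
  weight vector. No denominator vanishes on a monomial of the module.\<close>

definition nrm :: "complex => nat => nat => complex" where
  "nrm al a b = fact a * fact b / (\<Prod>i<a + b. al - of_nat i)"

lemma nrm_nonzero: "(a, b) \<in> idx al ==> nrm al a b \<noteq> 0"
  using idx_nonzero[of a b al] by (auto simp: nrm_def)

definition nrm_key :: "complex => complex ^ 3 => complex" where
  "nrm_key al k = (SOME c. \<exists>a b. k = ex al a b \<and> c = nrm al a b)"

lemma nrm_key [simp]: "nrm_key al (ex al a b) = nrm al a b"
  unfolding nrm_key_def by (rule some_equality) (auto simp: ex_inj)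

definition cform :: "complex => fexpr => fexpr => complex" where
  "cform al f g = (\<Sum>k\<in>keys f. lookup f k * lookup g k * nrm_key al k)"

lemma cform_superset:
  assumes "finite F" "keys f \<subseteq> F"
  shows "cform al f g = (\<Sum>k\<in>F. lookup f k * lookup g k * nrm_key al k)"
  unfolding cform_def using assms by (intro sum.mono_neutral_left) (auto simp: in_keys_iff)

lemma cform_sym: "cform al f g = cform al g f"
proof -
  let ?F = "keys f \<union> keys g"
  show ?thesis by (simp add: cform_superset[of ?F] mult.commute)
qed

lemma cform_add: "cform al (f + g) h = cform al f h + cform al g h"
proof -
  let ?F = "keys f \<union> keys g"
  have "keys (f + g) \<subseteq> ?F" by (rule Poly_Mapping.keys_add)
  then show ?thesis by (simp add: cform_superset[of ?F] lookup_add algebra_simps sum.distrib)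
qed

lemma cform_sc: "cform al (sc c f) h = c * cform al f h"
  by (simp only: cform_superset[of "keys f", OF finite_keys] cform_def[of al f h] keys_sc lookup_sc
      sum_distrib_left mult.assoc)

lemma cform_add_right: "cform al h (f + g) = cform al h f + cform al h g"
  by (simp add: cform_sym[of al h] cform_add)

lemma cform_sc_right: "cform al h (sc c f) = c * cform al h f"
  by (simp only: cform_sym[of al h] cform_sc)

lemma cform_zero [simp]: "cform al 0 g = 0" "cform al g 0 = 0"
  by (simp_all add: cform_def)

lemma cform_mon: "cform al (mon al a b) (mon al c d) = (if a = c \<and> b = d then nrm al a b else 0)"
proof -
  have "cform al (mon al a b) (mon al c d) = (\<Sum>k\<in>{ex al a b}. lookup (mon al a b) k * lookup (mon al c d) k * nrm_key al k)"
    by (rule cform_superset) (auto simp: mon_def)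
  then show ?thesis by (auto simp: lookup_mon)
qed

lemma cform_nondegenerate:
  assumes "f \<in> S al" "\<And>g. g \<in> S al ==> cform al f g = 0"
  shows "f = 0"
proof (rule poly_mapping_eqI, rule ccontr)
  fix k assume n: "lookup f k \<noteq> lookup 0 k"
  then have "k \<in> keys f" by (simp add: in_keys_iff)
  then obtain a b where k: "k = ex al a b" "(a, b) \<in> idx al" using S_keys[OF assms(1)] by blast
  have "cform al (mon al a b) f = (\<Sum>k\<in>{ex al a b}. lookup (mon al a b) k * lookup f k * nrm_key al k)"
    by (rule cform_superset) (auto simp: mon_def)
  then have "cform al f (mon al a b) = lookup f k * nrm al a b"
    by (simp add: cform_sym[of al f] lookup_mon k)
  then show False using assms(2)[of "mon al a b"] nrm_nonzero[OF k(2)] n k(2) by simp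
qed

definition adjoint_pair :: "complex => T => T => bool" where
  "adjoint_pair al p q \<longleftrightarrow> (\<forall>f\<in>S al. \<forall>g\<in>S al. cform al (act1 al p f) g = cform al f (act1 al q g))"

lemma adjoint_pair_monI:
  assumes "\<And>a b c d. (a, b) \<in> idx al ==> (c, d) \<in> idx al ==>
    cform al (act1 al p (mon al a b)) (mon al c d) = cform al (mon al a b) (act1 al q (mon al c d))"
  shows "adjoint_pair al p q"
  unfolding adjoint_pair_def
proof (intro ballI)
  fix f g assume "f \<in> S al" and g: "g \<in> S al"
  from this(1) show "cform al (act1 al p f) g = cform al f (act1 al q g)"
  proof (induction f rule: S_induct)
    case (monomial a b c)
    note ab = monomial
    from g have "cform al (act1 al p (mon al a b)) g = cform al (mon al a b) (act1 al q g)"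
    proof (induction g rule: S_induct)
      case (monomial a' b' c')
      then show ?case using assms[OF ab monomial] by (simp only: act1_sc(2)[OF mon_in_S] cform_sc_right)
    next
      case (add f g) then show ?case by (simp only: act1_simps(8) cform_add_right)
    qed simp
    then show ?case by (simp only: act1_sc(2)[OF mon_in_S[OF ab]] cform_sc)
  next
    case (add f h) then show ?case by (simp only: act1_simps(8) cform_add)
  qed simp
qed

lemma adjoint_pair_sym: "adjoint_pair al p q ==> adjoint_pair al q p"
  unfolding adjoint_pair_def by (metis cform_sym)

lemma nrm_step:
  assumes "(Suc a, b) \<in> idx al"
  shows "of_nat (Suc a) * nrm al a b = (al - of_nat a - of_nat b) * nrm al (Suc a) b"
    and "(a, Suc b) \<in> idx al ==> of_nat (Suc b) * nrm al a b = (al - of_nat a - of_nat b) * nrm al a (Suc b)"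
proof -
  have "al - of_nat (a + b) \<noteq> 0" using assms by (intro idx_nonzero) auto
  then have n: "al - of_nat a - of_nat b \<noteq> 0" by (simp add: algebra_simps)
  have P: "(\<Prod>i<Suc (a + b). al - of_nat i) = (\<Prod>i<a + b. al - of_nat i) * (al - of_nat a - of_nat b)"
    by (simp add: algebra_simps)
  have cancel: "c * (x / p) = n * (c * x / (p * n))" if "n \<noteq> 0" for c x p n :: complex using that by simp
  show "of_nat (Suc a) * nrm al a b = (al - of_nat a - of_nat b) * nrm al (Suc a) b"
    using cancel[OF n, of "of_nat (Suc a)" "fact a * fact b"] by (simp only: nrm_def add_Suc add_Suc_right P fact_Suc mult.assoc of_nat_mult)
  show "(a, Suc b) \<in> idx al ==> of_nat (Suc b) * nrm al a b = (al - of_nat a - of_nat b) * nrm al a (Suc b)"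
    using cancel[OF n, of "of_nat (Suc b)" "fact a * fact b"] by (simp only: nrm_def add_Suc add_Suc_right P fact_Suc mult.assoc mult.left_commute of_nat_mult)
qed

lemma adjoint_pair_gen: "adjoint_pair al (gen (i, j)) (gen (j, i))"
proof -
  have up: "(Suc a, b) \<in> idx al \<longleftrightarrow> (a, Suc b) \<in> idx al" for a b by (simp add: idx_def)
  have 12: "adjoint_pair al (gen (1, 2)) (gen (2, 1))"
  proof (rule adjoint_pair_monI)
    fix a b c d assume "(a, b) \<in> idx al" "(c, d) \<in> idx al"
    then show "cform al (act1 al (gen (1, 2)) (mon al a b)) (mon al c d) = cform al (mon al a b) (act1 al (gen (2, 1)) (mon al c d))"
      using nrm_step(1)[of c d al] by (cases a) (auto simp: mon_step cform_sc cform_sc_right cform_mon)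
  qed
  have 13: "adjoint_pair al (gen (1, 3)) (gen (3, 1))"
  proof (rule adjoint_pair_monI)
    fix a b c d assume "(a, b) \<in> idx al" "(c, d) \<in> idx al"
    then show "cform al (act1 al (gen (1, 3)) (mon al a b)) (mon al c d) = cform al (mon al a b) (act1 al (gen (3, 1)) (mon al c d))"
      using nrm_step(2)[of c d al] up[of c d] by (cases b) (auto simp: mon_step cform_sc cform_sc_right cform_mon)
  qed
  have 23: "adjoint_pair al (gen (2, 3)) (gen (3, 2))"
  proof (rule adjoint_pair_monI)
    fix a b c d assume "(a, b) \<in> idx al" "(c, d) \<in> idx al"
    moreover have "of_nat (Suc y) * nrm al (Suc x) y = of_nat (Suc x) * nrm al x (Suc y)" for x y
      by (simp add: nrm_def)
    ultimately show "cform al (act1 al (gen (2, 3)) (mon al a b)) (mon al c d) = cform al (mon al a b) (act1 al (gen (3, 2)) (mon al c d))"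
      by (cases b; cases c) (auto simp: mon_step cform_sc cform_sc_right cform_mon)
  qed
  have d: "adjoint_pair al (gen (i, i)) (gen (i, i))" for i
  proof (rule adjoint_pair_monI)
    fix a b c d assume "(a, b) \<in> idx al" "(c, d) \<in> idx al"
    then show "cform al (act1 al (gen (i, i)) (mon al a b)) (mon al c d) = cform al (mon al a b) (act1 al (gen (i, i)) (mon al c d))"
      using exhaust_3[of i] by (auto simp: mon_step cform_sc cform_sc_right cform_mon)
  qed
  show ?thesis using exhaust_3[of i] exhaust_3[of j] 12 13 23 d adjoint_pair_sym by auto
qed

lemma omega_adjoint:
  "\<exists>q. \<omega> (\<pi> p) = \<pi> q \<and> \<omega> (\<pi> q) = \<pi> p \<and> adjoint_pair al p q"
proof -
  have "p \<in> words UNIV" by simp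
  then show ?thesis
  proof (induction p rule: free_induct)
    case one
    have "adjoint_pair al 1 1" by (simp add: adjoint_pair_def act1_simps(3))
    then show ?case using omega_facts(5) P.map_one by (intro exI[of _ 1]) simp
  next
    case (gen x p)
    obtain i j where x: "x = (i, j)" by fastforce
    obtain q where q: "\<omega> (\<pi> p) = \<pi> q" "\<omega> (\<pi> q) = \<pi> p" and a: "adjoint_pair al p q" using gen by auto
    have "adjoint_pair al (Defs.gen x * p) (q * Defs.gen (j, i))"
      using a adjoint_pair_gen[of al i j] unfolding adjoint_pair_def x by (simp add: act1_simps(5))
    then show ?case using q
      using omega_facts(3)[of "Defs.gen (i, j)" p] omega_facts(3)[of q "Defs.gen (j, i)"]
      by (intro exI[of _ "q * Defs.gen (j, i)"]) (simp add: x omega_facts(6) P.map_mult)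
  next
    case (sc c p)
    obtain q where q: "\<omega> (\<pi> p) = \<pi> q" "\<omega> (\<pi> q) = \<pi> p" and a: "adjoint_pair al p q" using sc by auto
    have "adjoint_pair al (sc c p) (sc c q)"
      unfolding adjoint_pair_def
    proof (intro ballI)
      fix f g assume f: "f \<in> S al" and g: "g \<in> S al"
      show "cform al (act1 al (sc c p) f) g = cform al f (act1 al (sc c q) g)"
        unfolding act1_sc(1)[OF f] act1_sc(1)[OF g] cform_sc cform_sc_right
        using a f g unfolding adjoint_pair_def by simp
    qed
    then show ?case using q omega_facts(4)[of c p] omega_facts(4)[of c q]
      by (intro exI[of _ "sc c q"]) (simp add: P.map_sc)
  next
    case (add p p')
    obtain q q' where q: "\<omega> (\<pi> p) = \<pi> q" "\<omega> (\<pi> q) = \<pi> p" "\<omega> (\<pi> p') = \<pi> q'" "\<omega> (\<pi> q') = \<pi> p'"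
      and a: "adjoint_pair al p q" "adjoint_pair al p' q'" using add by auto
    have "adjoint_pair al (p + p') (q + q')"
      using a unfolding adjoint_pair_def by (simp add: act1_simps(2) cform_add cform_add_right)
    then show ?case using q omega_facts(2)[of p p'] omega_facts(2)[of q q']
      by (intro exI[of _ "q + q'"]) (simp add: P.map_add)
  qed
qed

lemma adjoint_Jp: "adjoint_pair al p q ==> p \<in> Jp al ==> q \<in> Jp al"
proof -
  assume a: "adjoint_pair al p q" and p: "p \<in> Jp al"
  have "act1 al q g = 0" if g: "g \<in> S al" for g
  proof (rule cform_nondegenerate)
    show "act1 al q g \<in> S al" using g by simp
    fix f assume f: "f \<in> S al"
    have "cform al f (act1 al q g) = cform al (act1 al p f) g" using a f g by (simp add: adjoint_pair_def)
    then show "cform al (act1 al q g) f = 0" using p f by (simp add: cform_sym[of al _ f] Jp_def)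
  qed
  then show ?thesis by (simp add: Jp_def)
qed

theorem form_nondegenerate:
  assumes al: "\<nexists>m::int. m < 0 \<and> al = of_int m"
  shows "\<exists>B :: Uelt set => Uelt set => complex.
         (\<forall>u\<in>carrier U. \<forall>v\<in>carrier U. B (\<AA>_class al u) (\<AA>_class al v) = U_form al u v) \<and>
         (\<forall>a\<in>carrier (\<AA> al). (\<forall>b\<in>carrier (\<AA> al). B a b = 0) --> a = \<zero>\<^bsub>\<AA> al\<^esub>) \<and>
         (\<forall>b\<in>carrier (\<AA> al). (\<forall>a\<in>carrier (\<AA> al). B a b = 0) --> b = \<zero>\<^bsub>\<AA> al\<^esub>)"
proof -
  interpret K: cover "\<AA> al" UNIV "\<kappa> al" by (rule \<kappa>_cover)
  have "\<forall>p. \<exists>q. \<omega> (\<pi> p) = \<pi> q \<and> \<omega> (\<pi> q) = \<pi> p \<and> adjoint_pair al p q" using omega_adjoint by blast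
  from choice[OF this] obtain w where w: "\<forall>p. \<omega> (\<pi> p) = \<pi> (w p) \<and> \<omega> (\<pi> (w p)) = \<pi> p \<and> adjoint_pair al p (w p)" by blast
  have form: "U_form al (\<pi> p) (\<pi> q) = tr al (p * w q)" for p q
    using w by (simp add: U_form_def tr_def P.map_mult)
  have tr_diff: "tr al p = tr al q" if "p - q \<in> Jp al" for p q
    using tr_add[of al "p - q" q] tr_Jp[OF that] by simp
  have wJ: "w p - w q \<in> Jp al" if d: "p - q \<in> Jp al" for p q
  proof (rule adjoint_Jp[OF _ d])
    show "adjoint_pair al (p - q) (w p - w q)"
      unfolding adjoint_pair_def
    proof (intro ballI)
      fix f g assume f: "f \<in> S al" and g: "g \<in> S al"
      have "cform al (act1 al p f) g = cform al f (act1 al (w p) g)" "cform al (act1 al q f) g = cform al f (act1 al (w q) g)"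
        using w f g unfolding adjoint_pair_def by blast+
      moreover have "cform al (x - y) g = cform al x g - cform al y g" "cform al f (x - y) = cform al f x - cform al f y" for x y
        using cform_add[of al "x - y" y g] cform_add_right[of al f "x - y" y] by simp_all
      ultimately show "cform al (act1 al (p - q) f) g = cform al f (act1 al (w p - w q) g)"
        using f g by (simp add: act1_simps(7))
    qed
  qed
  define B where "B a b = tr al ((SOME p. \<kappa> al p = a) * w (SOME p. \<kappa> al p = b))" for a b
  have B: "B (\<kappa> al p) (\<kappa> al q) = tr al (p * w q)" for p q
  proof -
    define p' q' where "p' = (SOME x. \<kappa> al x = \<kappa> al p)" and "q' = (SOME x. \<kappa> al x = \<kappa> al q)"
    have "\<kappa> al p' = \<kappa> al p" "\<kappa> al q' = \<kappa> al q" unfolding p'_def q'_def by (rule someI, rule refl)+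
    then have 1: "p' - p \<in> Jp al" "w q' - w q \<in> Jp al" using wJ by (simp_all add: \<kappa>_eq)
    have "p' * w q' - p * w q = (p' - p) * w q' + p * (w q' - w q)" by (simp add: algebra_simps)
    also have "\<dots> \<in> Jp al" by (rule Jp_subsp(2)[OF Jp_ideal(5)[OF 1(1)] Jp_ideal(4)[OF 1(2)]])
    finally show ?thesis unfolding B_def p'_def[symmetric] q'_def[symmetric] by (rule tr_diff)
  qed
  have ww: "\<exists>q'. tr al (p * w q') = tr al (p * q)" for p q
  proof -
    have "\<pi> (w (w q)) = \<pi> q" using w by metis
    then have "\<pi> (p * w (w q)) = \<pi> (p * q)" by (simp add: P.map_mult)
    then show ?thesis by (intro exI[of _ "w q"]) (simp add: tr_def)
  qed
  show ?thesis
  proof (intro exI[of _ B] conjI ballI impI)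
    fix u v assume "u \<in> carrier U" "v \<in> carrier U"
    then obtain p q where "u = \<pi> p" "v = \<pi> q" unfolding P.surj by blast
    then show "B (\<AA>_class al u) (\<AA>_class al v) = U_form al u v" using B[of p q] form[of p q] by (simp add: \<kappa>_def)
  next
    fix a assume "a \<in> carrier (\<AA> al)" and z: "\<forall>b\<in>carrier (\<AA> al). B a b = 0"
    then obtain p where p: "a = \<kappa> al p" unfolding K.surj by blast
    have t: "tr al (p * w q) = 0" for q using z K.map_closed[of q] B[of p q] unfolding p by simp
    have "p \<in> Jp al"
    proof (rule tr_radical[OF al])
      fix q show "tr al (p * q) = 0" using ww[of p q] t by metis
    qed
    then show "a = \<zero>\<^bsub>\<AA> al\<^esub>" by (simp add: p \<kappa>_zero)
  next
    fix b assume "b \<in> carrier (\<AA> al)" and z: "\<forall>a\<in>carrier (\<AA> al). B a b = 0"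
    then obtain q where q: "b = \<kappa> al q" unfolding K.surj by blast
    have t: "tr al (p * w q) = 0" for p using z K.map_closed[of p] B[of p q] unfolding q by simp
    have "w q \<in> Jp al" by (rule tr_radical[OF al]) (use t tr_comm in metis)
    moreover have "adjoint_pair al (w q) q" using w adjoint_pair_sym by blast
    ultimately have "q \<in> Jp al" by (rule adjoint_Jp[rotated])
    then show "b = \<zero>\<^bsub>\<AA> al\<^esub>" by (simp add: q \<kappa>_zero)
  qed
qed

section \<open>The base ring as functions on a plane\<close>

text \<open>One definition of substitution serves for values in the complex numbers and, in \<open>translate\<close>, for
  polynomials again.\<close>

definition pev :: "(complex => 'a::comm_ring_1) => (3 => 'a) => poly3 => 'a" where
  "pev j v p = (\<Sum>k\<in>keys p. j (lookup p k) * (\<Prod>i\<in>UNIV. v i ^ lookup k i))"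

definition scalars :: "(complex => 'a::comm_ring_1) => bool" where
  "scalars j \<longleftrightarrow> j 0 = 0 \<and> j 1 = 1 \<and> (\<forall>c d. j (c + d) = j c + j d \<and> j (c * d) = j c * j d)"

lemma scalars_instances: "scalars (\<lambda>c :: complex. c)" "scalars (\<lambda>c. single 0 c :: poly3)"
  by (auto simp: scalars_def single_add mult_single)

lemma pev_superset:
  assumes j: "scalars j" and "finite F" "keys p \<subseteq> F"
  shows "pev j v p = (\<Sum>k\<in>F. j (lookup p k) * (\<Prod>i\<in>UNIV. v i ^ lookup k i))"
  unfolding pev_def using assms by (intro sum.mono_neutral_left) (auto simp: in_keys_iff scalars_def)

lemma pev_add: "scalars j ==> pev j v (p + q) = pev j v p + pev j v q"
proof -
  assume j: "scalars j"
  let ?F = "keys p \<union> keys q"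
  have "keys (p + q) \<subseteq> ?F" by (rule Poly_Mapping.keys_add)
  then show ?thesis using j
    by (simp add: pev_superset[of _ ?F] lookup_add scalars_def distrib_right sum.distrib)
qed

lemma pev_single: "scalars j ==> pev j v (single k c) = j c * (\<Prod>i\<in>UNIV. v i ^ lookup k i)"
  by (subst pev_superset[of _ "{k}"]) simp_all

lemma pev_zero: "scalars j ==> pev j v 0 = 0" by (simp add: pev_def)

lemma pev_mult: "scalars j ==> pev j v (p * q) = pev j v p * pev j v q"
proof -
  assume j: "scalars j"
  show ?thesis
  proof (induction p rule: poly_mapping_induct)
    case (single k c)
    show ?case
    proof (induction q rule: poly_mapping_induct)
      case (single l d)
      then show ?case using j
        by (simp add: mult_single pev_single lookup_add power_add prod.distrib scalars_def mult_ac)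
    qed (simp_all add: pev_zero[OF j] pev_add[OF j] distrib_left)
  qed (simp_all add: pev_zero[OF j] pev_add[OF j] distrib_right)
qed

lemma pev_sc: "scalars j ==> pev j v (sc c p) = j c * pev j v p"
  by (simp add: pev_mult pev_single)

lemma pev_var: "scalars j ==> pev j v (poly3_var i) = v i"
proof -
  assume j: "scalars j"
  have "(\<Prod>l\<in>UNIV. v l ^ lookup (single i 1) l) = (\<Prod>l\<in>UNIV. if l = i then v i else 1)"
    by (intro prod.cong) (auto simp: lookup_single when_def)
  then show ?thesis using j by (simp add: poly3_var_def pev_single scalars_def)
qed

lemma pev_one: "scalars j ==> pev j v 1 = 1"
  using pev_single[of j v 0 1] by (simp add: scalars_def)

lemma pev_diff: "scalars j ==> pev j v (p - q) = pev j v p - pev j v q"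
  using pev_add[of j v "p - q" q] by simp

lemmas pev_hom = pev_add pev_mult pev_var pev_one pev_diff pev_zero

lemma poly3_induct [case_names one sc add var]:
  assumes "P 1" and "\<And>c p. P p ==> P (sc c p)" and "\<And>p q. P p ==> P q ==> P (p + q)"
    and var: "\<And>i p. P p ==> P (poly3_var i * p)"
  shows "P (p :: poly3)"
proof (induction p rule: poly_mapping_induct)
  case zero show ?case using assms(2)[OF assms(1), of 0] by simp
next
  case (single k c)
  have "P (single k 1)" for k
  proof (induction "\<Sum>i\<in>UNIV. lookup k i" arbitrary: k rule: less_induct)
    case less
    show ?case
    proof (cases "k = 0")
      case True then show ?thesis using assms(1) by simp
    next
      case False
      then obtain i where i: "lookup k i \<noteq> 0" by (metis poly_mapping_eqI lookup_zero)
      define l where "l = k - single i 1"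
      have k: "k = single i 1 + l"
      proof (rule poly_mapping_eqI)
        fix x show "lookup k x = lookup (single i 1 + l) x"
          using i by (auto simp: l_def lookup_add lookup_minus lookup_single when_def)
      qed
      have "(\<Sum>x\<in>UNIV. lookup k x) = (\<Sum>x\<in>UNIV. lookup (single i 1) x) + (\<Sum>x\<in>UNIV. lookup l x)"
        by (simp only: k lookup_add sum.distrib)
      moreover have "(\<Sum>x\<in>UNIV. lookup (single i (1::nat)) x) = 1"
        by (simp add: lookup_single when_def)
      ultimately have "P (single l 1)" using less[of l] by simp
      then have "P (poly3_var i * single l 1)" by (rule var)
      then show ?thesis by (simp only: poly3_var_def mult_single k[symmetric] mult_1)
    qed
  qed
  then have "P (sc c (single k 1))" by (rule assms(2))
  then show ?case by simp
next
  case (add p q) then show ?case by (rule assms(3))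
qed

abbreviation peval :: "complex ^ 3 => poly3 => complex" where
  "peval v \<equiv> pev (\<lambda>c. c) (($) v)"

abbreviation plane :: "complex => (complex ^ 3) set" where
  "plane al \<equiv> {v. v $ 1 + v $ 2 + v $ 3 = al}"

abbreviation poly3_const :: "complex => poly3" where
  "poly3_const c \<equiv> single 0 c"

lemma peval_hom: "peval v (p + q) = peval v p + peval v q" "peval v (p * q) = peval v p * peval v q"
  "peval v (poly3_var i) = v $ i" "peval v 1 = 1" "peval v (p - q) = peval v p - peval v q" "peval v 0 = 0"
  "peval v (poly3_const c) = c"
  using scalars_instances(1) by (simp_all add: pev_hom pev_single)

lemma cover_poly3: "cover poly3_alg UNIV (\<lambda>p. p)"
  unfolding poly3_alg_def by (rule cover_monoid_alg) simp

lemma vanishing_ideal: "ideal {p. \<forall>v\<in>V. peval v p = 0} poly3_alg"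
  using cover_idealI[OF cover_poly3, of "{p. \<forall>v\<in>V. peval v p = 0}"] by (simp add: peval_hom)

lemma R_ideal_ideal: "ideal (R_ideal al) poly3_alg"
proof -
  interpret C: cover poly3_alg UNIV "\<lambda>p. p" by (rule cover_poly3)
  show ?thesis unfolding R_ideal_def by (rule C.genideal_ideal) (simp add: C.surj)
qed

lemma R_ideal_vanishes:
  assumes "p \<in> R_ideal al" "v \<in> plane al"
  shows "peval v p = 0"
proof -
  interpret C: cover poly3_alg UNIV "\<lambda>p. p" by (rule cover_poly3)
  have "R_ideal al \<subseteq> {p. \<forall>v\<in>plane al. peval v p = 0}"
    unfolding R_ideal_def by (rule C.genideal_minimal[OF vanishing_ideal]) (simp add: peval_hom)
  then show ?thesis using assms by blast
qed

lemma R_ideal_facts: "0 \<in> R_ideal al" "p \<in> R_ideal al ==> q \<in> R_ideal al ==> p + q \<in> R_ideal al"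
  "p \<in> R_ideal al ==> q * p \<in> R_ideal al"
  using cover_idealD[OF cover_poly3 R_ideal_ideal[of al]] by auto

lemma R_ideal_gen: "poly3_var 1 + poly3_var 2 + poly3_var 3 - poly3_const al \<in> R_ideal al"
proof -
  interpret C: cover poly3_alg UNIV "\<lambda>p. p" by (rule cover_poly3)
  show ?thesis unfolding R_ideal_def by (rule C.genideal_self'[unfolded atomize_imp, simplified])
qed

text \<open>Normal forms modulo the ideal.\<close>

abbreviation poly2 :: "((nat \<times> nat) \<Rightarrow>\<^sub>0 complex) => poly3" where
  "poly2 \<equiv> lext (\<lambda>(m, n). poly3_var 2 ^ m * poly3_var 3 ^ n)"

lemma poly2_mult_var:
  "\<exists>e'. poly3_var 2 * poly2 e = poly2 e'" "\<exists>e'. poly3_var 3 * poly2 e = poly2 e'"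
proof -
  have "\<exists>e'. q * poly2 e = poly2 e'" if step: "\<And>m n. \<exists>m' n'. q * (poly3_var 2 ^ m * poly3_var 3 ^ n) = poly3_var 2 ^ m' * poly3_var 3 ^ n'" for q
  proof (induction e rule: poly_mapping_induct)
    case zero show ?case by (intro exI[of _ 0]) simp
  next
    case (single k c)
    obtain m n where k: "k = (m, n)" by (cases k)
    obtain m' n' where "q * (poly3_var 2 ^ m * poly3_var 3 ^ n) = poly3_var 2 ^ m' * poly3_var 3 ^ n'" using step by blast
    then have "sc c (q * (poly3_var 2 ^ m * poly3_var 3 ^ n)) = poly2 (single (m', n') c)"
      by (simp add: lext_single)
    then have "q * poly2 (single k c) = poly2 (single (m', n') c)"
      unfolding k lext_single[of _ "(m, n)"] prod.case sc_mult_right[of q] .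
    then show ?case by (rule exI)
  next
    case (add e f)
    then obtain e' f' where "q * poly2 e = poly2 e'" "q * poly2 f = poly2 f'" by blast
    then show ?case by (intro exI[of _ "e' + f'"]) (simp only: lext_add distrib_left)
  qed
  note * = this
  show "\<exists>e'. poly3_var 2 * poly2 e = poly2 e'"
  proof (rule *)
    show "\<exists>m' n'. poly3_var 2 * (poly3_var 2 ^ m * poly3_var 3 ^ n) = poly3_var 2 ^ m' * poly3_var 3 ^ n'" for m n
      by (intro exI[of _ "Suc m"] exI[of _ n]) (simp only: power_Suc mult.assoc)
  qed
  show "\<exists>e'. poly3_var 3 * poly2 e = poly2 e'"
  proof (rule *)
    show "\<exists>m' n'. poly3_var 3 * (poly3_var 2 ^ m * poly3_var 3 ^ n) = poly3_var 2 ^ m' * poly3_var 3 ^ n'" for m n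
      by (intro exI[of _ m] exI[of _ "Suc n"]) (simp only: power_Suc mult.left_commute)
  qed
qed

lemma reduce_to_poly2: "\<exists>e. p - poly2 e \<in> R_ideal al"
proof (induction p rule: poly3_induct)
  case one
  show ?case by (intro exI[of _ "single (0, 0) 1"]) (simp add: lext_single R_ideal_facts)
next
  case (sc c p)
  then obtain e where "p - poly2 e \<in> R_ideal al" by blast
  then have "sc c (p - poly2 e) \<in> R_ideal al" by (rule R_ideal_facts)
  then show ?case by (intro exI[of _ "sc c e"]) (simp only: lext_sc right_diff_distrib)
next
  case (add p q)
  then obtain e f where "p - poly2 e \<in> R_ideal al" "q - poly2 f \<in> R_ideal al" by blast
  then have "(p - poly2 e) + (q - poly2 f) \<in> R_ideal al" by (rule R_ideal_facts)
  then show ?case by (intro exI[of _ "e + f"]) (simp only: lext_add algebra_simps)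
next
  case (var i p)
  then obtain e where e: "p - poly2 e \<in> R_ideal al" by blast
  obtain e2 e3 where e2: "poly3_var 2 * poly2 e = poly2 e2" and e3: "poly3_var 3 * poly2 e = poly2 e3"
    using poly2_mult_var by metis
  have red: "poly3_var i * (p - poly2 e) \<in> R_ideal al" for i using e by (rule R_ideal_facts)
  consider "i = 1" | "i = 2" | "i = 3" using exhaust_3 by blast
  then show ?case
  proof cases
    case 1
    have "poly2 e * (poly3_var 1 + poly3_var 2 + poly3_var 3 - poly3_const al) \<in> R_ideal al"
      using R_ideal_gen by (rule R_ideal_facts)
    from R_ideal_facts(2)[OF red[of 1] this]
    have "poly3_var 1 * p + poly3_var 2 * poly2 e + poly3_var 3 * poly2 e - poly3_const al * poly2 e \<in> R_ideal al"
      by (simp add: algebra_simps)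
    moreover have "poly3_const al * poly2 e - poly2 e2 - poly2 e3 = poly2 (sc al e + sc (-1) e2 + sc (-1) e3)"
      by (simp only: lext_add lext_sc) (simp add: sc_minus_one)
    ultimately show ?thesis unfolding 1 e2 e3 by (intro exI[of _ "sc al e + sc (-1) e2 + sc (-1) e3"]) (simp add: algebra_simps)
  next
    case 2
    show ?thesis using red[of 2] unfolding 2 right_diff_distrib e2 by blast
  next
    case 3
    show ?thesis using red[of 3] unfolding 3 right_diff_distrib e3 by blast
  qed
qed

lemma peval_poly2:
  assumes "\<And>m n. (m, n) \<in> keys e ==> m \<le> N \<and> n \<le> N"
  shows "peval v (poly2 e) = (\<Sum>n\<le>N. (\<Sum>m\<le>N. lookup e (m, n) * v $ 2 ^ m) * v $ 3 ^ n)"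
proof -
  have pw: "peval v (p ^ n) = peval v p ^ n" for p n by (induction n) (simp_all add: peval_hom)
  have "keys e \<subseteq> {..N} \<times> {..N}" using assms by auto
  then have *: "poly2 e = (\<Sum>x\<in>{..N} \<times> {..N}. sc (lookup e x) (case x of (m, n) => poly3_var 2 ^ m * poly3_var 3 ^ n))"
    by (intro lext_superset) auto
  have sm: "peval v (sum h F) = (\<Sum>x\<in>F. peval v (h x))" for h and F :: "'x set"
    by (induction F rule: infinite_finite_induct) (simp_all add: peval_hom)
  have "peval v (poly2 e) = (\<Sum>(m, n)\<in>{..N} \<times> {..N}. lookup e (m, n) * v $ 2 ^ m * v $ 3 ^ n)"
    unfolding * sm by (intro sum.cong) (auto simp: peval_hom pw)
  also have "\<dots> = (\<Sum>m\<le>N. \<Sum>n\<le>N. lookup e (m, n) * v $ 2 ^ m * v $ 3 ^ n)"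
    by (simp only: sum.cartesian_product)
  finally show ?thesis unfolding sum_distrib_right by (subst sum.swap) simp
qed

lemma polynomial_vanishing_on_nat:
  assumes "\<And>x :: nat. (\<Sum>i\<le>N. c i * of_nat x ^ i) = (0 :: complex)" "i \<le> N"
  shows "c i = 0"
proof (rule ccontr)
  assume "c i \<noteq> 0"
  then have "finite {z. (\<Sum>i\<le>N. c i * z ^ i) = 0}" using polyfun_finite_roots[where c = c and n = N] assms(2) by blast
  moreover have "range (of_nat :: nat => complex) \<subseteq> {z. (\<Sum>i\<le>N. c i * z ^ i) = 0}" using assms(1) by auto
  ultimately have "finite (range (of_nat :: nat => complex))" by (rule finite_subset[rotated])
  then show False using finite_imageD[OF _ inj_of_nat] by blast
qed

text \<open>The ideal is the vanishing ideal of the plane, and the exponents \<open>ex al a b\<close> are already Zariski dense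
  in it: modulo the ideal a polynomial depends on the last two variables only, and it vanishes if it does at
  all pairs of natural numbers.\<close>

lemma R_ideal_iff_exponents: "p \<in> R_ideal al \<longleftrightarrow> (\<forall>a b. peval (ex al a b) p = 0)"
proof
  assume z: "\<forall>a b. peval (ex al a b) p = 0"
  obtain e where e: "p - poly2 e \<in> R_ideal al" using reduce_to_poly2 by blast
  have pl: "ex al a b \<in> plane al" for a b by simp
  have ze: "peval (ex al a b) (poly2 e) = 0" for a b
    using R_ideal_vanishes[OF e pl[of a b]] z by (simp add: peval_hom)
  define N where "N = Max (insert 0 (fst ` keys e \<union> snd ` keys e))"
  have N: "m \<le> N \<and> n \<le> N" if "(m, n) \<in> keys e" for m n
    unfolding N_def using that by (auto intro!: Max_ge simp: image_iff Bex_def)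
  have "lookup e (m, n) = 0" for m n
  proof (cases "m \<le> N \<and> n \<le> N")
    case True
    have s: "(\<Sum>n\<le>N. (\<Sum>m\<le>N. lookup e (m, n) * of_nat a ^ m) * of_nat b ^ n) = 0" for a b
      using ze[of a b] peval_poly2[of e N "ex al a b", OF N] by simp
    have "(\<Sum>m\<le>N. lookup e (m, n) * of_nat a ^ m) = 0" for a
      by (rule polynomial_vanishing_on_nat[where N = N and c = "\<lambda>n. (\<Sum>m\<le>N. lookup e (m, n) * of_nat a ^ m)"]) (use s True in auto)
    then show ?thesis by (rule polynomial_vanishing_on_nat[where N = N and c = "\<lambda>m. lookup e (m, n)"]) (use True in auto)
  next
    case False then show ?thesis using N by (auto simp: in_keys_iff)
  qed
  then have "e = 0" by (intro poly_mapping_eqI) auto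
  then show "p \<in> R_ideal al" using e by simp
qed (use R_ideal_vanishes in auto)

definition rcl :: "complex => poly3 => poly3 set" where
  "rcl al p = R_ideal al +>\<^bsub>poly3_alg\<^esub> p"

lemma R_cover: "cover (R_alg al) UNIV (rcl al)"
proof -
  have "rcl al = (\<lambda>p. R_ideal al +>\<^bsub>poly3_alg\<^esub> p)" by (simp add: fun_eq_iff rcl_def)
  then show ?thesis unfolding R_alg_def using cover_quot(1)[OF cover_poly3 R_ideal_ideal] by simp
qed

interpretation R: cover "R_alg al" UNIV "rcl al" for al by (rule R_cover)

lemma rcl_eq: "rcl al p = rcl al q \<longleftrightarrow> (\<forall>v\<in>plane al. peval v p = peval v q)"
  and rcl_eq_exponents: "rcl al p = rcl al q \<longleftrightarrow> (\<forall>a b. peval (ex al a b) p = peval (ex al a b) q)"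
proof -
  have *: "rcl al p = rcl al q \<longleftrightarrow> p - q \<in> R_ideal al"
    unfolding rcl_def using cover_quot(2)[OF cover_poly3 R_ideal_ideal] by simp
  show "rcl al p = rcl al q \<longleftrightarrow> (\<forall>a b. peval (ex al a b) p = peval (ex al a b) q)"
    unfolding * R_ideal_iff_exponents by (simp add: peval_hom)
  show "rcl al p = rcl al q \<longleftrightarrow> (\<forall>v\<in>plane al. peval v p = peval v q)"
  proof
    assume "rcl al p = rcl al q"
    then have "p - q \<in> R_ideal al" by (simp add: *)
    from R_ideal_vanishes[OF this] show "\<forall>v\<in>plane al. peval v p = peval v q" by (simp add: peval_hom)
  next
    assume "\<forall>v\<in>plane al. peval v p = peval v q"
    then show "rcl al p = rcl al q" unfolding * R_ideal_iff_exponents by (simp add: peval_hom)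
  qed
qed

definition rpoly :: "complex => poly3 set => poly3" where
  "rpoly al r = (SOME p. rcl al p = r)"

lemma rcl_rpoly: "r \<in> carrier (R_alg al) ==> rcl al (rpoly al r) = r"
  unfolding rpoly_def R.surj by (rule someI_ex) auto

lemma peval_rpoly: "v \<in> plane al ==> peval v (rpoly al (rcl al p)) = peval v p"
  using rcl_rpoly[of "rcl al p" al] unfolding rcl_eq by (simp add: R.surj)

section \<open>Translations of the plane\<close>

definition translate :: "complex ^ 3 => poly3 => poly3" where
  "translate u = pev poly3_const (\<lambda>i. poly3_var i + poly3_const (u $ i))"

lemmas translate_hom = pev_hom[OF scalars_instances(2), of "\<lambda>i. poly3_var i + poly3_const (u $ i)", folded translate_def]
  pev_sc[OF scalars_instances(2), of "\<lambda>i. poly3_var i + poly3_const (u $ i)", folded translate_def] for u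

lemma translate_const: "translate u (poly3_const c) = poly3_const c"
  using pev_single[OF scalars_instances(2), of "\<lambda>i. poly3_var i + poly3_const (u $ i)" 0 c] by (simp add: translate_def)

lemma peval_translate: "peval v (translate u p) = peval (v + u) p"
proof (induction p rule: poly3_induct)
  case (sc c p) then show ?case by (simp only: translate_hom translate_const peval_hom)
next
  case (var i p) then show ?case using vector_add_component[of v u i] by (simp only: translate_hom translate_const peval_hom)
qed (simp_all only: translate_hom peval_hom)

definition shift :: "complex => complex ^ 3 => poly3 set => poly3 set" where
  "shift al u r = rcl al (translate u (rpoly al r))"

lemma plane_add:
  assumes "v \<in> plane al" "u \<in> plane 0"
  shows "v + u \<in> plane al"
proof -
  have eq: "(v + u) $ 1 + (v + u) $ 2 + (v + u) $ 3 = (v $ 1 + v $ 2 + v $ 3) + (u $ 1 + u $ 2 + u $ 3)" by (simp only: vector_add_component add.assoc add.left_commute)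
  show ?thesis unfolding mem_Collect_eq eq using assms by simp
qed

lemma shift_rcl:
  assumes "u \<in> plane 0"
  shows "shift al u (rcl al p) = rcl al (translate u p)"
proof -
  have "peval (v + u) (rpoly al (rcl al p)) = peval (v + u) p" if "v \<in> plane al" for v
    by (rule peval_rpoly[OF plane_add[OF that assms]])
  then show ?thesis unfolding shift_def rcl_eq peval_translate by blast
qed

lemma shift_shift:
  assumes "u \<in> plane 0" "w \<in> plane 0" "r \<in> carrier (R_alg al)"
  shows "shift al u (shift al w r) = shift al (u + w) r"
proof -
  obtain p where r: "r = rcl al p" using assms(3) R.surj by auto
  have "u + w \<in> plane 0" by (rule plane_add[OF assms(1,2)])
  then show ?thesis unfolding r using shift_rcl[OF assms(1)] shift_rcl[OF assms(2)] shift_rcl[of "u + w" al p] by (simp only: rcl_eq peval_translate add.assoc simp_thms ball_simps)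
qed

lemma shift_zero: "r \<in> carrier (R_alg al) ==> shift al 0 r = r"
proof -
  assume "r \<in> carrier (R_alg al)"
  then obtain p where r: "r = rcl al p" using R.surj by auto
  have z: "0 \<in> plane 0" by simp
  show ?thesis unfolding r shift_rcl[OF z] rcl_eq peval_translate add_0_right by blast
qed

lemma shift_closed: "u \<in> plane 0 ==> shift al u r \<in> carrier (R_alg al)"
  by (simp add: shift_def R.surj)

lemma plane_uminus: "u \<in> plane 0 ==> - u \<in> plane 0"
proof -
  assume u: "u \<in> plane 0"
  have eq: "(- u) $ 1 + (- u) $ 2 + (- u) $ 3 = - (u $ 1 + u $ 2 + u $ 3)"
    by (simp only: vector_uminus_component minus_add_distrib)
  show ?thesis unfolding mem_Collect_eq eq using u by simp
qed

lemma shift_inverse: "u \<in> plane 0 ==> r \<in> carrier (R_alg al) ==> shift al (- u) (shift al u r) = r"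
  "u \<in> plane 0 ==> r \<in> carrier (R_alg al) ==> shift al u (shift al (- u) r) = r"
  using shift_shift[of "- u" u r al] shift_shift[of u "- u" r al] plane_uminus[of u]
  by (simp_all only: shift_zero right_minus left_minus)

lemma shift_bij: "u \<in> plane 0 ==> bij_betw (shift al u) (carrier (R_alg al)) (carrier (R_alg al))"
proof (rule bij_betw_byWitness[of _ "shift al (- u)"])
  assume u: "u \<in> plane 0"
  show "\<forall>r\<in>carrier (R_alg al). shift al (- u) (shift al u r) = r" "\<forall>r\<in>carrier (R_alg al). shift al u (shift al (- u) r) = r"
    using shift_inverse[OF u] by blast+
  show "shift al u ` carrier (R_alg al) \<subseteq> carrier (R_alg al)" "shift al (- u) ` carrier (R_alg al) \<subseteq> carrier (R_alg al)"
    using shift_closed[OF u] shift_closed[OF plane_uminus[OF u]] by blast+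
qed

lemma inv_shift:
  assumes "u \<in> plane 0" "r \<in> carrier (R_alg al)"
  shows "inv_into (carrier (R_alg al)) (shift al u) r = shift al (- u) r"
  using inv_into_f_f[OF bij_betw_imp_inj_on[OF shift_bij[OF assms(1)]] shift_closed[OF plane_uminus[OF assms(1)], of al r]] shift_inverse(2)[OF assms] by simp

lemma shift_iso:
  assumes u: "u \<in> plane 0"
  shows "shift al u \<in> alg_iso (R_alg al) (R_alg al)"
proof -
  have hom: "shift al u (rcl al p \<otimes>\<^bsub>R_alg al\<^esub> rcl al q) = shift al u (rcl al p) \<otimes>\<^bsub>R_alg al\<^esub> shift al u (rcl al q)"
    "shift al u (rcl al p \<oplus>\<^bsub>R_alg al\<^esub> rcl al q) = shift al u (rcl al p) \<oplus>\<^bsub>R_alg al\<^esub> shift al u (rcl al q)"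
    "shift al u (c \<odot>\<^bsub>R_alg al\<^esub> rcl al p) = c \<odot>\<^bsub>R_alg al\<^esub> shift al u (rcl al p)" for p q c
    by (simp_all only: R.map_mult[OF UNIV_I UNIV_I, symmetric] R.map_add[OF UNIV_I UNIV_I, symmetric] R.map_sc[OF UNIV_I, symmetric] shift_rcl[OF u] translate_hom translate_const)
  have one: "shift al u \<one>\<^bsub>R_alg al\<^esub> = \<one>\<^bsub>R_alg al\<^esub>"
    by (simp only: R.map_one[symmetric] shift_rcl[OF u] translate_hom)
  have "shift al u \<in> ring_hom (R_alg al) (R_alg al)"
    by (rule ring_hom_memI) (use shift_closed[OF u] hom one R.surj in auto)
  then show ?thesis unfolding alg_iso_def ring_iso_def using shift_bij[OF u] hom(3) R.surj by auto
qed

lemma R_algebra: "algebra \<CC> (R_alg al)"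
proof -
  have cr: "cring (R_alg al)"
  proof (rule cring.intro[OF R.ring_axioms], unfold_locales)
    fix x y assume "x \<in> carrier (R_alg al)" "y \<in> carrier (R_alg al)"
    then show "x \<otimes>\<^bsub>R_alg al\<^esub> y = y \<otimes>\<^bsub>R_alg al\<^esub> x" unfolding R.surj
      by (auto simp: R.map_mult[symmetric] mult.commute)
  qed
  show ?thesis
    by (intro algebra.intro cr R.module_axioms algebra_axioms.intro) (simp add: R.smult_mult_l)
qed

text \<open>The automorphism \<open>\<sigma>\<^sub>i\<close> is composition with this translation of the plane. It is the change of the
  exponents by which \<open>Y\<^sub>i\<close> moves a monomial.\<close>

definition step :: "nat => complex ^ 3" where
  "step i = (if i = 1 then vector [-1, 1, 0] else vector [0, -1, 1])"

definition edge_elt :: "complex => nat => poly3 set" where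
  "edge_elt al i = rcl al (if i = 1 then poly3_var 2 * (poly3_var 1 + 1) else poly3_var 3 * (poly3_var 2 + 1))"

lemma step_plane: "step i \<in> plane 0" by (simp add: step_def)

lemma step_nth: "step 1 $ 1 = -1" "step 1 $ 2 = 1" "step 1 $ 3 = 0"
  "step 2 $ 1 = 0" "step 2 $ 2 = -1" "step 2 $ 3 = 1" by (simp_all add: step_def)

lemma edge_tree: "finite_tree {1, 2 :: nat} {(1, 2), (2, 1)}"
proof -
  let ?E = "{(1, 2), (2, 1)} :: (nat \<times> nat) set"
  have short: "p = [u] \<and> u = v \<or> p = [u, v]" 
    if p: "p \<noteq> []" "hd p = u" "last p = v" "distinct p" "set p \<subseteq> {1, 2}" for p and u v :: nat
  proof -
    have "length p \<le> 2" using card_mono[OF _ p(5)] distinct_card[OF p(4)] by simp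
    then show ?thesis using p(1-3) by (cases p; cases "tl p"; cases "tl (tl p)") auto
  qed
  have "\<exists>!p. p \<noteq> [] \<and> hd p = u \<and> last p = v \<and> distinct p \<and> set p \<subseteq> {1, 2} \<and> successively (\<lambda>a b. (a, b) \<in> ?E) p"
    if "u \<in> {1, 2}" "v \<in> {1, 2}" for u v :: nat
  proof (cases "u = v")
    case True
    show ?thesis
    proof (rule ex1I[of _ "[u]"])
      fix p assume p: "p \<noteq> [] \<and> hd p = u \<and> last p = v \<and> distinct p \<and> set p \<subseteq> {1, 2} \<and> successively (\<lambda>a b. (a, b) \<in> ?E) p"
      then have "p = [u] \<and> u = v \<or> p = [u, v]" by (intro short) auto
      then show "p = [u]" using p True by (metis distinct_length_2_or_more)
    qed (use that True in auto)
  next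
    case False
    show ?thesis
    proof (rule ex1I[of _ "[u, v]"])
      fix p assume p: "p \<noteq> [] \<and> hd p = u \<and> last p = v \<and> distinct p \<and> set p \<subseteq> {1, 2} \<and> successively (\<lambda>a b. (a, b) \<in> ?E) p"
      then have "p = [u] \<and> u = v \<or> p = [u, v]" by (intro short) auto
      then show "p = [u, v]" using False by auto
    qed (use that False in auto)
  qed
  then show ?thesis unfolding finite_tree_def by (auto simp: sym_def irrefl_def)
qed

lemma sl3_tgwa_datum:
  "tgwa_datum {1, 2} {(1, 2), (2, 1)} (R_alg al) (\<lambda>i. shift al (step i)) (edge_elt al)"
proof -
  have comm: "shift al (step i) (shift al (step j) r) = shift al (step j) (shift al (step i) r)" if "r \<in> carrier (R_alg al)" for i j r
    using shift_shift[OF step_plane step_plane that] by (simp only: add.commute[of "step i"])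
  have ec: "edge_elt al i \<in> carrier (R_alg al)" for i by (simp add: edge_elt_def R.surj)
  have nz: "edge_elt al i \<noteq> \<zero>\<^bsub>R_alg al\<^esub>" if "i = 1 \<or> i = 2" for i
  proof
    assume "edge_elt al i = \<zero>\<^bsub>R_alg al\<^esub>"
    then have z: "\<forall>v\<in>plane al. peval v (if i = 1 then poly3_var 2 * (poly3_var 1 + 1) else poly3_var 3 * (poly3_var 2 + 1)) = 0"
      unfolding edge_elt_def R.map_zero[symmetric] rcl_eq by (simp add: peval_hom)
    show False using bspec[OF z, of "vector [1, 1, al - 2]"] bspec[OF z, of "vector [al - 2, 1, 1]"] by (auto simp: peval_hom split: if_splits)
  qed
  have inv: "inv_into (carrier (R_alg al)) (shift al (step i)) (edge_elt al j) = shift al (- step i) (edge_elt al j)" for i j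
    by (rule inv_shift[OF step_plane ec])
  have edge: "edge_elt al 1 \<otimes>\<^bsub>R_alg al\<^esub> edge_elt al 2 = shift al (- step 1) (edge_elt al 2) \<otimes>\<^bsub>R_alg al\<^esub> shift al (- step 2) (edge_elt al 1)"
    unfolding edge_elt_def shift_rcl[OF plane_uminus[OF step_plane]] R.map_mult[OF UNIV_I UNIV_I, symmetric] rcl_eq
    by (simp add: peval_hom peval_translate step_nth step_nth(1-3)[unfolded One_nat_def] mult_ac)
  have cr: "cring (R_alg al)" using R_algebra by (rule algebra.axioms)
  have edge': "edge_elt al 2 \<otimes>\<^bsub>R_alg al\<^esub> edge_elt al 1 = shift al (- step 2) (edge_elt al 1) \<otimes>\<^bsub>R_alg al\<^esub> shift al (- step 1) (edge_elt al 2)"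
    using edge ec shift_closed[OF plane_uminus[OF step_plane]] comm_monoid.m_comm[OF cring.axioms(2)[OF cr]] by metis
  show ?thesis
    unfolding tgwa_datum_def using edge_tree R_algebra shift_iso[OF step_plane] comm ec nz inv edge edge'
    by auto
qed

section \<open>Twisted generalized Weyl algebras\<close>

text \<open>Two algebras covered by the same set with the same kernel are isomorphic; no map has to be shown to be
  well defined on cosets.\<close>

lemma cover_iso:
  fixes A :: "(complex, 'a) module" and B :: "(complex, 'b) module"
  assumes "cover A C \<phi>" "cover B C \<psi>"
    and same_kernel: "\<And>p. p \<in> C ==> \<phi> p = \<zero>\<^bsub>A\<^esub> \<longleftrightarrow> \<psi> p = \<zero>\<^bsub>B\<^esub>"
  shows "alg_iso A B \<noteq> {}"
proof -
  interpret A: cover A C \<phi> by fact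
  interpret B: cover B C \<psi> by fact
  have eq: "\<phi> p = \<phi> q \<longleftrightarrow> \<psi> p = \<psi> q" if "p \<in> C" "q \<in> C" for p q
    using same_kernel[OF A.C_diff[OF that]] that
    by (simp add: A.map_diff B.map_diff)
  define f where "f a = \<psi> (SOME p. p \<in> C \<and> \<phi> p = a)" for a
  have f: "f (\<phi> p) = \<psi> p" if "p \<in> C" for p
  proof -
    have "(SOME q. q \<in> C \<and> \<phi> q = \<phi> p) \<in> C \<and> \<phi> (SOME q. q \<in> C \<and> \<phi> q = \<phi> p) = \<phi> p"
      by (rule someI[of _ p]) (simp add: that)
    then show ?thesis unfolding f_def using eq that by blast
  qed
  have "f \<in> ring_hom A B"
  proof (rule ring_hom_memI)
    show "f \<one>\<^bsub>A\<^esub> = \<one>\<^bsub>B\<^esub>" using f[OF A.C_one] by (simp only: A.map_one B.map_one)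
    fix x y assume "x \<in> carrier A" "y \<in> carrier A"
    then obtain p q where p: "p \<in> C" "x = \<phi> p" and q: "q \<in> C" "y = \<phi> q" unfolding A.surj by blast
    show "f x \<in> carrier B" unfolding p(2) f[OF p(1)] by (rule B.map_closed[OF p(1)])
    show "f (x \<otimes>\<^bsub>A\<^esub> y) = f x \<otimes>\<^bsub>B\<^esub> f y"
      unfolding p(2) q(2) A.map_mult[OF p(1) q(1), symmetric] f[OF p(1)] f[OF q(1)] f[OF A.C_mult[OF p(1) q(1)]]
      by (rule B.map_mult[OF p(1) q(1)])
    show "f (x \<oplus>\<^bsub>A\<^esub> y) = f x \<oplus>\<^bsub>B\<^esub> f y"
      unfolding p(2) q(2) A.map_add[OF p(1) q(1), symmetric] f[OF p(1)] f[OF q(1)] f[OF A.C_add[OF p(1) q(1)]]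
      by (rule B.map_add[OF p(1) q(1)])
  qed
  moreover have "bij_betw f (carrier A) (carrier B)"
  proof (rule bij_betw_imageI)
    show "inj_on f (carrier A)"
      unfolding A.surj by (rule inj_onI) (use eq f in auto)
    show "f ` carrier A = carrier B" unfolding A.surj B.surj by (auto simp: f image_iff intro!: bexI)
  qed
  moreover have "f (c \<odot>\<^bsub>A\<^esub> x) = c \<odot>\<^bsub>B\<^esub> f x" if x: "x \<in> carrier A" for c x
  proof -
    obtain p where p: "p \<in> C" "x = \<phi> p" using x unfolding A.surj by blast
    show ?thesis unfolding p(2) A.map_sc[OF p(1), symmetric] f[OF p(1)] f[OF A.C_sc[OF p(1)]] by (rule B.map_sc[OF p(1)])
  qed
  ultimately have "f \<in> alg_iso A B" by (simp add: alg_iso_def ring_iso_def)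
  then show ?thesis by blast
qed

lemma word_degree_simps [simp]: "word_degree [] = (\<lambda>_. 0)"
  "word_degree (g # w) = (\<lambda>v. gen_degree g v + word_degree w v)"
  "word_degree (u @ w) = (\<lambda>v. word_degree u v + word_degree w v)"
  by (auto simp: word_degree_def fun_eq_iff)

definition part :: "('v => int) => ('r, 'v) tgwa_gen free => ('r, 'v) tgwa_gen free" where
  "part d p = (\<Sum>w | w \<in> keys p \<and> word_degree w = d. single w (lookup p w))"

lemma lookup_part: "lookup (part d p) w = (if word_degree w = d then lookup p w else 0)"
  by (auto simp: part_def lookup_sum lookup_single when_def in_keys_iff)

lemma part_sum: "p = (\<Sum>d\<in>word_degree ` keys p. part d p)"
proof (rule poly_mapping_eqI)
  fix w show "lookup p w = lookup (\<Sum>d\<in>word_degree ` keys p. part d p) w"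
    by (auto simp: lookup_sum lookup_part in_keys_iff)
qed

lemma part_words: "p \<in> words G ==> part d p \<in> words G"
  by (auto simp: words_def in_keys_iff lookup_part split: if_splits)

lemma part_degree: "w \<in> keys (part d p) ==> word_degree w = d"
  by (auto simp: in_keys_iff lookup_part split: if_splits)

locale tgwa_data =
  fixes V :: "'v set" and E :: "('v \<times> 'v) set" and R :: "(complex, 'r) module"
    and \<sigma> :: "'v => 'r => 'r" and t :: "'v => 'r"
  assumes datum: "tgwa_datum V E R \<sigma> t"
begin

abbreviation "G \<equiv> tgwa_gens V R"
abbreviation "Rel \<equiv> tgwa_rel V R \<sigma> t"
abbreviation "A \<equiv> tgwa_pre V R \<sigma> t"
abbreviation "cls \<equiv> tgwa_class V R \<sigma> t"

lemma R_algebra: "algebra \<CC> R" using datum by (simp add: tgwa_datum_def)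

lemma R_closed: "\<one>\<^bsub>R\<^esub> \<in> carrier R" "r \<in> carrier R ==> s \<in> carrier R ==> r \<oplus>\<^bsub>R\<^esub> s \<in> carrier R"
  "r \<in> carrier R ==> s \<in> carrier R ==> r \<otimes>\<^bsub>R\<^esub> s \<in> carrier R" "r \<in> carrier R ==> c \<odot>\<^bsub>R\<^esub> r \<in> carrier R"
proof -
  interpret Q: algebra \<CC> R by (rule R_algebra)
  show "\<one>\<^bsub>R\<^esub> \<in> carrier R" "r \<in> carrier R ==> s \<in> carrier R ==> r \<oplus>\<^bsub>R\<^esub> s \<in> carrier R"
    "r \<in> carrier R ==> s \<in> carrier R ==> r \<otimes>\<^bsub>R\<^esub> s \<in> carrier R" by simp_all
  show "r \<in> carrier R ==> c \<odot>\<^bsub>R\<^esub> r \<in> carrier R" using Q.smult_closed[of c r] by simp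
qed

lemma sigma_closed: "i \<in> V ==> r \<in> carrier R ==> \<sigma> i r \<in> carrier R"
  "i \<in> V ==> r \<in> carrier R ==> inv_into (carrier R) (\<sigma> i) r \<in> carrier R"
  "i \<in> V ==> t i \<in> carrier R"
proof -
  have b: "bij_betw (\<sigma> i) (carrier R) (carrier R)" if "i \<in> V" for i
    using datum that by (simp add: tgwa_datum_def alg_iso_def ring_iso_def)
  show "i \<in> V ==> r \<in> carrier R ==> \<sigma> i r \<in> carrier R" using bij_betwE[OF b] by blast
  show "i \<in> V ==> r \<in> carrier R ==> inv_into (carrier R) (\<sigma> i) r \<in> carrier R"
    using b[of i] inv_into_into[of r "\<sigma> i" "carrier R"] by (simp add: bij_betw_def)
  show "i \<in> V ==> t i \<in> carrier R" using datum by (simp add: tgwa_datum_def)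
qed

lemma gens: "R_gen r \<in> G \<longleftrightarrow> r \<in> carrier R" "X_gen i \<in> G \<longleftrightarrow> i \<in> V" "Y_gen i \<in> G \<longleftrightarrow> i \<in> V"
  by (auto simp: tgwa_gens_def)

lemma gens_image [simp]: "set xs \<subseteq> V ==> X_gen ` set xs \<subseteq> G" "set xs \<subseteq> V ==> Y_gen ` set xs \<subseteq> G"
  by (auto simp: gens)

lemma words_closed: "p \<in> words G ==> q \<in> words G ==> p + q \<in> words G"
  "p \<in> words G ==> q \<in> words G ==> p * q \<in> words G" "p \<in> words G ==> sc c p \<in> words G" "1 \<in> words G" "0 \<in> words G"
  using subalg_words[of G] unfolding subalg_def by blast+

lemma const_words: "const c \<in> words G" by (auto simp: words_def const_def)

lemma rel_words: "Rel \<subseteq> words G \<times> words G"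
proof (rule subsetI)
  fix x assume "x \<in> Rel"
  then show "x \<in> words G \<times> words G"
    by (rule tgwa_rel.cases[of "fst x" "snd x", unfolded prod.collapse])
      (auto intro!: words_closed(1,2,4) gen_in_words const_words simp: mem_Times_iff gens R_closed sigma_closed)
qed

lemma A_cover: "cover A (words G) cls"
  unfolding tgwa_pre_def tgwa_class_def by (rule presented_cover(1)[OF rel_words])

interpretation A: cover A "words G" cls by (rule A_cover)

lemma cls_rel: "(l, r) \<in> Rel ==> cls l = cls r"
  unfolding tgwa_class_def by (rule presented_cover(3)[OF rel_words])

definition cl :: "('r, 'v) tgwa_gen list => ('r, 'v) tgwa_gen free set" where
  "cl w = cls (single w 1)"

lemma single_words: "set w \<subseteq> G ==> single w c \<in> words G"
  by (auto simp: words_def)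

lemma cl_append: "set u \<subseteq> G ==> set w \<subseteq> G ==> cl (u @ w) = cl u \<otimes>\<^bsub>A\<^esub> cl w"
  unfolding cl_def by (simp add: A.map_mult[symmetric] single_words mult_single plus_list_def)

lemma cl_cong:
  assumes "cl u = cl u'" "set u \<subseteq> G" "set u' \<subseteq> G" "set a \<subseteq> G" "set b \<subseteq> G"
  shows "cl (a @ u @ b) = cl (a @ u' @ b)"
  using assms by (simp add: cl_append)

lemma gen_two: "gen a * gen b = single [a, b] 1"
  by (simp add: gen_def mult_single plus_list_def)

lemma cl_rel:
  "r \<in> carrier R ==> s \<in> carrier R ==> cl [R_gen r, R_gen s] = cl [R_gen (r \<otimes>\<^bsub>R\<^esub> s)]"
  "cl [R_gen \<one>\<^bsub>R\<^esub>] = cl []"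
  "i \<in> V ==> r \<in> carrier R ==> cl [X_gen i, R_gen r] = cl [R_gen (\<sigma> i r), X_gen i]"
  "i \<in> V ==> r \<in> carrier R ==> cl [Y_gen i, R_gen r] = cl [R_gen (inv_into (carrier R) (\<sigma> i) r), Y_gen i]"
  "i \<in> V ==> j \<in> V ==> i \<noteq> j ==> cl [X_gen i, Y_gen j] = cl [Y_gen j, X_gen i]"
  "i \<in> V ==> cl [Y_gen i, X_gen i] = cl [R_gen (t i)]"
  "i \<in> V ==> cl [X_gen i, Y_gen i] = cl [R_gen (\<sigma> i (t i))]"
  using tgwa_rel.intros(3-9)[THEN cls_rel] unfolding cl_def gen_two[symmetric] gen_def[symmetric]
  by (simp_all add: zero_list_def[symmetric])

text \<open>Equality in the algebra up to a left factor from the base ring. The degree is part of the relation because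
  normal words of degree zero will be collapsed to the base ring.\<close>

definition red :: "('r, 'v) tgwa_gen list => ('r, 'v) tgwa_gen list => bool" where
  "red w u \<longleftrightarrow> set w \<subseteq> G \<and> set u \<subseteq> G \<and> word_degree w = word_degree u \<and> (\<exists>r\<in>carrier R. cl w = cl (R_gen r # u))"

lemma red_refl: "set w \<subseteq> G ==> red w w"
  unfolding red_def using cl_cong[OF cl_rel(2), of "[]" w] R_closed(1) by (auto simp: gens)

lemma red_trans:
  assumes "red w u" "red u v"
  shows "red w v"
proof -
  obtain r s where r: "r \<in> carrier R" "cl w = cl (R_gen r # u)" and s: "s \<in> carrier R" "cl u = cl (R_gen s # v)"
    using assms unfolding red_def by blast
  have sub: "set u \<subseteq> G" "set v \<subseteq> G" using assms unfolding red_def by blast+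
  have "cl (R_gen r # u) = cl (R_gen r # R_gen s # v)"
    using cl_cong[OF s(2), of "[R_gen r]" "[]"] r(1) s(1) sub by (simp add: gens)
  also have "\<dots> = cl (R_gen (r \<otimes>\<^bsub>R\<^esub> s) # v)"
    using cl_cong[OF cl_rel(1)[OF r(1) s(1)], of "[]" v] r(1) s(1) sub by (simp add: gens R_closed)
  finally show ?thesis using assms r s R_closed(3)[OF r(1) s(1)] unfolding red_def by auto
qed

lemma red_Cons:
  assumes g: "g \<in> X_gen ` V \<union> Y_gen ` V" and "red w u"
  shows "red (g # w) (g # u)"
proof -
  obtain r where r: "r \<in> carrier R" "cl w = cl (R_gen r # u)" and sub: "set w \<subseteq> G" "set u \<subseteq> G"
    using assms(2) unfolding red_def by blast
  have gG: "g \<in> G" using g by (auto simp: gens)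
  have "\<exists>r'\<in>carrier R. cl [g, R_gen r] = cl [R_gen r', g]" using g
  proof (elim UnE imageE)
    fix i assume "g = X_gen i" "i \<in> V"
    then show ?thesis using cl_rel(3)[of i r] sigma_closed(1)[of i r] r(1) by auto
  next
    fix i assume "g = Y_gen i" "i \<in> V"
    then show ?thesis using cl_rel(4)[of i r] sigma_closed(2)[of i r] r(1) by auto
  qed
  then obtain r' where r': "r' \<in> carrier R" "cl [g, R_gen r] = cl [R_gen r', g]" by blast
  have "cl (g # w) = cl (g # R_gen r # u)"
    using cl_cong[OF r(2), of "[g]" "[]"] gG sub r(1) by (simp add: gens)
  also have "\<dots> = cl (R_gen r' # g # u)"
    using cl_cong[OF r'(2), of "[]" u] gG sub r(1) r'(1) by (simp add: gens)
  finally show ?thesis using assms(2) gG r'(1) unfolding red_def by auto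
qed

lemma red_append:
  assumes "red w u" "set z \<subseteq> G"
  shows "red (w @ z) (u @ z)"
proof -
  obtain r where r: "r \<in> carrier R" "cl w = cl (R_gen r # u)" and sub: "set w \<subseteq> G" "set u \<subseteq> G"
    using assms(1) unfolding red_def by blast
  then show ?thesis using assms cl_cong[OF r(2), of "[]" z] unfolding red_def by (auto simp: gens)
qed

lemma red_pairs:
  "i \<in> V ==> red [Y_gen i, X_gen i] []" "i \<in> V ==> red [X_gen i, Y_gen i] []"
  "i \<in> V ==> j \<in> V ==> i \<noteq> j ==> red [X_gen i, Y_gen j] [Y_gen j, X_gen i]"
  "i \<in> V ==> j \<in> V ==> i \<noteq> j ==> red [Y_gen i, X_gen j] [X_gen j, Y_gen i]"
proof -
  show "i \<in> V ==> red [Y_gen i, X_gen i] []" "i \<in> V ==> red [X_gen i, Y_gen i] []"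
    using cl_rel(6,7)[of i] sigma_closed(1)[of i "t i"] sigma_closed(3)[of i] unfolding red_def by (auto simp: gens)
  have *: "red u w" if "cl u = cl w" "set u \<subseteq> G" "set w \<subseteq> G" "word_degree u = word_degree w" for u w
    using that red_refl[of w] unfolding red_def by simp
  show "i \<in> V ==> j \<in> V ==> i \<noteq> j ==> red [X_gen i, Y_gen j] [Y_gen j, X_gen i]"
    "i \<in> V ==> j \<in> V ==> i \<noteq> j ==> red [Y_gen i, X_gen j] [X_gen j, Y_gen i]"
    by (rule *; use cl_rel(5)[of i j] cl_rel(5)[of j i] in \<open>auto simp: gens\<close>)+
qed

text \<open>A generator \<open>X\<^sub>i\<close> commutes with the \<open>Y\<^sub>j\<close> for \<open>j \<noteq> i\<close>, and with the first \<open>Y\<^sub>i\<close> it merges into the base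
  ring.\<close>

lemma move_X:
  assumes i: "i \<in> V" and "set ys \<subseteq> V"
  shows "\<exists>ys' xs'. set ys' \<subseteq> V \<and> set xs' \<subseteq> V \<and> red (X_gen i # map Y_gen ys) (map Y_gen ys' @ map X_gen xs')"
  using assms(2)
proof (induction ys)
  case Nil
  show ?case using i by (intro exI[of _ "[]"] exI[of _ "[i]"]) (auto intro!: red_refl simp: gens)
next
  case (Cons j ys)
  have w: "set (map Y_gen ys) \<subseteq> G" using Cons.prems by (auto simp: gens)
  show ?case
  proof (cases "i = j")
    case True
    show ?thesis using red_append[OF red_pairs(2)[OF i] w] Cons.prems True
      by (intro exI[of _ ys] exI[of _ "[]"]) simp
  next
    case False
    have j: "j \<in> V" using Cons.prems by simp
    obtain ys' xs' where h: "set ys' \<subseteq> V" "set xs' \<subseteq> V" "red (X_gen i # map Y_gen ys) (map Y_gen ys' @ map X_gen xs')"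
      using Cons by auto
    have 1: "red (X_gen i # map Y_gen (j # ys)) (Y_gen j # X_gen i # map Y_gen ys)"
      using red_append[OF red_pairs(3)[OF i j False] w] by simp
    have 2: "red (Y_gen j # X_gen i # map Y_gen ys) (Y_gen j # map Y_gen ys' @ map X_gen xs')"
      by (rule red_Cons[OF _ h(3)]) (simp add: j)
    have "red (X_gen i # map Y_gen (j # ys)) (map Y_gen (j # ys') @ map X_gen xs')"
      using red_trans[OF 1 2] by simp
    moreover have "set (j # ys') \<subseteq> V" using j h(1) by simp
    ultimately show ?thesis using h(2) by blast
  qed
qed

lemma normal_word:
  assumes "set w \<subseteq> G"
  shows "\<exists>ys xs. set ys \<subseteq> V \<and> set xs \<subseteq> V \<and> red w (map Y_gen ys @ map X_gen xs)"
  using assms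
proof (induction w)
  case Nil
  show ?case using red_refl[of "[]"] by (intro exI[of _ "[]"]) simp
next
  case (Cons g w)
  then obtain ys xs where h: "set ys \<subseteq> V" "set xs \<subseteq> V" "red w (map Y_gen ys @ map X_gen xs)" by auto
  have sub: "set w \<subseteq> G" "g \<in> G" using Cons.prems by auto
  consider (R) r where "r \<in> carrier R" "g = R_gen r" | (X) i where "i \<in> V" "g = X_gen i" | (Y) i where "i \<in> V" "g = Y_gen i"
    using sub(2) unfolding tgwa_gens_def by blast
  then show ?case
  proof cases
    case R
    have "red (g # w) w" using sub R unfolding red_def by auto
    then show ?thesis using red_trans[OF _ h(3)] h(1,2) by blast
  next
    case X
    obtain ys' xs' where m: "set ys' \<subseteq> V" "set xs' \<subseteq> V" "red (X_gen i # map Y_gen ys) (map Y_gen ys' @ map X_gen xs')"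
      using move_X[OF X(1) h(1)] by blast
    have "red (g # w) (X_gen i # map Y_gen ys @ map X_gen xs)" unfolding X(2)
      by (rule red_Cons[OF _ h(3)]) (simp add: X)
    moreover have "red (X_gen i # map Y_gen ys @ map X_gen xs) (map Y_gen ys' @ map X_gen (xs' @ xs))"
      using red_append[OF m(3), of "map X_gen xs"] h(2) by (auto simp: gens)
    ultimately have "red (g # w) (map Y_gen ys' @ map X_gen (xs' @ xs))" by (rule red_trans)
    moreover have "set (xs' @ xs) \<subseteq> V" using m(2) h(2) by simp
    ultimately show ?thesis using m(1) by blast
  next
    case Y
    have "red (g # w) (map Y_gen (i # ys) @ map X_gen xs)" unfolding Y(2)
      using red_Cons[OF _ h(3), of "Y_gen i"] Y by simp
    moreover have "set (i # ys) \<subseteq> V" using Y h(1) by simp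
    ultimately show ?thesis using h(2) by blast
  qed
qed

lemma cancel_Y:
  assumes "i \<in> V" "set x1 \<subseteq> V" "set x2 \<subseteq> V" "i \<notin> set x1"
  shows "red (Y_gen i # map X_gen (x1 @ i # x2)) (map X_gen (x1 @ x2))"
  using assms(2,4)
proof (induction x1)
  case Nil
  show ?case using red_append[OF red_pairs(1)[OF assms(1)], of "map X_gen x2"] assms(3) by (auto simp: gens)
next
  case (Cons j x1)
  have 1: "red (Y_gen i # map X_gen ((j # x1) @ i # x2)) (X_gen j # Y_gen i # map X_gen (x1 @ i # x2))"
    using red_append[OF red_pairs(4)[of i j], of "map X_gen (x1 @ i # x2)"] Cons.prems assms by (auto simp: gens)
  have 2: "red (X_gen j # Y_gen i # map X_gen (x1 @ i # x2)) (X_gen j # map X_gen (x1 @ x2))"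
    by (rule red_Cons) (use Cons in auto)
  show ?case using red_trans[OF 1 2] by simp
qed

lemma red_Cons_word: "set ys \<subseteq> V ==> red w u ==> red (map Y_gen ys @ w) (map Y_gen ys @ u)"
  by (induction ys) (auto intro!: red_Cons)

lemma degree_signs:
  fixes xs ys :: "'v list"
  shows "word_degree (map X_gen xs :: ('r, 'v) tgwa_gen list) v \<ge> 0" "word_degree (map Y_gen ys :: ('r, 'v) tgwa_gen list) v \<le> 0"
    "v \<in> set xs ==> word_degree (map X_gen xs :: ('r, 'v) tgwa_gen list) v > 0"
    "v \<notin> set xs ==> word_degree (map X_gen xs :: ('r, 'v) tgwa_gen list) v = 0"
proof -
  have p: "word_degree (map X_gen xs :: ('r, 'v) tgwa_gen list) v \<ge> 0" for xs and v :: 'v by (induction xs) auto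
  show "word_degree (map X_gen xs :: ('r, 'v) tgwa_gen list) v \<ge> 0" by (rule p)
  show "word_degree (map Y_gen ys :: ('r, 'v) tgwa_gen list) v \<le> 0" by (induction ys) auto
  show "v \<in> set xs ==> word_degree (map X_gen xs :: ('r, 'v) tgwa_gen list) v > 0"
  proof (induction xs)
    case (Cons x xs) then show ?case using p[of xs v] by (cases "v \<in> set xs") auto
  qed simp
  show "v \<notin> set xs ==> word_degree (map X_gen xs :: ('r, 'v) tgwa_gen list) v = 0" by (induction xs) auto
qed

text \<open>In degree zero the last \<open>Y\<^sub>i\<close> has a partner \<open>X\<^sub>i\<close>. It commutes with the letters before the first partner, and
  the two merge into the base ring.\<close>

lemma collapse:
  assumes "set ys \<subseteq> V" "set xs \<subseteq> V" "word_degree (map Y_gen ys @ map X_gen xs :: ('r, 'v) tgwa_gen list) = (\<lambda>_. 0)"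
  shows "red (map Y_gen ys @ map X_gen xs) []"
  using assms
proof (induction ys arbitrary: xs rule: rev_induct)
  case Nil
  have "xs = []"
  proof (cases xs)
    case (Cons i l)
    have "word_degree (map X_gen xs :: ('r, 'v) tgwa_gen list) i > 0" by (rule degree_signs(3)) (simp add: Cons)
    then show ?thesis using fun_cong[OF Nil(3), of i] by simp
  qed
  then show ?case using red_refl[of "[]"] by simp
next
  case (snoc i ys)
  have "i \<in> set xs"
  proof (rule ccontr)
    assume "i \<notin> set xs"
    then have "word_degree (map X_gen xs :: ('r, 'v) tgwa_gen list) i = 0" by (rule degree_signs(4))
    moreover have "word_degree (map Y_gen ys :: ('r, 'v) tgwa_gen list) i \<le> 0" by (rule degree_signs(2))
    ultimately show False using fun_cong[OF snoc(4), of i] by simp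
  qed
  then obtain x1 x2 where x: "xs = x1 @ i # x2" "i \<notin> set x1" using split_list_first by metis
  have c: "red (Y_gen i # map X_gen (x1 @ i # x2)) (map X_gen (x1 @ x2))"
    by (rule cancel_Y) (use snoc.prems x in auto)
  have "red (map Y_gen (ys @ [i]) @ map X_gen xs) (map Y_gen ys @ map X_gen (x1 @ x2))"
    using red_Cons_word[OF _ c, of ys] snoc.prems x(1) by simp
  moreover have "red (map Y_gen ys @ map X_gen (x1 @ x2)) []"
  proof (rule snoc.IH)
    show "word_degree (map Y_gen ys @ map X_gen (x1 @ x2) :: ('r, 'v) tgwa_gen list) = (\<lambda>_. 0)"
      using calculation snoc(4) unfolding red_def by simp
  qed (use snoc.prems x in auto)
  ultimately show ?case by (rule red_trans)
qed

lemma degree_zero_word: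
  assumes "set w \<subseteq> G" "word_degree w = (\<lambda>_. 0)"
  shows "\<exists>r\<in>carrier R. cl w = cl [R_gen r]"
proof -
  obtain ys xs where h: "set ys \<subseteq> V" "set xs \<subseteq> V" "red w (map Y_gen ys @ map X_gen xs)"
    using normal_word[OF assms(1)] by blast
  have "red (map Y_gen ys @ map X_gen xs) []"
    by (rule collapse[OF h(1,2)]) (use h(3) assms(2) in \<open>simp add: red_def\<close>)
  from red_trans[OF h(3) this] show ?thesis unfolding red_def by blast
qed

lemma cls_R:
  "r \<in> carrier R ==> s \<in> carrier R ==> cls (gen (R_gen r)) \<oplus>\<^bsub>A\<^esub> cls (gen (R_gen s)) = cls (gen (R_gen (r \<oplus>\<^bsub>R\<^esub> s)))"
  "r \<in> carrier R ==> c \<odot>\<^bsub>A\<^esub> cls (gen (R_gen r)) = cls (gen (R_gen (c \<odot>\<^bsub>R\<^esub> r)))"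
proof -
  show "r \<in> carrier R ==> s \<in> carrier R ==> cls (gen (R_gen r)) \<oplus>\<^bsub>A\<^esub> cls (gen (R_gen s)) = cls (gen (R_gen (r \<oplus>\<^bsub>R\<^esub> s)))"
    using cls_rel[OF tgwa_rel.intros(1)] by (simp add: A.map_add gens)
  assume r: "r \<in> carrier R"
  have "cls (gen (R_gen (c \<odot>\<^bsub>R\<^esub> r))) = cls (sc c (gen (R_gen r)))"
    using cls_rel[OF tgwa_rel.intros(2)[OF r, of c]] by (simp add: const_eq mult.assoc)
  then show "c \<odot>\<^bsub>A\<^esub> cls (gen (R_gen r)) = cls (gen (R_gen (c \<odot>\<^bsub>R\<^esub> r)))" using A.map_sc[of "gen (R_gen r)" c] r by (simp add: gens)
qed

lemma degree_zero:
  assumes p: "p \<in> words G" and d: "\<And>w. w \<in> keys p ==> word_degree w = (\<lambda>_. 0)"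
  shows "\<exists>r\<in>carrier R. cls p = cls (gen (R_gen r))"
proof -
  have "p \<in> words G \<and> (\<exists>r\<in>carrier R. cls p = cls (gen (R_gen r)))"
  proof (induction p rule: poly_mapping_induct)
    case zero
    have "cls 0 = 0 \<odot>\<^bsub>A\<^esub> cls (gen (R_gen \<one>\<^bsub>R\<^esub>))" using R_closed(1) by (simp add: gens)
    then show ?case using cls_R(2)[OF R_closed(1), of 0] R_closed(4)[OF R_closed(1)] words_closed(5) by auto
  next
    case (single w c)
    have w: "set w \<subseteq> G" using p single by (auto simp: words_def)
    obtain r where r: "r \<in> carrier R" "cl w = cl [R_gen r]" using degree_zero_word[OF w d[OF single]] by blast
    have "cls (single w c) = c \<odot>\<^bsub>A\<^esub> cl w"
      using A.map_sc[OF single_words[OF w, of 1], of c] by (simp add: cl_def)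
    also have "\<dots> = cls (gen (R_gen (c \<odot>\<^bsub>R\<^esub> r)))" using cls_R(2)[OF r(1)] r(2) by (simp add: cl_def gen_def)
    finally show ?case using R_closed(4)[OF r(1)] single_words[OF w] by blast
  next
    case (add p q)
    then show ?case using A.map_add[of p q] cls_R(1) R_closed(2) words_closed(1) by metis
  qed
  then show ?thesis by blast
qed

text \<open>A graded ideal \<open>N\<close> meeting the base ring trivially is the largest one as soon as every homogeneous
  element outside it has a multiple of degree zero outside it: that multiple lies in the base ring, so no ideal
  with trivial intersection contains it.\<close>

theorem tgwa_cover:
  assumes N: "N \<subseteq> words G" "0 \<in> N" "\<And>p q. p \<in> N ==> q \<in> N ==> p + q \<in> N"
    "\<And>p q. p \<in> N ==> q \<in> words G ==> q * p \<in> N" "\<And>p q. p \<in> N ==> q \<in> words G ==> p * q \<in> N"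
    and sat: "\<And>p q. p \<in> N ==> q \<in> words G ==> cls p = cls q ==> q \<in> N"
    and hom: "\<And>p d. p \<in> N ==> part d p \<in> N"
    and inj: "\<And>r. r \<in> carrier R ==> gen (R_gen r) \<in> N ==> r = \<zero>\<^bsub>R\<^esub>"
    and nondeg: "\<And>p d. p \<in> words G ==> p \<notin> N ==> \<forall>w\<in>keys p. word_degree w = d ==>
      \<exists>q\<in>words G. (\<forall>w\<in>keys q. word_degree w = (\<lambda>v. - d v)) \<and> q * p \<notin> N"
  shows "\<exists>\<psi>. cover (tgwa V R \<sigma> t) (words G) \<psi> \<and> (\<forall>p\<in>words G. \<psi> p = \<zero>\<^bsub>tgwa V R \<sigma> t\<^esub> \<longleftrightarrow> p \<in> N)"
proof -
  let ?ok = "\<lambda>K. tgwa_homogeneous_ideal V R \<sigma> t K \<and> K \<inter> (\<lambda>r. cls (gen (R_gen r))) ` carrier R = {\<zero>\<^bsub>A\<^esub>}"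
  have id: "ideal (cls ` N) A" by (rule cover_idealI[OF A_cover N])
  have homog: "tgwa_homogeneous_ideal V R \<sigma> t (cls ` N)"
    unfolding tgwa_homogeneous_ideal_def
  proof (intro conjI id ballI)
    fix a assume "a \<in> cls ` N"
    then obtain p where p: "p \<in> N" "a = cls p" by blast
    have pw: "p \<in> words G" using p(1) N(1) by blast
    let ?D = "word_degree ` keys p"
    have "a = cls (\<Sum>d\<in>?D. part d p)" using p(2) part_sum[of p] by simp
    also have "\<dots> = (\<Oplus>\<^bsub>A\<^esub>d\<in>?D. cls (part d p))" by (rule A.map_sum) (rule part_words[OF pw])
    finally have sum: "a = (\<Oplus>\<^bsub>A\<^esub>d\<in>?D. cls (part d p))" .
    have "cls (part d p) \<in> cls ` N \<inter> tgwa_component V R \<sigma> t d" for d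
      unfolding tgwa_component_def using hom[OF p(1), of d] part_words[OF pw, of d] part_degree[of _ d p]
      by (auto simp: free_alg_words monoid_alg_def)
    then show "\<exists>D h. finite D \<and> (\<forall>d\<in>D. h d \<in> cls ` N \<inter> tgwa_component V R \<sigma> t d) \<and> a = (\<Oplus>\<^bsub>A\<^esub>d\<in>D. h d)"
      using sum by (intro exI[of _ ?D] exI[of _ "\<lambda>d. cls (part d p)"]) simp
  qed
  have Rz: "cls (gen (R_gen \<zero>\<^bsub>R\<^esub>)) = \<zero>\<^bsub>A\<^esub>" "\<zero>\<^bsub>R\<^esub> \<in> carrier R"
  proof -
    interpret Q: algebra \<CC> R by (rule R_algebra)
    have "0 \<odot>\<^bsub>R\<^esub> \<one>\<^bsub>R\<^esub> = \<zero>\<^bsub>R\<^esub>" using Q.smult_l_null[of "\<one>\<^bsub>R\<^esub>"] by simp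
    then show "cls (gen (R_gen \<zero>\<^bsub>R\<^esub>)) = \<zero>\<^bsub>A\<^esub>" using cls_R(2)[OF R_closed(1), of 0] R_closed(1) by (simp add: gens)
    show "\<zero>\<^bsub>R\<^esub> \<in> carrier R" by simp
  qed
  have triv: "cls ` N \<inter> (\<lambda>r. cls (gen (R_gen r))) ` carrier R = {\<zero>\<^bsub>A\<^esub>}"
  proof (intro equalityI subsetI)
    fix a assume "a \<in> cls ` N \<inter> (\<lambda>r. cls (gen (R_gen r))) ` carrier R"
    then obtain p r where h: "p \<in> N" "a = cls p" "r \<in> carrier R" "a = cls (gen (R_gen r))" by blast
    have "gen (R_gen r) \<in> N" by (rule sat[OF h(1)]) (use h in \<open>auto simp: gens\<close>)
    then have "r = \<zero>\<^bsub>R\<^esub>" by (rule inj[OF h(3)])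
    then show "a \<in> {\<zero>\<^bsub>A\<^esub>}" using h(4) Rz(1) by simp
  next
    fix a assume "a \<in> {\<zero>\<^bsub>A\<^esub>}"
    then have a: "a = cls 0" "a = cls (gen (R_gen \<zero>\<^bsub>R\<^esub>))" using Rz by simp_all
    show "a \<in> cls ` N \<inter> (\<lambda>r. cls (gen (R_gen r))) ` carrier R"
      using a(1) imageI[OF N(2), of cls] a(2) imageI[OF Rz(2), of "\<lambda>r. cls (gen (R_gen r))"] by simp
  qed
  have greatest: "K \<subseteq> cls ` N" if K: "?ok K" for K
  proof
    have Ki: "ideal K A" using K by (simp add: tgwa_homogeneous_ideal_def)
    have hd: "h \<in> cls ` N" if h: "h \<in> K" "h \<in> tgwa_component V R \<sigma> t d" for h d
    proof (rule ccontr)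
      assume n: "h \<notin> cls ` N"
      obtain p where p: "h = cls p" "p \<in> words G" "\<forall>w\<in>keys p. word_degree w = d"
        using h(2) unfolding tgwa_component_def by (auto simp: free_alg_words monoid_alg_def)
      have "p \<notin> N" using n p(1) by blast
      from nondeg[OF p(2) this p(3)] obtain q where q: "q \<in> words G"
        "\<forall>w\<in>keys q. word_degree w = (\<lambda>v. - d v)" "q * p \<notin> N" by blast
      have "word_degree w = (\<lambda>_. 0)" if key: "w \<in> keys (q * p)" for w
      proof -
        obtain x y where w: "w = x + y" "x \<in> keys q" "y \<in> keys p"
          using subsetD[OF keys_mult key] by blast
        then have "word_degree x = (\<lambda>v. - d v)" "word_degree y = d" using q(2) p(3) by blast+
        then show ?thesis unfolding w(1) plus_list_def by simp
      qed
      then obtain r where r: "r \<in> carrier R" "cls (q * p) = cls (gen (R_gen r))"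
        using degree_zero[OF words_closed(2)[OF q(1) p(2)]] by blast
      have "cls p \<in> K" using h(1) p(1) by simp
      then have "cls (q * p) \<in> K" by (rule cover_idealD(4)[OF A_cover Ki p(2) q(1)])
      then have "cls (q * p) \<in> {\<zero>\<^bsub>A\<^esub>}" using K r by blast
      then have "cls 0 = cls (q * p)" by simp
      from sat[OF N(2) words_closed(2)[OF q(1) p(2)] this] show False using q(3) by simp
    qed
    fix a assume a: "a \<in> K"
    have "\<forall>a\<in>K. \<exists>D h. finite D \<and> (\<forall>d\<in>D. h d \<in> K \<inter> tgwa_component V R \<sigma> t d) \<and> a = (\<Oplus>\<^bsub>A\<^esub>d\<in>D. h d)"
      using conjunct1[OF K] unfolding tgwa_homogeneous_ideal_def by (rule conjunct2)
    from bspec[OF this a] obtain D h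
      where Dh: "finite D \<and> (\<forall>d\<in>D. h d \<in> K \<inter> tgwa_component V R \<sigma> t d) \<and> a = (\<Oplus>\<^bsub>A\<^esub>d\<in>D. h d)"
      by (elim exE)
    note D = conjunct1[OF Dh] conjunct1[OF conjunct2[OF Dh]] conjunct2[OF conjunct2[OF Dh]]
    have "\<forall>d\<in>D. h d \<in> cls ` N" using D(2) hd by blast
    with D(1) have "(\<Oplus>\<^bsub>A\<^esub>d\<in>D. h d) \<in> cls ` N"
    proof (induction D)
      case empty show ?case using imageI[OF N(2), of cls] by simp
    next
      case (insert d D)
      have sub: "cls ` N \<subseteq> carrier A" using N(1) by auto
      have "(\<Oplus>\<^bsub>A\<^esub>d\<in>insert d D. h d) = h d \<oplus>\<^bsub>A\<^esub> (\<Oplus>\<^bsub>A\<^esub>d\<in>D. h d)"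
        by (rule A.finsum_insert) (use insert sub in auto)
      moreover obtain p q where "p \<in> N" "h d = cls p" "q \<in> N" "(\<Oplus>\<^bsub>A\<^esub>d\<in>D. h d) = cls q"
        using insert by auto
      moreover from this have "cls p \<oplus>\<^bsub>A\<^esub> cls q = cls (p + q)" "p + q \<in> N"
        using A.map_add[of p q] subsetD[OF N(1)] N(3)[of p q] by simp_all
      ultimately show ?case using imageI[of "p + q" N cls] by simp
    qed
    then show "a \<in> cls ` N" using D(3) by simp
  qed
  have "tgwa_ideal V R \<sigma> t = cls ` N"
    unfolding tgwa_ideal_def by (rule Greatest_equality) (use homog triv greatest in auto)
  then have eq: "tgwa V R \<sigma> t = quot_alg A (cls ` N)" by (simp add: tgwa_def)
  have "cls p \<in> cls ` N \<longleftrightarrow> p \<in> N" if "p \<in> words G" for p using sat[OF _ that] by blast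
  then show ?thesis unfolding eq
    using cover_quot(1)[OF A_cover id] cover_quot(3)[OF A_cover id] by (intro exI[of _ "\<lambda>p. cls ` N +>\<^bsub>A\<^esub> cls p"]) blast
qed

end

section \<open>The algebra of operators as a twisted generalized Weyl algebra\<close>

interpretation W: tgwa_data "{1, 2 :: nat}" "{(1, 2), (2, 1)}" "R_alg al" "\<lambda>i. shift al (step i)" "edge_elt al" for al
  by (rule tgwa_data.intro) (rule sl3_tgwa_datum)

abbreviation rv :: "complex => poly3 set => nat => nat => complex" where
  "rv al r a b \<equiv> peval (ex al a b) (rpoly al r)"

lemma rv_rcl: "rv al (rcl al p) a b = peval (ex al a b) p"
  by (rule peval_rpoly) simp

lemma act1_diag: "(a, b) \<in> idx al ==> act1 al (gen (i, i)) (mon al a b) = sc (ex al a b $ i) (mon al a b)"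
  using exhaust_3[of i] by (auto simp: mon_step)

lemma diag_exists:
  "\<exists>u. \<forall>a b. (a, b) \<in> idx al --> act1 al u (mon al a b) = sc (peval (ex al a b) p) (mon al a b)"
proof (induction p rule: poly3_induct)
  case one show ?case by (intro exI[of _ 1]) (simp add: act1_ring peval_hom)
next
  case (sc c p)
  then obtain u where "\<forall>a b. (a, b) \<in> idx al --> act1 al u (mon al a b) = sc (peval (ex al a b) p) (mon al a b)" by blast
  then have "act1 al (sc c u) (mon al a b) = sc (peval (ex al a b) (sc c p)) (mon al a b)" if ab: "(a, b) \<in> idx al" for a b
    using ab by (simp only: act1_sc(1)[OF mon_in_S[OF ab]] sc_sc peval_hom)
  then show ?case by blast
next
  case (add p q)
  then obtain u w where "\<forall>a b. (a, b) \<in> idx al --> act1 al u (mon al a b) = sc (peval (ex al a b) p) (mon al a b)"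
    "\<forall>a b. (a, b) \<in> idx al --> act1 al w (mon al a b) = sc (peval (ex al a b) q) (mon al a b)" by blast
  then show ?case by (intro exI[of _ "u + w"]) (simp add: act1_ring peval_hom sc_add_left)
next
  case (var i p)
  then obtain u where "\<forall>a b. (a, b) \<in> idx al --> act1 al u (mon al a b) = sc (peval (ex al a b) p) (mon al a b)" by blast
  then have "act1 al (gen (i, i) * u) (mon al a b) = sc (peval (ex al a b) (poly3_var i * p)) (mon al a b)"
    if ab: "(a, b) \<in> idx al" for a b
    using ab by (simp only: act1_simps(5)[OF mon_in_S[OF ab]] act1_sc(2)[OF mon_in_S[OF ab]] act1_diag sc_sc peval_hom mult.commute[of "peval (ex al a b) p"])
  then show ?case by blast
qed

definition diag_elt :: "complex => poly3 set => T" where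
  "diag_elt al r = (SOME u. \<forall>a b. (a, b) \<in> idx al --> act1 al u (mon al a b) = sc (rv al r a b) (mon al a b))"

lemma diag_elt: "(a, b) \<in> idx al ==> act1 al (diag_elt al r) (mon al a b) = sc (rv al r a b) (mon al a b)"
  using someI_ex[OF diag_exists[of al "rpoly al r"]] unfolding diag_elt_def by blast

definition img :: "complex => (poly3 set, nat) tgwa_gen => T" where
  "img al g = (case g of R_gen r => diag_elt al r
     | X_gen i => if i = 1 then gen (1, 2) else gen (2, 3)
     | Y_gen i => if i = 1 then gen (2, 1) else gen (3, 2))"

text \<open>The action of the generators lifted to words in the matrix units, so that the kernel can be computed
  in \<open>Jp al\<close>.\<close>

definition \<Psi> :: "complex => (poly3 set, nat) tgwa_gen free => T" where
  "\<Psi> al = free_eval (monoid_alg UNIV) (img al)"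

lemma free_algebra: "cx_alg (monoid_alg (UNIV :: T set))"
  by (rule alg_map.axioms(1)[OF cover.axioms(1)[OF cover_monoid_alg[OF subalg_UNIV]]])

lemma \<Psi>_hom: "\<Psi> al (p + q) = \<Psi> al p + \<Psi> al q" "\<Psi> al (p * q) = \<Psi> al p * \<Psi> al q" "\<Psi> al 1 = 1"
  "\<Psi> al 0 = 0" "\<Psi> al (gen x) = img al x"
  and \<Psi>_sc: "\<Psi> al (sc c p) = sc c (\<Psi> al p)"
proof -
  have c: "img al x \<in> carrier (monoid_alg UNIV)" for x by (simp add: monoid_alg_def)
  interpret E: alg_map "monoid_alg (UNIV :: T set)" UNIV "\<Psi> al"
    unfolding \<Psi>_def using free_eval_hom[OF free_algebra, of UNIV "img al", OF c] by simp
  show "\<Psi> al (p + q) = \<Psi> al p + \<Psi> al q" using E.map_add[of p q] by (simp add: monoid_alg_def)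
  show "\<Psi> al (p * q) = \<Psi> al p * \<Psi> al q" using E.map_mult[of p q] by (simp add: monoid_alg_def)
  show "\<Psi> al 1 = 1" using E.map_one by (simp add: monoid_alg_def)
  show "\<Psi> al 0 = 0" using E.map_zero by (simp add: monoid_alg_def)
  show "\<Psi> al (gen x) = img al x" unfolding \<Psi>_def by (rule free_eval_gen[where A = "monoid_alg UNIV" and f = "img al" and x = x, OF free_algebra c])
  show "\<Psi> al (sc c p) = sc c (\<Psi> al p)" using E.map_sc[of p c] by (simp add: monoid_alg_def)
qed

lemma \<Psi>_uminus: "\<Psi> al (- p) = - \<Psi> al p" and \<Psi>_diff: "\<Psi> al (p - q) = \<Psi> al p - \<Psi> al q"
proof -
  show m: "\<Psi> al (- p) = - \<Psi> al p" for p using \<Psi>_hom(1)[of al p "- p"] by (simp add: \<Psi>_hom(4) eq_neg_iff_add_eq_0 add.commute)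
  show "\<Psi> al (p - q) = \<Psi> al p - \<Psi> al q" using \<Psi>_hom(1)[of al p "- q"] by (simp add: m)
qed

definition N :: "complex => (poly3 set, nat) tgwa_gen free set" where
  "N al = {p \<in> words (W.G al). \<Psi> al p \<in> Jp al}"

lemma N_ideal: "N al \<subseteq> words (W.G al)" "0 \<in> N al" "p \<in> N al ==> q \<in> N al ==> p + q \<in> N al"
  "p \<in> N al ==> q \<in> words (W.G al) ==> q * p \<in> N al" "p \<in> N al ==> q \<in> words (W.G al) ==> p * q \<in> N al"
  by (simp_all add: N_def W.words_closed \<Psi>_hom Jp_ideal subset_iff del: One_nat_def)

context
  fixes al :: complex
  assumes al: "al \<notin> \<nat>"
begin

lemma idx_all [simp]: "(a, b) \<in> idx al"
  using al by (auto simp: idx_def)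

lemma weight_nonzero: "al - of_nat a - of_nat b \<noteq> 0"
proof
  assume "al - of_nat a - of_nat b = 0"
  then have "al = of_nat (a + b)" by (simp add: algebra_simps)
  then show False using al by simp
qed

lemma img_act:
  "act1 al (img al (R_gen r)) (mon al a b) = sc (rv al r a b) (mon al a b)"
  "act1 al (img al (X_gen 1)) (mon al a b) = sc (of_nat a) (mon al (a - 1) b)"
  "act1 al (img al (X_gen 2)) (mon al a b) = sc (of_nat b) (mon al (a + 1) (b - 1))"
  "act1 al (img al (Y_gen 1)) (mon al a b) = sc (al - of_nat a - of_nat b) (mon al (a + 1) b)"
  "act1 al (img al (Y_gen 2)) (mon al a b) = sc (of_nat a) (mon al (a - 1) (b + 1))"
  using diag_elt[of a b al] mon_step[of a b al] by (simp_all add: img_def)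

lemma img_act_mult: "act1 al (u * img al g) (mon al a b) = act1 al u (act1 al (img al g) (mon al a b))"
  by (rule act1_simps(5)) simp

lemma act1_sc_mon: "act1 al u (sc c (mon al a b)) = sc c (act1 al u (mon al a b))"
  by (rule act1_sc(2)) simp

lemma rv_hom:
  assumes "r \<in> carrier (R_alg al)" "s \<in> carrier (R_alg al)"
  shows "rv al (r \<oplus>\<^bsub>R_alg al\<^esub> s) a b = rv al r a b + rv al s a b"
    "rv al (r \<otimes>\<^bsub>R_alg al\<^esub> s) a b = rv al r a b * rv al s a b"
    "rv al (c \<odot>\<^bsub>R_alg al\<^esub> r) a b = c * rv al r a b" "rv al \<one>\<^bsub>R_alg al\<^esub> a b = 1"
proof -
  obtain p q where pq: "r = rcl al p" "s = rcl al q" using assms R.surj by auto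
  show "rv al (r \<oplus>\<^bsub>R_alg al\<^esub> s) a b = rv al r a b + rv al s a b"
    unfolding pq R.map_add[OF UNIV_I UNIV_I, symmetric] rv_rcl by (rule peval_hom)
  show "rv al (r \<otimes>\<^bsub>R_alg al\<^esub> s) a b = rv al r a b * rv al s a b"
    unfolding pq R.map_mult[OF UNIV_I UNIV_I, symmetric] rv_rcl by (rule peval_hom)
  show "rv al (c \<odot>\<^bsub>R_alg al\<^esub> r) a b = c * rv al r a b"
    unfolding pq R.map_sc[OF UNIV_I, symmetric] rv_rcl by (simp only: peval_hom)
  show "rv al \<one>\<^bsub>R_alg al\<^esub> a b = 1" unfolding R.map_one[symmetric] rv_rcl by (rule peval_hom)
qed

lemma ex_step: "ex al a b + step 1 = ex al (Suc a) b" "ex al (Suc a) b + - step 1 = ex al a b"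
  "ex al (Suc a) b + step 2 = ex al a (Suc b)" "ex al a (Suc b) + - step 2 = ex al (Suc a) b"
  by (rule vec3_eqI; simp add: step_def)+

lemma rv_shift:
  assumes "r \<in> carrier (R_alg al)"
  shows "rv al (shift al (step 1) r) a b = rv al r (Suc a) b"
    "rv al (shift al (- step 1) r) (Suc a) b = rv al r a b"
    "rv al (shift al (step 2) r) (Suc a) b = rv al r a (Suc b)"
    "rv al (shift al (- step 2) r) a (Suc b) = rv al r (Suc a) b"
proof -
  obtain p where p: "r = rcl al p" using assms R.surj by auto
  show "rv al (shift al (step 1) r) a b = rv al r (Suc a) b"
    "rv al (shift al (- step 1) r) (Suc a) b = rv al r a b"
    "rv al (shift al (step 2) r) (Suc a) b = rv al r a (Suc b)"
    "rv al (shift al (- step 2) r) a (Suc b) = rv al r (Suc a) b"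
    unfolding p shift_rcl[OF step_plane] shift_rcl[OF plane_uminus[OF step_plane]] rv_rcl peval_translate ex_step
    by (rule refl)+
qed

lemma rv_edge: "rv al (edge_elt al 1) a b = of_nat a * (al - of_nat a - of_nat b + 1)"
  "rv al (edge_elt al 2) a b = of_nat b * (of_nat a + 1)"
  unfolding edge_elt_def rv_rcl by (simp_all add: peval_hom)

lemma sc_eqI: "c = d ==> p = q \<or> c = 0 ==> sc c p = sc d (q :: fexpr)"
  by auto

lemma edge_closed: "edge_elt al i \<in> carrier (R_alg al)" by (simp add: edge_elt_def R.surj)

text \<open>Both sides are multiples of the same monomial or vanish; the cases on exponents treat the boundary, where
  truncated subtraction is compensated by a zero coefficient.\<close>

lemma \<Psi>_relations:
  assumes "(l, r) \<in> W.Rel al"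
  shows "act1 al (\<Psi> al l) (mon al a b) = act1 al (\<Psi> al r) (mon al a b)"
  using assms
proof (cases rule: tgwa_rel.cases)
  case (1 r s)
  then show ?thesis by (simp add: \<Psi>_hom act1_ring img_act rv_hom(1) sc_add_left)
next
  case (2 r c)
  then show ?thesis unfolding 2 const_eq mult.assoc mult_1
    by (simp only: \<Psi>_hom(5) \<Psi>_sc act1_sc(1)[OF mon_in_S[OF idx_all]] img_act rv_hom(3) sc_sc)
next
  case (3 r' s')
  show ?thesis by (simp only: 3(1,2) \<Psi>_hom img_act_mult img_act act1_sc_mon sc_sc rv_hom(2)[OF 3(3,4)] mult.commute[of "rv al s' a b"])
next
  case 4
  then show ?thesis by (simp add: \<Psi>_hom img_act act1_ring rv_hom(4)[OF edge_closed edge_closed])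
next
  case (5 i r)
  show ?thesis
  proof (cases "i = 1")
    case True
    show ?thesis unfolding 5 True \<Psi>_hom img_act_mult img_act act1_sc_mon sc_sc
      by (rule sc_eqI; cases a; simp add: rv_shift(1)[OF 5(4)] Suc_eq_plus1[symmetric] Suc_eq_plus1_left[symmetric] algebra_simps del: One_nat_def)
  next
    case False
    then have i: "i = 2" using 5 by simp
    show ?thesis unfolding 5 i \<Psi>_hom img_act_mult img_act act1_sc_mon sc_sc
      by (rule sc_eqI; cases b; simp add: rv_shift(3)[OF 5(4)] Suc_eq_plus1[symmetric] Suc_eq_plus1_left[symmetric] algebra_simps del: One_nat_def)
  qed
next
  case (6 i r)
  show ?thesis
  proof (cases "i = 1")
    case True
    show ?thesis unfolding 6 True \<Psi>_hom img_act_mult img_act act1_sc_mon sc_sc inv_shift[OF step_plane 6(4)]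
      by (rule sc_eqI; simp add: rv_shift(2)[OF 6(4)] Suc_eq_plus1[symmetric] Suc_eq_plus1_left[symmetric] algebra_simps del: One_nat_def)
  next
    case False
    then have i: "i = 2" using 6 by simp
    show ?thesis unfolding 6 i \<Psi>_hom img_act_mult img_act act1_sc_mon sc_sc inv_shift[OF step_plane 6(4)]
      by (rule sc_eqI; cases a; simp add: rv_shift(4)[OF 6(4)] Suc_eq_plus1[symmetric] Suc_eq_plus1_left[symmetric] algebra_simps del: One_nat_def)
  qed
next
  case (7 i j)
  then consider "i = 1" "j = 2" | "i = 2" "j = 1" by auto
  then show ?thesis
  proof cases
    case 1
    show ?thesis unfolding 7 1 \<Psi>_hom img_act_mult img_act act1_sc_mon sc_sc by (rule sc_eqI; simp add:  Suc_eq_plus1[symmetric] Suc_eq_plus1_left[symmetric] algebra_simps del: One_nat_def)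
  next
    case 2
    show ?thesis unfolding 7 2 \<Psi>_hom img_act_mult img_act act1_sc_mon sc_sc
      by (rule sc_eqI; cases b; simp add:  Suc_eq_plus1[symmetric] Suc_eq_plus1_left[symmetric] algebra_simps del: One_nat_def)
  qed
next
  case (8 i)
  show ?thesis
  proof (cases "i = 1")
    case True
    show ?thesis unfolding 8 True \<Psi>_hom img_act_mult img_act act1_sc_mon sc_sc rv_edge
      by (rule sc_eqI; cases a; simp add:  Suc_eq_plus1[symmetric] Suc_eq_plus1_left[symmetric] algebra_simps del: One_nat_def)
  next
    case False
    then have i: "i = 2" using 8 by simp
    show ?thesis unfolding 8 i \<Psi>_hom img_act_mult img_act act1_sc_mon sc_sc rv_edge
      by (rule sc_eqI; cases b; simp add:  Suc_eq_plus1[symmetric] Suc_eq_plus1_left[symmetric] algebra_simps del: One_nat_def)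
  qed
next
  case (9 i)
  show ?thesis
  proof (cases "i = 1")
    case True
    show ?thesis unfolding 9 True \<Psi>_hom img_act_mult img_act act1_sc_mon sc_sc rv_shift(1)[OF edge_closed] rv_edge
      by (rule sc_eqI; simp add:  Suc_eq_plus1[symmetric] Suc_eq_plus1_left[symmetric] algebra_simps del: One_nat_def)
  next
    case False
    then have i: "i = 2" using 9 by simp
    show ?thesis
    proof (cases a)
      case 0
      have "rv al (shift al (step 2) (edge_elt al 2)) 0 b = 0"
        unfolding edge_elt_def shift_rcl[OF step_plane] rv_rcl peval_translate by (simp add: peval_hom step_nth)
      then show ?thesis unfolding 9 i 0 \<Psi>_hom img_act_mult img_act act1_sc_mon sc_sc by simp
    next
      case (Suc a')
      show ?thesis unfolding 9 i Suc \<Psi>_hom img_act_mult img_act act1_sc_mon sc_sc rv_shift(3)[OF edge_closed] rv_edge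
        by (rule sc_eqI; simp add:  Suc_eq_plus1[symmetric] Suc_eq_plus1_left[symmetric] algebra_simps del: One_nat_def)
    qed
  qed
qed

lemma N_saturated:
  assumes "p \<in> N al" "q \<in> words (W.G al)" "W.cls al p = W.cls al q"
  shows "q \<in> N al"
proof -
  let ?F = "monoid_alg (words (W.G al))"
  have cov: "cover ?F (words (W.G al)) (\<lambda>p. p)" by (rule cover_monoid_alg[OF subalg_words])
  have id: "ideal (N al) ?F" using cover_idealI[OF cov N_ideal[where al = al]] by simp
  have gens: "{l - r | l r. (l, r) \<in> W.Rel al} \<subseteq> N al"
  proof (rule subsetI, elim CollectE exE conjE)
    fix x l r assume x: "x = l - r" and lr: "(l, r) \<in> W.Rel al"
    have "\<Psi> al (l - r) \<in> Jp al"
      by (rule Jp_monI) (simp add: \<Psi>_diff act1_ring \<Psi>_relations[OF lr])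
    moreover have "l - r \<in> words (W.G al)"
      using subsetD[OF W.rel_words lr] alg_map.C_diff[OF cover.axioms(1)[OF cov]] by blast
    ultimately show "x \<in> N al" by (simp add: N_def x)
  qed
  have "ring ?F" using id by (rule ideal.axioms(2))
  then have "rel_ideal (W.G al) (W.Rel al) \<subseteq> N al"
    unfolding rel_ideal_def free_alg_words by (rule ring.genideal_minimal[OF _ id gens])
  moreover have "p - q \<in> rel_ideal (W.G al) (W.Rel al)"
    using presented_cover(2)[OF W.rel_words _ assms(2), where p = p] assms(1,3) unfolding tgwa_class_def by (simp add: N_def)
  ultimately have "p - q \<in> N al" by blast
  then have "\<Psi> al p - \<Psi> al q \<in> Jp al" by (simp add: N_def \<Psi>_diff)
  moreover have "\<Psi> al p \<in> Jp al" using assms(1) by (simp add: N_def)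
  ultimately show ?thesis using assms(2) Jp_ideal(3) by (simp add: N_def)
qed

text \<open>The degree of an operator that takes one monomial to a multiple of another one.\<close>

definition move :: "nat => nat => nat => nat => nat => int" where
  "move a b x y v = (if v = 1 then int a - int x + (int b - int y) else if v = 2 then int b - int y else 0)"

text \<open>A word takes a monomial to a multiple of a monomial, and its degree can be read off from the exponents. This
  makes the kernel of the action homogeneous.\<close>

lemma word_action:
  assumes "set w \<subseteq> W.G al"
  shows "\<exists>s x y. act1 al (\<Psi> al (single w c)) (mon al a b) = sc s (mon al x y) \<and> (s = 0 \<or> word_degree w = move a b x y)"
  using assms
proof (induction w)
  case Nil
  have "act1 al (\<Psi> al (single [] c)) (mon al a b) = sc c (mon al a b)"
    unfolding single_Nil \<Psi>_sc \<Psi>_hom(3) by (simp only: act1_sc(1)[OF mon_in_S[OF idx_all]] act1_simps(3)[OF mon_in_S[OF idx_all]])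
  then show ?case by (intro exI[of _ c] exI[of _ a] exI[of _ b]) (simp add: move_def fun_eq_iff)
next
  case (Cons g w)
  then obtain s x y where h: "act1 al (\<Psi> al (single w c)) (mon al a b) = sc s (mon al x y)"
    "s = 0 \<or> word_degree w = move a b x y" by auto
  have act: "act1 al (\<Psi> al (single (g # w) c)) (mon al a b) = sc s (act1 al (img al g) (mon al x y))"
    unfolding single_Cons \<Psi>_hom act1_simps(5)[OF mon_in_S[OF idx_all]] h(1) by (rule act1_sc_mon)
  have "g \<in> W.G al" using Cons.prems by simp
  then consider r where "g = R_gen r" | "g = X_gen 1" | "g = X_gen 2" | "g = Y_gen 1" | "g = Y_gen 2"
    unfolding tgwa_gens_def by auto
  then show ?case
  proof cases
    case (1 r)
    show ?thesis unfolding act unfolding 1 img_act sc_sc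
      by (intro exI[of _ "s * rv al r x y"] exI[of _ x] exI[of _ y]) (use h(2) in auto)
  next
    case 2
    show ?thesis unfolding act unfolding 2 img_act sc_sc
      by (intro exI[of _ "s * of_nat x"] exI[of _ "x - 1"] exI[of _ y]) (use h(2) in \<open>cases x; auto simp: move_def fun_eq_iff\<close>)
  next
    case 3
    show ?thesis unfolding act unfolding 3 img_act sc_sc
      by (intro exI[of _ "s * of_nat y"] exI[of _ "x + 1"] exI[of _ "y - 1"]) (use h(2) in \<open>cases y; auto simp: move_def fun_eq_iff\<close>)
  next
    case 4
    show ?thesis unfolding act unfolding 4 img_act sc_sc
      by (intro exI[of _ "s * (al - of_nat x - of_nat y)"] exI[of _ "x + 1"] exI[of _ y]) (use h(2) in \<open>auto simp: move_def fun_eq_iff\<close>)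
  next
    case 5
    show ?thesis unfolding act unfolding 5 img_act sc_sc
      by (intro exI[of _ "s * of_nat x"] exI[of _ "x - 1"] exI[of _ "y + 1"]) (use h(2) in \<open>cases x; auto simp: move_def fun_eq_iff\<close>)
  qed
qed

definition coef :: "nat => nat => nat => nat => (poly3 set, nat) tgwa_gen free => complex" where
  "coef a b x y p = lookup (act1 al (\<Psi> al p) (mon al a b)) (ex al x y)"

lemma coef_word:
  assumes "set w \<subseteq> W.G al" "coef a b x y (single w c) \<noteq> 0"
  shows "word_degree w = move a b x y"
proof -
  obtain s x' y' where h: "act1 al (\<Psi> al (single w c)) (mon al a b) = sc s (mon al x' y')"
    "s = 0 \<or> word_degree w = move a b x' y'" using word_action[OF assms(1)] by blast
  have "s * lookup (mon al x' y') (ex al x y) \<noteq> 0" using assms(2) unfolding coef_def h(1) lookup_sc .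
  then show ?thesis using h(2) by (auto simp: lookup_mon split: if_splits)
qed

lemma coef_sum: "coef a b x y (sum h F) = (\<Sum>i\<in>F. coef a b x y (h i))"
  by (induction F rule: infinite_finite_induct) (simp_all add: coef_def \<Psi>_hom act1_ring lookup_add)

lemma coef_part:
  assumes "p \<in> words (W.G al)"
  shows "coef a b x y (part d p) = (if d = move a b x y then coef a b x y p else 0)"
proof -
  have w: "set w \<subseteq> W.G al" if "w \<in> keys p" for w using assms that by (simp add: words_def)
  have "coef a b x y (part d p) = (\<Sum>w | w \<in> keys p \<and> word_degree w = d. coef a b x y (single w (lookup p w)))"
    unfolding part_def coef_sum ..
  also have "\<dots> = (if d = move a b x y then \<Sum>w\<in>keys p. coef a b x y (single w (lookup p w)) else 0)"
  proof (cases "d = move a b x y")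
    case True
    have "(\<Sum>w | w \<in> keys p \<and> word_degree w = d. coef a b x y (single w (lookup p w))) =
      (\<Sum>w\<in>keys p. coef a b x y (single w (lookup p w)))"
      by (rule sum.mono_neutral_left) (use coef_word[OF w] True in auto)
    then show ?thesis using True by simp
  next
    case False
    have "(\<Sum>w | w \<in> keys p \<and> word_degree w = d. coef a b x y (single w (lookup p w))) = 0"
      by (rule sum.neutral) (use coef_word[OF w] False in auto)
    then show ?thesis using False by simp
  qed
  also have "(\<Sum>w\<in>keys p. coef a b x y (single w (lookup p w))) = coef a b x y p"
    unfolding coef_sum[symmetric] by (simp only: poly_mapping_expand[symmetric])
  finally show ?thesis .
qed

lemma S_eqI:
  assumes "f \<in> S al" "g \<in> S al" "\<And>x y. lookup f (ex al x y) = lookup g (ex al x y)"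
  shows "f = g"
proof (rule poly_mapping_eqI)
  fix k show "lookup f k = lookup g k"
  proof (cases "k \<in> keys f \<or> k \<in> keys g")
    case True
    then obtain x y where "k = ex al x y" using S_keys[OF assms(1)] S_keys[OF assms(2)] by blast
    then show ?thesis using assms(3) by simp
  qed (simp add: in_keys_iff)
qed

lemma N_iff_coef: "p \<in> words (W.G al) ==> p \<in> N al \<longleftrightarrow> (\<forall>a b x y. coef a b x y p = 0)"
proof
  assume "p \<in> N al"
  then have "act1 al (\<Psi> al p) (mon al a b) = 0" for a b by (simp add: N_def Jp_def)
  then show "\<forall>a b x y. coef a b x y p = 0" by (simp add: coef_def)
next
  assume p: "p \<in> words (W.G al)" and z: "\<forall>a b x y. coef a b x y p = 0"
  have "act1 al (\<Psi> al p) (mon al a b) = 0" for a b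
    by (rule S_eqI) (use z in \<open>simp_all add: coef_def\<close>)
  then show "p \<in> N al" using p Jp_monI by (simp add: N_def)
qed

lemma N_homogeneous: "p \<in> N al ==> part d p \<in> N al"
  using N_iff_coef[of p] N_iff_coef[of "part d p"] part_words[of p "W.G al" d] subsetD[OF N_ideal(1)[of al], of p]
  by (simp add: coef_part)

lemma N_meets_R:
  assumes "r \<in> carrier (R_alg al)" "gen (R_gen r) \<in> N al"
  shows "r = \<zero>\<^bsub>R_alg al\<^esub>"
proof -
  have "diag_elt al r \<in> Jp al" using assms(2) by (simp add: N_def \<Psi>_hom img_def)
  then have "sc (rv al r a b) (mon al a b) = 0" for a b
    using diag_elt[of a b al r] by (simp add: Jp_def)
  then have "rv al r a b = 0" for a b by (simp only: mon_nonzero)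
  then have "rcl al (rpoly al r) = rcl al 0" unfolding rcl_eq_exponents by (simp add: peval_hom)
  then show ?thesis using rcl_rpoly[OF assms(1)] by simp
qed

definition reaches :: "nat \<times> nat => nat \<times> nat => bool" where
  "reaches k l \<longleftrightarrow> (\<exists>w c. set w \<subseteq> W.G al \<and> c \<noteq> 0 \<and>
     act1 al (\<Psi> al (single w 1)) (mon al (fst k) (snd k)) = sc c (mon al (fst l) (snd l)))"

lemma reaches_refl: "reaches k k"
  unfolding reaches_def
  by (cases k, intro exI[of _ "[]"] exI[of _ 1]) (simp add: single_Nil \<Psi>_hom act1_ring)

lemma reaches_step:
  assumes "reaches k (x, y)" "g \<in> W.G al" "act1 al (img al g) (mon al x y) = sc c (mon al x' y')" "c \<noteq> 0"
  shows "reaches k (x', y')"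
proof -
  obtain w d where w: "set w \<subseteq> W.G al" "d \<noteq> 0" "act1 al (\<Psi> al (single w 1)) (mon al (fst k) (snd k)) = sc d (mon al x y)"
    using assms(1) unfolding reaches_def by auto
  have "act1 al (\<Psi> al (single (g # w) 1)) (mon al (fst k) (snd k)) = sc (d * c) (mon al x' y')"
    unfolding single_Cons \<Psi>_hom act1_simps(5)[OF mon_in_S[OF idx_all]] w(3) act1_sc_mon assms(3) sc_sc ..
  then show ?thesis unfolding reaches_def using w assms(2,4)
    by (intro exI[of _ "g # w"] exI[of _ "d * c"]) simp
qed

lemma reaches_steps:
  "reaches k (Suc x, y) ==> reaches k (x, y)" "reaches k (x, Suc y) ==> reaches k (Suc x, y)"
  "reaches k (x, y) ==> reaches k (Suc x, y)" "reaches k (Suc x, y) ==> reaches k (x, Suc y)"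
proof -
  have n: "of_nat (Suc m) \<noteq> (0 :: complex)" for m by (simp del: of_nat_Suc)
  show "reaches k (Suc x, y) ==> reaches k (x, y)"
    using reaches_step[of k "Suc x" y "X_gen 1" "of_nat (Suc x)" x y] by (simp add: img_act(2) W.gens n weight_nonzero Suc_eq_plus1[symmetric] del: of_nat_Suc One_nat_def)
  show "reaches k (x, Suc y) ==> reaches k (Suc x, y)"
    using reaches_step[of k x "Suc y" "X_gen 2" "of_nat (Suc y)" "Suc x" y] by (simp add: img_act(3) W.gens n weight_nonzero Suc_eq_plus1[symmetric] del: of_nat_Suc One_nat_def)
  show "reaches k (x, y) ==> reaches k (Suc x, y)"
    using reaches_step[of k x y "Y_gen 1" "al - of_nat x - of_nat y" "Suc x" y] weight_nonzero[of x y] by (simp add: img_act(4) W.gens n weight_nonzero Suc_eq_plus1[symmetric] del: of_nat_Suc One_nat_def)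
  show "reaches k (Suc x, y) ==> reaches k (x, Suc y)"
    using reaches_step[of k "Suc x" y "Y_gen 2" "of_nat (Suc x)" x "Suc y"] by (simp add: img_act(5) W.gens n weight_nonzero Suc_eq_plus1[symmetric] del: of_nat_Suc One_nat_def)
qed

lemma reaches_all: "reaches k (x, y)"
proof -
  have down: "reaches k (m, n) ==> reaches k (0, 0)" for m n
  proof (induction n arbitrary: m)
    case 0 then show ?case by (induction m) (auto intro: reaches_steps(1))
  next
    case (Suc n) then show ?case using reaches_steps(2) by blast
  qed
  have "reaches k (fst k, snd k)" using reaches_refl by simp
  from down[OF this] have z: "reaches k (0, 0)" .
  have row: "reaches k (m, 0)" for m by (induction m) (auto intro: z reaches_steps(3))
  show ?thesis by (induction y arbitrary: x) (auto intro: row reaches_steps(4))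
qed

text \<open>A homogeneous element takes some monomial to a nonzero multiple of another one, and a word leads back
  from there.\<close>

lemma N_nondegenerate:
  assumes p: "p \<in> words (W.G al)" "p \<notin> N al" and d: "\<forall>w\<in>keys p. word_degree w = d"
  shows "\<exists>q\<in>words (W.G al). (\<forall>w\<in>keys q. word_degree w = (\<lambda>v. - d v)) \<and> q * p \<notin> N al"
proof -
  obtain a b x y where nz: "coef a b x y p \<noteq> 0" using N_iff_coef[OF p(1)] p(2) by blast
  have "part d p = p"
    by (rule poly_mapping_eqI) (use d in \<open>auto simp: lookup_part in_keys_iff\<close>)
  then have c: "coef a' b' x' y' p = (if d = move a' b' x' y' then coef a' b' x' y' p else 0)" for a' b' x' y'
    using coef_part[OF p(1), of a' b' x' y' d] by simp
  have dm: "d = move a b x y" using c[of a b x y] nz by (simp split: if_splits)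
  have only: "x' = x \<and> y' = y" if "coef a b x' y' p \<noteq> 0" for x' y'
  proof -
    have "move a b x y = move a b x' y'" using c[of a b x' y'] that dm by (simp split: if_splits)
    from fun_cong[OF this, of 1] fun_cong[OF this, of 2] show ?thesis by (simp add: move_def)
  qed
  have act: "act1 al (\<Psi> al p) (mon al a b) = sc (coef a b x y p) (mon al x y)"
  proof (rule S_eqI)
    fix x' y'
    show "lookup (act1 al (\<Psi> al p) (mon al a b)) (ex al x' y') = lookup (sc (coef a b x y p) (mon al x y)) (ex al x' y')"
      using only[of x' y'] unfolding lookup_sc lookup_mon by (auto simp: coef_def)
  qed simp_all
  obtain w s where w: "set w \<subseteq> W.G al" "s \<noteq> 0" "act1 al (\<Psi> al (single w 1)) (mon al x y) = sc s (mon al a b)"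
    using reaches_all[of "(x, y)" a b] unfolding reaches_def by auto
  have "coef x y a b (single w 1) = s" unfolding coef_def w(3) lookup_sc lookup_mon by simp
  then have "word_degree w = move x y a b" using coef_word[OF w(1), of x y a b 1] w(2) by simp
  then have deg: "word_degree w = (\<lambda>v. - d v)" by (simp add: dm move_def fun_eq_iff)
  have "act1 al (\<Psi> al (single w 1 * p)) (mon al a b) = sc (coef a b x y p * s) (mon al a b)"
    unfolding \<Psi>_hom act1_simps(5)[OF mon_in_S[OF idx_all]] act act1_sc_mon w(3) sc_sc ..
  moreover have "sc (coef a b x y p * s) (mon al a b) \<noteq> 0" unfolding mon_nonzero using nz w(2) by simp
  moreover have "act1 al (\<Psi> al u) (mon al a b) = 0" if "u \<in> N al" for u using that by (simp add: N_def Jp_def)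
  ultimately have "single w 1 * p \<notin> N al" by metis
  then show ?thesis using deg W.single_words[OF w(1), of 1] by (intro bexI[of _ "single w 1"]) auto
qed

text \<open>The two units that are not generators are commutators of generators.\<close>

lemma \<Psi>_covers_units: "\<exists>g\<in>words (W.G al). \<Psi> al g - gen (i, j) \<in> Jp al"
proof -
  have xy: "gen (X_gen 1) \<in> words (W.G al)" "gen (X_gen 2) \<in> words (W.G al)" "gen (Y_gen 1) \<in> words (W.G al)" "gen (Y_gen 2) \<in> words (W.G al)"
    by (simp_all add: W.gens del: One_nat_def)
  have cd: "p \<in> words (W.G al) ==> q \<in> words (W.G al) ==> p * q - q * p \<in> words (W.G al)" for p q
    using alg_map.C_diff[OF cover.axioms(1)[OF W.A_cover]] W.words_closed(2) by blast
  have diag: ?thesis if "i = j"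
  proof (rule bexI)
    show "gen (R_gen (rcl al (poly3_var i))) \<in> words (W.G al)" by (simp add: W.gens R.surj del: One_nat_def)
    show "\<Psi> al (gen (R_gen (rcl al (poly3_var i)))) - gen (i, j) \<in> Jp al"
      by (rule Jp_monI) (simp add: that[symmetric] \<Psi>_hom act1_ring img_act(1) act1_diag rv_rcl peval_hom)
  qed
  have raw: ?thesis if "g \<in> words (W.G al)" "\<Psi> al g = gen (i, j)" for g
    using that Jp_ideal(1)[of al] by (intro bexI[of _ g]) simp_all
  have comm: "gen (i, k) * gen (k, j) - gen (k, j) * gen (i, k) - gen (i, j) \<in> Jp al" if "i \<noteq> j" for k
    using act1_\<pi>[OF \<pi>_comm[of i k k j], of al] that by (simp add: Jp_def act1_ring) 
  consider "i = j" | "i = 1" "j = 2" | "i = 2" "j = 3" | "i = 2" "j = 1" | "i = 3" "j = 2" | "i = 1" "j = 3" | "i = 3" "j = 1"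
    using exhaust_3[of i] exhaust_3[of j] by blast
  then show ?thesis
  proof cases
    case 1 then show ?thesis by (rule diag)
  next
    case 2 then show ?thesis using raw[OF xy(1)] by (simp add: \<Psi>_hom img_def)
  next
    case 3 then show ?thesis using raw[OF xy(2)] by (simp add: \<Psi>_hom img_def)
  next
    case 4 then show ?thesis using raw[OF xy(3)] by (simp add: \<Psi>_hom img_def)
  next
    case 5 then show ?thesis using raw[OF xy(4)] by (simp add: \<Psi>_hom img_def)
  next
    case 6
    then have "\<Psi> al (gen (X_gen 1) * gen (X_gen 2) - gen (X_gen 2) * gen (X_gen 1)) - gen (i, j) \<in> Jp al"
      using comm[of 2] by (simp add: \<Psi>_diff \<Psi>_hom img_def)
    then show ?thesis using cd[OF xy(1,2)] by blast
  next
    case 7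
    then have "\<Psi> al (gen (Y_gen 2) * gen (Y_gen 1) - gen (Y_gen 1) * gen (Y_gen 2)) - gen (i, j) \<in> Jp al"
      using comm[of 2] by (simp add: \<Psi>_diff \<Psi>_hom img_def)
    then show ?thesis using cd[OF xy(4,3)] by blast
  qed
qed

lemma \<Psi>_covers: "\<exists>q\<in>words (W.G al). \<Psi> al q - u \<in> Jp al"
proof -
  have "u \<in> words UNIV" by simp
  then show ?thesis
  proof (induction u rule: free_induct)
    case one show ?case by (rule bexI[of _ 1]) (simp_all add: \<Psi>_hom Jp_ideal W.words_closed del: One_nat_def)
  next
    case (gen x u)
    then obtain q where q: "q \<in> words (W.G al)" "\<Psi> al q - u \<in> Jp al" by blast
    obtain g where g: "g \<in> words (W.G al)" "\<Psi> al g - Defs.gen x \<in> Jp al" using \<Psi>_covers_units[of "fst x" "snd x"] by auto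
    have "(\<Psi> al g - Defs.gen x) * \<Psi> al q + Defs.gen x * (\<Psi> al q - u) \<in> Jp al"
      by (intro Jp_ideal(2) Jp_ideal(4)[OF q(2)] Jp_ideal(5)[OF g(2)])
    then have "\<Psi> al (g * q) - Defs.gen x * u \<in> Jp al" by (simp add: \<Psi>_hom algebra_simps)
    then show ?case using W.words_closed(2)[OF g(1) q(1)] by blast
  next
    case (sc c u)
    then obtain q where q: "q \<in> words (W.G al)" "\<Psi> al q - u \<in> Jp al" by blast
    have "sc c (\<Psi> al q - u) \<in> Jp al" by (rule Jp_ideal(4)[OF q(2)])
    then have "\<Psi> al (sc c q) - sc c u \<in> Jp al" by (simp only: \<Psi>_sc right_diff_distrib)
    then show ?case using W.words_closed(3)[OF q(1)] by blast
  next
    case (add u w)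
    then obtain q q' where q: "q \<in> words (W.G al)" "\<Psi> al q - u \<in> Jp al" "q' \<in> words (W.G al)" "\<Psi> al q' - w \<in> Jp al" by blast
    have "(\<Psi> al q - u) + (\<Psi> al q' - w) \<in> Jp al" by (rule Jp_ideal(2)[OF q(2,4)])
    then have "\<Psi> al (q + q') - (u + w) \<in> Jp al" by (simp add: \<Psi>_hom algebra_simps)
    then show ?case using W.words_closed(1)[OF q(1,3)] by blast
  qed
qed

lemma \<AA>_cover: "cover (\<AA> al) (words (W.G al)) (\<lambda>p. \<kappa> al (\<Psi> al p))"
proof -
  interpret K: cover "\<AA> al" UNIV "\<kappa> al" by (rule \<kappa>_cover)
  show ?thesis
  proof (rule cover.intro[OF alg_map.intro[OF K.cx_alg_axioms alg_map_axioms.intro] cover_axioms.intro])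
    show "carrier (\<AA> al) = (\<lambda>p. \<kappa> al (\<Psi> al p)) ` words (W.G al)"
    proof (intro equalityI subsetI)
      fix a assume "a \<in> carrier (\<AA> al)"
      then obtain u where u: "a = \<kappa> al u" using K.surj by auto
      obtain q where "q \<in> words (W.G al)" "\<Psi> al q - u \<in> Jp al" using \<Psi>_covers by blast
      then show "a \<in> (\<lambda>p. \<kappa> al (\<Psi> al p)) ` words (W.G al)" unfolding u \<kappa>_eq[symmetric] by (intro image_eqI[of _ _ q]) simp_all
    qed auto
    show "\<kappa> al (\<Psi> al (sc c p)) = c \<odot>\<^bsub>\<AA> al\<^esub> \<kappa> al (\<Psi> al p)" for c p
      by (simp only: \<Psi>_sc K.map_sc UNIV_I)
  qed (simp_all only: subalg_words K.map_closed \<Psi>_hom \<Psi>_sc K.map_add K.map_mult K.map_one K.map_sc UNIV_I)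
qed

theorem \<AA>_is_tgwa:
  "alg_iso (\<AA> al) (tgwa {1, 2} (R_alg al) (\<lambda>i. shift al (step i)) (edge_elt al)) \<noteq> {}"
proof -
  have covered: "\<exists>\<psi>. cover (tgwa {1, 2} (R_alg al) (\<lambda>i. shift al (step i)) (edge_elt al)) (words (W.G al)) \<psi> \<and>
    (\<forall>p\<in>words (W.G al). \<psi> p = \<zero>\<^bsub>tgwa {1, 2} (R_alg al) (\<lambda>i. shift al (step i)) (edge_elt al)\<^esub> \<longleftrightarrow> p \<in> N al)"
    by (rule W.tgwa_cover[where N = "N al"], rule N_ideal(1), rule N_ideal(2), erule (1) N_ideal(3), erule (1) N_ideal(4),
      erule (1) N_ideal(5), erule (2) N_saturated, erule N_homogeneous, erule (1) N_meets_R, erule (2) N_nondegenerate)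
  obtain \<psi> where \<psi>: "cover (tgwa {1, 2} (R_alg al) (\<lambda>i. shift al (step i)) (edge_elt al)) (words (W.G al)) \<psi>"
    "\<forall>p\<in>words (W.G al). \<psi> p = \<zero>\<^bsub>tgwa {1, 2} (R_alg al) (\<lambda>i. shift al (step i)) (edge_elt al)\<^esub> \<longleftrightarrow> p \<in> N al"
    using covered by blast
  show ?thesis
    by (rule cover_iso[OF \<AA>_cover \<psi>(1)]) (use \<psi>(2) in \<open>simp add: \<kappa>_zero N_def\<close>)
qed

end

section \<open>Structure of the quotient algebras\<close>

theorem theorem2p2:
  fixes \<alpha> :: complex
  shows
    "irreducible_gmod (S_mod \<alpha>) \<and>
     ((\<nexists>m::int. m < 0 \<and> \<alpha> = of_int m) \<longrightarrow> maximalideal (J \<alpha>) U) \<and>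
     (\<alpha> \<notin> \<nat> \<longrightarrow>
       gmodule (\<AA>_adjoint \<alpha>) \<and>
       (\<exists>L :: nat \<Rightarrow> Uelt set gmod.
          (\<forall>k. is_L_theta k (L k)) \<and> gmod_iso (\<AA>_adjoint \<alpha>) (gmod_sum UNIV L) \<noteq> {})) \<and>
     (\<forall>n::nat. \<alpha> = of_nat n \<longrightarrow>
       gmodule (\<AA>_adjoint \<alpha>) \<and>
       (\<exists>L :: nat \<Rightarrow> Uelt set gmod.
          (\<forall>k\<le>n. is_L_theta k (L k)) \<and> gmod_iso (\<AA>_adjoint \<alpha>) (gmod_sum {0..n} L) \<noteq> {})) \<and>
     (\<alpha> \<notin> \<nat> \<longrightarrow>
       (\<exists>(\<sigma> :: nat \<Rightarrow> poly3 set \<Rightarrow> poly3 set) (t :: nat \<Rightarrow> poly3 set).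
         let R = R_alg \<alpha>; E = R_E \<alpha>; V = {1, 2}; Edges = {(1, 2), (2, 1)} in
           \<sigma> 1 (E 1) = E 1 \<ominus>\<^bsub>R\<^esub> \<one>\<^bsub>R\<^esub> \<and> \<sigma> 1 (E 2) = E 2 \<oplus>\<^bsub>R\<^esub> \<one>\<^bsub>R\<^esub> \<and> \<sigma> 1 (E 3) = E 3 \<and>
           \<sigma> 2 (E 1) = E 1 \<and> \<sigma> 2 (E 2) = E 2 \<ominus>\<^bsub>R\<^esub> \<one>\<^bsub>R\<^esub> \<and> \<sigma> 2 (E 3) = E 3 \<oplus>\<^bsub>R\<^esub> \<one>\<^bsub>R\<^esub> \<and>
           t 1 = E 2 \<otimes>\<^bsub>R\<^esub> (E 1 \<oplus>\<^bsub>R\<^esub> \<one>\<^bsub>R\<^esub>) \<and> t 2 = E 3 \<otimes>\<^bsub>R\<^esub> (E 2 \<oplus>\<^bsub>R\<^esub> \<one>\<^bsub>R\<^esub>) \<and>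
           tgwa_datum V Edges R \<sigma> t \<and>
           alg_iso (\<AA> \<alpha>) (tgwa V R \<sigma> t) \<noteq> {})) \<and>
     ((\<nexists>m::int. m < 0 \<and> \<alpha> = of_int m) \<longrightarrow>
       (\<exists>B :: Uelt set \<Rightarrow> Uelt set \<Rightarrow> complex.
         (\<forall>u\<in>carrier U. \<forall>v\<in>carrier U. B (\<AA>_class \<alpha> u) (\<AA>_class \<alpha> v) = U_form \<alpha> u v) \<and>
         (\<forall>a\<in>carrier (\<AA> \<alpha>). (\<forall>b\<in>carrier (\<AA> \<alpha>). B a b = 0) \<longrightarrow> a = \<zero>\<^bsub>\<AA> \<alpha>\<^esub>) \<and>
         (\<forall>b\<in>carrier (\<AA> \<alpha>). (\<forall>a\<in>carrier (\<AA> \<alpha>). B a b = 0) \<longrightarrow> b = \<zero>\<^bsub>\<AA> \<alpha>\<^esub>)))"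
proof (intro conjI impI allI)
  show "irreducible_gmod (S_mod \<alpha>)" by (rule S_mod_irreducible)
  show "maximalideal (J \<alpha>) U" if "\<nexists>m::int. m < 0 \<and> \<alpha> = of_int m" using that by (rule J_maximal)
  show "gmodule (\<AA>_adjoint \<alpha>)" "gmodule (\<AA>_adjoint \<alpha>)" by (rule \<AA>_adjoint_gmodule)+
  show "\<exists>L :: nat \<Rightarrow> Uelt set gmod.
      (\<forall>k. is_L_theta k (L k)) \<and> gmod_iso (\<AA>_adjoint \<alpha>) (gmod_sum UNIV L) \<noteq> {}" if "\<alpha> \<notin> \<nat>"
  proof (intro exI conjI allI)
    show "is_L_theta k (Lk \<alpha> k)" for k
      using that by (intro Lk_is_L_theta) (auto simp: e13_in_Jp)
    show "gmod_iso (\<AA>_adjoint \<alpha>) (gmod_sum UNIV (Lk \<alpha>)) \<noteq> {}"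
      by (rule \<AA>_adjoint_decomposition) simp
  qed
  show "\<exists>L :: nat \<Rightarrow> Uelt set gmod.
      (\<forall>k\<le>n. is_L_theta k (L k)) \<and> gmod_iso (\<AA>_adjoint \<alpha>) (gmod_sum {0..n} L) \<noteq> {}" if "\<alpha> = of_nat n" for n
  proof (intro exI conjI allI impI)
    show "is_L_theta k (Lk \<alpha> k)" if "k \<le> n" for k
      using that \<open>\<alpha> = of_nat n\<close> by (intro Lk_is_L_theta) (simp add: e13_in_Jp)
    show "gmod_iso (\<AA>_adjoint \<alpha>) (gmod_sum {0..n} (Lk \<alpha>)) \<noteq> {}"
      by (rule \<AA>_adjoint_decomposition) (simp add: e13_in_Jp that)
  qed
  show "\<exists>(\<sigma> :: nat \<Rightarrow> poly3 set \<Rightarrow> poly3 set) (t :: nat \<Rightarrow> poly3 set).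
      let R = R_alg \<alpha>; E = R_E \<alpha>; V = {1, 2}; Edges = {(1, 2), (2, 1)} in
        \<sigma> 1 (E 1) = E 1 \<ominus>\<^bsub>R\<^esub> \<one>\<^bsub>R\<^esub> \<and> \<sigma> 1 (E 2) = E 2 \<oplus>\<^bsub>R\<^esub> \<one>\<^bsub>R\<^esub> \<and> \<sigma> 1 (E 3) = E 3 \<and>
        \<sigma> 2 (E 1) = E 1 \<and> \<sigma> 2 (E 2) = E 2 \<ominus>\<^bsub>R\<^esub> \<one>\<^bsub>R\<^esub> \<and> \<sigma> 2 (E 3) = E 3 \<oplus>\<^bsub>R\<^esub> \<one>\<^bsub>R\<^esub> \<and>
        t 1 = E 2 \<otimes>\<^bsub>R\<^esub> (E 1 \<oplus>\<^bsub>R\<^esub> \<one>\<^bsub>R\<^esub>) \<and> t 2 = E 3 \<otimes>\<^bsub>R\<^esub> (E 2 \<oplus>\<^bsub>R\<^esub> \<one>\<^bsub>R\<^esub>) \<and>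
        tgwa_datum V Edges R \<sigma> t \<and>
        alg_iso (\<AA> \<alpha>) (tgwa V R \<sigma> t) \<noteq> {}" if "\<alpha> \<notin> \<nat>"
  proof -
    have E: "R_E \<alpha> i = rcl \<alpha> (poly3_var i)" for i by (simp add: R_E_def rcl_def)
    note R = R.map_add[OF UNIV_I UNIV_I, symmetric] R.map_diff[OF UNIV_I UNIV_I, symmetric]
      R.map_mult[OF UNIV_I UNIV_I, symmetric] R.map_one[symmetric]
    note sh = E R shift_rcl[OF step_plane] rcl_eq peval_translate peval_hom vector_add_component step_nth
    show ?thesis
      unfolding Let_def
    proof (intro exI conjI)
      show "shift \<alpha> (step 1) (R_E \<alpha> 1) = R_E \<alpha> 1 \<ominus>\<^bsub>R_alg \<alpha>\<^esub> \<one>\<^bsub>R_alg \<alpha>\<^esub>"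
        "shift \<alpha> (step 1) (R_E \<alpha> 2) = R_E \<alpha> 2 \<oplus>\<^bsub>R_alg \<alpha>\<^esub> \<one>\<^bsub>R_alg \<alpha>\<^esub>" "shift \<alpha> (step 1) (R_E \<alpha> 3) = R_E \<alpha> 3"
        "shift \<alpha> (step 2) (R_E \<alpha> 1) = R_E \<alpha> 1" "shift \<alpha> (step 2) (R_E \<alpha> 2) = R_E \<alpha> 2 \<ominus>\<^bsub>R_alg \<alpha>\<^esub> \<one>\<^bsub>R_alg \<alpha>\<^esub>"
        "shift \<alpha> (step 2) (R_E \<alpha> 3) = R_E \<alpha> 3 \<oplus>\<^bsub>R_alg \<alpha>\<^esub> \<one>\<^bsub>R_alg \<alpha>\<^esub>"
        unfolding sh by simp_all
      show "edge_elt \<alpha> 1 = R_E \<alpha> 2 \<otimes>\<^bsub>R_alg \<alpha>\<^esub> (R_E \<alpha> 1 \<oplus>\<^bsub>R_alg \<alpha>\<^esub> \<one>\<^bsub>R_alg \<alpha>\<^esub>)"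
        "edge_elt \<alpha> 2 = R_E \<alpha> 3 \<otimes>\<^bsub>R_alg \<alpha>\<^esub> (R_E \<alpha> 2 \<oplus>\<^bsub>R_alg \<alpha>\<^esub> \<one>\<^bsub>R_alg \<alpha>\<^esub>)"
        unfolding E R edge_elt_def by simp_all
      show "tgwa_datum {1, 2} {(1, 2), (2, 1)} (R_alg \<alpha>) (\<lambda>i. shift \<alpha> (step i)) (edge_elt \<alpha>)" by (rule sl3_tgwa_datum)
      show "alg_iso (\<AA> \<alpha>) (tgwa {1, 2} (R_alg \<alpha>) (\<lambda>i. shift \<alpha> (step i)) (edge_elt \<alpha>)) \<noteq> {}" by (rule \<AA>_is_tgwa[OF that])
    qed
  qed
  show "\<exists>B :: Uelt set \<Rightarrow> Uelt set \<Rightarrow> complex.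
      (\<forall>u\<in>carrier U. \<forall>v\<in>carrier U. B (\<AA>_class \<alpha> u) (\<AA>_class \<alpha> v) = U_form \<alpha> u v) \<and>
      (\<forall>a\<in>carrier (\<AA> \<alpha>). (\<forall>b\<in>carrier (\<AA> \<alpha>). B a b = 0) \<longrightarrow> a = \<zero>\<^bsub>\<AA> \<alpha>\<^esub>) \<and>
      (\<forall>b\<in>carrier (\<AA> \<alpha>). (\<forall>a\<in>carrier (\<AA> \<alpha>). B a b = 0) \<longrightarrow> b = \<zero>\<^bsub>\<AA> \<alpha>\<^esub>)"
    if "\<nexists>m::int. m < 0 \<and> \<alpha> = of_int m" using that by (rule form_nondegenerate)
qed

end
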